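(* Let $\theta>0$, let $\mu$ be a probability distribution on $(0,\infty)$ satisfying the extreme value assumption (EV) of the context, and let $(\tau_n,W_n,Z_n)_{n\ge1}$, $M(t)$, $u_t,v_t,w_t$ and $\Phi$ be as in the context. Let $$\mathcal S:=\begin{cases}[0,\infty]\times[-\infty,\infty]\times(-\infty,\infty]&\text{in the Weibull and Gumbel cases},\\ [0,1]\times[0,\infty]\times(0,\infty]&\text{in the Fréchet case}.\end{cases}$$ Then the random point measures $$\Gamma_t:=\sum_{n=1}^{M(t)}\delta\Big(\frac{\tau_n}{u_t},\frac{W_n-v_t}{w_t},\frac{\log Z_n(t)-tv_t}{tw_t}\Big),$$ regarded as random elements of the space of Radon measures on $\mathcal S$ equipped with the vague topology (points not in $\mathcal S$ being discarded), converge in distribution as $t\to\infty$ to a Poisson point process $\Gamma_\infty$ on $\mathcal S$ with intensity measure $$d\zeta(s,y,z)=\begin{cases}\theta\,ds\otimes(-\Phi'(y))\,dy\otimes\delta_{y-s}(dz)&\text{in the Weibull and Gumbel cases},\\ \theta\,ds\otimes(-\Phi'(y))\,dy\otimes\delta_{y(1-s)}(dz)&\text{in the Fréchet case}.\end{cases}$$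
   Context: **Continuous-time process.** Let $(W_i)_{i\ge1}$ be i.i.d. with distribution $\mu$; let $\tau_1<\tau_2<\cdots$ be the jump times of a Poisson process of rate $\theta$; let $(Y_i)_{i\ge1}$ be i.i.d. Yule processes of parameter one (each started from one individual; each individual is immortal and gives birth to one more at rate $1$, independently); these three families are independent. Set $Z_i(t)=Y_i(W_i(t-\tau_i))\mathbf 1_{t\ge\tau_i}$ (size of table $i$ at time $t$) and $M(t)=\#\{i\ge1\colon\tau_i\le t\}$ (number of tables at time $t$; not to be confused with the constant $M$). **Assumption (EV).** $\mu$ is absolutely continuous. If $\mu$ has bounded support, its essential supremum is normalised to be $1$ and $M:=1$; if its support is unbounded, $M:=\infty$. There are continuous functions $A,B$ on $[0,\infty)$, with $B\ge 0$ (and non-zero wherever one divides by it), such that for all $x\in\mathbb R$, $t\,\mu((A(t)+xB(t),M))\to\Phi(x)$ as $t\to\infty$ (the measure being $0$ if the left endpoint is $\ge M$), where one of the following holds: - Weibull case: $M=1$, $A\equiv1$, $\Phi(x)=|x|^\alpha\mathbf 1_{x<0}$ for some $\alpha>0$; - Gumbel case: $M\in\{1,\infty\}$, $A$ is increasing, bounded away from zero and converges to $M$, $\Phi(x)=e^{-x}$; - Fréchet case: $M=\infty$, $A\equiv0$, $\Phi(x)=\infty$ for $x\le0$ and $\Phi(x)=x^{-\alpha}$ for $x>0$, for some $\alpha>0$. In the Weibull and Gumbel cases, moreover, $A(t)/B(t)$ is non-decreasing and tends to infinity, and for all $x>0$, $\int_x^\infty t\,\mu((A(t)+uB(t),M))\,du\to\int_x^\infty\Phi(u)\,du$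 as $t\to\infty$. **Scaling functions.** In the Weibull and Gumbel cases, for all large $t$, $u_t$ is the unique solution of $tB(u_t)=u_tA(u_t)$, and $v_t=A(u_t)$, $w_t=B(u_t)$. In the Fréchet case, $u_t=t$, $v_t=0$, $w_t=B(t)$. **Conventions.** $-\Phi'(y)dy$ is carried by $(-\infty,0)$, $\mathbb R$, $(0,\infty)$ in the Weibull, Gumbel, Fréchet cases respectively; in the Fréchet case $s$ ranges over $[0,1]$, otherwise over $[0,\infty)$. Vague convergence is convergence of integrals of non-negative continuous compactly supported functions. *)

theory Defs
  imports "HOL-Probability.Probability"
begin

section \<open>Random measures and the vague topology\<close>

definition radon_measures :: "'a::topological_space set \<Rightarrow> 'a measure set" where
  "radon_measures S =
     {m. sets m = sets (restrict_space borel S) \<and>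
         (\<forall>K. compact K \<and> K \<subseteq> S \<longrightarrow> emeasure m K < \<infinity>)}"

text \<open>For the locally compact second countable Hausdorff spaces \<open>S\<close> used below, a Borel measure
  that is finite on compact sets is automatically regular, so these are exactly the Radon
  measures. Compactness of \<open>K \<subseteq> S\<close> does not depend on the ambient space.\<close>

definition vague_test :: "'a::topological_space set \<Rightarrow> ('a \<Rightarrow> real) \<Rightarrow> bool" where
  "vague_test S f \<longleftrightarrow>
     continuous_on S f \<and> (\<forall>x\<in>S. 0 \<le> f x) \<and>
     (\<exists>K. compact K \<and> K \<subseteq> S \<and> (\<forall>x\<in>S - K. f x = 0))"

definition vague_topology :: "'a::topological_space set \<Rightarrow> 'a measure topology" where
  "vague_topology S =
     topology_generated_by
       {{m \<in> radon_measures S. integral\<^sup>L m f \<in> U} | f U. vague_test S f \<and> open (U :: real set)}"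

definition random_element :: "'b topology \<Rightarrow> 'a measure \<Rightarrow> ('a \<Rightarrow> 'b) \<Rightarrow> bool" where
  "random_element X P \<xi> \<longleftrightarrow> \<xi> \<in> P \<rightarrow>\<^sub>M sigma (topspace X) {U. openin X U}"

definition converges_in_distribution ::
  "'b topology \<Rightarrow> 'a measure \<Rightarrow> ('i \<Rightarrow> 'a \<Rightarrow> 'b) \<Rightarrow> 'i filter \<Rightarrow> 'c measure \<Rightarrow> ('c \<Rightarrow> 'b) \<Rightarrow> bool" where
  "converges_in_distribution X P \<xi> F Q \<eta> \<longleftrightarrow>
     (\<forall>\<^sub>F t in F. random_element X P (\<xi> t)) \<and> random_element X Q \<eta> \<and>
     (\<forall>h. continuous_map X euclideanreal h \<and> bounded (h ` topspace X) \<longrightarrow>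
        ((\<lambda>t. \<integral>\<omega>. h (\<xi> t \<omega>) \<partial>P) \<longlongrightarrow> (\<integral>\<omega>. h (\<eta> \<omega>) \<partial>Q)) F)"

definition poisson_point_process ::
  "'c measure \<Rightarrow> 'a::topological_space set \<Rightarrow> 'a measure \<Rightarrow> ('c \<Rightarrow> 'a measure) \<Rightarrow> bool" where
  "poisson_point_process Q S \<zeta> N \<longleftrightarrow>
     prob_space Q \<and> (\<forall>\<omega>\<in>space Q. N \<omega> \<in> radon_measures S) \<and>
     (\<forall>B\<in>sets (restrict_space borel S).
        (\<lambda>\<omega>. emeasure (N \<omega>) B) \<in> borel_measurable Q \<and>
        (if emeasure \<zeta> B = \<infinity> then AE \<omega> in Q. emeasure (N \<omega>) B = \<infinity>
         else \<forall>k::nat. measure Q {\<omega> \<in> space Q. emeasure (N \<omega>) B = of_nat k}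
                       = measure \<zeta> B ^ k / fact k * exp (- measure \<zeta> B))) \<and>
     (\<forall>n (B :: nat \<Rightarrow> 'a set).
        (\<forall>i<n. B i \<in> sets (restrict_space borel S)) \<and> disjoint_family_on B {..<n} \<longrightarrow>
        prob_space.indep_vars Q (\<lambda>_. borel) (\<lambda>i \<omega>. emeasure (N \<omega>) (B i)) {..<n})"

text \<open>The sum of the Dirac masses at \<open>p i\<close>, \<open>i \<in> I\<close>, counted with multiplicity and discarding
  the points outside \<open>S\<close>, is the image of a counting measure.\<close>

definition dirac_sum :: "'a::topological_space set \<Rightarrow> 'i set \<Rightarrow> ('i \<Rightarrow> 'a) \<Rightarrow> 'a measure" where
  "dirac_sum S I p = distr (count_space {i \<in> I. p i \<in> S}) (restrict_space borel S) p"


section \<open>Poisson and Yule processes\<close>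

definition poisson_jump_times :: "'a measure \<Rightarrow> real \<Rightarrow> (nat \<Rightarrow> 'a \<Rightarrow> real) \<Rightarrow> bool" where
  "poisson_jump_times P \<theta> \<tau> \<longleftrightarrow>
     (let gap = (\<lambda>n \<omega>. \<tau> n \<omega> - (if n = 0 then 0 else \<tau> (n - 1) \<omega>)) in
       prob_space.indep_vars P (\<lambda>_. borel) gap UNIV \<and>
       (\<forall>n. distributed P lborel (gap n) (exponential_density \<theta>)))"

text \<open>Individuals are labelled by their ancestral line: \<open>[]\<close> is the root and \<open>k # u\<close> is child
  number \<open>k\<close> (counted from 0) of \<open>u\<close>. The time between the birth of \<open>u\<close> and its first birth is
  \<open>e u 0\<close>, and \<open>e u j\<close> is the time between its births number \<open>j - 1\<close> and \<open>j\<close>.\<close>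

primrec birth_time :: "(nat list \<Rightarrow> nat \<Rightarrow> real) \<Rightarrow> nat list \<Rightarrow> real" where
  "birth_time e [] = 0"
| "birth_time e (k # u) = birth_time e u + (\<Sum>j\<le>k. e u j)"

text \<open>Yule process of parameter one: each individual is immortal and gives birth at the points of
  its own rate one Poisson process. The population is almost surely finite at all times (on the
  exceptional null set \<open>card\<close> may be \<open>0\<close>). Times \<open>t < 0\<close> are included only so that \<open>Y t\<close> is
  specified everywhere; almost surely \<open>Y t = 0\<close> there.\<close>

definition yule_process :: "'a measure \<Rightarrow> (real \<Rightarrow> 'a \<Rightarrow> nat) \<Rightarrow> bool" where
  "yule_process P Y \<longleftrightarrow>
     (\<exists>e :: nat list \<Rightarrow> nat \<Rightarrow> 'a \<Rightarrow> real.
        prob_space.indep_vars P (\<lambda>_. borel) (\<lambda>(u, j). e u j) UNIV \<and>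
        (\<forall>u j. distributed P lborel (e u j) (exponential_density 1)) \<and>
        (\<forall>t. \<forall>\<omega>\<in>space P. Y t \<omega> = card {u. birth_time (\<lambda>u j. e u j \<omega>) u \<le> t}))"

datatype source = Weight nat | Arrivals | Growth nat

text \<open>Independence of all \<open>W i\<close>, the whole sequence \<open>\<tau>\<close> and all the processes \<open>Y i\<close>, through the
  sigma-algebras that they generate.\<close>

definition independent_sources ::
  "'a measure \<Rightarrow> (nat \<Rightarrow> 'a \<Rightarrow> real) \<Rightarrow> (nat \<Rightarrow> 'a \<Rightarrow> real) \<Rightarrow> (nat \<Rightarrow> real \<Rightarrow> 'a \<Rightarrow> nat) \<Rightarrow> bool" where
  "independent_sources P W \<tau> Y \<longleftrightarrow>
     prob_space.indep_sets P
       (\<lambda>x. case x of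
          Weight i \<Rightarrow> sets (vimage_algebra (space P) (W i) borel)
        | Arrivals \<Rightarrow> sets (vimage_algebra (space P) (\<lambda>\<omega> n. \<tau> n \<omega>) (\<Pi>\<^sub>M n\<in>UNIV. borel))
        | Growth i \<Rightarrow> sets (vimage_algebra (space P) (\<lambda>\<omega> t. Y i t \<omega>) (\<Pi>\<^sub>M t\<in>UNIV. count_space UNIV)))
       UNIV"

text \<open>Tables are numbered from 0.\<close>

definition table_size ::
  "(nat \<Rightarrow> 'a \<Rightarrow> real) \<Rightarrow> (nat \<Rightarrow> 'a \<Rightarrow> real) \<Rightarrow> (nat \<Rightarrow> real \<Rightarrow> 'a \<Rightarrow> nat) \<Rightarrow> nat \<Rightarrow> real \<Rightarrow> 'a \<Rightarrow> nat" where
  "table_size W \<tau> Y i t \<omega> = (if \<tau> i \<omega> \<le> t then Y i (W i \<omega> * (t - \<tau> i \<omega>)) \<omega> else 0)"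

definition num_tables :: "(nat \<Rightarrow> 'a \<Rightarrow> real) \<Rightarrow> real \<Rightarrow> 'a \<Rightarrow> nat" where
  "num_tables \<tau> t \<omega> = card {i. \<tau> i \<omega> \<le> t}"


section \<open>The extreme value assumption\<close>

datatype ev_class = Weibull real | Gumbel | Frechet real

primrec ev_limit :: "ev_class \<Rightarrow> real \<Rightarrow> ennreal" where
  "ev_limit (Weibull \<alpha>) x = (if x < 0 then ennreal (\<bar>x\<bar> powr \<alpha>) else 0)"
| "ev_limit Gumbel x = ennreal (exp (- x))"
| "ev_limit (Frechet \<alpha>) x = (if x \<le> 0 then \<infinity> else ennreal (x powr (- \<alpha>)))"

definition ess_end :: "real measure \<Rightarrow> ereal" where
  "ess_end \<mu> = esssup \<mu> ereal"

definition tail_mass :: "real measure \<Rightarrow> real \<Rightarrow> ennreal" where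
  "tail_mass \<mu> a = emeasure \<mu> {x. a < x \<and> ereal x < ess_end \<mu>}"

definition ratio_and_tail_condition ::
  "ev_class \<Rightarrow> real measure \<Rightarrow> (real \<Rightarrow> real) \<Rightarrow> (real \<Rightarrow> real) \<Rightarrow> bool" where
  "ratio_and_tail_condition c \<mu> A B \<longleftrightarrow>
     (\<forall>t\<ge>0. B t \<noteq> 0) \<and>
     mono_on {0..} (\<lambda>t. A t / B t) \<and> filterlim (\<lambda>t. A t / B t) at_top at_top \<and>
     (\<forall>x>0. ((\<lambda>t. \<integral>\<^sup>+u\<in>{x..}. ennreal t * tail_mass \<mu> (A t + u * B t) \<partial>lborel)
                \<longlongrightarrow> (\<integral>\<^sup>+u\<in>{x..}. ev_limit c u \<partial>lborel)) at_top)"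

text \<open>In the Frechet case, \<open>B t > 0\<close> for all large \<open>t\<close> is a consequence of the convergence of
  the tails.\<close>

definition ev_assumption ::
  "ev_class \<Rightarrow> real measure \<Rightarrow> (real \<Rightarrow> real) \<Rightarrow> (real \<Rightarrow> real) \<Rightarrow> bool" where
  "ev_assumption c \<mu> A B \<longleftrightarrow>
     prob_space \<mu> \<and> sets \<mu> = sets borel \<and> (AE x in \<mu>. 0 < x) \<and> absolutely_continuous lborel \<mu> \<and>
     continuous_on {0..} A \<and> continuous_on {0..} B \<and> (\<forall>t\<ge>0. 0 \<le> B t) \<and>
     (\<forall>x. ((\<lambda>t. ennreal t * tail_mass \<mu> (A t + x * B t)) \<longlongrightarrow> ev_limit c x) at_top) \<and>
     (case c of
        Weibull \<alpha> \<Rightarrow>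
          0 < \<alpha> \<and> ess_end \<mu> = 1 \<and> (\<forall>t\<ge>0. A t = 1) \<and> ratio_and_tail_condition c \<mu> A B
      | Gumbel \<Rightarrow>
          ess_end \<mu> \<in> {1, \<infinity>} \<and> mono_on {0..} A \<and> (\<exists>a>0. \<forall>t\<ge>0. a \<le> A t) \<and>
          ((\<lambda>t. ereal (A t)) \<longlongrightarrow> ess_end \<mu>) at_top \<and> ratio_and_tail_condition c \<mu> A B
      | Frechet \<alpha> \<Rightarrow>
          0 < \<alpha> \<and> ess_end \<mu> = \<infinity> \<and> (\<forall>t\<ge>0. A t = 0))"

text \<open>Under the assumption, \<open>u * A u / B u\<close> is continuous and strictly increasing from \<open>0\<close> to
  infinity in the Weibull and Gumbel cases, so the equation below has a unique solution.\<close>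

definition scale_u :: "ev_class \<Rightarrow> (real \<Rightarrow> real) \<Rightarrow> (real \<Rightarrow> real) \<Rightarrow> real \<Rightarrow> real" where
  "scale_u c A B t =
     (case c of Frechet \<alpha> \<Rightarrow> t | _ \<Rightarrow> (THE u. 0 \<le> u \<and> t * B u = u * A u))"

definition scale_v :: "ev_class \<Rightarrow> (real \<Rightarrow> real) \<Rightarrow> (real \<Rightarrow> real) \<Rightarrow> real \<Rightarrow> real" where
  "scale_v c A B t = (case c of Frechet \<alpha> \<Rightarrow> 0 | _ \<Rightarrow> A (scale_u c A B t))"

definition scale_w :: "ev_class \<Rightarrow> (real \<Rightarrow> real) \<Rightarrow> (real \<Rightarrow> real) \<Rightarrow> real \<Rightarrow> real" where
  "scale_w c A B t = (case c of Frechet \<alpha> \<Rightarrow> B t | _ \<Rightarrow> B (scale_u c A B t))"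


section \<open>The point measures and the limiting intensity\<close>

type_synonym point = "ereal \<times> ereal \<times> ereal"

definition state_space :: "ev_class \<Rightarrow> point set" where
  "state_space c =
     (case c of Frechet \<alpha> \<Rightarrow> {0..1} \<times> {0..\<infinity>} \<times> {0<..\<infinity>}
      | _ \<Rightarrow> {0..\<infinity>} \<times> {-\<infinity>..\<infinity>} \<times> {-\<infinity><..\<infinity>})"

definition table_point_measure ::
  "ev_class \<Rightarrow> (real \<Rightarrow> real) \<Rightarrow> (real \<Rightarrow> real) \<Rightarrow> (nat \<Rightarrow> 'a \<Rightarrow> real) \<Rightarrow> (nat \<Rightarrow> 'a \<Rightarrow> real) \<Rightarrow>
   (nat \<Rightarrow> real \<Rightarrow> 'a \<Rightarrow> nat) \<Rightarrow> real \<Rightarrow> 'a \<Rightarrow> point measure" where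
  "table_point_measure c A B W \<tau> Y t \<omega> =
     (let u = scale_u c A B t; v = scale_v c A B t; w = scale_w c A B t in
        dirac_sum (state_space c) {..<num_tables \<tau> t \<omega>}
          (\<lambda>n. (ereal (\<tau> n \<omega> / u), ereal ((W n \<omega> - v) / w),
                 ereal ((ln (real (table_size W \<tau> Y n t \<omega>)) - t * v) / (t * w)))))"

definition time_domain :: "ev_class \<Rightarrow> real set" where
  "time_domain c = (case c of Frechet \<alpha> \<Rightarrow> {0..1} | _ \<Rightarrow> {0..})"

definition mark_domain :: "ev_class \<Rightarrow> real set" where
  "mark_domain c = (case c of Weibull \<alpha> \<Rightarrow> {..<0} | Gumbel \<Rightarrow> UNIV | Frechet \<alpha> \<Rightarrow> {0<..})"

definition mark_measure :: "ev_class \<Rightarrow> real measure" where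
  "mark_measure c =
     density lborel
       (\<lambda>y. ennreal (- deriv (\<lambda>x. enn2real (ev_limit c x)) y) * indicator (mark_domain c) y)"

definition limit_height :: "ev_class \<Rightarrow> real \<Rightarrow> real \<Rightarrow> real" where
  "limit_height c s y = (case c of Frechet \<alpha> \<Rightarrow> y * (1 - s) | _ \<Rightarrow> y - s)"

text \<open>Integrating the kernel \<open>\<delta>\<^bsub>h(s,y)\<^esub>(dz)\<close> against a measure in \<open>(s, y)\<close> gives the image of that
  measure under \<open>(s, y) \<mapsto> (s, y, h(s,y))\<close>.\<close>

definition limit_intensity :: "ev_class \<Rightarrow> real \<Rightarrow> point measure" where
  "limit_intensity c \<theta> =
     restrict_space
       (distr (density lborel (\<lambda>s. ennreal \<theta> * indicator (time_domain c) s) \<Otimes>\<^sub>M mark_measure c) borel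
          (\<lambda>(s, y). (ereal s, ereal y, ereal (limit_height c s y))))
       (state_space c)"

end

theory Submission
  imports Defs "HOL-Real_Asymp.Real_Asymp"
begin

text \<open>Marks are represented through the quantile function: the tables born before \<open>t\<close>, with \<open>W\<close>
  written as a quantile, form a Poisson process with intensity \<open>\<theta> ds dr\<close> on a window that increases
  to the quadrant of all \<open>(s, r)\<close>, each point carrying an independent Yule path. Hence all \<open>\<Gamma>\<^sub>t\<close> can
  be coupled on one Poisson process in the plane. There the point \<open>(s, r)\<close> converges to
  \<open>(s, y, h(s, y))\<close>, where \<open>y\<close> is the inverse of \<open>\<Phi>\<close> at \<open>r\<close>: the rescaled quantiles converge by
  the extreme value assumption, and \<open>log (Y x) - x\<close> is tight because \<open>Y x\<close> is geometric with mean
  \<open>exp x\<close>. The integrated tail assumption makes the expected number of points above any level outside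
  a bounded box small, uniformly in \<open>t\<close>. Along a sequence of times, Borel--Cantelli upgrades this to
  almost sure vague convergence.\<close>

text \<open>The state space is compactified in every direction except the lower end of the height. A
  compact set therefore only bounds the height from below, and every table above a level counts,
  however late it is born and however light it is; convergence of single points cannot suffice.
  Convergence in distribution is tested with arbitrary bounded continuous functionals of a topology
  given only by a subbasis. An almost surely convergent coupling passes under such functionals by
  dominated convergence, and their measurability comes from a factorisation through a second
  countable space. The coupling must have the right law for each fixed \<open>t\<close>. A point
  measure of finitely many points depends only on their multiset, so both sides are compared as
  values of one operator, \<open>poisson_mean\<close>, on symmetric functions of finite samples. The
  planar process is itself built from marked arrivals on a half-line, so that a single computation
  with exponential gaps serves the tables and the planar process alike.\<close>

abbreviation "borel2 \<equiv> borel \<Otimes>\<^sub>M borel"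

section \<open>Symmetric functionals of Poisson samples\<close>

abbreviation pts :: "(nat => 'a) => nat set => 'a multiset" where
 "pts x I \<equiv> image_mset x (mset_set I)"

text \<open>Symmetric functions are written as functions of the multiset of sample points;
  measurability is asked of every finite sample size, which avoids a sigma-algebra on
  multisets.\<close>

definition mset_meas :: "'a measure => ('a multiset => ennreal) => bool" where
 "mset_meas N F \<longleftrightarrow>
   (ALL m. (%x. F (pts x {..<m})) \<in> borel_measurable (\<Pi>\<^sub>M i\<in>{..<m}. N))"

definition mset_int :: "'a measure => nat => ('a multiset => ennreal) => ennreal" where
 "mset_int nv m F = (\<integral>\<^sup>+x. F (pts x {..<m}) \<partial>(\<Pi>\<^sub>M i\<in>{..<m}. nv))"

text \<open>This is the expectation of \<open>F\<close> over a Poisson process with finite intensity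
  \<open>nv\<close>. Given \<open>m\<close> points, they are independent with the normalised law,
  and the powers of the total mass cancel between the Poisson weight and the normalisation.\<close>

definition poisson_mean :: "'a measure => ('a multiset => ennreal) => ennreal" where
 "poisson_mean nv F =
   (\<Sum>m. ennreal (exp (- measure nv (space nv)) / fact m) * mset_int nv m F)"

lemma product_sigma_finite_const:
 "sigma_finite_measure nv ==> product_sigma_finite (%_. nv)" by (simp add: product_sigma_finite_def)

lemma mset_meas_cong_sets:
 assumes "sets N = sets N'"
 shows "mset_meas N F = mset_meas N' F"
proof -
 have "measurable (\<Pi>\<^sub>M i\<in>{..<m}. N) (borel :: ennreal measure) = measurable (\<Pi>\<^sub>M i\<in>{..<m}. N') borel"
  for m :: nat by (intro measurable_cong_sets sets_PiM_cong) (simp_all add: assms)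
 then show ?thesis by (simp add: mset_meas_def)
qed

lemma pts_fun_upd:
 "pts (x(m := y)) {..<Suc m} = add_mset y (pts x {..<m})"
proof -
 have "image_mset (x(m := y)) (mset_set {..<m}) = image_mset x (mset_set {..<m})" by (intro image_mset_cong) auto
 then show ?thesis by (simp add: lessThan_Suc)
qed

text \<open>The points of \<open>J\<close> are renumbered by an initial segment, which a function of
  the multiset cannot notice.\<close>

lemma mset_meas_subset:
 fixes F :: "'a multiset => ennreal"
 assumes F: "mset_meas N F" and J: "J <= {..<m}"
 shows "(%x. F (pts x J)) \<in> borel_measurable (\<Pi>\<^sub>M i\<in>{..<m}. N)"
proof -
 have fin: "finite J" using J finite_subset by blast
 obtain e where e: "bij_betw e {..<card J} J"
  using bij_betw_from_nat_into_finite[OF fin] by blast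
 have ej: "e i \<in> {..<m}" if "i < card J" for i
  using e J that unfolding bij_betw_def by auto
 have *: "(%x. \<lambda>i\<in>{..<card J}. x (e i)) \<in> measurable (\<Pi>\<^sub>M i\<in>{..<m}. N) (\<Pi>\<^sub>M i\<in>{..<card J}. N)"
  by (rule measurable_restrict, rule measurable_component_singleton) (use ej in auto)
 have "pts (\<lambda>i\<in>{..<card J}. x (e i)) {..<card J} = pts x J" for x :: "nat => 'a"
 proof -
  have "pts (\<lambda>i\<in>{..<card J}. x (e i)) {..<card J} = pts (x \<circ> e) {..<card J}" by (intro image_mset_cong) auto
  also have "... = image_mset x (image_mset e (mset_set {..<card J}))" by (simp add: multiset.map_comp)
  also have "image_mset e (mset_set {..<card J}) = mset_set J"
   using e by (simp add: bij_betw_def image_mset_mset_set)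
  finally show ?thesis .
 qed
 then have "(%x. F (pts (\<lambda>i\<in>{..<card J}. x (e i)) {..<card J})) = (%x. F (pts x J))" by (simp only:)
 with measurable_compose[OF * F[unfolded mset_meas_def, rule_format, of "card J"]]
 show ?thesis by (simp only:)
qed

lemma mset_meas_add_joint:
 assumes "mset_meas N F"
 shows "(%(x, y). F (add_mset y (pts x {..<m})))
      \<in> borel_measurable ((\<Pi>\<^sub>M i\<in>{..<m}. N) \<Otimes>\<^sub>M N)"
proof -
 have "(%(x, y). x(m := y)) \<in> measurable ((\<Pi>\<^sub>M i\<in>{..<m}. N) \<Otimes>\<^sub>M N) (\<Pi>\<^sub>M i\<in>insert m {..<m}. N)"
  by (rule measurable_add_dim)
 then have "(%(x, y). F (pts (x(m := y)) {..<Suc m}))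
   \<in> borel_measurable ((\<Pi>\<^sub>M i\<in>{..<m}. N) \<Otimes>\<^sub>M N)"
  using measurable_compose[of "%(x, y). x(m := y)", OF _ assms[unfolded mset_meas_def, rule_format, of "Suc m"]]
  by (simp add: lessThan_Suc split_beta')
 then show ?thesis by (simp only: pts_fun_upd)
qed

lemma mset_meas_add:
 assumes F: "mset_meas N F" and y: "y \<in> space N"
 shows "mset_meas N (%X. F (add_mset y X))"
 unfolding mset_meas_def
proof
 fix m :: nat
 show "(%x. F (add_mset y (pts x {..<m}))) \<in> borel_measurable (\<Pi>\<^sub>M i\<in>{..<m}. N)"
  using measurable_compose[OF measurable_Pair2'[OF y] mset_meas_add_joint[OF F, of m]] by simp
qed

lemma mset_int_0: "sigma_finite_measure nv ==> mset_int nv 0 F = F {#}"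
 using product_sigma_finite.nn_integral_empty[OF product_sigma_finite_const[of nv, where 'b=nat], of "%_. F {#}"] by (simp add: mset_int_def)

lemma mset_int_Suc:
 assumes nv: "sigma_finite_measure nv" and F: "mset_meas nv F"
 shows "mset_int nv (Suc m) F = (\<integral>\<^sup>+y. mset_int nv m (%X. F (add_mset y X)) \<partial>nv)"
proof -
 interpret product_sigma_finite "%_::nat. nv" by (rule product_sigma_finite_const[OF nv])
 have "mset_int nv (Suc m) F = (\<integral>\<^sup>+x. F (pts x {..<Suc m}) \<partial>(\<Pi>\<^sub>M i\<in>insert m {..<m}. nv))"
  by (simp add: mset_int_def lessThan_Suc)
 also have "... = (\<integral>\<^sup>+y. \<integral>\<^sup>+x. F (pts (x(m := y)) {..<Suc m}) \<partial>(\<Pi>\<^sub>M i\<in>{..<m}. nv) \<partial>nv)"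
  using F[unfolded mset_meas_def, rule_format, of "Suc m"] by (intro product_nn_integral_insert_rev) (auto simp: lessThan_Suc)
 finally show ?thesis by (simp add: mset_int_def pts_fun_upd)
qed

lemma borel_measurable_mset_int_add:
 assumes nv: "sigma_finite_measure nv" and F: "mset_meas N F" and N: "sets nv = sets N"
 shows "(%y. mset_int nv m (%X. F (add_mset y X))) \<in> borel_measurable N"
proof -
 interpret product_sigma_finite "%_::nat. nv" by (rule product_sigma_finite_const[OF nv])
 interpret sigma_finite_measure "\<Pi>\<^sub>M i\<in>{..<m}. nv" by (rule sigma_finite) simp
 have "(%(y, x). F (add_mset y (pts x {..<m}))) \<in> borel_measurable (nv \<Otimes>\<^sub>M (\<Pi>\<^sub>M i\<in>{..<m}. nv))"
  using mset_meas_add_joint[of nv F m] F mset_meas_cong_sets[OF N, of F] by (subst measurable_pair_swap_iff) (simp add: split_beta')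
 then show ?thesis
  unfolding mset_int_def measurable_cong_sets[OF N refl, symmetric] by (intro borel_measurable_nn_integral) simp
qed

lemma mset_int_cong:
 assumes "!!X. set_mset X <= space nv ==> size X = m ==> F X = G X"
 shows "mset_int nv m F = mset_int nv m G"
 unfolding mset_int_def by (intro nn_integral_cong assms) (auto simp: space_PiM PiE_def)

text \<open>Only finitely many sets \<open>J\<close> of indices can be the ones outside
  \<open>B\<close>; on each of these events the function depends on the sample restricted to
  \<open>J\<close>.\<close>

lemma mset_meas_filter:
 assumes F: "!!k. mset_meas N (F k)" and B: "B \<in> sets N"
 shows "mset_meas N (%X. F (size (filter_mset (%x. x \<in> B) X)) (filter_mset (%x. x \<notin> B) X))"
 unfolding mset_meas_def
proof
 fix m :: nat
 let ?P = "\<Pi>\<^sub>M i\<in>{..<m}. N"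
 let ?G = "%X. F (size (filter_mset (%x. x \<in> B) X)) (filter_mset (%x. x \<notin> B) X)"
 have G: "?G (pts x {..<m}) =
   (\<Sum>J\<in>Pow {..<m}. indicator {x\<in>space ?P. {i\<in>{..<m}. x i \<notin> B} = J} x * F (m - card J) (pts x J))"
  if x: "x \<in> space ?P" for x
 proof -
  let ?J = "{i\<in>{..<m}. x i \<notin> B}"
  have "card {i\<in>{..<m}. x i \<in> B} = card ({..<m} - ?J)" by (rule arg_cong[of _ _ card]) auto
  also have "... = m - card ?J" by (subst card_Diff_subset) auto
  finally have c: "card {i\<in>{..<m}. x i \<in> B} = m - card ?J" .
  have "?G (pts x {..<m}) = F (m - card ?J) (pts x ?J)"
   using c by (simp add: filter_mset_image_mset filter_mset_mset_set)
  also have "... = (\<Sum>J\<in>Pow {..<m}. if J = ?J then F (m - card J) (pts x J) else 0)" by (subst sum.delta) auto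
  also have "... = (\<Sum>J\<in>Pow {..<m}. indicator {x\<in>space ?P. {i\<in>{..<m}. x i \<notin> B} = J} x * F (m - card J) (pts x J))"
   using x by (intro sum.cong) (auto simp: indicator_def)
  finally show ?thesis .
 qed
 have mJ: "{x\<in>space ?P. {i\<in>{..<m}. x i \<notin> B} = J} \<in> sets ?P" if "J <= {..<m}" for J
 proof -
  have [measurable]: "{x \<in> space ?P. (x i \<notin> B) = (i \<in> J)} \<in> sets ?P" if "i < m" for i
  proof -
   have [measurable]: "(%x. x i) \<in> measurable ?P N" by (rule measurable_component_singleton) (use that in auto)
   show ?thesis using B by measurable
  qed
  have "{x\<in>space ?P. {i\<in>{..<m}. x i \<notin> B} = J} = {x\<in>space ?P. \<forall>i\<in>{..<m}. (x i \<notin> B) = (i \<in> J)}"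
   using that by auto
  also have "... \<in> sets ?P" by (rule sets.sets_Collect_finite_All) auto
  finally show ?thesis .
 qed
 have "(%x. \<Sum>J\<in>Pow {..<m}. indicator {x\<in>space ?P. {i\<in>{..<m}. x i \<notin> B} = J} x * F (m - card J) (pts x J))
   \<in> borel_measurable ?P" by (intro borel_measurable_sum borel_measurable_times_ennreal borel_measurable_indicator
    mset_meas_subset F mJ) auto
 then show "(%x. ?G (pts x {..<m})) \<in> borel_measurable ?P" by (subst measurable_cong[OF G])
qed

lemma mset_meas_size: "mset_meas N (%X. g (size X))" by (simp add: mset_meas_def)

lemma mset_meas_times:
 "mset_meas N F ==> mset_meas N G ==> mset_meas N (%X. F X * G X)" by (simp add: mset_meas_def borel_measurable_times_ennreal)

lemma mset_meas_image:
 fixes f :: "'b => 'a"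
 assumes F: "mset_meas N' F" and f[measurable]: "f \<in> measurable N N'"
 shows "mset_meas N (%X. F (image_mset f X))"
 unfolding mset_meas_def
proof
 fix m :: nat
 have *: "(%x. \<lambda>i\<in>{..<m}. f (x i)) \<in> measurable (\<Pi>\<^sub>M i\<in>{..<m}. N) (\<Pi>\<^sub>M i\<in>{..<m}. N')" by measurable
 have "pts (\<lambda>i\<in>{..<m}. f (x i)) {..<m} = image_mset f (pts x {..<m})" for x :: "nat => 'b"
  by (subst multiset.map_comp) (intro image_mset_cong, auto)
 then show "(%x. F (image_mset f (pts x {..<m}))) \<in> borel_measurable (\<Pi>\<^sub>M i\<in>{..<m}. N)"
  using measurable_compose[OF * F[unfolded mset_meas_def, rule_format, of m]] by simp
qed

section \<open>Images, thinning and restriction of Poisson samples\<close>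

lemma mset_int_distr:
 assumes nv: "sigma_finite_measure nv" and f: "f \<in> measurable nv N"
  and d: "sigma_finite_measure (distr nv N f)" and F: "mset_meas N F"
 shows "mset_int (distr nv N f) m F = mset_int nv m (%X. F (image_mset f X))"
 using F
proof (induction m arbitrary: F)
 case 0
 then show ?case by (simp add: mset_int_0 nv d)
next
 case (Suc m)
 have F': "mset_meas (distr nv N f) F"
  using Suc.prems mset_meas_cong_sets[of "distr nv N f" N F] by simp
 have "mset_int (distr nv N f) (Suc m) F
   = (\<integral>\<^sup>+y. mset_int (distr nv N f) m (%X. F (add_mset y X)) \<partial>distr nv N f)" by (rule mset_int_Suc[OF d F'])
 also have "... = (\<integral>\<^sup>+y. mset_int (distr nv N f) m (%X. F (add_mset (f y) X)) \<partial>nv)"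
  by (intro nn_integral_distr f) (rule borel_measurable_mset_int_add[OF d F'], simp)
 also have "... = (\<integral>\<^sup>+y. mset_int nv m (%X. F (image_mset f (add_mset y X))) \<partial>nv)"
  using f by (intro nn_integral_cong) (auto simp: Suc.IH mset_meas_add[OF Suc.prems] measurable_space)
 also have "... = mset_int nv (Suc m) (%X. F (image_mset f X))" by (rule mset_int_Suc[OF nv mset_meas_image[OF Suc.prems f], symmetric])
 finally show ?case .
qed

text \<open>Each of the \<open>m\<close> points lies in \<open>B\<close> or not: the binomial
  coefficient chooses those in \<open>B\<close>, each of them contributes the mass of
  \<open>B\<close>, and the others form a sample from the rest. Peeling off one point turns this
  into Pascal's rule.\<close>

lemma mset_int_thin:
 fixes nv :: "'a measure"
 assumes nv: "sigma_finite_measure nv" and B[measurable]: "B \<in> sets nv" and F: "mset_meas nv F"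
 defines "nv' \<equiv> density nv (indicator (space nv - B))"
 assumes nv': "sigma_finite_measure nv'"
 shows "mset_int nv m (%X. indicator {k} (size (filter_mset (%x. x \<in> B) X)) * F (filter_mset (%x. x \<notin> B) X))
    = of_nat (m choose k) * emeasure nv B ^ k * mset_int nv' (m - k) F"
 using F
proof (induction m arbitrary: F k)
 case 0
 then show ?case by (cases k) (simp_all add: mset_int_0 nv nv')
next
 case (Suc m)
 note F = Suc.prems
 have sets': "sets nv' = sets nv" and space': "space nv' = space nv" by (simp_all add: nv'_def)
 have F': "mset_meas nv' F" using F mset_meas_cong_sets[OF sets', of F] by simp
 have meas: "mset_meas nv (%X. indicator {k} (size (filter_mset (%x. x \<in> B) X)) * F (filter_mset (%x. x \<notin> B) X))"
  by (rule mset_meas_filter[where F="%n X. indicator {k} n * F X"])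
    (auto intro!: mset_meas_times F mset_meas_size)
 \<comment> \<open>A new point in \<open>B\<close> lowers the required count \<open>k\<close> by
   one, which is impossible for \<open>k = 0\<close>; a point outside \<open>B\<close> joins the
   remaining sample.\<close>
 have step: "mset_int nv m (%X. indicator {k} (size (filter_mset (%x. x \<in> B) (add_mset y X)))
    * F (filter_mset (%x. x \<notin> B) (add_mset y X)))
   = indicator B y * (case k of 0 => 0 | Suc l =>
      of_nat (m choose l) * emeasure nv B ^ l * mset_int nv' (m - l) F)
    + of_nat (m choose k) * emeasure nv B ^ k *
     (indicator (space nv - B) y * mset_int nv' (m - k) (%X. F (add_mset y X)))"
  if y: "y \<in> space nv" for y
 proof (cases "y \<in> B")
  case True
  show ?thesis
  proof (cases k)
   case 0
   then show ?thesis using True by (simp add: mset_int_def)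
  next
   case (Suc l)
   have "indicator {Suc l} (Suc n) = (indicator {l} n :: ennreal)" for n :: nat by (simp add: indicator_def)
   with Suc True show ?thesis using Suc.IH[OF F, of l] by simp
  qed
 next
  case False
  then show ?thesis using Suc.IH[OF mset_meas_add[OF F y], of k] y by simp
 qed
 have mm: "(%y. mset_int nv' n (%X. F (add_mset y X))) \<in> borel_measurable nv" for n
  using borel_measurable_mset_int_add[OF nv' F sets'] .
 have dens: "(\<integral>\<^sup>+y. indicator (space nv - B) y * mset_int nv' n (%X. F (add_mset y X)) \<partial>nv)
   = mset_int nv' (Suc n) F" for n
 proof -
  have "mset_int nv' (Suc n) F = (\<integral>\<^sup>+y. mset_int nv' n (%X. F (add_mset y X)) \<partial>nv')" by (rule mset_int_Suc[OF nv' F'])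
  also have "... = (\<integral>\<^sup>+y. indicator (space nv - B) y * mset_int nv' n (%X. F (add_mset y X)) \<partial>nv)"
   by (subst (1) nv'_def, rule nn_integral_density) (auto intro: mm)
  finally show ?thesis by simp
 qed
 have "mset_int nv (Suc m) (%X. indicator {k} (size (filter_mset (%x. x \<in> B) X)) * F (filter_mset (%x. x \<notin> B) X))
   = (\<integral>\<^sup>+y. indicator B y * (case k of 0 => 0 | Suc l =>
      of_nat (m choose l) * emeasure nv B ^ l * mset_int nv' (m - l) F)
    + of_nat (m choose k) * emeasure nv B ^ k *
     (indicator (space nv - B) y * mset_int nv' (m - k) (%X. F (add_mset y X))) \<partial>nv)"
  by (subst mset_int_Suc[OF nv meas]) (intro nn_integral_cong step)
 also have "... = emeasure nv B * (case k of 0 => 0 | Suc l =>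
      of_nat (m choose l) * emeasure nv B ^ l * mset_int nv' (m - l) F)
    + of_nat (m choose k) * emeasure nv B ^ k * mset_int nv' (Suc (m - k)) F"
  using mm by (subst nn_integral_add) (auto simp: nn_integral_multc nn_integral_cmult dens)
 also have "... = of_nat (Suc m choose k) * emeasure nv B ^ k * mset_int nv' (Suc m - k) F"
 proof (cases k)
  case 0
  then show ?thesis by simp
 next
  case (Suc l)
  show ?thesis
  proof (cases "k <= m")
   case True
   then have "Suc (m - k) = m - l" using Suc by simp
   then show ?thesis using Suc by (simp add: ring_distribs mult_ac)
  next
   \<comment> \<open>Here \<open>k > m\<close>, so \<open>m choose k\<close> vanishes, and truncated
     subtraction still gives \<open>Suc m - k = m - l\<close>.\<close>
   case False
   then show ?thesis using Suc by (simp add: binomial_eq_0 mult_ac)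
  qed
 qed
 finally show ?case .
qed

text \<open>The count in \<open>B\<close> is Poisson and independent of the points outside
  \<open>B\<close>: after shifting the series by \<open>k\<close>,
  \<open>(m + k choose k) / fact (m + k)\<close> splits as \<open>1 / (fact k * fact m)\<close>, and
  the exponential splits by additivity of the mass.\<close>

lemma poisson_mean_thin:
 fixes nv :: "'a measure"
 assumes nv: "finite_measure nv" and B: "B \<in> sets nv" and F: "mset_meas nv F"
 shows "poisson_mean nv (%X. indicator {k} (size (filter_mset (%x. x \<in> B) X)) * F (filter_mset (%x. x \<notin> B) X))
    = ennreal (measure nv B ^ k / fact k * exp (- measure nv B))
     * poisson_mean (density nv (indicator (space nv - B))) F"
proof -
 interpret finite_measure nv by fact
 define nv' where "nv' = density nv (indicator (space nv - B))"
 have e': "emeasure nv' (space nv') = emeasure nv (space nv - B)"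
  unfolding nv'_def using B by (subst emeasure_density) (auto simp: nn_integral_indicator intro!: nn_integral_cong simp flip: nn_integral_indicator)
 then have fin': "finite_measure nv'" by (intro finite_measureI) simp
 then interpret n: finite_measure nv' .
 have m': "measure nv' (space nv') = measure nv (space nv) - measure nv B"
  using e' finite_measure_compl[OF B] by (simp add: measure_def)
 let ?b = "measure nv B" and ?c = "measure nv (space nv)"
 have T: "mset_int nv m (%X. indicator {k} (size (filter_mset (%x. x \<in> B) X)) * F (filter_mset (%x. x \<notin> B) X))
    = ennreal (real (m choose k) * ?b ^ k) * mset_int nv' (m - k) F" for m
  using mset_int_thin[OF sigma_finite_measure_axioms B F, of m k] n.sigma_finite_measure_axioms
  unfolding nv'_def by (simp add: emeasure_eq_measure ennreal_power ennreal_mult ennreal_of_nat_eq_real_of_nat)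
 have tm: "ennreal (exp (- ?c) / fact (m + k)) * (ennreal (real (m + k choose k) * ?b ^ k) * mset_int nv' m F)
   = ennreal (?b ^ k / fact k * exp (- ?b)) * (ennreal (exp (- measure nv' (space nv')) / fact m) * mset_int nv' m F)" for m
 proof -
  have "exp (- ?c) / fact (m + k) * (real (m + k choose k) * ?b ^ k)
    = ?b ^ k / fact k * exp (- ?b) * (exp (- measure nv' (space nv')) / fact m)" by (simp add: binomial_fact m' exp_diff exp_minus field_simps)
  then show ?thesis by (simp add: mult.assoc[symmetric] ennreal_mult[symmetric])
 qed
 have "poisson_mean nv (%X. indicator {k} (size (filter_mset (%x. x \<in> B) X)) * F (filter_mset (%x. x \<notin> B) X))
   = (\<Sum>m. ennreal (exp (- ?c) / fact m) * (ennreal (real (m choose k) * ?b ^ k) * mset_int nv' (m - k) F))" by (simp add: poisson_mean_def T)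
 also have "... = (\<Sum>m. ennreal (exp (- ?c) / fact (m + k)) * (ennreal (real (m + k choose k) * ?b ^ k) * mset_int nv' m F))"
  by (subst suminf_offset[of _ k]) (auto simp: binomial_eq_0 intro!: summableI)
 also have "... = (\<Sum>m. ennreal (?b ^ k / fact k * exp (- ?b)) * (ennreal (exp (- measure nv' (space nv')) / fact m) * mset_int nv' m F))"
  by (simp only: tm)
 also have "... = ennreal (?b ^ k / fact k * exp (- ?b)) * poisson_mean nv' F" by (simp add: poisson_mean_def ennreal_suminf_cmult)
 finally show ?thesis by (simp add: nv'_def)
qed

lemma poisson_mean_suminf:
 assumes "!!k. mset_meas nv (G k)"
 shows "poisson_mean nv (%X. \<Sum>k. G k X) = (\<Sum>k. poisson_mean nv (G k))"
proof -
 let ?c = "%m. ennreal (exp (- measure nv (space nv)) / fact m)"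
 have "poisson_mean nv (%X. \<Sum>k. G k X) = (\<Sum>m. \<Sum>k. ?c m * mset_int nv m (G k))"
  using assms by (simp add: poisson_mean_def mset_int_def mset_meas_def nn_integral_suminf)
 also have "... = (\<integral>\<^sup>+m. (\<Sum>k. ?c m * mset_int nv m (G k)) \<partial>count_space UNIV)" by (simp add: nn_integral_count_space_nat)
 also have "... = (\<Sum>k. poisson_mean nv (G k))" by (subst nn_integral_suminf) (simp_all add: nn_integral_count_space_nat poisson_mean_def)
 finally show ?thesis .
qed

lemma suminf_poisson: "(\<Sum>k. ennreal (b ^ k / fact k * exp (- b))) = 1" if "0 <= b" for b :: real
proof -
 have "(%k. b ^ k / fact k * exp (- b)) sums (exp b * exp (- b))"
  using exp_converges[of b] by (intro sums_mult2) (simp add: divide_inverse mult.commute scaleR_conv_of_real)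
 then have "(%k. b ^ k / fact k * exp (- b)) sums 1" by (simp add: exp_minus)
 then have "(%k. ennreal (b ^ k / fact k * exp (- b))) sums ennreal 1"
  using that by (subst sums_ennreal) auto
 then show ?thesis by (simp add: sums_iff)
qed

lemma finite_measure_density_indicator:
 "finite_measure nv ==> B \<in> sets nv ==> finite_measure (density nv (indicator B))"
 using finite_measure.emeasure_finite[of nv B] by (intro finite_measureI) (simp add: emeasure_density less_top[symmetric])

text \<open>The thinning identity is summed over the number of points in \<open>B\<close>, whose
  Poisson weights add up to one.\<close>

lemma poisson_mean_restrict:
 assumes nv: "finite_measure nv" and B: "B \<in> sets nv" and F: "mset_meas nv F"
 shows "poisson_mean nv (%X. F (filter_mset (%x. x \<notin> B) X))
    = poisson_mean (density nv (indicator (space nv - B))) F"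
proof -
 have 1: "c = (\<Sum>k. indicator {k} n * c)" for c :: ennreal and n :: nat by (subst suminf_finite[of "{n}"]) (auto simp del: ennreal_suminf_multc)
 have "poisson_mean nv (%X. F (filter_mset (%x. x \<notin> B) X))
   = poisson_mean nv (%X. \<Sum>k. indicator {k} (size (filter_mset (%x. x \<in> B) X)) * F (filter_mset (%x. x \<notin> B) X))"
  by (rule arg_cong[of _ _ "poisson_mean nv"], rule ext, rule 1)
 also have "... = (\<Sum>k. poisson_mean nv (%X. indicator {k} (size (filter_mset (%x. x \<in> B) X)) * F (filter_mset (%x. x \<notin> B) X)))"
  by (intro poisson_mean_suminf mset_meas_filter[where F="%n X. indicator {k} n * F X" for k]
    mset_meas_times F mset_meas_size B)
 also have "... = (\<Sum>k. ennreal (measure nv B ^ k / fact k * exp (- measure nv B))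
   * poisson_mean (density nv (indicator (space nv - B))) F)" by (simp only: poisson_mean_thin[OF nv B F])
 also have "... = poisson_mean (density nv (indicator (space nv - B))) F"
  by (simp only: ennreal_suminf_multc suminf_poisson[OF measure_nonneg] mult_1_left)
 finally show ?thesis .
qed

lemma poisson_mean_distr:
 assumes nv: "finite_measure nv" and f: "f \<in> measurable nv N" and F: "mset_meas N F"
 shows "poisson_mean (distr nv N f) F = poisson_mean nv (%X. F (image_mset f X))"
proof -
 interpret finite_measure nv by fact
 interpret d: finite_measure "distr nv N f" by (rule finite_measure_distr[OF f])
 have "measure (distr nv N f) (space (distr nv N f)) = measure nv (space nv)"
  using f by (subst measure_distr) (auto simp: measurable_space intro!: arg_cong[of _ _ "measure nv"])
 then show ?thesis by (simp add: poisson_mean_def mset_int_distr[OF sigma_finite_measure_axioms f d.sigma_finite_measure_axioms F])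
qed

lemma mset_int_const:
 assumes "sigma_finite_measure nv"
 shows "mset_int nv m (%_. c) = c * emeasure nv (space nv) ^ m"
proof (induction m)
 case (Suc m)
 then show ?case
  using mset_int_Suc[OF assms, of "%_. c" m] by (simp add: mset_meas_def mult_ac)
qed (simp add: mset_int_0 assms)

lemma poisson_mean_const:
 assumes "finite_measure nv"
 shows "poisson_mean nv (%_. c) = c"
proof -
 interpret finite_measure nv by fact
 have "poisson_mean nv (%_. c) = (\<Sum>m. ennreal (measure nv (space nv) ^ m / fact m * exp (- measure nv (space nv))) * c)"
  unfolding poisson_mean_def
 proof (intro arg_cong[of _ _ suminf] ext)
  fix m :: nat
  let ?c = "measure nv (space nv)"
  have "ennreal (?c ^ m / fact m * exp (- ?c)) = ennreal (exp (- ?c) / fact m) * ennreal (?c ^ m)"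
   by (subst ennreal_mult[symmetric]) (auto simp: field_simps)
  then show "ennreal (exp (- ?c) / fact m) * mset_int nv m (%_. c) = ennreal (?c ^ m / fact m * exp (- ?c)) * c"
   by (simp add: mset_int_const[OF sigma_finite_measure_axioms] emeasure_eq_measure ennreal_power mult_ac)
 qed
 then show ?thesis by (simp only: ennreal_suminf_multc suminf_poisson[OF measure_nonneg] mult_1_left)
qed

lemma mset_meas_prod:
 "(!!i. i \<in> I ==> mset_meas N (F i)) ==> mset_meas N (%X. \<Prod>i\<in>I. F i X)" by (simp add: mset_meas_def borel_measurable_prod_ennreal)

lemma mset_meas_count:
 "B \<in> sets N ==> mset_meas N (%X. g (size (filter_mset (%x. x \<in> B) X)))"
 by (rule mset_meas_filter[where F="%n X. g n"]) (auto simp: mset_meas_def)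

text \<open>Thinning splits off one set at a time. Disjointness makes the remaining counts
  insensitive to the removal of the points in \<open>B j\<close> and keeps the masses of the other
  sets.\<close>

lemma poisson_mean_counts:
 assumes "finite I" "finite_measure nv" "!!i. i \<in> I ==> B i \<in> sets nv" "disjoint_family_on B I"
 shows "poisson_mean nv (%X. \<Prod>i\<in>I. indicator {k i} (size (filter_mset (%x. x \<in> B i) X)))
    = (\<Prod>i\<in>I. ennreal (measure nv (B i) ^ k i / fact (k i) * exp (- measure nv (B i))))"
 using assms
proof (induction I arbitrary: nv rule: finite_induct)
 case empty
 then show ?case by (simp add: poisson_mean_const)
next
 case (insert j I)
 interpret finite_measure nv by fact
 let ?F = "%X. \<Prod>i\<in>I. indicator {k i} (size (filter_mset (%x. x \<in> B i) X)) :: ennreal"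
 let ?nv = "density nv (indicator (space nv - B j))"
 have disj: "B i Int B j = {}" if "i \<in> I" for i
  using insert.prems(3) insert.hyps(2) that by (auto simp: disjoint_family_on_def)
 have F: "mset_meas nv ?F" by (intro mset_meas_prod mset_meas_count insert.prems) auto
 have "filter_mset (%x. x \<in> B i) (filter_mset (%x. x \<notin> B j) X) = filter_mset (%x. x \<in> B i) X" if "i \<in> I" for i X
  using disj[OF that] by (auto simp: filter_filter_mset intro!: filter_mset_cong)
 then have FX: "?F (filter_mset (%x. x \<notin> B j) X) = ?F X" for X by (intro prod.cong) auto
 have m: "measure ?nv (B i) = measure nv (B i)" if "i \<in> I" for i
 proof -
  have Bi: "B i \<in> sets nv" using insert.prems(2) that by auto
  have "emeasure ?nv (B i) = (\<integral>\<^sup>+x. indicator (B i) x \<partial>nv)"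
   using disj[OF that] Bi insert.prems(2)[of j] sets.sets_into_space[OF Bi]
   by (subst emeasure_density) (auto split: split_indicator intro!: nn_integral_cong simp del: nn_integral_indicator)
  then show ?thesis using Bi by (simp add: measure_def)
 qed
 have "poisson_mean nv (%X. indicator {k j} (size (filter_mset (%x. x \<in> B j) X)) * ?F (filter_mset (%x. x \<notin> B j) X))
   = ennreal (measure nv (B j) ^ k j / fact (k j) * exp (- measure nv (B j))) * poisson_mean ?nv ?F"
  by (rule poisson_mean_thin[OF insert.prems(1) _ F]) (use insert.prems in auto)
 also have "poisson_mean ?nv ?F = (\<Prod>i\<in>I. ennreal (measure nv (B i) ^ k i / fact (k i) * exp (- measure nv (B i))))"
  using insert.prems finite_measure_density_indicator[OF insert.prems(1)] by (subst insert.IH) (auto simp: m disjoint_family_on_def)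
 finally show ?case by (simp only: FX prod.insert[OF insert.hyps])
qed

text \<open>The index set is random, so the value is split according to its code under
  \<open>set_encode\<close>, which takes countably many values.\<close>

lemma measurable_pts:
 assumes X: "!!i. X i \<in> measurable M N" and P[measurable]: "!!i. Measurable.pred M (P i)"
  and F: "mset_meas N F"
 shows "(%om. F (pts (%i. X i om) {i. P i om})) \<in> borel_measurable M"
proof -
 let ?g = "%om. set_encode {i. P i om}"
 \<comment> \<open>An infinite index set has code 0, just like the empty one;
   \<open>mset_set\<close> sends both to the empty multiset, so the two cases can share a
   code.\<close>
 have 1: "?g om = n \<longleftrightarrow> (ALL i. P i om = (i \<in> set_decode n)) \<or> (n = 0 & (ALL k. \<exists>i\<ge>k. P i om))" for om n
 proof (cases "finite {i. P i om}")
  case True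
  then have "\<not> (ALL k. \<exists>i\<ge>k. P i om)" by (auto simp: finite_nat_set_iff_bounded not_le)
  moreover have "?g om = n \<longleftrightarrow> {i. P i om} = set_decode n"
   using True set_encode_inverse[OF True] by auto
  ultimately show ?thesis by (auto simp: set_eq_iff)
 next
  case False
  then have *: "ALL k. \<exists>i\<ge>k. P i om" by (auto simp: infinite_nat_iff_unbounded_le)
  have "\<not> (ALL i. P i om = (i \<in> set_decode n))"
  proof
   assume "ALL i. P i om = (i \<in> set_decode n)"
   then have "{i. P i om} = set_decode n" by auto
   with False show False by simp
  qed
  with * False show ?thesis by (auto simp: set_encode_inf)
 qed
 have g: "?g \<in> measurable M (count_space UNIV)"
 proof (rule measurable_count_space_eq2_countable[THEN iffD2], safe)
  fix n
  have "?g -` {n} Int space M = {om\<in>space M. (ALL i. P i om = (i \<in> set_decode n)) \<or> (n = 0 & (ALL k. \<exists>i\<ge>k. P i om))}"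
   by (intro set_eqI) (simp only: vimage_eq Int_iff singleton_iff mem_Collect_eq 1 conj_commute)
  also have "... \<in> sets M" by measurable
  finally show "?g -` {n} Int space M \<in> sets M" .
 qed auto
 have "(%om. F (pts (%i. X i om) (set_decode n))) \<in> borel_measurable M" for n
 proof -
  obtain m where m: "set_decode n <= {..<m}"
   using finite_set_decode[of n] by (meson finite_nat_iff_bounded)
  have "(%om. \<lambda>i\<in>{..<m}. X i om) \<in> measurable M (\<Pi>\<^sub>M i\<in>{..<m}. N)" by (intro measurable_restrict X)
  from measurable_compose[OF this mset_meas_subset[OF F m]]
  have "(%om. F (pts (\<lambda>i\<in>{..<m}. X i om) (set_decode n))) \<in> borel_measurable M" .
  moreover have "pts (\<lambda>i\<in>{..<m}. X i om) (set_decode n) = pts (%i. X i om) (set_decode n)" for om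
   using m by (intro image_mset_cong) auto
  ultimately show ?thesis by simp
 qed
 from measurable_compose_countable[OF this g]
 have "(%om. F (pts (%i. X i om) (set_decode (?g om)))) \<in> borel_measurable M" .
 moreover have "pts (%i. X i om) (set_decode (?g om)) = pts (%i. X i om) {i. P i om}" for om
  by (cases "finite {i. P i om}") (auto simp: set_encode_inverse set_encode_inf)
 ultimately show ?thesis by simp
qed

text \<open>This is the thinning identity for the complement of \<open>A\<close> with no point
  allowed there.\<close>

lemma mset_int_density:
 assumes nv: "sigma_finite_measure nv" and A: "A \<in> sets nv" and F: "mset_meas nv F"
  and nv': "sigma_finite_measure (density nv (indicator A))"
 shows "mset_int (density nv (indicator A)) m F
    = mset_int nv m (%X. indicator {X. set_mset X <= A} X * F X)"
proof -
 have B: "space nv - A \<in> sets nv" using A by auto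
 have d: "density nv (indicator A) = density nv (indicator (space nv - (space nv - A)))"
  using sets.sets_into_space[OF A] by (simp add: double_diff)
 have "mset_int nv m (%X. indicator {X. set_mset X <= A} X * F X)
   = mset_int nv m (%X. indicator {0} (size (filter_mset (%x. x \<in> space nv - A) X)) * F (filter_mset (%x. x \<notin> space nv - A) X))"
 proof (rule mset_int_cong)
  fix X assume X: "set_mset X <= space nv"
  show "indicator {X. set_mset X <= A} X * F X = indicator {0} (size (filter_mset (%x. x \<in> space nv - A) X)) * F (filter_mset (%x. x \<notin> space nv - A) X)"
  proof (cases "set_mset X <= A")
   case True
   then have "filter_mset (%x. x \<in> space nv - A) X = {#}" "filter_mset (%x. x \<notin> space nv - A) X = X" by (auto simp: filter_mset_eq_conv)
   then show ?thesis using True by simp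
  next
   case False
   with X obtain x where "x \<in># X" "x \<in> space nv - A" by auto
   then have "x \<in># filter_mset (%x. x \<in> space nv - A) X" by simp
   then have "filter_mset (%x. x \<in> space nv - A) X ~= {#}" by (metis empty_not_add_mset multi_member_split)
   then show ?thesis using False by simp
  qed
 qed
 also have "... = mset_int (density nv (indicator A)) m F"
  using mset_int_thin[OF nv B F, of m 0] nv' unfolding d by simp
 finally show ?thesis ..
qed

section \<open>Poisson arrivals with independent marks\<close>

text \<open>The transposition of the index \<open>j\<close> with the last one preserves the product measure, and
  almost everywhere exactly one index carries the largest time; hence the factor \<open>m!\<close>.\<close>

lemma nn_integral_PiM_transpose:
 fixes j k n :: nat
 assumes nv: "sigma_finite_measure nv" and j: "j < n" "k < n"
  and f: "f \<in> borel_measurable (\<Pi>\<^sub>M i\<in>{..<n}. nv)"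
 shows "(\<integral>\<^sup>+x. f (\<lambda>i\<in>{..<n}. x (Transposition.transpose j k i)) \<partial>(\<Pi>\<^sub>M i\<in>{..<n}. nv)) = (\<integral>\<^sup>+x. f x \<partial>(\<Pi>\<^sub>M i\<in>{..<n}. nv))"
proof -
 interpret product_sigma_finite "%_::nat. nv" by (rule product_sigma_finite_const[OF nv])
 let ?P = "\<Pi>\<^sub>M i\<in>{..<n}. nv"
 let ?t = "Transposition.transpose j k"
 let ?T = "%x. \<lambda>i\<in>{..<n}. x (?t i)"
 have t: "?t i < n" if "i < n" for i using that j by (auto simp: Transposition.transpose_def)
 have T: "?T \<in> measurable ?P ?P" by (rule measurable_restrict, rule measurable_component_singleton) (use t in auto)
 have "distr ?P ?P ?T = ?P"
 proof (rule PiM_eqI)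
  fix A assume A: "!!i. i \<in> {..<n} ==> A i \<in> sets nv"
  have "?T -` Pi\<^sub>E {..<n} A Int space ?P = Pi\<^sub>E {..<n} (%i. A (?t i))"
  proof (intro set_eqI iffI)
   fix x assume x: "x \<in> ?T -` Pi\<^sub>E {..<n} A Int space ?P"
   have "x i \<in> A (?t i)" if "i < n" for i
   proof -
    have "?T x (?t i) \<in> A (?t i)" using x t[OF that] by (auto simp: PiE_def Pi_def)
    then show ?thesis using t[OF that] by simp
   qed
   then show "x \<in> Pi\<^sub>E {..<n} (%i. A (?t i))" using x by (auto simp: space_PiM PiE_def)
  next
   fix x assume x: "x \<in> Pi\<^sub>E {..<n} (%i. A (?t i))"
   have "x (?t i) \<in> A i" if "i < n" for i
    using x t[OF that] by (auto simp: PiE_def Pi_def dest!: spec[of _ "?t i"])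
   moreover have "x i \<in> space nv" if "i < n" for i
   proof -
    have "x i \<in> A (?t i)" using x that by auto
    then show ?thesis using sets.sets_into_space[OF A, of "?t i"] t[OF that] by auto
   qed
   ultimately show "x \<in> ?T -` Pi\<^sub>E {..<n} A Int space ?P"
    using x by (auto simp: space_PiM PiE_def)
  qed
  then have "emeasure (distr ?P ?P ?T) (Pi\<^sub>E {..<n} A) = emeasure ?P (Pi\<^sub>E {..<n} (%i. A (?t i)))"
   using A by (subst emeasure_distr[OF T]) (auto intro!: sets_PiM_I_finite)
  also have "... = (\<Prod>i\<in>{..<n}. emeasure nv (A (?t i)))"
   using A t by (subst emeasure_PiM) auto
  also have "... = (\<Prod>i\<in>{..<n}. emeasure nv (A i))" by (rule prod.reindex_bij_witness[of _ ?t ?t]) (use t in auto)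
  finally show "emeasure (distr ?P ?P ?T) (Pi\<^sub>E {..<n} A) = (\<Prod>i\<in>{..<n}. emeasure nv (A i))" .
 qed auto
 then have "(\<integral>\<^sup>+x. f x \<partial>?P) = (\<integral>\<^sup>+x. f x \<partial>distr ?P ?P ?T)" by simp
 also have "... = (\<integral>\<^sup>+x. f (?T x) \<partial>?P)" using nn_integral_distr[OF T, of f] f by simp
 finally show ?thesis ..
qed

text \<open>Fubini in the coordinate \<open>j\<close>: with the other coordinates fixed, a tie means
  that \<open>g (x j)\<close> hits one prescribed value.\<close>

lemma AE_PiM_no_ties:
 fixes g :: "'a => real" and i j n :: nat
 assumes nv: "sigma_finite_measure nv" and g[measurable]: "g \<in> borel_measurable nv"
  and null: "!!c. emeasure nv {y\<in>space nv. g y = c} = 0" and ij: "i < n" "j < n" "i ~= j"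
 shows "AE x in (\<Pi>\<^sub>M i\<in>{..<n}. nv). g (x i) ~= g (x j)"
proof -
 interpret product_sigma_finite "%_::nat. nv" by (rule product_sigma_finite_const[OF nv])
 let ?J = "{..<n} - {j}"
 have n: "{..<n} = insert j ?J" using ij by auto
 let ?P = "\<Pi>\<^sub>M i\<in>insert j ?J. nv"
 have [measurable]: "(%x. x i) \<in> measurable ?P nv" "(%x. x j) \<in> measurable ?P nv" by (rule measurable_component_singleton, use ij in auto)+
 let ?N = "{x\<in>space ?P. g (x i) = g (x j)}"
 have N[measurable]: "?N \<in> sets ?P" by measurable
 have "emeasure ?P ?N = (\<integral>\<^sup>+x. indicator ?N x \<partial>?P)" by (rule nn_integral_indicator[OF N, symmetric])
 also have "... = (\<integral>\<^sup>+x. \<integral>\<^sup>+y. indicator ?N (x(j := y)) \<partial>nv \<partial>(\<Pi>\<^sub>M i\<in>?J. nv))"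
  by (rule product_nn_integral_insert[OF _ _ borel_measurable_indicator[OF N]]) auto
 also have "... = (\<integral>\<^sup>+x. 0 \<partial>(\<Pi>\<^sub>M i\<in>?J. nv))"
 proof (intro nn_integral_cong)
  fix x assume x: "x \<in> space (\<Pi>\<^sub>M i\<in>?J. nv)"
  have "(\<integral>\<^sup>+y. indicator ?N (x(j := y)) \<partial>nv) <= (\<integral>\<^sup>+y. indicator {y\<in>space nv. g y = g (x i)} y \<partial>nv)"
   using ij by (intro nn_integral_mono) (auto simp: indicator_def)
  also have "... = 0" using null[of "g (x i)"] by simp
  finally show "(\<integral>\<^sup>+y. indicator ?N (x(j := y)) \<partial>nv) = 0" by simp
 qed
 finally have "emeasure ?P ?N = 0" by simp
 then have "AE x in ?P. g (x i) ~= g (x j)" by (intro AE_I[OF _ _ N]) auto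
 then show ?thesis by (simp only: n[symmetric])
qed

section \<open>Ordered samples\<close>

definition sorted_times :: "nat => (nat => real \<times> 'k) => bool" where
 "sorted_times m x \<longleftrightarrow> (\<forall>i<m. \<forall>j<i. fst (x j) <= fst (x i))"

lemma sorted_times_upd:
 "sorted_times (Suc m) (x(m := y)) \<longleftrightarrow> sorted_times m x & (\<forall>i<m. fst (x i) <= fst y)"
 unfolding sorted_times_def by (auto simp: less_Suc_eq)

lemma measurable_time_component:
 assumes "fst \<in> borel_measurable nv" "i \<in> I"
 shows "(%x. fst (x i)) \<in> borel_measurable (\<Pi>\<^sub>M i\<in>I. nv)"
 using measurable_compose[OF measurable_component_singleton[of i I "%_. nv"] assms(1)] assms(2) by simp

lemma measurable_sorted_times:
 assumes fst: "fst \<in> borel_measurable nv"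
 shows "Measurable.pred (\<Pi>\<^sub>M i\<in>{..<m}. nv) (sorted_times m)"
proof -
 have [measurable]: "Measurable.pred (\<Pi>\<^sub>M i\<in>{..<m}. nv) (%x. fst (x j) <= fst (x i))" if "i < m" "j < i" for i j
  unfolding pred_def by (rule borel_measurable_le; rule measurable_time_component[OF fst]) (use that in auto)
 have "Measurable.pred (\<Pi>\<^sub>M i\<in>{..<m}. nv) (%x. \<forall>i\<in>{..<m}. \<forall>j\<in>{..<i}. fst (x j) <= fst (x i))"
  by (intro pred_intros_finite) auto
 then show ?thesis by (simp add: sorted_times_def[abs_def] Ball_def)
qed

lemma mset_int_sorted:
 fixes nv :: "(real \<times> 'k) measure"
 assumes nv: "sigma_finite_measure nv" and fst_m: "fst \<in> borel_measurable nv"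
  and null: "!!c. emeasure nv {y\<in>space nv. fst y = c} = 0"
  and F: "mset_meas nv F"
 shows "mset_int nv m F
    = fact m * (\<integral>\<^sup>+x. indicator {x. sorted_times m x} x * F (pts x {..<m}) \<partial>(\<Pi>\<^sub>M i\<in>{..<m}. nv))"
 using F
proof (induction m arbitrary: F)
 case 0
 have "mset_int nv 0 F = (\<integral>\<^sup>+x. indicator {x. sorted_times 0 x} x * F (pts x {..<0}) \<partial>(\<Pi>\<^sub>M i\<in>{..<0}. nv))"
  by (simp add: mset_int_def sorted_times_def)
 then show ?case by simp
next
 case (Suc m)
 interpret product_sigma_finite "%_::nat. nv" by (rule product_sigma_finite_const[OF nv])
 note F = Suc.prems
 let ?P = "%m. \<Pi>\<^sub>M i\<in>{..<m}. nv"
 let ?f = "%x. F (pts x {..<Suc m})"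
 note tm[measurable] = measurable_time_component[OF fst_m]
 have f[measurable]: "?f \<in> borel_measurable (?P (Suc m))" using F by (simp add: mset_meas_def)
 define L where "L j x \<longleftrightarrow> (\<forall>i\<in>{..<Suc m}. fst (x i :: real \<times> 'k) <= fst (x j))" for j x
 have L[measurable]: "Measurable.pred (?P (Suc m)) (L j)" if "j < Suc m" for j
  unfolding L_def[abs_def]
 proof (intro pred_intros_finite)
  fix i assume "i \<in> {..<Suc m}"
  then show "Measurable.pred (?P (Suc m)) (%x. fst (x i) <= fst (x j))"
   using that unfolding pred_def by (intro borel_measurable_le tm) auto
 qed simp
 have AE: "AE x in ?P (Suc m). \<forall>j\<in>{..<Suc m}. \<forall>i\<in>{..<Suc m}. i ~= j --> fst (x i) ~= fst (x j)"
  by (auto simp: AE_finite_all AE_ball_countable intro!: AE_PiM_no_ties[OF nv fst_m null] AE_impI)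
 \<comment> \<open>There is almost everywhere a unique latest point, so the indicators of its index
   sum to one.\<close>
 have "mset_int nv (Suc m) F = (\<integral>\<^sup>+x. (\<Sum>j<Suc m. indicator {x. L j x} x * ?f x) \<partial>?P (Suc m))"
  unfolding mset_int_def
 proof (rule nn_integral_cong_AE, use AE in eventually_elim)
  fix x :: "nat => real \<times> 'k"
  assume x: "\<forall>j\<in>{..<Suc m}. \<forall>i\<in>{..<Suc m}. i ~= j --> fst (x i) ~= fst (x j)"
  obtain j where j: "j < Suc m" "L j x"
  proof -
   have "Max ((%i. fst (x i)) ` {..<Suc m}) \<in> (%i. fst (x i)) ` {..<Suc m}" by (rule Max_in) auto
   then obtain j where "j < Suc m" "fst (x j) = Max ((%i. fst (x i)) ` {..<Suc m})" by auto
   then show ?thesis by (intro that[of j]) (auto simp: L_def)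
  qed
  have u: "i = j" if "i < Suc m" "L i x" for i
   using x j that unfolding L_def by (metis lessThan_iff order_antisym)
  have "(\<Sum>i<Suc m. indicator {x. L i x} x * c) = c" for c :: ennreal
  proof -
   have "(\<Sum>i<Suc m. indicator {x. L i x} x * c) = (\<Sum>i<Suc m. if i = j then c else 0)"
   proof (rule sum.cong)
    fix i assume "i \<in> {..<Suc m}"
    then show "indicator {x. L i x} x * c = (if i = j then c else 0)"
     using j u[of i] by (cases "L i x") auto
   qed simp
   also have "... = c" using j by (subst sum.delta) auto
   finally show ?thesis .
  qed
  then show "?f x = (\<Sum>j<Suc m. indicator {x. L j x} x * ?f x)" by (rule sym)
 qed
 also have "... = (\<Sum>j<Suc m. \<integral>\<^sup>+x. indicator {x. L j x} x * ?f x \<partial>?P (Suc m))" by (rule nn_integral_sum) (use L in auto)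
 also have "... = (\<Sum>j<Suc m. \<integral>\<^sup>+x. indicator {x. L m x} x * ?f x \<partial>?P (Suc m))"
 proof (rule sum.cong, rule refl)
  fix j assume "j \<in> {..<Suc m}"
  then have j: "j < Suc m" by simp
  let ?t = "Transposition.transpose j m"
  have t: "?t i < Suc m" if "i < Suc m" for i using that j by (auto simp: Transposition.transpose_def)
  have inj: "inj_on ?t A" for A by (rule inj_onI) (metis transpose_eq_iff)
  have im: "?t ` {..<Suc m} = {..<Suc m}"
  proof
   show "?t ` {..<Suc m} <= {..<Suc m}" using t by auto
   show "{..<Suc m} <= ?t ` {..<Suc m}"
   proof
    fix i assume "i \<in> {..<Suc m}"
    then have "?t i \<in> {..<Suc m}" "i = ?t (?t i)" using t by auto
    then show "i \<in> ?t ` {..<Suc m}" by blast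
   qed
  qed
  have meas: "(%x. indicator {x. L m x} x * ?f x) \<in> borel_measurable (?P (Suc m))" by measurable
  have "(\<integral>\<^sup>+x. indicator {x. L m x} x * ?f x \<partial>?P (Suc m))
    = (\<integral>\<^sup>+x. indicator {x. L m x} (\<lambda>i\<in>{..<Suc m}. x (?t i)) * ?f (\<lambda>i\<in>{..<Suc m}. x (?t i)) \<partial>?P (Suc m))"
   by (rule nn_integral_PiM_transpose[OF nv j _ meas, symmetric]) simp
  also have "... = (\<integral>\<^sup>+x. indicator {x. L j x} x * ?f x \<partial>?P (Suc m))"
  proof (rule nn_integral_cong)
   fix x assume "x \<in> space (?P (Suc m))"
   have "L m (\<lambda>i\<in>{..<Suc m}. x (?t i)) \<longleftrightarrow> (\<forall>i\<in>{..<Suc m}. fst (x (?t i)) <= fst (x j))"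
    by (simp add: L_def Ball_def)
   also have "... \<longleftrightarrow> (\<forall>i\<in>?t ` {..<Suc m}. fst (x i) <= fst (x j))" by blast
   finally have 1: "L m (\<lambda>i\<in>{..<Suc m}. x (?t i)) \<longleftrightarrow> L j x" by (simp only: im L_def)
   have "pts (\<lambda>i\<in>{..<Suc m}. x (?t i)) {..<Suc m} = pts (x \<circ> ?t) {..<Suc m}" by (intro image_mset_cong) auto
   also have "... = image_mset x (image_mset ?t (mset_set {..<Suc m}))" by (simp only: multiset.map_comp)
   also have "image_mset ?t (mset_set {..<Suc m}) = mset_set {..<Suc m}" by (simp only: image_mset_mset_set[OF inj] im)
   finally show "indicator {x. L m x} (\<lambda>i\<in>{..<Suc m}. x (?t i)) * ?f (\<lambda>i\<in>{..<Suc m}. x (?t i))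
     = indicator {x. L j x} x * ?f x"
    using 1 by (simp only: indicator_def mem_Collect_eq)
  qed
  finally show "(\<integral>\<^sup>+x. indicator {x. L j x} x * ?f x \<partial>?P (Suc m))
    = (\<integral>\<^sup>+x. indicator {x. L m x} x * ?f x \<partial>?P (Suc m))" ..
 qed
 also have "... = of_nat (Suc m) * (\<integral>\<^sup>+x. indicator {x. L m x} x * ?f x \<partial>?P (Suc m))" by simp
 also have "(\<integral>\<^sup>+x. indicator {x. L m x} x * ?f x \<partial>?P (Suc m))
   = (\<integral>\<^sup>+y. \<integral>\<^sup>+x. indicator {x. L m x} (x(m := y)) * ?f (x(m := y)) \<partial>?P m \<partial>nv)"
 proof -
  have m: "(%x. indicator {x. L m x} x * ?f x) \<in> borel_measurable (\<Pi>\<^sub>M i\<in>insert m {..<m}. nv)"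
   using L[of m] f by (simp add: lessThan_Suc[symmetric])
  show ?thesis
   unfolding lessThan_Suc[of m] by (rule product_nn_integral_insert_rev[OF _ _ m[unfolded lessThan_Suc[of m]]]) auto
 qed
 \<comment> \<open>With the latest point \<open>y\<close> fixed, the other points form an unordered
   sample of times at most \<open>fst y\<close>, to which the induction hypothesis applies with a
   new symmetric function.\<close>
 also have "... = (\<integral>\<^sup>+y. mset_int nv m (%X. indicator {X. \<forall>z\<in>#X. fst z <= fst y} X * F (add_mset y X)) \<partial>nv)"
 proof (intro nn_integral_cong)
  fix y x
  have "L m (x(m := y)) \<longleftrightarrow> (\<forall>z\<in>#pts x {..<m}. fst z <= fst y)" for x by (auto simp: L_def less_Suc_eq)
  then show "(\<integral>\<^sup>+x. indicator {x. L m x} (x(m := y)) * ?f (x(m := y)) \<partial>?P m)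
    = mset_int nv m (%X. indicator {X. \<forall>z\<in>#X. fst z <= fst y} X * F (add_mset y X))"
   unfolding mset_int_def pts_fun_upd by (intro nn_integral_cong) (simp add: indicator_def)
 qed
 also have "... = (\<integral>\<^sup>+y. fact m * (\<integral>\<^sup>+x. indicator {x. sorted_times (Suc m) x} (x(m := y)) * ?f (x(m := y)) \<partial>?P m) \<partial>nv)"
 proof (intro nn_integral_cong)
  fix y assume y: "y \<in> space nv"
  have 1: "mset_meas nv (%X. indicator {X. \<forall>z\<in>#X. fst z <= fst y} X)"
   unfolding mset_meas_def
  proof
   fix n :: nat
   have "Measurable.pred (?P n) (%x. \<forall>i\<in>{..<n}. fst (x i) <= fst y)"
    unfolding pred_def by (intro sets.sets_Collect_finite_All borel_measurable_le tm) auto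
   then have "(%x. indicator {x. \<forall>i\<in>{..<n}. fst (x i) <= fst y} x :: ennreal) \<in> borel_measurable (?P n)" by measurable
   then show "(%x. indicator {X. \<forall>z\<in>#X. fst z <= fst y} (pts x {..<n}) :: ennreal) \<in> borel_measurable (?P n)"
    by (simp add: indicator_def)
  qed
  show "mset_int nv m (%X. indicator {X. \<forall>z\<in>#X. fst z <= fst y} X * F (add_mset y X))
    = fact m * (\<integral>\<^sup>+x. indicator {x. sorted_times (Suc m) x} (x(m := y)) * ?f (x(m := y)) \<partial>?P m)"
   unfolding pts_fun_upd Suc.IH[OF mset_meas_times[OF 1 mset_meas_add[OF F y]]]
  proof (rule arg_cong2[of _ _ _ _ "(*)"], rule refl, rule nn_integral_cong)
   fix x :: "nat => real \<times> 'k"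
   have "sorted_times (Suc m) (x(m := y)) \<longleftrightarrow> sorted_times m x & (\<forall>z\<in>#pts x {..<m}. fst z <= fst y)"
    by (auto simp: sorted_times_upd)
   then show "indicator {x. sorted_times m x} x * (indicator {X. \<forall>z\<in>#X. fst z <= fst y} (pts x {..<m})
      * F (add_mset y (pts x {..<m})))
     = indicator {x. sorted_times (Suc m) x} (x(m := y)) * F (add_mset y (pts x {..<m}))"
    by (simp only: indicator_def mem_Collect_eq of_bool_conj mult.assoc)
  qed
 qed
 also have "... = fact m * (\<integral>\<^sup>+x. indicator {x. sorted_times (Suc m) x} x * ?f x \<partial>?P (Suc m))"
 proof -
  have "Measurable.pred (\<Pi>\<^sub>M i\<in>insert m {..<m}. nv) (sorted_times (Suc m))"
   using measurable_sorted_times[OF fst_m, of "Suc m"] by (simp add: lessThan_Suc)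
  then have m: "(%x. indicator {x. sorted_times (Suc m) x} x * ?f x) \<in> borel_measurable (\<Pi>\<^sub>M i\<in>insert m {..<m}. nv)"
   using f by (simp add: lessThan_Suc[symmetric])
  have eq: "(\<integral>\<^sup>+x. indicator {x. sorted_times (Suc m) x} x * ?f x \<partial>?P (Suc m))
   = (\<integral>\<^sup>+y. \<integral>\<^sup>+x. indicator {x. sorted_times (Suc m) x} (x(m := y)) * ?f (x(m := y)) \<partial>?P m \<partial>nv)"
   unfolding lessThan_Suc[of m] by (rule product_nn_integral_insert_rev[OF _ _ m[unfolded lessThan_Suc[of m]]]) auto
  interpret P: sigma_finite_measure "?P m" by (rule sigma_finite) simp
  have "(%(x, y). x(m := y)) \<in> measurable (?P m \<Otimes>\<^sub>M nv) (\<Pi>\<^sub>M i\<in>insert m {..<m}. nv)" by (rule measurable_add_dim)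
  from measurable_compose[OF this m]
  have mm: "(%(x, y). indicator {x. sorted_times (Suc m) x} (x(m := y)) * ?f (x(m := y))) \<in> borel_measurable (?P m \<Otimes>\<^sub>M nv)"
   by (simp only: split_beta')
  have "(%y. \<integral>\<^sup>+x. indicator {x. sorted_times (Suc m) x} (x(m := y)) * ?f (x(m := y)) \<partial>?P m) \<in> borel_measurable nv"
   by (rule P.borel_measurable_nn_integral, subst measurable_pair_swap_iff)
     (use mm in \<open>simp only: split_beta' fst_conv snd_conv\<close>)
  then show ?thesis unfolding eq by (rule nn_integral_cmult)
 qed
 finally show ?case by (simp add: mult.assoc)
qed

section \<open>From exponential gaps to Poisson samples\<close>

definition arr_intensity :: "real => 'k measure => real set => (real \<times> 'k) measure" where
 "arr_intensity th ka I = density (lborel \<Otimes>\<^sub>M ka) (%z. ennreal th * indicator I (fst z))"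

definition exp_marked :: "real => 'k measure => (real \<times> 'k) measure" where
 "exp_marked th ka = density lborel (exponential_density th) \<Otimes>\<^sub>M ka"

definition arr_points :: "nat => (nat => real \<times> 'k) => nat => real \<times> 'k" where
 "arr_points m x = (\<lambda>i\<in>{..<m}. (\<Sum>j\<le>i. fst (x j), snd (x i)))"

lemma sets_arr_intensity[measurable_cong, simp]:
 "sets (arr_intensity th ka I) = sets (borel \<Otimes>\<^sub>M ka)" by (simp add: arr_intensity_def cong: sets_pair_measure_cong)

lemma sets_exp_marked[measurable_cong, simp]: "sets (exp_marked th ka) = sets (borel \<Otimes>\<^sub>M ka)"
 unfolding exp_marked_def by (rule sets_pair_measure_cong) simp_all

lemma space_exp_marked: "space (exp_marked th ka) = UNIV \<times> space ka" by (simp add: exp_marked_def space_pair_measure)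

lemma prob_space_exp_marked: "0 < th ==> prob_space ka ==> prob_space (exp_marked th ka)"
 unfolding exp_marked_def by (intro prob_space_pair prob_space_exponential_density)

lemma nn_integral_arr_intensity:
 assumes ka: "prob_space ka" and I[measurable]: "I \<in> sets borel" and f: "f \<in> borel_measurable (borel \<Otimes>\<^sub>M ka)"
 shows "(\<integral>\<^sup>+z. f z \<partial>arr_intensity th ka I) = (\<integral>\<^sup>+v. ennreal th * indicator I v * (\<integral>\<^sup>+k. f (v, k) \<partial>ka) \<partial>lborel)"
proof -
 interpret ka: prob_space ka by fact
 note f[measurable]
 have "(\<integral>\<^sup>+z. f z \<partial>arr_intensity th ka I) = (\<integral>\<^sup>+z. ennreal th * indicator I (fst z) * f z \<partial>(lborel \<Otimes>\<^sub>M ka))"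
  unfolding arr_intensity_def by (rule nn_integral_density) measurable
 also have "... = (\<integral>\<^sup>+v. \<integral>\<^sup>+k. ennreal th * indicator I v * f (v, k) \<partial>ka \<partial>lborel)"
  by (subst ka.nn_integral_fst[symmetric]) ((measurable)[1], simp)
 also have "... = (\<integral>\<^sup>+v. ennreal th * indicator I v * (\<integral>\<^sup>+k. f (v, k) \<partial>ka) \<partial>lborel)"
  by (intro nn_integral_cong nn_integral_cmult) measurable
 finally show ?thesis .
qed

lemma emeasure_arr_intensity_space:
 assumes "prob_space ka" "I \<in> sets borel"
 shows "emeasure (arr_intensity th ka I) (space (arr_intensity th ka I)) = ennreal th * emeasure lborel I"
proof -
 interpret ka: prob_space ka by fact
 have "emeasure (arr_intensity th ka I) (space (arr_intensity th ka I)) = (\<integral>\<^sup>+z. 1 \<partial>arr_intensity th ka I)" by simp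
 also have "... = (\<integral>\<^sup>+v. ennreal th * indicator I v \<partial>lborel)"
  using assms by (subst nn_integral_arr_intensity) (auto simp: ka.emeasure_space_1)
 finally show ?thesis using assms(2) by (simp add: nn_integral_cmult)
qed

lemma sigma_finite_arr_intensity:
 assumes "prob_space ka" "I \<in> sets borel"
 shows "sigma_finite_measure (arr_intensity th ka I)"
proof -
 interpret ka: prob_space ka by fact
 interpret pair_sigma_finite lborel ka ..
 show ?thesis
  using assms(2) unfolding arr_intensity_def by (subst sigma_finite_iff_density_finite) (auto simp: indicator_def ennreal_mult_eq_top_iff)
qed

lemma arr_intensity_null:
 assumes "prob_space ka" "I \<in> sets borel"
 shows "emeasure (arr_intensity th ka I) {y\<in>space (arr_intensity th ka I). fst y = c} = 0"
proof -
 interpret ka: prob_space ka by fact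
 have m: "{y\<in>space (arr_intensity th ka I). fst y = c} = {c} \<times> space ka" by (auto simp: arr_intensity_def space_pair_measure)
 have "emeasure (arr_intensity th ka I) ({c} \<times> space ka) = (\<integral>\<^sup>+z. indicator ({c} \<times> space ka) z \<partial>arr_intensity th ka I)"
  by (rule nn_integral_indicator[symmetric]) auto
 also have "... = (\<integral>\<^sup>+v. ennreal th * indicator I v * indicator {c} v \<partial>lborel)"
  using assms by (subst nn_integral_arr_intensity)
    (auto simp: indicator_times nn_integral_cmult ka.emeasure_space_1)
 also have "... = 0"
  using assms(2) by (subst nn_integral_0_iff_AE) (auto simp: AE_lborel_singleton intro!: eventually_mono[OF AE_lborel_singleton[of c]])
 finally show ?thesis by (simp add: m)
qed

lemma AE_gaps_nonneg:
 fixes I :: "nat set"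
 assumes th: "0 < th" and ka: "prob_space ka"
 shows "AE x in (\<Pi>\<^sub>M i\<in>I. exp_marked th ka). \<forall>i\<in>I. 0 <= fst (x i)"
proof -
 interpret ka: prob_space ka by fact
 interpret e: prob_space "density lborel (exponential_density th)" by (rule prob_space_exponential_density[OF th])
 interpret p: pair_sigma_finite "density lborel (exponential_density th)" ka ..
 have "AE g in density lborel (exponential_density th). 0 <= g" by (subst AE_density) (auto simp: exponential_density_def)
 then have "AE z in exp_marked th ka. 0 <= fst z"
  unfolding exp_marked_def by (intro p.AE_pair_measure) ((measurable)[1], auto elim: eventually_mono)
 then have "AE x in (\<Pi>\<^sub>M i\<in>I. exp_marked th ka). 0 <= fst (x i)" if "i \<in> I" for i
  using that by (intro AE_PiM_component[where P="%z. 0 <= fst z"] prob_space_exp_marked th ka)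
 then show ?thesis by (simp add: AE_ball_countable)
qed

lemma measurable_arr_points[measurable]:
 "arr_points m \<in> measurable (\<Pi>\<^sub>M i\<in>{..<m}. borel \<Otimes>\<^sub>M ka) (\<Pi>\<^sub>M i\<in>{..<m}. borel \<Otimes>\<^sub>M ka)"
proof -
 have "(%x. (\<Sum>j\<le>i. fst (x j) :: real, snd (x i))) \<in> measurable (\<Pi>\<^sub>M i\<in>{..<m}. borel \<Otimes>\<^sub>M ka) (borel \<Otimes>\<^sub>M ka)" if "i < m" for i
 proof (rule measurable_Pair)
  have "(%x. x j) \<in> measurable (\<Pi>\<^sub>M i\<in>{..<m}. borel \<Otimes>\<^sub>M ka) ((borel :: real measure) \<Otimes>\<^sub>M ka)" if "j < m" for j
   by (rule measurable_component_singleton) (use that in auto)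
  note * = measurable_compose[OF this measurable_fst] measurable_compose[OF this measurable_snd]
  show "(%x. \<Sum>j\<le>i. fst (x j) :: real) \<in> borel_measurable (\<Pi>\<^sub>M i\<in>{..<m}. borel \<Otimes>\<^sub>M ka)"
  proof (rule borel_measurable_sum)
   fix j assume "j \<in> {..i}"
   with that show "(%x. fst (x j) :: real) \<in> borel_measurable (\<Pi>\<^sub>M i\<in>{..<m}. borel \<Otimes>\<^sub>M ka)" by (intro *(1)) simp
  qed
  show "(%x. snd (x i)) \<in> measurable (\<Pi>\<^sub>M i\<in>{..<m}. (borel :: real measure) \<Otimes>\<^sub>M ka) ka" by (rule *(2)) (rule that)
 qed
 then show ?thesis unfolding arr_points_def[abs_def] by (intro measurable_restrict) auto
qed

lemma arr_points_upd:
 "arr_points (Suc m) (x(m := y)) = (arr_points m x)(m := ((\<Sum>j<m. fst (x j)) + fst y, snd y))"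
proof
 fix i
 have "(\<Sum>j\<le>m. fst ((x(m := y)) j)) = (\<Sum>j<m. fst (x j)) + fst y" by (simp add: atMost_Suc lessThan_Suc_atMost[symmetric])
 moreover have "(\<Sum>j\<le>i. fst ((x(m := y)) j)) = (\<Sum>j\<le>i. fst (x j))" if "i < m"
  using that by (intro sum.cong) auto
 ultimately show "arr_points (Suc m) (x(m := y)) i = ((arr_points m x)(m := ((\<Sum>j<m. fst (x j)) + fst y, snd y))) i"
  by (auto simp: arr_points_def)
qed

text \<open>Change of variables from gaps to arrival times. The exponential factor on the left
  cancels the densities of the gaps, so each gap carries \<open>th\<close> times Lebesgue measure;
  partial sums of non-negative gaps then sweep exactly the sorted sequences of times.\<close>

lemma nn_integral_arr_points:
 assumes th: "0 < th" and ka: "prob_space ka"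
  and G: "G \<in> borel_measurable (\<Pi>\<^sub>M i\<in>{..<m}. borel \<Otimes>\<^sub>M ka)"
 shows "(\<integral>\<^sup>+x. ennreal (exp (th * (\<Sum>j<m. fst (x j)))) * G (arr_points m x) \<partial>(\<Pi>\<^sub>M i\<in>{..<m}. exp_marked th ka))
    = (\<integral>\<^sup>+x. indicator {x. sorted_times m x} x * G x \<partial>(\<Pi>\<^sub>M i\<in>{..<m}. arr_intensity th ka {0..}))"
 using G
proof (induction m arbitrary: G)
 case 0
 have 1: "sigma_finite_measure (exp_marked th ka)"
  using prob_space_exp_marked[OF th ka] by (simp add: prob_space_def finite_measure_def)
 note 2 = sigma_finite_arr_intensity[OF ka, of "{0..}" th]
 show ?case
  using product_sigma_finite.nn_integral_empty[OF product_sigma_finite_const[OF 1, where 'b=nat], of "%x. G (arr_points 0 x)"]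
  using product_sigma_finite.nn_integral_empty[OF product_sigma_finite_const[OF 2, where 'b=nat], of "G"]
  by (simp add: sorted_times_def arr_points_def restrict_def)
next
 case (Suc m)
 interpret ka: prob_space ka by fact
 interpret e: prob_space "exp_marked th ka" by (rule prob_space_exp_marked[OF th ka])
 interpret a: sigma_finite_measure "arr_intensity th ka {0..}" by (rule sigma_finite_arr_intensity[OF ka]) simp
 interpret E: product_sigma_finite "%_::nat. exp_marked th ka" by (rule product_sigma_finite_const) unfold_locales
 interpret A: product_sigma_finite "%_::nat. arr_intensity th ka {0..}" by (rule product_sigma_finite_const) unfold_locales
 let ?N = "borel \<Otimes>\<^sub>M ka :: (real \<times> 'a) measure"
 let ?E = "\<Pi>\<^sub>M i\<in>{..<m}. exp_marked th ka"
 let ?A = "\<Pi>\<^sub>M i\<in>{..<m}. arr_intensity th ka {0..}"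
 let ?P = "\<Pi>\<^sub>M i\<in>{..<m}. ?N"
 note G[measurable] = Suc.prems
 have G': "G \<in> borel_measurable (\<Pi>\<^sub>M i\<in>insert m {..<m}. ?N)" using G by (simp add: lessThan_Suc)
 have upd: "(%(x, y). x(m := y)) \<in> measurable (?P \<Otimes>\<^sub>M ?N) (\<Pi>\<^sub>M i\<in>insert m {..<m}. ?N)" by (rule measurable_add_dim)
 have Gupd[measurable]: "(%(x, y). G (x(m := y))) \<in> borel_measurable (?P \<Otimes>\<^sub>M ?N)"
  using measurable_compose[OF upd G'] by (simp add: split_beta')
 have setsE: "sets ?E = sets ?P" and setsA: "sets ?A = sets ?P" by (auto intro!: sets_PiM_cong)
 have setsE': "sets (\<Pi>\<^sub>M i\<in>insert m {..<m}. exp_marked th ka) = sets (\<Pi>\<^sub>M i\<in>insert m {..<m}. ?N)"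
  and setsA': "sets (\<Pi>\<^sub>M i\<in>insert m {..<m}. arr_intensity th ka {0..}) = sets (\<Pi>\<^sub>M i\<in>insert m {..<m}. ?N)"
  by (auto intro!: sets_PiM_cong)
 have cmp[measurable]: "(%x. fst (x i)) \<in> borel_measurable ?P" if "i < m" for i by (rule measurable_time_component) (use that in auto)
 \<comment> \<open>The last arrival is integrated out over all times after the earlier ones;
   \<open>H\<close> is the test function for the induction hypothesis.\<close>
 define H where "H x = (\<integral>\<^sup>+y. indicator {z. \<forall>i<m. fst (x i) <= fst z} y * G (x(m := y)) \<partial>arr_intensity th ka {0..})" for x
 have le: "Measurable.pred (?P \<Otimes>\<^sub>M ?N) (%z. \<forall>i<m. fst (fst z i) <= fst (snd z))"
 proof -
  have "Measurable.pred (?P \<Otimes>\<^sub>M ?N) (%z. \<forall>i\<in>{..<m}. fst (fst z i) <= fst (snd z))"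
  proof (intro pred_intros_finite)
   fix i assume "i \<in> {..<m}"
   then have "i < m" by simp
   have [measurable]: "(%z. fst (fst z i)) \<in> borel_measurable (?P \<Otimes>\<^sub>M ?N)"
    by (rule measurable_compose[OF measurable_fst cmp[OF \<open>i < m\<close>]])
   show "Measurable.pred (?P \<Otimes>\<^sub>M ?N) (%z. fst (fst z i) <= fst (snd z))" by measurable
  qed simp
  then show ?thesis by (simp add: Ball_def)
 qed
 have Hm0: "(%(x, y). indicator {z. \<forall>i<m. fst (x i) <= fst z} y * G (x(m := y)) :: ennreal) \<in> borel_measurable (?P \<Otimes>\<^sub>M ?N)"
 proof -
  have "(%z. indicator {z. \<forall>i<m. fst (fst z i) <= fst (snd z)} z * (case z of (x, y) => G (x(m := y))) :: ennreal) \<in> borel_measurable (?P \<Otimes>\<^sub>M ?N)"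
   using le by (intro borel_measurable_times_ennreal Gupd) measurable
  then show ?thesis by (simp add: split_beta' indicator_def)
 qed
 have Hm[measurable]: "H \<in> borel_measurable ?P"
  unfolding H_def[abs_def] using Hm0 by (intro a.borel_measurable_nn_integral) (simp cong: measurable_cong_sets sets_pair_measure_cong)
 have inner: "(\<integral>\<^sup>+y. ennreal (exp (th * (\<Sum>j<Suc m. fst ((x(m := y)) j)))) * G (arr_points (Suc m) (x(m := y))) \<partial>exp_marked th ka)
   = ennreal (exp (th * (\<Sum>j<m. fst (x j)))) * H (arr_points m x)"
  if x: "x \<in> space ?E" and pos: "\<forall>i\<in>{..<m}. 0 <= fst (x i)" for x
 proof -
  define T where "T = (\<Sum>j<m. fst (x j))"
  define x' where "x' = arr_points m x"
  have "x' \<in> space ?P"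
   unfolding x'_def using measurable_space[OF measurable_arr_points, of x m ka] x sets_eq_imp_space_eq[OF setsE] by simp
  then have Gx[measurable]: "(%y. G (x'(m := y))) \<in> borel_measurable ?N"
   using measurable_compose[OF measurable_Pair1'[OF \<open>x' \<in> space ?P\<close>] Gupd] by simp
  define K where "K v = (\<integral>\<^sup>+k. G (x'(m := (v, k))) \<partial>ka)" for v
  have K[measurable]: "K \<in> borel_measurable borel"
   unfolding K_def[abs_def] by (rule ka.borel_measurable_nn_integral) simp
  have T: "0 <= T" unfolding T_def using pos by (intro sum_nonneg) auto
  \<comment> \<open>The gaps being non-negative, the latest earlier arrival is their full sum
    \<open>T\<close>; for \<open>m = 0\<close> the lower bound comes from the condition
    \<open>0 <= v\<close>.\<close>
  have le_T: "(0 <= v & (\<forall>i<m. fst (x' i) <= v)) \<longleftrightarrow> T <= v" for v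
  proof
   assume v: "0 <= v & (\<forall>i<m. fst (x' i) <= v)"
   show "T <= v"
   proof (cases m)
    case (Suc l)
    then have "fst (x' l) <= v" using v by auto
    then show ?thesis using Suc by (simp add: x'_def arr_points_def T_def lessThan_Suc_atMost)
   qed (use v in \<open>simp add: T_def\<close>)
  next
   assume "T <= v"
   moreover have "fst (x' i) <= T" if "i < m" for i
    unfolding x'_def arr_points_def T_def using that pos by (auto intro!: sum_mono2)
   ultimately show "0 <= v & (\<forall>i<m. fst (x' i) <= v)" using T by force
  qed
  have sumT: "(\<Sum>j<Suc m. fst ((x(m := y)) j)) = T + fst y" for y by (simp add: T_def)
  have "(\<integral>\<^sup>+y. ennreal (exp (th * (\<Sum>j<Suc m. fst ((x(m := y)) j)))) * G (arr_points (Suc m) (x(m := y))) \<partial>exp_marked th ka)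
    = (\<integral>\<^sup>+y. ennreal (exp (th * (T + fst y))) * G (x'(m := (T + fst y, snd y))) \<partial>exp_marked th ka)"
   by (simp only: sumT arr_points_upd T_def[symmetric] x'_def[symmetric])
  also have "... = (\<integral>\<^sup>+g. \<integral>\<^sup>+k. ennreal (exp (th * (T + g))) * G (x'(m := (T + g, k))) \<partial>ka \<partial>density lborel (exponential_density th))"
   unfolding exp_marked_def
  proof (subst ka.nn_integral_fst[symmetric])
   have "(%y. (T + fst y, snd y)) \<in> measurable (density lborel (exponential_density th) \<Otimes>\<^sub>M ka) ?N" by measurable
   from measurable_compose[OF this Gx]
   show "(%y. ennreal (exp (th * (T + fst y))) * G (x'(m := (T + fst y, snd y)))) \<in> borel_measurable (density lborel (exponential_density th) \<Otimes>\<^sub>M ka)"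
    by (intro borel_measurable_times_ennreal) measurable
  qed simp
  also have "... = (\<integral>\<^sup>+g. ennreal (exp (th * (T + g))) * K (T + g) \<partial>density lborel (exponential_density th))"
  proof (intro nn_integral_cong)
   fix g
   have "(%k. G (x'(m := (T + g, k)))) \<in> borel_measurable ka"
    using measurable_compose[OF measurable_Pair1' Gx, of "T + g"] by simp
   then show "(\<integral>\<^sup>+k. ennreal (exp (th * (T + g))) * G (x'(m := (T + g, k))) \<partial>ka) = ennreal (exp (th * (T + g))) * K (T + g)"
    unfolding K_def by (rule nn_integral_cmult)
  qed
  also have "... = (\<integral>\<^sup>+g. ennreal (exponential_density th g) * (ennreal (exp (th * (T + g))) * K (T + g)) \<partial>lborel)"
   by (rule nn_integral_density) measurable
  also have "... = (\<integral>\<^sup>+g. ennreal (exp (th * T)) * (ennreal th * indicator {0..} g * K (T + g)) \<partial>lborel)"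
  proof (intro nn_integral_cong)
   fix g
   have "ennreal (exponential_density th g) * ennreal (exp (th * (T + g))) = ennreal (exp (th * T)) * (ennreal th * indicator {0..} g)"
   proof (cases "0 <= g")
    case True
    then have "exponential_density th g * exp (th * (T + g)) = exp (th * T) * th"
     by (simp add: exponential_density_def exp_minus exp_add ring_distribs field_simps)
    then show ?thesis using True th by (simp add: ennreal_mult[symmetric] exponential_density_nonneg)
   qed (simp add: exponential_density_def)
   then show "ennreal (exponential_density th g) * (ennreal (exp (th * (T + g))) * K (T + g)) = ennreal (exp (th * T)) * (ennreal th * indicator {0..} g * K (T + g))"
    by (simp only: mult.assoc[symmetric])
  qed
  \<comment> \<open>Writing the integrand in \<open>T + 1 * g\<close> prepares the translation of
    Lebesgue measure by \<open>T\<close>.\<close>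
  also have "... = ennreal (exp (th * T)) * (\<integral>\<^sup>+g. ennreal th * indicator {T..} (T + 1 * g) * K (T + 1 * g) \<partial>lborel)"
   by (subst nn_integral_cmult[symmetric]) (auto simp: indicator_def)
  also have "(\<integral>\<^sup>+g. ennreal th * indicator {T..} (T + 1 * g) * K (T + 1 * g) \<partial>lborel) = (\<integral>\<^sup>+v. ennreal th * indicator {T..} v * K v \<partial>lborel)"
   by (subst (2) nn_integral_real_affine[of _ 1 T]) auto
  also have "... = (\<integral>\<^sup>+v. ennreal th * indicator {0..} v * (\<integral>\<^sup>+k. indicator {z. \<forall>i<m. fst (x' i) <= fst z} (v, k) * G (x'(m := (v, k))) \<partial>ka) \<partial>lborel)"
  proof (intro nn_integral_cong)
   fix v
   have "(%k. G (x'(m := (v, k)))) \<in> borel_measurable ka"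
    using measurable_compose[OF measurable_Pair1' Gx, of v] by simp
   then have "(\<integral>\<^sup>+k. indicator {v. \<forall>i<m. fst (x' i) <= v} v * G (x'(m := (v, k))) \<partial>ka) = indicator {v. \<forall>i<m. fst (x' i) <= v} v * K v"
    unfolding K_def by (rule nn_integral_cmult)
   moreover have "indicator {T..} v = (indicator {0..} v * indicator {v. \<forall>i<m. fst (x' i) <= v} v :: ennreal)"
    using le_T[of v] by (auto simp: indicator_def)
   ultimately show "ennreal th * indicator {T..} v * K v = ennreal th * indicator {0..} v * (\<integral>\<^sup>+k. indicator {z. \<forall>i<m. fst (x' i) <= fst z} (v, k) * G (x'(m := (v, k))) \<partial>ka)"
    by (simp add: indicator_def mult.assoc)
  qed
  also have "... = H x'"
   unfolding H_def
  proof (rule nn_integral_arr_intensity[OF ka, symmetric])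
   show "(%y. indicator {z. \<forall>i<m. fst (x' i) <= fst z} y * G (x'(m := y))) \<in> borel_measurable ?N"
    using measurable_compose[OF measurable_Pair1'[OF \<open>x' \<in> space ?P\<close>] Hm0] by simp
  qed simp
  finally show ?thesis unfolding T_def x'_def .
 qed
 have "(\<integral>\<^sup>+x. ennreal (exp (th * (\<Sum>j<Suc m. fst (x j)))) * G (arr_points (Suc m) x) \<partial>(\<Pi>\<^sub>M i\<in>{..<Suc m}. exp_marked th ka))
   = (\<integral>\<^sup>+x. \<integral>\<^sup>+y. ennreal (exp (th * (\<Sum>j<Suc m. fst ((x(m := y)) j)))) * G (arr_points (Suc m) (x(m := y))) \<partial>exp_marked th ka \<partial>?E)"
 proof -
  have "(%x. ennreal (exp (th * (\<Sum>j<Suc m. fst (x j)))) * G (arr_points (Suc m) x)) \<in> borel_measurable (\<Pi>\<^sub>M i\<in>{..<Suc m}. ?N)"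
  proof (intro borel_measurable_times_ennreal)
   have "(%x. \<Sum>j<Suc m. fst (x j)) \<in> borel_measurable (\<Pi>\<^sub>M i\<in>{..<Suc m}. ?N)"
    by (intro borel_measurable_sum measurable_time_component) auto
   then show "(%x. ennreal (exp (th * (\<Sum>j<Suc m. fst (x j))))) \<in> borel_measurable (\<Pi>\<^sub>M i\<in>{..<Suc m}. ?N)" by measurable
   show "(%x. G (arr_points (Suc m) x)) \<in> borel_measurable (\<Pi>\<^sub>M i\<in>{..<Suc m}. ?N)" by measurable
  qed
  then show ?thesis
   unfolding lessThan_Suc[of m] measurable_cong_sets[OF setsE' refl, symmetric] by (intro E.product_nn_integral_insert) auto
 qed
 also have "... = (\<integral>\<^sup>+x. ennreal (exp (th * (\<Sum>j<m. fst (x j)))) * H (arr_points m x) \<partial>?E)"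
  by (rule nn_integral_cong_AE, use AE_gaps_nonneg[OF th ka, of "{..<m}"] AE_space in eventually_elim) (rule inner)
 also have "... = (\<integral>\<^sup>+x. indicator {x. sorted_times m x} x * H x \<partial>?A)" by (rule Suc.IH) measurable
 also have "... = (\<integral>\<^sup>+x. \<integral>\<^sup>+y. indicator {x. sorted_times (Suc m) x} (x(m := y)) * G (x(m := y)) \<partial>arr_intensity th ka {0..} \<partial>?A)"
 proof (intro nn_integral_cong)
  fix x assume x: "x \<in> space ?A"
  then have xP: "x \<in> space ?P" using sets_eq_imp_space_eq[OF setsA] by simp
  have "(%y. indicator {z. \<forall>i<m. fst (x i) <= fst z} y * G (x(m := y))) \<in> borel_measurable (arr_intensity th ka {0..})"
   using measurable_compose[OF measurable_Pair1'[OF xP] Hm0] by (simp only: measurable_cong_sets[OF sets_arr_intensity refl] prod.case)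
  then have "indicator {x. sorted_times m x} x * H x
    = (\<integral>\<^sup>+y. indicator {x. sorted_times m x} x * (indicator {z. \<forall>i<m. fst (x i) <= fst z} y * G (x(m := y))) \<partial>arr_intensity th ka {0..})"
   unfolding H_def by (rule nn_integral_cmult[symmetric])
  also have "... = (\<integral>\<^sup>+y. indicator {x. sorted_times (Suc m) x} (x(m := y)) * G (x(m := y)) \<partial>arr_intensity th ka {0..})"
   by (intro nn_integral_cong) (simp only: indicator_def mem_Collect_eq sorted_times_upd of_bool_conj mult.assoc)
  finally show "indicator {x. sorted_times m x} x * H x = ..." .
 qed
 also have "... = (\<integral>\<^sup>+x. indicator {x. sorted_times (Suc m) x} x * G x \<partial>(\<Pi>\<^sub>M i\<in>{..<Suc m}. arr_intensity th ka {0..}))"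
 proof -
  have "Measurable.pred (\<Pi>\<^sub>M i\<in>{..<Suc m}. ?N) (sorted_times (Suc m))" by (rule measurable_sorted_times) simp
  then have "(%x. indicator {x. sorted_times (Suc m) x} x * G x) \<in> borel_measurable (\<Pi>\<^sub>M i\<in>{..<Suc m}. ?N)" by measurable
  then show ?thesis
   unfolding lessThan_Suc[of m] measurable_cong_sets[OF setsA' refl, symmetric] by (intro A.product_nn_integral_insert[symmetric]) auto
 qed
 finally show ?case .
qed

lemma mset_meas_subset_indicator:
 assumes B: "B \<in> sets N"
 shows "mset_meas N (indicator {X. set_mset X <= B})"
 unfolding mset_meas_def
proof
 fix m :: nat
 let ?P = "\<Pi>\<^sub>M i\<in>{..<m}. N"
 have "Measurable.pred ?P (%x. \<forall>i\<in>{..<m}. x i \<in> B)"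
 proof (intro pred_intros_finite)
  fix i assume "i \<in> {..<m}"
  then have [measurable]: "(%x. x i) \<in> measurable ?P N" by (rule measurable_component_singleton)
  show "Measurable.pred ?P (%x. x i \<in> B)" using B by measurable
 qed simp
 then have "(%x. indicator {x. \<forall>i\<in>{..<m}. x i \<in> B} x :: ennreal) \<in> borel_measurable ?P" by measurable
 then show "(%x. indicator {X. set_mset X <= B} (pts x {..<m}) :: ennreal) \<in> borel_measurable ?P"
  by (rule measurable_cong[THEN iffD1, rotated]) (auto simp: indicator_def image_subset_iff)
qed

lemma emeasure_exp_marked_greater:
 assumes th: "0 < th" and ka: "prob_space ka" and a: "0 <= a"
 shows "emeasure (exp_marked th ka) {z\<in>space (exp_marked th ka). a < fst z} = ennreal (exp (- th * a))"
proof -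
 interpret ka: prob_space ka by fact
 interpret e: prob_space "density lborel (exponential_density th)" by (rule prob_space_exponential_density[OF th])
 let ?e = "density lborel (exponential_density th)"
 have 1: "distributed ?e lborel (%x. x) (exponential_density th)" by (simp add: distributed_def distr_id2 exponential_density_nonneg th less_imp_le)
 have "{z\<in>space (exp_marked th ka). a < fst z} = {a<..} \<times> space ka" by (auto simp: space_exp_marked)
 then have "emeasure (exp_marked th ka) {z\<in>space (exp_marked th ka). a < fst z} = emeasure ?e {a<..}"
  unfolding exp_marked_def by (simp add: ka.emeasure_pair_measure_Times ka.emeasure_space_1)
 also have "... = ennreal (exp (- th * a))"
  using e.exponential_distributedD_gt[OF 1 a th] by (simp add: e.emeasure_eq_measure greaterThan_def mult.commute)
 finally show ?thesis .
qed

text \<open>The event says that exactly \<open>m\<close> arrivals happen up to \<open>T\<close>.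
  Given the first \<open>m\<close> gaps, the next one is long enough with probability
  \<open>exp (- th * (T - sum))\<close>; its factor \<open>exp (th * sum)\<close> is the one that
  the change of variables to arrival times requires, and \<open>1 / fact m\<close> comes from
  forgetting the order.\<close>

lemma mset_int_arrivals:
 assumes th: "0 < th" and ka: "prob_space ka" and T: "0 <= T" and F: "mset_meas (borel \<Otimes>\<^sub>M ka) F"
 shows "(\<integral>\<^sup>+om. indicator {om. (\<Sum>j<m. fst (om j)) <= T & T < (\<Sum>j<m. fst (om j)) + fst (om m)} om
      * F (pts (arr_points m om) {..<m}) \<partial>(\<Pi>\<^sub>M i\<in>UNIV. exp_marked th ka))
    = ennreal (exp (- th * T) / fact m) * mset_int (arr_intensity th ka {0..T}) m F"
proof -
 interpret ka: prob_space ka by fact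
 interpret e: prob_space "exp_marked th ka" by (rule prob_space_exp_marked[OF th ka])
 interpret E: product_sigma_finite "%_::nat. exp_marked th ka" by (rule product_sigma_finite_const) unfold_locales
 interpret EP: product_prob_space "%_::nat. exp_marked th ka" UNIV ..
 let ?N = "borel \<Otimes>\<^sub>M ka :: (real \<times> 'a) measure"
 let ?E = "%m::nat. \<Pi>\<^sub>M i\<in>{..<m}. exp_marked th ka"
 let ?P = "%m::nat. \<Pi>\<^sub>M i\<in>{..<m}. ?N"
 let ?U = "\<Pi>\<^sub>M i\<in>(UNIV::nat set). exp_marked th ka"
 let ?A = "arr_intensity th ka {0..}"
 have setsE: "sets (?E m) = sets (?P m)" for m by (auto intro!: sets_PiM_cong)
 have setsA: "sets (\<Pi>\<^sub>M i\<in>{..<m}. ?A) = sets (?P m)" by (auto intro!: sets_PiM_cong)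
 have leT: "{z\<in>space ?A. fst z <= T} \<in> sets ?A" by measurable
 \<comment> \<open>The condition that the last arrival is at most \<open>T\<close> becomes the
   symmetric condition that all arrivals are.\<close>
 define F' where "F' X = indicator {X. set_mset X <= {z\<in>space ?A. fst z <= T}} X * F X" for X
 have F': "mset_meas ?A F'"
  unfolding F'_def[abs_def] using F mset_meas_cong_sets[of ?A ?N F] by (intro mset_meas_times mset_meas_subset_indicator leT) simp
 then have F'm: "(%x. F' (pts x {..<m})) \<in> borel_measurable (?P m)"
  using mset_meas_cong_sets[of ?A ?N F'] by (simp add: mset_meas_def)
 have dens: "density ?A (indicator {z\<in>space ?A. fst z <= T}) = arr_intensity th ka {0..T}"
 proof -
  have "density ?A (indicator {z\<in>space ?A. fst z <= T})
    = density (lborel \<Otimes>\<^sub>M ka) (%z. ennreal th * indicator {0..} (fst z) * indicator {z\<in>space ?A. fst z <= T} z)"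
   unfolding arr_intensity_def by (rule density_density_eq) (use leT in \<open>auto simp: arr_intensity_def\<close>)
  also have "... = arr_intensity th ka {0..T}"
   unfolding arr_intensity_def by (rule density_cong) (use leT in \<open>auto simp: arr_intensity_def indicator_def\<close>)
  finally show ?thesis .
 qed
 define g where "g om = indicator {om. (\<Sum>j<m. fst (om j)) <= T & T < (\<Sum>j<m. fst (om j)) + fst (om m)} om
      * F (pts (arr_points m om) {..<m})" for om :: "nat => real \<times> 'a"
 have cmp: "(%x. fst (x i)) \<in> borel_measurable (?P n)" if "i < n" for i n by (rule measurable_time_component) (use that in auto)
 have Fm: "(%x. F (pts x {..<m})) \<in> borel_measurable (?P m)"
  using F by (simp add: mset_meas_def)
 have restr: "(%x. restrict x {..<m}) \<in> measurable (?P (Suc m)) (?P m)" by (rule measurable_restrict_subset) auto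
 have apr: "arr_points m (restrict x {..<m}) = arr_points m x" for x :: "nat => real \<times> 'a"
  by (auto simp: arr_points_def intro!: restrict_ext sum.cong)
 have Fap: "(%x. F (pts (arr_points m x) {..<m})) \<in> borel_measurable (?P m)" by (rule measurable_compose[OF measurable_arr_points Fm])
 have gm: "g \<in> borel_measurable (?P (Suc m))"
 proof -
  have 1: "(%x. F (pts (arr_points m x) {..<m})) \<in> borel_measurable (?P (Suc m))"
   using measurable_compose[OF restr Fap] by (simp only: apr)
  have [measurable]: "(%x. \<Sum>j<m. fst (x j)) \<in> borel_measurable (?P (Suc m))" "(%x. fst (x m)) \<in> borel_measurable (?P (Suc m))"
   by (auto intro!: borel_measurable_sum cmp)
  show ?thesis unfolding g_def[abs_def] by (intro borel_measurable_times_ennreal 1) measurable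
 qed
 have gr: "g (restrict om {..<Suc m}) = g om" for om
 proof -
  have "arr_points m (restrict om {..<Suc m}) = arr_points m om" by (auto simp: arr_points_def intro!: restrict_ext sum.cong)
  moreover have "(\<Sum>j<m. fst (restrict om {..<Suc m} j)) = (\<Sum>j<m. fst (om j))" by (intro sum.cong) auto
  ultimately show ?thesis by (simp add: g_def indicator_def)
 qed
 have "(\<integral>\<^sup>+om. g om \<partial>?U) = (\<integral>\<^sup>+om. g om \<partial>distr ?U (?E (Suc m)) (%om. restrict om {..<Suc m}))"
  using gm measurable_cong_sets[OF setsE refl, of "Suc m" borel] by (subst nn_integral_distr) (auto simp: gr intro!: measurable_restrict_subset)
 also have "distr ?U (?E (Suc m)) (%om. restrict om {..<Suc m}) = ?E (Suc m)" by (rule EP.distr_PiM_restrict_finite) auto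
 also have "(\<integral>\<^sup>+om. g om \<partial>?E (Suc m)) = (\<integral>\<^sup>+x. \<integral>\<^sup>+y. g (x(m := y)) \<partial>exp_marked th ka \<partial>?E m)"
  using gm measurable_cong_sets[OF setsE refl, of "Suc m" borel]
  unfolding lessThan_Suc[of m] by (intro E.product_nn_integral_insert) auto
 also have "... = (\<integral>\<^sup>+x. ennreal (exp (th * (\<Sum>j<m. fst (x j)))) * (ennreal (exp (- th * T)) * F' (pts (arr_points m x) {..<m})) \<partial>?E m)"
 proof (rule nn_integral_cong_AE, use AE_gaps_nonneg[OF th ka, of "{..<m}"] AE_space in eventually_elim)
  fix x assume pos: "\<forall>i\<in>{..<m}. 0 <= fst (x i)" and x: "x \<in> space (?E m)"
  let ?T = "\<Sum>j<m. fst (x j)"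
  have xs: "x i \<in> space (exp_marked th ka)" if "i < m" for i using x that by (auto simp: space_PiM)
  \<comment> \<open>For non-negative gaps the last partial sum is the largest; with
    \<open>m = 0\<close> both sides hold because \<open>0 <= T\<close>.\<close>
  have in_iff: "set_mset (pts (arr_points m x) {..<m}) <= {z\<in>space ?A. fst z <= T} \<longleftrightarrow> ?T <= T"
  proof
   assume *: "set_mset (pts (arr_points m x) {..<m}) <= {z\<in>space ?A. fst z <= T}"
   show "?T <= T"
   proof (cases m)
    case (Suc l)
    then have "arr_points m x l \<in> {z\<in>space ?A. fst z <= T}" using * by auto
    then show ?thesis using Suc by (simp add: arr_points_def lessThan_Suc_atMost)
   qed (use T in simp)
  next
   assume "?T <= T"
   moreover have "(\<Sum>j\<le>i. fst (x j)) <= ?T" if "i < m" for i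
    using that pos by (auto intro!: sum_mono2)
   ultimately show "set_mset (pts (arr_points m x) {..<m}) <= {z\<in>space ?A. fst z <= T}"
    using xs by (force simp: arr_points_def arr_intensity_def space_exp_marked space_pair_measure)
  qed
  have "arr_points m (x(m := y)) = arr_points m x" for y by (auto simp: arr_points_def intro!: restrict_ext sum.cong)
  moreover have "(\<Sum>j<m. fst ((x(m := y)) j)) = ?T" for y by (intro sum.cong) auto
  ultimately have gx: "g (x(m := y)) = indicator {..T} ?T * F (pts (arr_points m x) {..<m}) *
    indicator {z\<in>space (exp_marked th ka). T - ?T < fst z} y" if "y \<in> space (exp_marked th ka)" for y
   using that by (auto simp: g_def indicator_def)
  have "(\<integral>\<^sup>+y. g (x(m := y)) \<partial>exp_marked th ka) = (\<integral>\<^sup>+y. indicator {..T} ?T * F (pts (arr_points m x) {..<m}) *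
    indicator {z\<in>space (exp_marked th ka). T - ?T < fst z} y \<partial>exp_marked th ka)" by (intro nn_integral_cong gx)
  also have "... = indicator {..T} ?T * F (pts (arr_points m x) {..<m}) *
    emeasure (exp_marked th ka) {z\<in>space (exp_marked th ka). T - ?T < fst z}"
  proof -
   have "{z\<in>space (exp_marked th ka). T - ?T < fst z} \<in> sets (exp_marked th ka)" by measurable
   then show ?thesis by (rule nn_integral_cmult_indicator)
  qed
  also have "... = indicator {..T} ?T * F (pts (arr_points m x) {..<m}) * ennreal (exp (- th * (T - ?T)))"
   by (cases "?T <= T") (simp_all add: emeasure_exp_marked_greater[OF th ka])
  also have "ennreal (exp (- th * (T - ?T))) = ennreal (exp (th * ?T)) * ennreal (exp (- th * T))"
   by (simp add: ennreal_mult[symmetric] exp_add[symmetric] algebra_simps)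
  finally have *: "(\<integral>\<^sup>+y. g (x(m := y)) \<partial>exp_marked th ka) = indicator {..T} ?T *
    F (pts (arr_points m x) {..<m}) * (ennreal (exp (th * ?T)) * ennreal (exp (- th * T)))" .
  show "(\<integral>\<^sup>+y. g (x(m := y)) \<partial>exp_marked th ka) = ennreal (exp (th * ?T)) * (ennreal (exp (- th * T)) * F' (pts (arr_points m x) {..<m}))"
  proof -
   have "indicator {..T} ?T = (indicator {X. set_mset X <= {z\<in>space ?A. fst z <= T}} (pts (arr_points m x) {..<m}) :: ennreal)"
    by (simp only: indicator_def mem_Collect_eq atMost_iff in_iff)
   with * show ?thesis by (simp only: F'_def ac_simps)
  qed
 qed
 also have "... = (\<integral>\<^sup>+x. indicator {x. sorted_times m x} x * (ennreal (exp (- th * T)) * F' (pts x {..<m})) \<partial>(\<Pi>\<^sub>M i\<in>{..<m}. ?A))"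
  using F'm by (intro nn_integral_arr_points[OF th ka]) simp
 also have "... = ennreal (exp (- th * T)) * (\<integral>\<^sup>+x. indicator {x. sorted_times m x} x * F' (pts x {..<m}) \<partial>(\<Pi>\<^sub>M i\<in>{..<m}. ?A))"
 proof (subst nn_integral_cmult[symmetric])
  have "Measurable.pred (?P m) (sorted_times m)" by (rule measurable_sorted_times) simp
  then have "(%x. indicator {x. sorted_times m x} x * F' (pts x {..<m})) \<in> borel_measurable (?P m)"
   using F'm by measurable
  then show "(%x. indicator {x. sorted_times m x} x * F' (pts x {..<m})) \<in> borel_measurable (\<Pi>\<^sub>M i\<in>{..<m}. ?A)"
   by (simp only: measurable_cong_sets[OF setsA refl])
 qed (simp add: mult.left_commute)
 also have "... = ennreal (exp (- th * T) / fact m) * mset_int ?A m F'"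
 proof -
  have c: "ennreal (exp (- th * T) / fact m) * fact m = ennreal (exp (- th * T))"
  proof -
   have "(fact m :: ennreal) = ennreal (fact m)" by (metis ennreal_of_nat_eq_real_of_nat of_nat_fact)
   then show ?thesis by (simp add: ennreal_mult'[symmetric])
  qed
  have "mset_int ?A m F' = fact m * (\<integral>\<^sup>+x. indicator {x. sorted_times m x} x * F' (pts x {..<m}) \<partial>(\<Pi>\<^sub>M i\<in>{..<m}. ?A))"
  proof (rule mset_int_sorted)
   show "sigma_finite_measure ?A" by (rule sigma_finite_arr_intensity[OF ka]) simp
   show "fst \<in> borel_measurable ?A" by measurable
   show "emeasure ?A {y \<in> space ?A. fst y = c} = 0" for c by (rule arr_intensity_null[OF ka]) simp
   show "mset_meas ?A F'" by (rule F')
  qed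
  then show ?thesis by (simp only: mult.assoc[symmetric] c)
 qed
 also have "mset_int ?A m F' = mset_int (density ?A (indicator {z\<in>space ?A. fst z <= T})) m F"
  unfolding F'_def
 proof (rule mset_int_density[symmetric])
  show "sigma_finite_measure ?A" by (rule sigma_finite_arr_intensity[OF ka]) simp
  show "sigma_finite_measure (density ?A (indicator {z \<in> space ?A. fst z <= T}))"
   unfolding dens by (rule sigma_finite_arr_intensity[OF ka]) simp
  show "mset_meas ?A F" using F mset_meas_cong_sets[of ?A ?N F] by simp
 qed (rule leT)
 also note dens
 finally show ?thesis by (simp only: g_def)
qed

lemma borel_measurable_time_sum:
 fixes ka :: "'k measure" and i :: nat
 shows "(%om. \<Sum>j\<le>i. fst (om j)) \<in> borel_measurable (\<Pi>\<^sub>M i\<in>UNIV. exp_marked th ka)"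
proof (rule borel_measurable_sum)
 show "(%om. fst (om j)) \<in> borel_measurable (\<Pi>\<^sub>M i\<in>UNIV. exp_marked th ka)" for j :: nat
  by (rule measurable_time_component) ((measurable)[1], simp)
qed

text \<open>Summing over the number of arrivals up to \<open>T\<close> produces the Poisson series.
  The constant function 1 shows that these events have total probability one, so arrivals almost
  surely do not accumulate before \<open>T\<close>.\<close>

lemma nn_integral_arrivals:
 assumes th: "0 < th" and ka: "prob_space ka" and T: "0 <= T" and F: "mset_meas (borel \<Otimes>\<^sub>M ka) F"
 shows "(\<integral>\<^sup>+om. F (pts (%i. (\<Sum>j\<le>i. fst (om j), snd (om i))) {i. (\<Sum>j\<le>i. fst (om j)) <= T})
      \<partial>(\<Pi>\<^sub>M i\<in>UNIV. exp_marked th ka)) = poisson_mean (arr_intensity th ka {0..T}) F"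
  and "AE om in (\<Pi>\<^sub>M i\<in>(UNIV :: nat set). exp_marked th ka). finite {i. (\<Sum>j\<le>i. fst (om j)) <= T}"
proof -
 interpret ka: prob_space ka by fact
 interpret e: prob_space "exp_marked th ka" by (rule prob_space_exp_marked[OF th ka])
 let ?N = "borel \<Otimes>\<^sub>M ka :: (real \<times> 'a) measure"
 let ?U = "\<Pi>\<^sub>M i\<in>(UNIV::nat set). exp_marked th ka"
 interpret U: prob_space ?U by (rule prob_space_PiM) unfold_locales
 let ?nv = "arr_intensity th ka {0..T}"
 let ?A = "%m. {om :: nat => real \<times> 'a. (\<Sum>j<m. fst (om j)) <= T & T < (\<Sum>j<m. fst (om j)) + fst (om m)}"
 have es: "emeasure ?nv (space ?nv) = ennreal (th * T)"
  using th T by (simp add: emeasure_arr_intensity_space[OF ka] ennreal_mult)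
 then have fin: "finite_measure ?nv" by (intro finite_measureI) simp
 have ms: "measure ?nv (space ?nv) = th * T" using es th T by (simp add: measure_def)
 have [measurable]: "(%om. \<Sum>j<m. fst (om j)) \<in> borel_measurable ?U" "(%om. fst (om m)) \<in> borel_measurable ?U" for m
 proof -
  have *: "(%om. fst (om j)) \<in> borel_measurable ?U" for j by (rule measurable_time_component) ((measurable)[1], simp)
  show "(%om. \<Sum>j<m. fst (om j)) \<in> borel_measurable ?U" "(%om. fst (om m)) \<in> borel_measurable ?U" by (intro borel_measurable_sum *)+
 qed
 have Gm: "(%om. indicator (?A m) om * G (pts (arr_points m om) {..<m})) \<in> borel_measurable ?U"
  if G: "mset_meas ?N G" for G m
 proof -
  have "(%om. \<lambda>i\<in>{..<m}. (\<Sum>j\<le>i. fst (om j), snd (om i))) \<in> measurable ?U (\<Pi>\<^sub>M i\<in>{..<m}. ?N)"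
  proof (rule measurable_restrict)
   fix i :: nat
   have "(%om. om i) \<in> measurable ?U (exp_marked th ka)" by (rule measurable_component_singleton) simp
   then have "(%om. om i) \<in> measurable ?U ?N" by (simp only: measurable_cong_sets[OF refl sets_exp_marked])
   from measurable_compose[OF this measurable_snd]
   show "(%om. (\<Sum>j\<le>i. fst (om j), snd (om i))) \<in> measurable ?U ?N" by (intro measurable_Pair borel_measurable_time_sum)
  qed
  from measurable_compose[OF this G[unfolded mset_meas_def, rule_format, of m]]
  have 1: "(%om. G (pts (arr_points m om) {..<m})) \<in> borel_measurable ?U" by (simp only: arr_points_def)
  show ?thesis by (intro borel_measurable_times_ennreal 1) measurable
 qed
 have sum: "(\<integral>\<^sup>+om. (\<Sum>m. indicator (?A m) om * G (pts (arr_points m om) {..<m})) \<partial>?U) = poisson_mean ?nv G"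
  if G: "mset_meas ?N G" for G by (subst nn_integral_suminf[OF Gm[OF G]]) (simp add: mset_int_arrivals[OF th ka T G] poisson_mean_def ms)
 have A: "{i. (\<Sum>j\<le>i. fst (om j)) <= T} = {..<m}" if pos: "\<forall>i\<in>UNIV. 0 <= fst (om i)" and m: "om \<in> ?A m" for om m
 proof -
  have "(\<Sum>j\<le>i. fst (om j)) <= (\<Sum>j<m. fst (om j))" if "i < m" for i
   using that pos by (intro sum_mono2) auto
  moreover have "(\<Sum>j<m. fst (om j)) + fst (om m) <= (\<Sum>j\<le>i. fst (om j))" if "m <= i" for i
  proof -
   have "(\<Sum>j<Suc m. fst (om j)) <= (\<Sum>j\<le>i. fst (om j))" using that pos by (intro sum_mono2) auto
   then show ?thesis by simp
  qed
  ultimately show ?thesis using m by (fastforce simp: not_less[symmetric])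
 qed
 have uniq: "m = n" if pos: "\<forall>i\<in>UNIV. 0 <= fst (om i)" and "om \<in> ?A m" "om \<in> ?A n" for om m n
  using A[OF pos that(2)] A[OF pos that(3)] by (metis lessThan_eq_iff)
 let ?B = "{om\<in>space ?U. EX m. T < (\<Sum>j<m. fst (om j)) + fst (om m)}"
 have ex: "EX m. om \<in> ?A m" if "EX m. T < (\<Sum>j<m. fst (om j)) + fst (om m)" for om :: "nat => real \<times> 'a"
 proof -
  \<comment> \<open>The first index at which the partial sum passes \<open>T\<close>; minimality
    gives the other inequality.\<close>
  define m where "m = (LEAST m. T < (\<Sum>j<m. fst (om j)) + fst (om m))"
  have 1: "T < (\<Sum>j<m. fst (om j)) + fst (om m)" unfolding m_def by (rule LeastI_ex[OF that])
  have "(\<Sum>j<m. fst (om j)) <= T"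
  proof (cases m)
   case (Suc l)
   then have "\<not> T < (\<Sum>j<l. fst (om j)) + fst (om l)"
    using not_less_Least[of l "%m. T < (\<Sum>j<m. fst (om j)) + fst (om m)"] by (simp add: m_def)
   then show ?thesis using Suc by simp
  qed (use T in simp)
  with 1 show ?thesis by auto
 qed
 have one: "(\<Sum>m. indicator (?A m) om * (f m :: ennreal)) = f n" if pos: "\<forall>i\<in>UNIV. 0 <= fst (om i)" and n: "om \<in> ?A n" for om n f
 proof -
  have "indicator (?A m) om * f m = 0" if "m ~= n" for m
  proof -
   have "om \<notin> ?A m" using uniq[OF pos _ n, of m] that by blast
   then show ?thesis by (simp only: indicator_simps(2) not_False_eq_True mult_zero_left)
  qed
  then have "(\<Sum>m. indicator (?A m) om * f m) = (\<Sum>m\<in>{n}. indicator (?A m) om * f m)" by (intro suminf_finite) auto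
  also have "... = f n" using n by (simp only: sum.insert finite.emptyI empty_iff not_False_eq_True sum.empty indicator_simps(1) mult_1_left add_0_right)
  finally show ?thesis .
 qed
 note AE_pos = AE_gaps_nonneg[OF th ka, of UNIV]
 \<comment> \<open>The Poisson series of the constant 1 is 1, which forces some partial sum to
   exceed \<open>T\<close> almost surely.\<close>
 have "1 = (\<integral>\<^sup>+om. (\<Sum>m. indicator (?A m) om * 1) \<partial>?U)"
  using sum[of "%_. 1"] by (simp add: poisson_mean_const[OF fin] mset_meas_def)
 also have "... = (\<integral>\<^sup>+om. indicator ?B om \<partial>?U)"
 proof (rule nn_integral_cong_AE, use AE_pos AE_space in eventually_elim)
  fix om :: "nat => real \<times> 'a" assume pos: "\<forall>i\<in>UNIV. 0 <= fst (om i)" and sp: "om \<in> space ?U"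
  show "(\<Sum>m. indicator (?A m) om * 1) = (indicator ?B om :: ennreal)"
  proof (cases "EX m. om \<in> ?A m")
   case True
   then obtain m where m: "om \<in> ?A m" by blast
   then have "om \<in> ?B" using sp by auto
   then show ?thesis using one[OF pos m, of "%_. 1"] by simp
  next
   case False
   then have "indicator (?A m) om = (0::ennreal)" for m by (meson indicator_simps(2))
   moreover have "om \<notin> ?B" using ex False by blast
   ultimately show ?thesis by simp
  qed
 qed
 also have "... = emeasure ?U ?B" by (rule nn_integral_indicator) measurable
 finally have AE_B: "AE om in ?U. om \<in> ?B" by (intro U.AE_prob_1) (simp add: U.emeasure_eq_measure)
 have "(\<integral>\<^sup>+om. F (pts (%i. (\<Sum>j\<le>i. fst (om j), snd (om i))) {i. (\<Sum>j\<le>i. fst (om j)) <= T}) \<partial>?U)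
   = (\<integral>\<^sup>+om. (\<Sum>m. indicator (?A m) om * F (pts (arr_points m om) {..<m})) \<partial>?U)"
 proof (rule nn_integral_cong_AE, use AE_B AE_pos in eventually_elim)
  fix om :: "nat => real \<times> 'a" assume B: "om \<in> ?B" and pos: "\<forall>i\<in>UNIV. 0 <= fst (om i)"
  obtain m where m: "om \<in> ?A m" using ex B by blast
  have "pts (arr_points m om) {..<m} = pts (%i. (\<Sum>j\<le>i. fst (om j), snd (om i))) {..<m}" by (intro image_mset_cong) (simp add: arr_points_def)
  then show "F (pts (%i. (\<Sum>j\<le>i. fst (om j), snd (om i))) {i. (\<Sum>j\<le>i. fst (om j)) <= T})
    = (\<Sum>m. indicator (?A m) om * F (pts (arr_points m om) {..<m}))" by (simp only: one[OF pos m] A[OF pos m])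
 qed
 also have "... = poisson_mean ?nv F" by (rule sum[OF F])
 finally show "(\<integral>\<^sup>+om. F (pts (%i. (\<Sum>j\<le>i. fst (om j), snd (om i))) {i. (\<Sum>j\<le>i. fst (om j)) <= T}) \<partial>?U)
   = poisson_mean ?nv F" .
 show "AE om in ?U. finite {i. (\<Sum>j\<le>i. fst (om j)) <= T}"
  using AE_B AE_pos
 proof eventually_elim
  fix om :: "nat => real \<times> 'a" assume B: "om \<in> ?B" and pos: "\<forall>i\<in>UNIV. 0 <= fst (om i)"
  obtain m where "om \<in> ?A m" using ex B by blast
  from A[OF pos this] show "finite {i. (\<Sum>j\<le>i. fst (om j)) <= T}" by simp
 qed
qed

section \<open>The one-dimensional marginals of the Yule process\<close>

abbreviation tree_birth :: "(nat list \<times> nat => real) => nat list => real" where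
 "tree_birth e \<equiv> birth_time (%u j. e (u, j))"

definition popul :: "real => (nat list \<times> nat => real) => nat" where
 "popul s e = card {u. tree_birth e u <= s}"

abbreviation unit_exp :: "real measure" where
 "unit_exp \<equiv> density lborel (exponential_density 1)"

definition exp_tree :: "(nat list \<times> nat => real) measure" where
 "exp_tree = (\<Pi>\<^sub>M i\<in>UNIV. unit_exp)"

text \<open>Decomposition at the first birth: the founder's remaining life, with its children renumbered,
  is again a founder's life (\<open>cont_index\<close>), and the first child founds a subtree (\<open>child_index\<close>).\<close>

definition cont_index :: "nat list \<times> nat => nat list \<times> nat" where
 "cont_index = (%(u, j). if u = [] then ([], Suc j) else (butlast u @ [Suc (last u)], j))"

definition child_index :: "nat list \<times> nat => nat list \<times> nat" where
 "child_index = (%(u, j). (u @ [0], j))"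

text \<open>The inverse of the decomposition: a founder with first birth at \<open>T\<close>,
  continued as \<open>a\<close>, whose first child founds \<open>b\<close>. Labels grow at the head,
  so \<open>last u\<close> is the number of the founder's child in the ancestral line; 0 leads into
  \<open>b\<close>, and \<open>Suc k\<close> to child \<open>k\<close> of the continued founder in
  \<open>a\<close>.\<close>

definition graft :: "real \<times> (nat list \<times> nat => real) \<times> (nat list \<times> nat => real) => nat list \<times> nat => real" where
 "graft = (%(T, a, b) (u, j). if u = [] then (case j of 0 => T | Suc k => a ([], k))
   else (case last u of 0 => b (butlast u, j) | Suc k => a (butlast u @ [k], j)))"

lemma prob_space_unit_exp: "prob_space unit_exp" by (rule prob_space_exponential_density) simp

lemma prob_space_exp_tree: "prob_space exp_tree"
 unfolding exp_tree_def by (rule prob_space_PiM) (rule prob_space_unit_exp)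

section \<open>Splitting the family tree at the first birth\<close>

lemma graft_root: "graft (T, a, b) ([], 0) = T"
 and graft_cont: "graft (T, a, b) (cont_index x) = a x"
 and graft_child: "graft (T, a, b) (child_index x) = b x" by (cases x; simp add: graft_def cont_index_def child_index_def)+

lemma inj_cont_index: "inj cont_index"
proof (rule injI)
 fix x y assume "cont_index x = cont_index y"
 then show "x = y" by (cases x; cases y; cases "fst x" rule: rev_cases; cases "fst y" rule: rev_cases)
    (auto simp: cont_index_def)
qed

lemma inj_child_index: "inj child_index" by (rule injI) (auto simp: child_index_def)

lemma tree_index_cases:
 obtains "i = ([], 0)" | x where "i = cont_index x" | x where "i = child_index x"
proof -
 obtain u j where i: "i = (u, j)" by (cases i)
 show thesis
 proof (cases u rule: rev_cases)
  case Nil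
  then show thesis
  proof (cases j)
   case (Suc k)
   then have "i = cont_index ([], k)" using Nil i by (simp add: cont_index_def)
   then show thesis by (rule that)
  qed (use Nil i that(1) in simp)
 next
  case (snoc v k)
  show thesis
  proof (cases k)
   case 0
   then have "i = child_index (v, j)" using snoc i by (simp add: child_index_def)
   then show thesis by (rule that)
  next
   case (Suc l)
   then have "i = cont_index (v @ [l], j)" using snoc i by (simp add: cont_index_def)
   then show thesis by (rule that)
  qed
 qed
qed

lemma child_neq_cont: "child_index x ~= cont_index y" by (cases x; cases y) (auto simp: child_index_def cont_index_def)

lemma root_neq: "([], 0) ~= cont_index y" "([], 0) ~= child_index y" by (cases y; simp add: child_index_def cont_index_def)+

lemma measurable_tree_component[measurable]: "(%e. e i) \<in> borel_measurable exp_tree"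
 unfolding exp_tree_def
 using measurable_component_singleton[of i UNIV "%_. unit_exp"] by simp

lemma space_exp_tree: "space exp_tree = UNIV" by (simp add: exp_tree_def space_PiM)

lemma measurable_graft: "graft \<in> measurable (unit_exp \<Otimes>\<^sub>M exp_tree \<Otimes>\<^sub>M exp_tree) exp_tree"
proof -
 have "(%z i. graft z i) \<in> measurable (unit_exp \<Otimes>\<^sub>M exp_tree \<Otimes>\<^sub>M exp_tree) (\<Pi>\<^sub>M i\<in>UNIV. unit_exp)"
 proof (rule measurable_PiM_single')
  fix i
  have "(%z. graft z i) \<in> borel_measurable (unit_exp \<Otimes>\<^sub>M exp_tree \<Otimes>\<^sub>M exp_tree)"
  proof (cases i rule: tree_index_cases)
   case 1
   have "(%z. graft z i) = (%z. fst z)" by (auto simp: 1 graft_root)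
   then show ?thesis by simp
  next
   case (2 x)
   have "(%z. graft z i) = (%z. fst (snd z) x)" by (auto simp: 2 graft_cont)
   then show ?thesis by simp
  next
   case (3 x)
   have "(%z. graft z i) = (%z. snd (snd z) x)" by (auto simp: 3 graft_child)
   then show ?thesis by simp
  qed
  then show "(%z. graft z i) \<in> measurable (unit_exp \<Otimes>\<^sub>M exp_tree \<Otimes>\<^sub>M exp_tree) unit_exp" by simp
 qed (auto simp: PiE_def)
 then show ?thesis by (simp add: exp_tree_def)
qed

text \<open>The root coordinate, the images of \<open>cont_index\<close> and those of
  \<open>child_index\<close> partition all indices, so grafting merely rearranges independent unit
  exponential variables.\<close>

lemma distr_graft: "distr (unit_exp \<Otimes>\<^sub>M exp_tree \<Otimes>\<^sub>M exp_tree) exp_tree graft = exp_tree"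
proof -
 interpret E: prob_space unit_exp by (rule prob_space_unit_exp)
 interpret P: product_prob_space "%_ :: nat list \<times> nat. unit_exp" UNIV ..
 interpret M: prob_space exp_tree by (rule prob_space_exp_tree)
 interpret MM: pair_prob_space exp_tree exp_tree ..
 let ?Q = "unit_exp \<Otimes>\<^sub>M exp_tree \<Otimes>\<^sub>M exp_tree"
 have "distr ?Q exp_tree graft = (\<Pi>\<^sub>M i\<in>UNIV. unit_exp)"
 proof (rule P.PiM_eq)
  show "sets (distr ?Q exp_tree graft) = sets (\<Pi>\<^sub>M i\<in>UNIV. unit_exp)" by (simp add: exp_tree_def)
  fix J :: "(nat list \<times> nat) set" and F :: "nat list \<times> nat => real set"
  assume J: "finite J" "J <= UNIV" and F: "!!j. j \<in> J ==> F j \<in> sets unit_exp"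
  let ?X = "prod_emb UNIV (%_. unit_exp) J (Pi\<^sub>E J F)"
  let ?r = "([], 0) :: nat list \<times> nat"
  define R where "R = (if ?r \<in> J then F ?r else UNIV)"
  define Ca where "Ca = {a \<in> space exp_tree. \<forall>x\<in>cont_index -` J. a x \<in> F (cont_index x)}"
  define Cb where "Cb = {b \<in> space exp_tree. \<forall>x\<in>child_index -` J. b x \<in> F (child_index x)}"
  have fa: "finite (cont_index -` J)" "finite (child_index -` J)" by (intro finite_vimageI J inj_cont_index inj_child_index)+
  have ea: "emeasure exp_tree Ca = (\<Prod>x\<in>cont_index -` J. emeasure unit_exp (F (cont_index x)))"
   and eb: "emeasure exp_tree Cb = (\<Prod>x\<in>child_index -` J. emeasure unit_exp (F (child_index x)))"
   unfolding exp_tree_def Ca_def Cb_def by (intro P.emeasure_PiM_Collect fa; use F in auto)+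
  have Cs[measurable]: "Ca \<in> sets exp_tree" "Cb \<in> sets exp_tree"
   unfolding Ca_def Cb_def using fa F by (auto intro!: sets.sets_Collect_finite_All)
  have X: "?X = {e. \<forall>i\<in>J. e i \<in> F i}" by (auto simp: prod_emb_def PiE_iff space_PiM)
  \<comment> \<open>A cylinder set pulls back to a product of a condition on \<open>T\<close> and
    one cylinder for each of the two trees.\<close>
  have "(\<forall>i\<in>J. graft (T, a, b) i \<in> F i) \<longleftrightarrow> T \<in> R & a \<in> Ca & b \<in> Cb" for T a b
  proof
   assume *: "\<forall>i\<in>J. graft (T, a, b) i \<in> F i"
   show "T \<in> R & a \<in> Ca & b \<in> Cb"
    using *[rule_format, of "?r"] *[rule_format, of "cont_index _"] *[rule_format, of "child_index _"]
    by (auto simp: R_def Ca_def Cb_def space_exp_tree graft_root graft_cont graft_child)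
  next
   assume *: "T \<in> R & a \<in> Ca & b \<in> Cb"
   show "\<forall>i\<in>J. graft (T, a, b) i \<in> F i"
   proof
    fix i assume "i \<in> J"
    then show "graft (T, a, b) i \<in> F i"
     using * by (cases i rule: tree_index_cases) (auto simp: R_def Ca_def Cb_def graft_root graft_cont graft_child)
   qed
  qed
  then have "graft -` ?X Int space ?Q = R \<times> Ca \<times> Cb"
   unfolding X by (auto simp: space_pair_measure space_exp_tree)
  moreover have "?X \<in> sets exp_tree" unfolding exp_tree_def using J F by (intro sets_PiM_I) auto
  ultimately have "emeasure (distr ?Q exp_tree graft) ?X = emeasure ?Q (R \<times> Ca \<times> Cb)" by (simp add: emeasure_distr measurable_graft)
  also have "... = emeasure unit_exp R * (emeasure exp_tree Ca * emeasure exp_tree Cb)"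
  proof -
   have "R \<in> sets unit_exp" using F by (simp add: R_def)
   then show ?thesis
    using Cs by (simp add: MM.P.emeasure_pair_measure_Times M.emeasure_pair_measure_Times)
  qed
  also have "emeasure unit_exp R = (\<Prod>i\<in>J Int {?r}. emeasure unit_exp (F i))"
   using E.emeasure_space_1 by (simp add: R_def)
  also have "emeasure exp_tree Ca = (\<Prod>i\<in>cont_index ` (cont_index -` J). emeasure unit_exp (F i))"
   using inj_on_subset[OF inj_cont_index] by (subst prod.reindex) (auto simp: ea)
  also have "emeasure exp_tree Cb = (\<Prod>i\<in>child_index ` (child_index -` J). emeasure unit_exp (F i))"
   using inj_on_subset[OF inj_child_index] by (subst prod.reindex) (auto simp: eb)
  also have "(\<Prod>i\<in>J Int {?r}. emeasure unit_exp (F i)) * ((\<Prod>i\<in>cont_index ` (cont_index -` J). emeasure unit_exp (F i)) *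
    (\<Prod>i\<in>child_index ` (child_index -` J). emeasure unit_exp (F i)))
   = (\<Prod>i\<in>(J Int {?r}) Un (cont_index ` (cont_index -` J) Un child_index ` (child_index -` J)). emeasure unit_exp (F i))"
  proof -
   have d1: "cont_index ` (cont_index -` J) Int child_index ` (child_index -` J) = {}"
    using child_neq_cont by (metis (no_types, opaque_lifting) disjoint_iff imageE)
   have d2: "(J Int {?r}) Int (cont_index ` (cont_index -` J) Un child_index ` (child_index -` J)) = {}"
    using root_neq by blast
   have r: "finite (J Int {?r})" by simp
   note f = finite_imageI[OF fa(1), of cont_index] finite_imageI[OF fa(2), of child_index] r
   show ?thesis by (simp only: prod.union_disjoint[OF f(3) finite_UnI[OF f(1,2)] d2] prod.union_disjoint[OF f(1,2) d1])
  qed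
  also have "(J Int {?r}) Un (cont_index ` (cont_index -` J) Un child_index ` (child_index -` J)) = J"
  proof
   show "J <= (J Int {?r}) Un (cont_index ` (cont_index -` J) Un child_index ` (child_index -` J))"
   proof
    fix i assume "i \<in> J"
    then show "i \<in> (J Int {?r}) Un (cont_index ` (cont_index -` J) Un child_index ` (child_index -` J))" by (cases i rule: tree_index_cases) auto
   qed
  qed auto
  finally show "emeasure (distr ?Q exp_tree graft) ?X = (\<Prod>j\<in>J. emeasure unit_exp (F j))" .
 qed
 then show ?thesis by (simp add: exp_tree_def)
qed

lemma birth_time_graft_child: "tree_birth (graft (T, a, b)) (u @ [0]) = T + tree_birth b u"
proof (induction u)
 case Nil
 then show ?case using graft_root[of T a b] by simp
next
 case (Cons k u)
 have "graft (T, a, b) (u @ [0], j) = b (u, j)" for j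
  using graft_child[of T a b "(u, j)"] by (simp add: child_index_def)
 then show ?case using Cons by simp
qed

lemma birth_time_graft_cont: "tree_birth (graft (T, a, b)) (u @ [Suc k]) = T + tree_birth a (u @ [k])"
proof (induction u)
 case Nil
 have "graft (T, a, b) ([], Suc j) = a ([], j)" for j
  using graft_cont[of T a b "([], j)"] by (simp add: cont_index_def)
 then have "(\<Sum>j\<le>Suc k. graft (T, a, b) ([], j)) = T + (\<Sum>j\<le>k. a ([], j))"
  using graft_root[of T a b] by (simp only: sum.atMost_Suc_shift)
 then show ?case by simp
next
 case (Cons l u)
 have "graft (T, a, b) (u @ [Suc k], j) = a (u @ [k], j)" for j
  using graft_cont[of T a b "(u @ [k], j)"] by (simp add: cont_index_def)
 then show ?case using Cons by simp
qed

lemma birth_time_nonneg: "(!!i. 0 <= e i) ==> 0 <= tree_birth e u" by (induction u) (auto intro!: add_nonneg_nonneg sum_nonneg)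

text \<open>Apart from the founder's, birth times are \<open>T\<close> plus those in the first
  child's family or in the continued founder's family; the label \<open>[]\<close> of the latter is
  the founder again and is removed.\<close>

lemma births_graft:
 assumes "0 <= s"
 shows "{u. tree_birth (graft (T, a, b)) u <= s} =
  insert [] ((%v. v @ [0]) ` {u. tree_birth b u <= s - T} \<union>
    (%v. butlast v @ [Suc (last v)]) ` ({u. tree_birth a u <= s - T} - {[]}))"
 (is "?L = ?R")
proof (intro set_eqI iffI)
 fix u assume u: "u \<in> ?L"
 show "u \<in> ?R"
 proof (cases u rule: rev_cases)
  case (snoc v k)
  show ?thesis
  proof (cases k)
   case 0
   then have "tree_birth b v <= s - T" using u snoc by (simp add: birth_time_graft_child)
   then show ?thesis using snoc 0 by auto
  next
   case (Suc l)
   then have "tree_birth a (v @ [l]) <= s - T" using u snoc by (simp add: birth_time_graft_cont)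
   then have "butlast (v @ [l]) @ [Suc (last (v @ [l]))] \<in> ?R" by blast
   then show ?thesis using snoc Suc by simp
  qed
 qed simp
next
 fix u assume "u \<in> ?R"
 then consider "u = []" | v where "u = v @ [0]" "tree_birth b v <= s - T"
  | v where "u = butlast v @ [Suc (last v)]" "tree_birth a v <= s - T" "v ~= []" by auto
 then show "u \<in> ?L"
 proof cases
  case (3 v)
  then have "tree_birth a (butlast v @ [last v]) <= s - T" by simp
  then show ?thesis using 3(1) by (simp add: birth_time_graft_cont)
 qed (use assms in \<open>auto simp: birth_time_graft_child\<close>)
qed

lemma popul_graft_before:
 assumes "0 <= s" "s < T" "!!i. 0 <= a i" "!!i. 0 <= b i"
 shows "popul s (graft (T, a, b)) = 1"
proof -
 have "s - T < tree_birth b u" "s - T < tree_birth a u" for u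
  using birth_time_nonneg[of a u, OF assms(3)] birth_time_nonneg[of b u, OF assms(4)] assms(2) by linarith+
 then have "{u. tree_birth b u <= s - T} = {}" "{u. tree_birth a u <= s - T} = {}" by (auto simp: not_le)
 then show ?thesis by (simp add: popul_def births_graft[OF assms(1)])
qed

text \<open>The continued founder's family and the first child's family share out the population,
  both at age \<open>s - T\<close> and each with at least one member.\<close>

lemma popul_graft_after:
 assumes "0 <= s" "T <= s" "0 < k"
 shows "popul s (graft (T, a, b)) = k \<longleftrightarrow>
  (\<exists>i\<in>{1..<k}. popul (s - T) a = i & popul (s - T) b = k - i)"
proof -
 let ?A = "{u. tree_birth a u <= s - T}" and ?B = "{u. tree_birth b u <= s - T}"
 let ?S = "{u. tree_birth (graft (T, a, b)) u <= s}"
 let ?f = "%v :: nat list. v @ [0]" and ?g = "%v :: nat list. butlast v @ [Suc (last v)]"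
 have nil: "[] \<in> ?A" "[] \<in> ?B" using assms by auto
 have f: "inj_on ?f X" for X by (auto intro: inj_onI)
 have g: "inj_on ?g (?A - {[]})" by (rule inj_onI) (metis DiffE append_butlast_last_id append_same_eq butlast_snoc insertI1 last_snoc nat.inject)
 have S: "?S = insert [] (?f ` ?B Un ?g ` (?A - {[]}))" by (rule births_graft[OF assms(1)])
 have fin: "finite ?S \<longleftrightarrow> finite ?A & finite ?B"
  unfolding S using f g by (auto simp: finite_image_iff)
 have card: "card ?S = card ?A + card ?B" if "finite ?A" "finite ?B"
 proof -
  have "card ?S = Suc (card (?f ` ?B Un ?g ` (?A - {[]})))"
   unfolding S using that by (subst card_insert_disjoint) auto
  also have "card (?f ` ?B Un ?g ` (?A - {[]})) = card (?f ` ?B) + card (?g ` (?A - {[]}))"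
   using that by (intro card_Un_disjoint) auto
  also have "... = card ?B + (card ?A - 1)"
   using f g nil that by (simp only: card_image card_Diff_singleton)
  moreover have "0 < card ?A" using nil(1) that(1) by (metis card_gt_0_iff empty_iff)
  ultimately show ?thesis by simp
 qed
 have pos: "0 < card ?A" if "finite ?A" using that nil(1) by (metis card_gt_0_iff empty_iff)
 have pos': "0 < card ?B" if "finite ?B" using that nil(2) by (metis card_gt_0_iff empty_iff)
 show ?thesis
 proof
  assume p: "popul s (graft (T, a, b)) = k"
  \<comment> \<open>An infinite population has \<open>card\<close> 0, which \<open>0 < k\<close>
    excludes.\<close>
  then have "finite ?S" using assms(3) by (auto simp: popul_def intro: card_ge_0_finite)
  then have "finite ?A" "finite ?B" using fin by auto
  with p card pos pos' show "\<exists>i\<in>{1..<k}. popul (s - T) a = i & popul (s - T) b = k - i" by (auto simp: popul_def)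
 next
  assume "\<exists>i\<in>{1..<k}. popul (s - T) a = i & popul (s - T) b = k - i"
  then have "card ?A + card ?B = k" "0 < card ?A" "0 < card ?B" by (auto simp: popul_def)
  moreover from this have "finite ?A" "finite ?B" by (auto intro: card_ge_0_finite)
  ultimately show "popul s (graft (T, a, b)) = k" using card by (simp add: popul_def)
 qed
qed

lemma measurable_birth_time[measurable]: "(%e. tree_birth e u) \<in> borel_measurable exp_tree"
proof (induction u)
 case (Cons k u)
 have [measurable]: "(%e. \<Sum>j\<le>k. e (u, j)) \<in> borel_measurable exp_tree" by (intro borel_measurable_sum measurable_tree_component)
 show ?case using Cons by simp
qed simp

lemma measurable_popul:
 assumes [measurable]: "\<sigma> \<in> borel_measurable M" "E \<in> measurable M exp_tree"
 shows "(%om. popul (\<sigma> om) (E om)) \<in> measurable M (count_space UNIV)"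
proof -
 have [measurable]: "(%om. tree_birth (E om) u) \<in> borel_measurable M" for u by (rule measurable_compose[OF _ measurable_birth_time]) measurable
 \<comment> \<open>Lists are coded by naturals, so that the population becomes the cardinality of a
   measurable random set of naturals.\<close>
 have "popul s e = card {n. EX u. n = to_nat u & tree_birth e u <= s}" for s e
 proof -
  have "{n. EX u. n = to_nat u & tree_birth e u <= s} = to_nat ` {u. tree_birth e u <= s}" by auto
  then show ?thesis by (simp add: popul_def card_image)
 qed
 moreover have "(%om. card {n. EX u. n = to_nat u & tree_birth (E om) u <= \<sigma> om}) \<in> measurable M (count_space UNIV)" by measurable
 ultimately show ?thesis by simp
qed

lemma AE_exp_tree_nonneg: "AE e in exp_tree. ALL i. 0 <= e i"
proof -
 have "AE x in unit_exp. 0 <= x" by (subst AE_density) (auto simp: exponential_density_def)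
 then have "AE e in exp_tree. 0 <= e i" for i
  unfolding exp_tree_def by (intro AE_PiM_component[where P="%x. 0 <= x"] prob_space_unit_exp) auto
 then show ?thesis by (simp add: AE_all_countable)
qed

section \<open>The geometric law of the population size\<close>

definition popul_prob :: "nat => real => ennreal" where
 "popul_prob k s = emeasure exp_tree {e \<in> space exp_tree. popul s e = k}"

lemma popul_sets[measurable]: "{e \<in> space exp_tree. popul s e = k} \<in> sets exp_tree"
proof -
 have [measurable]: "(%e. popul s e) \<in> measurable exp_tree (count_space UNIV)" by (rule measurable_popul) auto
 show ?thesis by measurable
qed

text \<open>Renewal at the first birth: before it there is one individual, after it two independent
  families of age \<open>s - T\<close> add up.\<close>

lemma popul_prob_rec:
 assumes s: "0 <= s" and k: "0 < k"
 shows "popul_prob k s = (\<integral>\<^sup>+T. (if s < T then (if k = 1 then 1 else 0)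
   else (\<Sum>i\<in>{1..<k}. popul_prob i (s - T) * popul_prob (k - i) (s - T))) \<partial>unit_exp)"
proof -
 interpret E: prob_space unit_exp by (rule prob_space_unit_exp)
 interpret M: prob_space exp_tree by (rule prob_space_exp_tree)
 interpret MM: pair_prob_space exp_tree exp_tree ..
 let ?Q = "unit_exp \<Otimes>\<^sub>M exp_tree \<Otimes>\<^sub>M exp_tree"
 let ?S = "{e \<in> space exp_tree. popul s e = k}"
 have m: "(%z. indicator ?S (graft z) :: ennreal) \<in> borel_measurable ?Q" by (rule measurable_compose[OF measurable_graft]) measurable
 have mT: "(%p. indicator ?S (graft (T, p)) :: ennreal) \<in> borel_measurable (exp_tree \<Otimes>\<^sub>M exp_tree)" for T
  using measurable_compose[OF measurable_Pair1' m, of T] by simp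
 have "popul_prob k s = (\<integral>\<^sup>+e. indicator ?S e \<partial>distr ?Q exp_tree graft)"
  unfolding popul_prob_def distr_graft by simp
 also have "... = (\<integral>\<^sup>+z. indicator ?S (graft z) \<partial>?Q)" by (rule nn_integral_distr[OF measurable_graft]) measurable
 also have "... = (\<integral>\<^sup>+T. \<integral>\<^sup>+p. indicator ?S (graft (T, p)) \<partial>(exp_tree \<Otimes>\<^sub>M exp_tree) \<partial>unit_exp)"
  by (rule MM.P.nn_integral_fst[OF m, symmetric])
 also have "... = (\<integral>\<^sup>+T. \<integral>\<^sup>+a. \<integral>\<^sup>+b. indicator ?S (graft (T, a, b)) \<partial>exp_tree \<partial>exp_tree \<partial>unit_exp)"
  by (intro nn_integral_cong M.nn_integral_fst[OF mT, symmetric])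
 also have "... = (\<integral>\<^sup>+T. (if s < T then (if k = 1 then 1 else 0)
   else (\<Sum>i\<in>{1..<k}. popul_prob i (s - T) * popul_prob (k - i) (s - T))) \<partial>unit_exp)"
 proof (intro nn_integral_cong)
  fix T :: real
  show "(\<integral>\<^sup>+a. \<integral>\<^sup>+b. indicator ?S (graft (T, a, b)) \<partial>exp_tree \<partial>exp_tree) = (if s < T then (if k = 1 then 1 else 0)
   else (\<Sum>i\<in>{1..<k}. popul_prob i (s - T) * popul_prob (k - i) (s - T)))"
  proof (cases "s < T")
   case True
   have "(\<integral>\<^sup>+a. \<integral>\<^sup>+b. indicator ?S (graft (T, a, b)) \<partial>exp_tree \<partial>exp_tree)
     = (\<integral>\<^sup>+a. \<integral>\<^sup>+b. (if k = 1 then 1 else 0) \<partial>exp_tree \<partial>exp_tree)"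
   proof (rule nn_integral_cong_AE, use AE_exp_tree_nonneg in eventually_elim)
    fix a :: "nat list \<times> nat => real" assume a: "ALL i. 0 <= a i"
    show "(\<integral>\<^sup>+b. indicator ?S (graft (T, a, b)) \<partial>exp_tree) = (\<integral>\<^sup>+b. (if k = 1 then 1 else 0) \<partial>exp_tree)"
    proof (rule nn_integral_cong_AE, use AE_exp_tree_nonneg in eventually_elim)
     fix b :: "nat list \<times> nat => real" assume "ALL i. 0 <= b i"
     then have "popul s (graft (T, a, b)) = 1" using a s True by (intro popul_graft_before) auto
     then show "indicator ?S (graft (T, a, b)) = (if k = 1 then 1 else 0 :: ennreal)" by (auto simp: indicator_def space_exp_tree)
    qed
   qed
   then show ?thesis using True by (simp add: M.emeasure_space_1)
  next
   case False
   let ?I = "%i. indicator {e \<in> space exp_tree. popul (s - T) e = i} :: _ => ennreal"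
   \<comment> \<open>At most one \<open>i\<close> can be the size of the family in \<open>a\<close>,
     so the sum is the indicator of a disjoint union.\<close>
   have ind: "indicator ?S (graft (T, a, b)) = (\<Sum>i\<in>{1..<k}. ?I i a * ?I (k - i) b)" for a b
   proof -
    have "(\<Sum>i\<in>{1..<k}. ?I i a * ?I (k - i) b)
      = (\<Sum>i\<in>{1..<k}. if i = popul (s - T) a then ?I (k - i) b else 0)" by (intro sum.cong) (auto simp: indicator_def space_exp_tree)
    also have "... = indicator ?S (graft (T, a, b))"
     using popul_graft_after[OF s _ k, of T a b] False by (subst sum.delta) (auto simp: indicator_def space_exp_tree)
    finally show ?thesis ..
   qed
   have "(\<integral>\<^sup>+a. \<integral>\<^sup>+b. indicator ?S (graft (T, a, b)) \<partial>exp_tree \<partial>exp_tree)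
     = (\<integral>\<^sup>+a. (\<Sum>i\<in>{1..<k}. ?I i a * popul_prob (k - i) (s - T)) \<partial>exp_tree)"
   proof (unfold ind, rule nn_integral_cong)
   fix a
   have m: "{e \<in> space exp_tree. popul (s - T) e = i} \<in> sets exp_tree" for i by measurable
   have I: "?I i \<in> borel_measurable exp_tree" for i by (rule borel_measurable_indicator[OF m])
   have "(\<integral>\<^sup>+b. (\<Sum>i\<in>{1..<k}. ?I i a * ?I (k - i) b) \<partial>exp_tree) = (\<Sum>i\<in>{1..<k}. \<integral>\<^sup>+b. ?I i a * ?I (k - i) b \<partial>exp_tree)"
    by (rule nn_integral_sum) (rule borel_measurable_times_ennreal[OF measurable_const I], simp)
   also have "... = (\<Sum>i\<in>{1..<k}. ?I i a * popul_prob (k - i) (s - T))"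
    by (simp only: nn_integral_cmult[OF I] nn_integral_indicator[OF m] popul_prob_def)
   finally show "(\<integral>\<^sup>+b. (\<Sum>i\<in>{1..<k}. ?I i a * ?I (k - i) b) \<partial>exp_tree) = (\<Sum>i\<in>{1..<k}. ?I i a * popul_prob (k - i) (s - T))" .
  qed
   also have "... = (\<Sum>i\<in>{1..<k}. popul_prob i (s - T) * popul_prob (k - i) (s - T))"
    by (subst nn_integral_sum) (auto simp: nn_integral_multc popul_prob_def)
   finally show ?thesis using False by simp
  qed
 qed
 finally show ?thesis .
qed

text \<open>In the renewal equation, the convolution of two geometric laws consists of
  \<open>k - 1\<close> equal terms, and its integral over the first birth has an explicit
  antiderivative; so the geometric form reproduces itself.\<close>

lemma popul_prob_geometric:
 assumes "0 <= s" "0 < k"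
 shows "popul_prob k s = ennreal (exp (- s) * (1 - exp (- s)) ^ (k - 1))"
 using assms
proof (induction k arbitrary: s rule: less_induct)
 case (less k)
 interpret E: prob_space unit_exp by (rule prob_space_unit_exp)
 note s = \<open>0 <= s\<close>
 show ?case
 proof (cases "k = 1")
  case True
  have 1: "distributed unit_exp lborel (%x. x) (exponential_density 1)" by (simp add: distributed_def distr_id2 exponential_density_nonneg)
  have "popul_prob k s = (\<integral>\<^sup>+T. indicator {s<..} T \<partial>unit_exp)"
   unfolding True by (subst popul_prob_rec) (use s in \<open>auto intro!: nn_integral_cong simp: indicator_def simp del: nn_integral_indicator\<close>)
  also have "... = emeasure unit_exp {s<..}" by simp
  also have "... = ennreal (exp (- s))"
   using E.exponential_distributedD_gt[OF 1 s] by (simp add: E.emeasure_eq_measure greaterThan_def)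
  finally show ?thesis by (simp add: True)
 next
  case False
  then obtain m where m: "k = Suc (Suc m)" using less.prems by (metis One_nat_def not0_implies_Suc less_numeral_extra(3))
  \<comment> \<open>The integrand of the renewal equation after
    \<open>exp (- T) * exp (- (s - T)) = exp (- s)\<close>; it is the derivative of
    \<open>- (exp (- s) * (1 - exp (- (s - T))) ^ Suc m)\<close> in \<open>T\<close>.\<close>
  define g where "g T = exp (- s) * (real (Suc m) * (1 - exp (- (s - T))) ^ m * exp (- (s - T)))" for T
  have sum: "(\<Sum>i\<in>{1..<k}. popul_prob i (s - T) * popul_prob (k - i) (s - T))
    = ennreal (real (Suc m) * (exp (- (s - T)) * exp (- (s - T)) * (1 - exp (- (s - T))) ^ m))" if T: "T <= s" for T
  proof -
   let ?q = "exp (- (s - T))"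
   have q: "0 <= 1 - ?q" using T by simp
   have "popul_prob i (s - T) * popul_prob (k - i) (s - T) = ennreal (?q * ?q * (1 - ?q) ^ m)" if i: "i \<in> {1..<k}" for i
   proof -
    have "popul_prob i (s - T) = ennreal (?q * (1 - ?q) ^ (i - 1))" by (rule less.IH) (use i T in auto)
    moreover have "popul_prob (k - i) (s - T) = ennreal (?q * (1 - ?q) ^ (k - i - 1))" by (rule less.IH) (use i T in auto)
    moreover have "(1 - ?q) ^ (i - 1) * (1 - ?q) ^ (k - i - 1) = (1 - ?q) ^ m"
     using i m by (simp add: power_add[symmetric])
    then have "?q * (1 - ?q) ^ (i - 1) * (?q * (1 - ?q) ^ (k - i - 1)) = ?q * ?q * (1 - ?q) ^ m" by (simp add: algebra_simps)
    ultimately show ?thesis using q by (simp add: ennreal_mult[symmetric])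
   qed
   then have "(\<Sum>i\<in>{1..<k}. popul_prob i (s - T) * popul_prob (k - i) (s - T))
     = of_nat (Suc m) * ennreal (?q * ?q * (1 - ?q) ^ m)" by (simp add: m)
   also have "... = ennreal (real (Suc m) * (?q * ?q * (1 - ?q) ^ m))"
    using q by (subst ennreal_of_nat_eq_real_of_nat, subst ennreal_mult) auto
   finally show ?thesis .
  qed
  have "popul_prob k s = (\<integral>\<^sup>+T. ennreal (g T) * indicator {0..s} T \<partial>lborel)"
  proof -
   have "popul_prob k s = (\<integral>\<^sup>+T. indicator {..s} T *
     ennreal (real (Suc m) * (exp (- (s - T)) * exp (- (s - T)) * (1 - exp (- (s - T))) ^ m)) \<partial>unit_exp)"
    unfolding popul_prob_rec[OF less.prems]
   proof (intro nn_integral_cong)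
    fix T
    show "(if s < T then if k = 1 then 1 else 0
      else (\<Sum>i\<in>{1..<k}. popul_prob i (s - T) * popul_prob (k - i) (s - T)))
     = indicator {..s} T * ennreal (real (Suc m) * (exp (- (s - T)) * exp (- (s - T)) * (1 - exp (- (s - T))) ^ m))"
    proof (cases "T <= s")
     case True
     then have "\<not> s < T" "indicator {..s} T = (1 :: ennreal)" by auto
     then show ?thesis by (simp only: sum[OF True] if_False mult_1_left)
    qed (use False in auto)
   qed
   also have "... = (\<integral>\<^sup>+T. ennreal (exponential_density 1 T) * (indicator {..s} T *
     ennreal (real (Suc m) * (exp (- (s - T)) * exp (- (s - T)) * (1 - exp (- (s - T))) ^ m))) \<partial>lborel)"
    proof (rule nn_integral_density)
    have "continuous_on UNIV (%T. real (Suc m) * (exp (- (s - T)) * exp (- (s - T)) * (1 - exp (- (s - T))) ^ m))" by (intro continuous_intros)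
    then have "(%T. real (Suc m) * (exp (- (s - T)) * exp (- (s - T)) * (1 - exp (- (s - T))) ^ m)) \<in> borel_measurable borel"
     by (rule borel_measurable_continuous_onI)
    then show "(%T. indicator {..s} T * ennreal (real (Suc m) * (exp (- (s - T)) * exp (- (s - T)) * (1 - exp (- (s - T))) ^ m)))
      \<in> borel_measurable lborel"
     by (intro borel_measurable_times_ennreal borel_measurable_indicator measurable_compose[OF _ measurable_ennreal]) auto
   qed simp
   also have "... = (\<integral>\<^sup>+T. ennreal (g T) * indicator {0..s} T \<partial>lborel)"
   proof (intro nn_integral_cong)
    fix T :: real
    show "ennreal (exponential_density 1 T) * (indicator {..s} T *
     ennreal (real (Suc m) * (exp (- (s - T)) * exp (- (s - T)) * (1 - exp (- (s - T))) ^ m))) = ennreal (g T) * indicator {0..s} T"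
    proof (cases "0 <= T & T <= s")
     case True
     have e: "exp (- T) * exp (- (s - T)) = exp (- s)" by (simp add: exp_add[symmetric])
     have "exp (- T) * (real (Suc m) * (exp (- (s - T)) * exp (- (s - T)) * (1 - exp (- (s - T))) ^ m))
       = (exp (- T) * exp (- (s - T))) * (real (Suc m) * (1 - exp (- (s - T))) ^ m * exp (- (s - T)))" by (simp add: mult_ac)
     also have "... = g T" by (simp only: e g_def)
     finally show ?thesis using True by (simp add: exponential_density_def ennreal_mult'[symmetric])
    qed (auto simp: exponential_density_def indicator_def)
   qed
   finally show ?thesis .
  qed
  also have "... = ennreal (- (exp (- s) * (1 - exp (- (s - s))) ^ Suc m) - - (exp (- s) * (1 - exp (- (s - 0))) ^ Suc m))"
  proof (rule nn_integral_FTC_Icc)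
   show "g \<in> borel_measurable borel" unfolding g_def[abs_def] by measurable
   fix T assume T: "T \<in> {0..s}"
   show "((%T. - (exp (- s) * (1 - exp (- (s - T))) ^ Suc m)) has_real_derivative g T) (at T)"
    unfolding g_def by (auto intro!: derivative_eq_intros simp: algebra_simps simp del: power_Suc)
   show "0 <= g T" unfolding g_def using T by simp
  qed (rule s)
  finally show ?thesis by (simp add: m)
 qed
qed

text \<open>All three follow from the geometric law. Bernoulli's inequality gives the lower tail and
  the monotonicity of the geometric weights the upper one; total mass one excludes infinite
  populations, whose \<open>card\<close> is 0.\<close>

lemma popul_tail:
 assumes "0 <= s"
 shows "emeasure exp_tree {e \<in> space exp_tree. popul s e <= k} <= ennreal (real k * exp (- s))" (is ?lower)
  and "0 < x ==> emeasure exp_tree {e \<in> space exp_tree. x <= real (popul s e)} <= ennreal (exp s / x)" (is "_ ==> ?upper")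
  and "AE e in exp_tree. 0 < popul s e"
proof -
 interpret M: prob_space exp_tree by (rule prob_space_exp_tree)
 let ?S = "%k. {e \<in> space exp_tree. popul s e = k}"
 let ?q = "1 - exp (- s)"
 have q: "0 <= ?q" "?q < 1" using assms by auto
 have pr: "M.prob (?S (Suc k)) = exp (- s) * ?q ^ k" for k
  using popul_prob_geometric[OF assms, of "Suc k"] q by (simp add: popul_prob_def M.emeasure_eq_measure)
 have le: "M.prob (\<Union>i<k. ?S (Suc i)) = 1 - ?q ^ k" for k
 proof -
  have "M.prob (\<Union>i<k. ?S (Suc i)) = (\<Sum>i<k. M.prob (?S (Suc i)))"
   by (rule M.finite_measure_finite_Union) (auto simp: disjoint_family_on_def)
  also have "... = (1 - ?q) * (\<Sum>i<k. ?q ^ i)" by (simp add: pr sum_distrib_left)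
  also have "... = 1 - ?q ^ k" by (simp only: one_diff_power_eq)
  finally show ?thesis .
 qed
 have "(%k. M.prob (\<Union>i<k. ?S (Suc i))) \<longlonglongrightarrow> M.prob (\<Union>k. \<Union>i<k. ?S (Suc i))"
  by (rule M.finite_Lim_measure_incseq) (auto simp: incseq_def intro: less_le_trans)
 moreover have "(%k. M.prob (\<Union>i<k. ?S (Suc i))) \<longlonglongrightarrow> 1 - 0"
  unfolding le using q by (intro tendsto_diff tendsto_const LIMSEQ_realpow_zero)
 ultimately have "M.prob (\<Union>k. \<Union>i<k. ?S (Suc i)) = 1" by (simp add: LIMSEQ_unique)
 then have "AE e in exp_tree. e \<in> (\<Union>k. \<Union>i<k. ?S (Suc i))" by (rule M.AE_prob_1)
 then show AE: "AE e in exp_tree. 0 < popul s e" by (rule eventually_mono) auto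
 show ?lower
 proof -
  have [measurable]: "(%e. popul s e) \<in> measurable exp_tree (count_space UNIV)" by (rule measurable_popul) auto
  have "M.prob {e \<in> space exp_tree. popul s e <= k} <= M.prob (\<Union>i<k. ?S (Suc i))"
  proof (rule M.finite_measure_mono_AE)
   show "AE e in exp_tree. e \<in> {e \<in> space exp_tree. popul s e <= k} --> e \<in> (\<Union>i<k. ?S (Suc i))"
    using AE
   proof eventually_elim
    case (elim e)
    show ?case
    proof
     assume "e \<in> {e \<in> space exp_tree. popul s e <= k}"
     then have "e \<in> ?S (Suc (popul s e - 1))" "popul s e - 1 < k" using elim by auto
     then show "e \<in> (\<Union>i<k. ?S (Suc i))" by blast
    qed
   qed
  qed auto
  also have "... = 1 - ?q ^ k" by (rule le)
  also have "... <= real k * exp (- s)"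
   using Bernoulli_inequality[of "- exp (- s)" k] assms by simp
  finally show ?thesis by (simp add: M.emeasure_eq_measure ennreal_leI)
 qed
 show ?upper if x: "0 < x"
 proof -
  have [measurable]: "(%e. popul s e) \<in> measurable exp_tree (count_space UNIV)" by (rule measurable_popul) auto
  \<comment> \<open>\<open>k + 1\<close> is the least integer at or above \<open>x\<close>, so a
    population of at least \<open>x\<close> avoids the sizes from 1 to \<open>k\<close>.\<close>
  obtain k where k: "nat \<lceil>x\<rceil> = Suc k" using x by (metis One_nat_def Suc_pred ceiling_less_zero not_gr_zero zero_less_ceiling zero_less_nat_eq)
  have xk: "x <= real (Suc k)" using k real_nat_ceiling_ge[of x] by simp
  have "M.prob {e \<in> space exp_tree. x <= real (popul s e)} <= M.prob (space exp_tree - (\<Union>i<k. ?S (Suc i)))"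
  proof (rule M.finite_measure_mono)
   show "{e \<in> space exp_tree. x <= real (popul s e)} <= space exp_tree - (\<Union>i<k. ?S (Suc i))"
   proof safe
    fix e i assume "i < k" "x <= real (popul s e)" "popul s e = Suc i"
    then have "\<lceil>x\<rceil> <= int (Suc i)" by (simp add: ceiling_le_iff)
    then show False using k \<open>i < k\<close> by simp
   qed
  qed measurable
  also have "... = ?q ^ k" by (subst M.prob_compl) (auto simp: le)
  also have "... <= exp s / real (Suc k)"
  proof -
   \<comment> \<open>The last of \<open>k + 1\<close> decreasing weights, counted
     \<open>k + 1\<close> times, is at most their sum; the outcome is the bound that Markov's
     inequality would give for the mean \<open>exp s\<close>.\<close>
   have "real (Suc k) * (exp (- s) * ?q ^ k) = (\<Sum>i<Suc k. exp (- s) * ?q ^ k)" by simp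
   also have "... <= (\<Sum>i<Suc k. exp (- s) * ?q ^ i)"
    using q by (intro sum_mono mult_left_mono power_decreasing) auto
   also have "... = exp (- s) * (\<Sum>i<Suc k. ?q ^ i)" by (rule sum_distrib_left[symmetric])
   also have "... = (1 - ?q) * (\<Sum>i<Suc k. ?q ^ i)" by simp
   also have "... = 1 - ?q ^ Suc k" by (simp only: one_diff_power_eq)
   also have "... <= 1" using q by simp
   finally show ?thesis by (simp add: exp_minus field_simps)
  qed
  also have "... <= exp s / x" using xk x by (intro divide_left_mono) auto
  finally show ?thesis by (simp add: M.emeasure_eq_measure ennreal_leI)
 qed
qed

declare measurable_tree_component[measurable del]

text \<open>A Yule path is recorded on the rationals only, which keeps the space of marks countably
  generated; the values at real times are recovered by right continuity.\<close>

definition path_space :: "(rat => nat) measure" where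
 "path_space = (\<Pi>\<^sub>M q\<in>UNIV. count_space UNIV)"

definition path_eval :: "real => (rat => nat) => nat" where
 "path_eval s p = Inf {p q | q. s <= of_rat q}"

definition ylaw :: "(rat => nat) measure" where
 "ylaw = distr exp_tree path_space (%e q. popul (of_rat q) e)"

lemma sets_ylaw[measurable_cong, simp]: "sets ylaw = sets path_space" by (simp add: ylaw_def)

lemma space_path_space: "space path_space = UNIV" by (simp add: path_space_def space_PiM)

lemma rat_above: "EX q. s <= real_of_rat q"
 using of_rat_dense[of s "s + 1"] by (auto intro: less_imp_le)

text \<open>An infimum of naturals is attained, so the comparison reduces to countably many rational
  times.\<close>

lemma path_eval_le_iff: "path_eval s p <= k \<longleftrightarrow> (EX q. s <= of_rat q & p q <= k)"
proof -
 have ne: "{p q | q. s <= of_rat q} ~= {}" using rat_above[of s] by auto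
 from Inf_nat_def1[OF ne] have "EX q. s <= of_rat q & p q = path_eval s p" by (auto simp: path_eval_def)
 moreover have "path_eval s p <= p q" if "s <= of_rat q" for q
  unfolding path_eval_def using that by (intro cInf_lower) auto
 ultimately show ?thesis by (metis order_trans order_refl)
qed

lemma measurable_path_eval:
 assumes [measurable]: "\<sigma> \<in> borel_measurable M" and p: "p \<in> measurable M path_space"
 shows "(%om. path_eval (\<sigma> om) (p om)) \<in> measurable M (count_space UNIV)"
proof -
 have [measurable]: "(%om. p om q) \<in> measurable M (count_space UNIV)" for q
  using measurable_compose[OF p[unfolded path_space_def] measurable_component_singleton[of q]] by simp
 have le: "{om\<in>space M. path_eval (\<sigma> om) (p om) <= k} \<in> sets M" for k
  unfolding path_eval_le_iff by measurable
 show ?thesis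
 proof (rule measurable_count_space_eq2_countable[THEN iffD2], safe)
  fix n
  have "(%om. path_eval (\<sigma> om) (p om)) -` {n} Int space M =
    {om\<in>space M. path_eval (\<sigma> om) (p om) <= n} - (\<Union>k\<in>{..<n}. {om\<in>space M. path_eval (\<sigma> om) (p om) <= k})"
   by (auto simp: not_le) (metis lessThan_iff less_irrefl le_neq_implies_less)
  also have "... \<in> sets M" using le by auto
  finally show "(%om. path_eval (\<sigma> om) (p om)) -` {n} Int space M \<in> sets M" .
 qed auto
qed

lemma measurable_tree_path: "(%e q. popul (of_rat q) e) \<in> measurable exp_tree path_space"
 unfolding path_space_def
proof (rule measurable_PiM_single')
 show "(%e. popul (of_rat q) e) \<in> measurable exp_tree (count_space UNIV)" for q by (rule measurable_popul) auto
qed auto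

lemma space_ylaw: "space ylaw = UNIV"
 using sets_eq_imp_space_eq[OF sets_ylaw] by (simp add: space_path_space)

lemma prob_space_ylaw: "prob_space ylaw"
 unfolding ylaw_def by (rule prob_space.prob_space_distr[OF prob_space_exp_tree measurable_tree_path])

text \<open>Only finitely many births occur up to time \<open>s + 1\<close>, so some rational time
  after \<open>s\<close> precedes the next birth; there the population is still the one at
  \<open>s\<close>.\<close>

lemma path_eval_popul:
 assumes fin: "!!n::nat. finite {u. tree_birth e u <= real n}"
 shows "path_eval s (%q. popul (of_rat q) e) = popul s e"
proof -
 have fin': "finite {u. tree_birth e u <= r}" for r
 proof -
  obtain n where "r <= real n" using real_arch_simple by blast
  then have "{u. tree_birth e u <= r} <= {u. tree_birth e u <= real n}" by auto
  then show ?thesis using fin finite_subset by blast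
 qed
 have mono: "popul s e <= popul r e" if "s <= r" for r
  unfolding popul_def using that by (intro card_mono fin') auto
 define A where "A = tree_birth e ` {u. tree_birth e u <= s + 1} Int {s<..}"
 have "finite A" using fin'[of "s + 1"] by (simp add: A_def)
 \<comment> \<open>No birth happens strictly between \<open>s\<close> and \<open>r\<close>;
   inserting \<open>s + 1\<close> covers the case that \<open>A\<close> is empty.\<close>
 define r where "r = Min (insert (s + 1) A)"
 have "s < r" using \<open>finite A\<close> by (simp add: r_def A_def)
 then obtain q where q: "s < of_rat q" "of_rat q < r" using of_rat_dense by blast
 have "{u. tree_birth e u <= of_rat q} = {u. tree_birth e u <= s}"
 proof (intro subset_antisym subsetI)
  fix u assume "u \<in> {u. tree_birth e u <= of_rat q}"
  then have u: "tree_birth e u < r" using q by simp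
  have "r <= s + 1" using \<open>finite A\<close> by (simp add: r_def)
  show "u \<in> {u. tree_birth e u <= s}"
  proof (rule ccontr)
   assume "u \<notin> {u. tree_birth e u <= s}"
   then have "tree_birth e u \<in> A" using u \<open>r <= s + 1\<close> by (auto simp: A_def)
   then have "r <= tree_birth e u" using \<open>finite A\<close> by (simp add: r_def)
   with u show False by simp
  qed
 qed (use q in auto)
 then have eq: "popul (of_rat q) e = popul s e" by (simp add: popul_def)
 show ?thesis
 proof (rule antisym)
  show "path_eval s (%q. popul (of_rat q) e) <= popul s e"
   unfolding path_eval_le_iff using q eq by (auto intro: exI[of _ q])
  have "EX q. s <= of_rat q & popul (of_rat q) e <= path_eval s (%q. popul (of_rat q) e)"
   using path_eval_le_iff[of s "%q. popul (of_rat q) e"] by blast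
  then show "popul s e <= path_eval s (%q. popul (of_rat q) e)"
   using mono by (meson order_trans)
 qed
qed

lemma AE_path_eval_popul:
 "AE e in exp_tree. ALL s. path_eval s (%q. popul (of_rat q) e) = popul s e"
proof -
 have "AE e in exp_tree. \<forall>n::nat. 0 < popul (real n) e"
  unfolding AE_all_countable by (intro allI popul_tail(3)) simp
 then show ?thesis
 proof eventually_elim
  case (elim e)
  then have "finite {u. tree_birth e u <= real n}" for n :: nat by (auto simp: popul_def intro: card_ge_0_finite)
  then show ?case by (intro allI path_eval_popul)
 qed
qed

lemma ylaw_tail:
 assumes "0 <= s"
 shows "emeasure ylaw {p \<in> space ylaw. path_eval s p <= k} <= ennreal (real k * exp (- s))"
  and "0 < x ==> emeasure ylaw {p \<in> space ylaw. x <= real (path_eval s p)} <= ennreal (exp s / x)"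
proof -
 have [measurable]: "(%p. path_eval s p) \<in> measurable path_space (count_space UNIV)" by (rule measurable_path_eval) auto
 have [measurable]: "(%e. popul s e) \<in> measurable exp_tree (count_space UNIV)" by (rule measurable_popul) auto
 have *: "emeasure ylaw {p \<in> space ylaw. Q (path_eval s p)} = emeasure exp_tree {e \<in> space exp_tree. Q (popul s e)}" for Q
 proof -
  have "{p \<in> space ylaw. Q (path_eval s p)} \<in> sets path_space" by (simp add: ylaw_def)
  then have "emeasure ylaw {p \<in> space ylaw. Q (path_eval s p)}
    = emeasure exp_tree ((%e q. popul (of_rat q) e) -` {p \<in> space ylaw. Q (path_eval s p)} Int space exp_tree)"
   unfolding ylaw_def by (intro emeasure_distr measurable_tree_path) simp
  also have "... = emeasure exp_tree {e \<in> space exp_tree. Q (popul s e)}"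
  proof (rule emeasure_eq_AE)
   show "AE e in exp_tree. (e \<in> (%e q. popul (of_rat q) e) -` {p \<in> space ylaw. Q (path_eval s p)} Int space exp_tree)
     \<longleftrightarrow> e \<in> {e \<in> space exp_tree. Q (popul s e)}"
    using AE_path_eval_popul by eventually_elim (auto simp: ylaw_def space_path_space)
   show "(%e q. popul (of_rat q) e) -` {p \<in> space ylaw. Q (path_eval s p)} Int space exp_tree \<in> sets exp_tree"
    by (rule measurable_sets[OF measurable_tree_path]) (simp add: ylaw_def)
  qed simp
  finally show ?thesis .
 qed
 show "emeasure ylaw {p \<in> space ylaw. path_eval s p <= k} <= ennreal (real k * exp (- s))"
  using popul_tail(1)[OF assms, of k] *[of "%n. n <= k"] by simp
 show "emeasure ylaw {p \<in> space ylaw. x <= real (path_eval s p)} <= ennreal (exp s / x)" if "0 < x"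
  using popul_tail(2)[OF assms that] *[of "%n. x <= real n"] by simp
qed

text \<open>Everything is transported from \<open>exp_tree\<close> along the tree of waiting times
  that witnesses \<open>yule_process\<close>. The third statement evaluates the process at a random
  time, which rests on measurability of the population jointly in time and tree.\<close>

lemma yule_processD:
 assumes P: "prob_space P" and Y: "yule_process P Y"
 shows "distr P path_space (%om q. Y (of_rat q) om) = ylaw"
  and "AE om in P. ALL s. path_eval s (%q. Y (of_rat q) om) = Y s om"
  and "!!\<sigma>. \<sigma> \<in> borel_measurable P ==> (%om. Y (\<sigma> om) om) \<in> measurable P (count_space UNIV)"
  and "(%om q. Y (of_rat q) om) \<in> measurable P path_space"
proof -
 interpret prob_space P by fact
 obtain e :: "nat list => nat => 'a => real" where
  ind: "indep_vars (%_. borel) (%(u, j). e u j) UNIV" and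
  e: "!!u j. distributed P lborel (e u j) (exponential_density 1)" and
  Ye: "!!t om. om \<in> space P ==> Y t om = card {u. birth_time (%u j. e u j om) u <= t}"
  using Y unfolding yule_process_def by blast
 define E where "E om = (%(u, j). e u j om)" for om
 have em: "e u j \<in> borel_measurable P" for u j
  using e[of u j] by (simp add: distributed_def)
 have E[measurable]: "E \<in> measurable P exp_tree"
  unfolding exp_tree_def by (rule measurable_PiM_single') (auto simp: E_def em split: prod.split)
 have YE: "Y t om = popul t (E om)" if "om \<in> space P" for t om
  using Ye[OF that, of t] by (simp add: popul_def E_def)
 have dE: "distr P exp_tree E = exp_tree"
 proof -
  have "distr P (\<Pi>\<^sub>M i\<in>UNIV. borel) (%x. \<lambda>i\<in>UNIV. (case i of (u, j) => e u j) x)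
    = (\<Pi>\<^sub>M i\<in>UNIV. distr P borel (case i of (u, j) => e u j))"
   using ind by (subst (asm) indep_vars_iff_distr_eq_PiM) (auto simp: em)
  moreover have "distr P borel (case i of (u, j) => e u j) = unit_exp" for i
  proof (cases i)
   case (Pair u j)
   have "distr P borel (e u j) = distr P lborel (e u j)" by (rule distr_cong) auto
   also have "... = unit_exp" using e[of u j] by (simp add: distributed_def)
   finally show ?thesis using Pair by simp
  qed
  moreover have "distr P (\<Pi>\<^sub>M i\<in>UNIV. borel) (%x. \<lambda>i\<in>UNIV. (case i of (u, j) => e u j) x) = distr P exp_tree E"
   by (rule distr_cong) (auto simp: exp_tree_def E_def intro!: sets_PiM_cong)
  ultimately show ?thesis by (simp add: exp_tree_def)
 qed
 show pm: "(%om q. Y (of_rat q) om) \<in> measurable P path_space"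
  using measurable_compose[OF E measurable_tree_path] by (rule measurable_cong[THEN iffD1, rotated]) (simp add: YE)
 show "distr P path_space (%om q. Y (of_rat q) om) = ylaw"
 proof -
  have "distr P path_space (%om q. Y (of_rat q) om) = distr P path_space (%om q. popul (of_rat q) (E om))" by (rule distr_cong) (auto simp: YE)
  also have "... = distr (distr P exp_tree E) path_space (%e q. popul (of_rat q) e)"
   by (subst distr_distr[OF measurable_tree_path E]) (simp add: comp_def)
  finally show ?thesis by (simp add: dE ylaw_def)
 qed
 have "AE e in distr P exp_tree E. ALL s. path_eval s (%q. popul (of_rat q) e) = popul s e"
  unfolding dE by (rule AE_path_eval_popul)
 then have "AE om in P. ALL s. path_eval s (%q. popul (of_rat q) (E om)) = popul s (E om)" by (rule AE_distrD[OF E])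
 then show "AE om in P. ALL s. path_eval s (%q. Y (of_rat q) om) = Y s om"
  using AE_space by eventually_elim (simp add: YE)
 show "(%om. Y (\<sigma> om) om) \<in> measurable P (count_space UNIV)" if "\<sigma> \<in> borel_measurable P" for \<sigma>
  using measurable_popul[OF that E] by (rule measurable_cong[THEN iffD1, rotated]) (simp add: YE)
qed

section \<open>Sums of Dirac masses as random elements of the vague topology\<close>

lemma topspace_vague_topology: "topspace (vague_topology S) = radon_measures S"
proof -
 have "vague_test S (%_. 0)" by (auto simp: vague_test_def intro!: exI[of _ "{}"])
 then have "radon_measures S \<in> {{m \<in> radon_measures S. integral\<^sup>L m f \<in> U} | f U. vague_test S f & open (U :: real set)}"
  by (intro CollectI exI[of _ "%_. 0"] exI[of _ UNIV]) auto
 then show ?thesis unfolding vague_topology_def topology_generated_by_topspace by blast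
qed

lemma sets_dirac_sum[simp]: "sets (dirac_sum S I p) = sets (restrict_space borel S)" by (simp add: dirac_sum_def)

lemma space_dirac_sum[simp]: "space (dirac_sum S I p) = S" by (simp add: dirac_sum_def space_restrict_space)

lemma measurable_dirac_points: "p \<in> measurable (count_space {i \<in> I. p i \<in> S}) (restrict_space borel S)"
 by (auto simp: space_restrict_space)

lemma emeasure_dirac_sum:
 assumes "B \<in> sets (restrict_space borel S)"
 shows "emeasure (dirac_sum S I p) B = emeasure (count_space UNIV) {i \<in> I. p i \<in> B}"
proof -
 have "B <= S" using sets.sets_into_space[OF assms] by (simp add: space_restrict_space)
 have "emeasure (dirac_sum S I p) B = emeasure (count_space {i \<in> I. p i \<in> S}) (p -` B Int {i \<in> I. p i \<in> S})"
  unfolding dirac_sum_def using assms by (subst emeasure_distr[OF measurable_dirac_points]) auto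
 also have "p -` B Int {i \<in> I. p i \<in> S} = {i \<in> I. p i \<in> B}" using \<open>B <= S\<close> by auto
 also have "emeasure (count_space {i \<in> I. p i \<in> S}) {i \<in> I. p i \<in> B} = emeasure (count_space UNIV) {i \<in> I. p i \<in> B}"
  using \<open>B <= S\<close> by (cases "finite {i \<in> I. p i \<in> B}") (auto simp: emeasure_count_space_finite emeasure_count_space_infinite subset_eq)
 finally show ?thesis .
qed

lemma integral_dirac_sum:
 assumes f: "continuous_on S f" and F: "finite F" "F <= {i \<in> I. p i \<in> S}"
  and z: "!!i. i \<in> I ==> p i \<in> S ==> i \<notin> F ==> f (p i) = (0::real)"
 shows "integral\<^sup>L (dirac_sum S I p) f = (\<Sum>i\<in>F. f (p i))"
proof -
 have "integral\<^sup>L (dirac_sum S I p) f = integral\<^sup>L (count_space {i \<in> I. p i \<in> S}) (%i. f (p i))"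
  unfolding dirac_sum_def by (rule integral_distr[OF measurable_dirac_points]) (rule borel_measurable_continuous_on_restrict[OF f])
 also have "... = (\<Sum>i | i \<in> {i \<in> I. p i \<in> S} & f (p i) ~= 0. f (p i))"
  by (rule lebesgue_integral_count_space_finite_support) (rule finite_subset[OF _ F(1)], use z in auto)
 also have "... = (\<Sum>i\<in>F. f (p i))" by (rule sum.mono_neutral_left[OF F(1)]) (use z F(2) in auto)
 finally show ?thesis .
qed

text \<open>The sets \<open>K c\<close> catch every compact subset of \<open>S\<close>. Local
  finiteness is therefore only checked along \<open>K\<close>, and every test function vanishes
  outside some \<open>K c\<close>.\<close>

locale compact_exhaustion =
 fixes S :: "'a::{second_countable_topology, t2_space} set" and K :: "nat => 'a set"
 assumes K_subset: "!!c. K c <= S" and K_borel: "!!c. K c \<in> sets borel"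
  and K_cofinal: "!!C. compact C ==> C <= S ==> EX c. C <= K c"
begin

lemma Un_K: "(\<Union>c. K c) = S"
proof
 show "S <= (\<Union>c. K c)"
 proof
  fix x assume "x \<in> S"
  then show "x \<in> (\<Union>c. K c)" using K_cofinal[of "{x}"] by auto
 qed
qed (use K_subset in auto)

lemma dirac_sum_radon:
 assumes "!!c. finite {i \<in> I. p i \<in> K c}"
 shows "dirac_sum S I p \<in> radon_measures S"
 unfolding radon_measures_def
proof (intro CollectI conjI allI impI)
 fix C assume C: "compact C & C <= S"
 then obtain c where c: "C <= K c" using K_cofinal by blast
 have "finite {i \<in> I. p i \<in> C}" by (rule finite_subset[OF _ assms[of c]]) (use c in auto)
 moreover have "C \<in> sets (restrict_space borel S)"
  using C borel_compact[of C] by (auto simp: sets_restrict_space Int_absorb1 image_iff intro!: bexI[of _ C])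
 ultimately show "emeasure (dirac_sum S I p) C < \<infinity>" by (simp add: emeasure_dirac_sum emeasure_count_space_finite of_nat_less_top)
qed simp

lemma vague_test_support:
 assumes "vague_test S f"
 obtains c where "!!x. x \<in> S ==> x \<notin> K c ==> f x = 0"
 using assms K_cofinal unfolding vague_test_def by (metis DiffI subsetD)

text \<open>A fixed finite index set \<open>F\<close> carries all contributions to a test function
  supported in \<open>K c\<close>, for the limit and eventually for the sequence; the integrals are
  then finite sums that converge term by term. \<open>F\<close> may contain indices whose limits lie
  outside \<open>K c\<close>, because points can cross its boundary.\<close>

lemma limitin_vague_dirac_sum:
 assumes radon: "!!j. dirac_sum S (I j) (p j) \<in> radon_measures S" "dirac_sum S J g \<in> radon_measures S"
  and F: "!!c. EX F. finite F & F <= {i \<in> J. g i \<in> S} & {i \<in> J. g i \<in> K c} <= F \<and>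
    (\<forall>\<^sub>F j in sequentially. {i \<in> I j. p j i \<in> K c} <= F) \<and>
    (\<forall>i\<in>F. (\<forall>\<^sub>F j in sequentially. i \<in> I j & p j i \<in> S) & (%j. p j i) \<longlonglongrightarrow> g i)"
 shows "limitin (vague_topology S) (%j. dirac_sum S (I j) (p j)) (dirac_sum S J g) sequentially"
proof -
 have conv: "(%j. integral\<^sup>L (dirac_sum S (I j) (p j)) f) \<longlonglongrightarrow> integral\<^sup>L (dirac_sum S J g) f"
  if f: "vague_test S f" for f
 proof -
  have cf: "continuous_on S f" using f by (simp add: vague_test_def)
  obtain c where c: "!!x. x \<in> S ==> x \<notin> K c ==> f x = 0" using vague_test_support[OF f] by blast
  obtain F where F: "finite F" "F <= {i \<in> J. g i \<in> S}" "{i \<in> J. g i \<in> K c} <= F"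
   "\<forall>\<^sub>F j in sequentially. {i \<in> I j. p j i \<in> K c} <= F"
   "!!i. i \<in> F ==> \<forall>\<^sub>F j in sequentially. i \<in> I j & p j i \<in> S"
   "!!i. i \<in> F ==> (%j. p j i) \<longlonglongrightarrow> g i" using F[of c] by blast
  have lim: "integral\<^sup>L (dirac_sum S J g) f = (\<Sum>i\<in>F. f (g i))" by (rule integral_dirac_sum[OF cf F(1,2)]) (use F(3) c in blast)
  have "(%j. \<Sum>i\<in>F. f (p j i)) \<longlonglongrightarrow> (\<Sum>i\<in>F. f (g i))"
  proof (rule tendsto_sum)
   fix i assume i: "i \<in> F"
   show "(%j. f (p j i)) \<longlonglongrightarrow> f (g i)" by (rule continuous_on_tendsto_compose[OF cf F(6)[OF i]])
      (use F(2) i in auto, use F(5)[OF i] in \<open>auto elim: eventually_mono\<close>)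
  qed
  moreover have "\<forall>\<^sub>F j in sequentially. \<forall>i\<in>F. i \<in> I j & p j i \<in> S"
   using F(1,5) by (simp add: eventually_ball_finite)
  with F(4) have "\<forall>\<^sub>F j in sequentially. (\<Sum>i\<in>F. f (p j i)) = integral\<^sup>L (dirac_sum S (I j) (p j)) f"
  proof eventually_elim
   case (elim j)
   then show ?case by (intro integral_dirac_sum[OF cf F(1), symmetric]) (use c in blast)+
  qed
  ultimately show ?thesis unfolding lim by (rule Lim_transform_eventually)
 qed
 show ?thesis
  unfolding limitin_def
 proof (intro conjI allI impI)
  show "dirac_sum S J g \<in> topspace (vague_topology S)" using radon by (simp add: topspace_vague_topology)
  fix U assume U: "openin (vague_topology S) U & dirac_sum S J g \<in> U"
  let ?B = "{{m \<in> radon_measures S. integral\<^sup>L m f \<in> U} | f U. vague_test S f & open (U :: real set)}"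
  have "generate_topology_on ?B U" using U by (simp add: vague_topology_def openin_topology_generated_by)
  then show "\<forall>\<^sub>F j in sequentially. dirac_sum S (I j) (p j) \<in> U"
   using U[THEN conjunct2]
  \<comment> \<open>Eventual membership passes through finite intersections and arbitrary unions, so
    the subbasis sets suffice.\<close>
  proof (induction rule: generate_topology_on.induct)
   case (Int a b)
   then show ?case by (auto intro: eventually_conj)
  next
   case (UN A)
   then obtain X where X: "X \<in> A" "dirac_sum S J g \<in> X" by auto
   show ?case using UN.IH[OF X] by (rule eventually_mono) (use X in blast)
  next
   case (Basis s)
   then obtain f V where s: "s = {m \<in> radon_measures S. integral\<^sup>L m f \<in> V}" "vague_test S f" "open V" by blast
   have "\<forall>\<^sub>F j in sequentially. integral\<^sup>L (dirac_sum S (I j) (p j)) f \<in> V"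
    by (rule topological_tendstoD[OF conv[OF s(2)] s(3)]) (use Basis s in auto)
   then show ?case by eventually_elim (use radon s in auto)
  qed auto
 qed
qed

text \<open>Membership in every vaguely open set must be measurable, while the topology is known
  only through a subbasis. The map is factored through pairs of a code sequence and a point
  sequence, which form a second countable space. On the set \<open>D\<close> of admissible pairs the
  passage to the measure is continuous, because the code tells which finitely many points matter for
  \<open>K c\<close>.\<close>

lemma random_element_dirac_sum:
 fixes p :: "nat => 'w => 'a" and I :: "'w => nat set"
 assumes p: "!!i. p i \<in> borel_measurable M" and I: "!!i. {om \<in> space M. i \<in> I om} \<in> sets M"
  and fin: "!!om c. om \<in> space M ==> finite {i \<in> I om. p i om \<in> K c}"
 shows "random_element (vague_topology S) M (%om. dirac_sum S (I om) (%i. p i om))"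
proof -
 define code where "code I q c = set_encode {i \<in> I. q i \<in> K c}" for I and q :: "nat => 'a" and c
 \<comment> \<open>The pairs whose codes really list the indices of the points in each
   \<open>K c\<close>; there the codes and the points determine the integrals.\<close>
 define D :: "((nat => nat) \<times> (nat => 'a)) set" where
  "D = {(a, q). EX I. (ALL c. finite {i \<in> I. q i \<in> K c}) & a = code I q}"
 define V where "V d = dirac_sum S (\<Union>c. set_decode (fst d c)) (snd d)" for d :: "(nat => nat) \<times> (nat => 'a)"
 define T where "T om = (code (I om) (%i. p i om), %i. p i om)" for om
 have decode: "set_decode (code I q c) = {i \<in> I. q i \<in> K c}" if "ALL c. finite {i \<in> I. q i \<in> K c}" for I q c
  using that by (simp add: code_def set_encode_inverse)
 have Un: "(\<Union>c. set_decode (code I q c)) = {i \<in> I. q i \<in> S}" if "ALL c. finite {i \<in> I. q i \<in> K c}" for I q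
  using decode[OF that] Un_K by auto
 have V_code: "V (code I q, q) = dirac_sum S I q" if "ALL c. finite {i \<in> I. q i \<in> K c}" for I q by (simp add: V_def Un[OF that] dirac_sum_def)
 have VI: "V (a, q) \<in> radon_measures S" if d: "(a, q) \<in> D" for a q
 proof -
  obtain I where "ALL c. finite {i \<in> I. q i \<in> K c}" "a = code I q" using d by (auto simp: D_def)
  then show ?thesis by (simp add: V_code dirac_sum_radon)
 qed
 have cont: "continuous_map (top_of_set D) (vague_topology S) V"
  unfolding vague_topology_def
 proof (rule continuous_on_generated_topo)
  fix W assume "W \<in> {{m \<in> radon_measures S. integral\<^sup>L m f \<in> U} | f U. vague_test S f & open (U :: real set)}"
  then obtain f U where W: "W = {m \<in> radon_measures S. integral\<^sup>L m f \<in> U}" and f: "vague_test S f" and U: "open U" by blast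
  have cf: "continuous_on S f" using f by (simp add: vague_test_def)
  obtain c where c: "!!x. x \<in> S ==> x \<notin> K c ==> f x = 0" using vague_test_support[OF f] by blast
  \<comment> \<open>The code at \<open>c\<close> is a natural number and hence locally constant, so
    on each relatively open piece \<open>Dn n\<close> the integral is a sum over one fixed finite
    index set.\<close>
  define Dn where "Dn n = {d \<in> D. fst d c = n}" for n
  have in_S: "snd d i \<in> S" if d: "d \<in> D" and i: "i \<in> set_decode (fst d c)" for d i
  proof -
   obtain I where "ALL c. finite {i \<in> I. snd d i \<in> K c}" "fst d = code I (snd d)" using d by (auto simp: D_def)
   then show ?thesis using i K_subset decode by auto
  qed
  have int: "integral\<^sup>L (V d) f = (\<Sum>i\<in>set_decode (fst d c). f (snd d i))" if d: "d \<in> D" for d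
  proof -
   obtain a q where dq: "d = (a, q)" by (cases d)
   obtain I where I: "ALL c. finite {i \<in> I. q i \<in> K c}" "a = code I q" using d dq by (auto simp: D_def)
   have "integral\<^sup>L (dirac_sum S I q) f = (\<Sum>i\<in>{i \<in> I. q i \<in> K c}. f (q i))"
    by (rule integral_dirac_sum[OF cf]) (use I(1) K_subset c in auto)
   then show ?thesis using I dq by (simp add: V_code decode)
  qed
  have "openin (top_of_set D) (V -` W Int Dn n)" for n :: nat
  proof (rule openin_trans[of "Dn n"])
   have "open {d :: (nat => nat) \<times> (nat => 'a). fst d c = n}"
   proof -
    have "continuous_on UNIV (%d :: (nat => nat) \<times> (nat => 'a). fst d c)"
     by (rule continuous_on_product_then_coordinatewise[OF continuous_on_fst[OF continuous_on_id]])
    then have "open ((%d :: (nat => nat) \<times> (nat => 'a). fst d c) -` {n})" by (rule open_vimage[OF discrete_topology_class.open_discrete])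
    then show ?thesis by (simp add: vimage_def)
   qed
   then show "openin (top_of_set D) (Dn n)"
    unfolding Dn_def openin_open by (intro exI[of _ "{d. fst d c = n}"]) auto
   have "continuous_on (Dn n) (%d. \<Sum>i\<in>set_decode n. f (snd d i))"
   proof (rule continuous_on_sum)
    fix i assume i: "i \<in> set_decode n"
    have "continuous_on (Dn n) (%d. snd d i)" by (rule continuous_on_product_then_coordinatewise[OF continuous_on_snd[OF continuous_on_id]])
    then show "continuous_on (Dn n) (%d. f (snd d i))" by (rule continuous_on_compose2[OF cf]) (use in_S i in \<open>auto simp: Dn_def\<close>)
   qed
   then have "openin (top_of_set (Dn n)) (Dn n Int (%d. \<Sum>i\<in>set_decode n. f (snd d i)) -` U)"
    using U by (rule continuous_openin_preimage_gen)
   moreover have "V -` W Int Dn n = Dn n Int (%d. \<Sum>i\<in>set_decode n. f (snd d i)) -` U"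
    using VI by (auto simp: W Dn_def int)
   ultimately show "openin (top_of_set (Dn n)) (V -` W Int Dn n)" by simp
  qed
  then have "openin (top_of_set D) (\<Union>n. V -` W Int Dn n)" by (intro openin_Union) auto
  moreover have "(\<Union>n. V -` W Int Dn n) = V -` W Int topspace (top_of_set D)" by (auto simp: Dn_def)
  ultimately show "openin (top_of_set D) (V -` W Int topspace (top_of_set D))" by simp
 next
  show "V ` topspace (top_of_set D) <= \<Union>{{m \<in> radon_measures S. integral\<^sup>L m f \<in> U} | f U. vague_test S f & open (U :: real set)}"
   using VI topspace_vague_topology[of S] unfolding vague_topology_def topology_generated_by_topspace by auto
 qed
 have T: "T \<in> borel_measurable M"
  unfolding T_def
 proof (rule borel_measurable_Pair)
  show "(%om i. p i om) \<in> borel_measurable M" by (rule measurable_coordinatewise_then_product) (rule p)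
  show "(%om. code (I om) (%i. p i om)) \<in> borel_measurable M"
  proof (rule measurable_coordinatewise_then_product)
   fix c
   have "(%om. code (I om) (%i. p i om) c) \<in> measurable M (count_space UNIV)"
   proof (rule measurable_count_space_eq2_countable[THEN iffD2], safe)
    fix n
    have "(%om. code (I om) (%i. p i om) c) -` {n} Int space M
      = {om\<in>space M. ALL i. (i \<in> I om & p i om \<in> K c) = (i \<in> set_decode n)}"
    proof (intro set_eqI)
     fix om
     have "code (I om) (%i. p i om) c = n \<longleftrightarrow> {i \<in> I om. p i om \<in> K c} = set_decode n" if "om \<in> space M"
      using fin[OF that, of c] by (metis code_def set_decode_inverse set_encode_inverse)
     then show "om \<in> (%om. code (I om) (%i. p i om) c) -` {n} Int space M
       \<longleftrightarrow> om \<in> {om\<in>space M. ALL i. (i \<in> I om & p i om \<in> K c) = (i \<in> set_decode n)}" by (auto simp: set_eq_iff)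
    qed
    also have "... \<in> sets M"
    proof -
     have [measurable]: "Measurable.pred M (%om. i \<in> I om)" for i using I[of i] by (simp add: pred_def)
     note p[measurable] K_borel[measurable]
     show ?thesis by measurable
    qed
    finally show "(%om. code (I om) (%i. p i om) c) -` {n} Int space M \<in> sets M" .
   qed auto
   then show "(%om. code (I om) (%i. p i om) c) \<in> borel_measurable M" by (rule measurable_compose) simp
  qed
 qed
 have TD: "T om \<in> D" and VT: "V (T om) = dirac_sum S (I om) (%i. p i om)" if "om \<in> space M" for om
  using fin[OF that] by (auto simp: T_def D_def V_code)
 show ?thesis
  unfolding random_element_def
 proof (rule measurable_sigma_sets[where \<Omega>="topspace (vague_topology S)" and A="{U. openin (vague_topology S) U}"])
  show "{U. openin (vague_topology S) U} <= Pow (topspace (vague_topology S))" by (auto dest: openin_subset)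
  show "(%om. dirac_sum S (I om) (%i. p i om)) \<in> space M \<rightarrow> topspace (vague_topology S)"
   using fin by (auto simp: topspace_vague_topology intro!: dirac_sum_radon)
  fix W assume "W \<in> {U. openin (vague_topology S) U}"
  then have "openin (top_of_set D) {d \<in> D. V d \<in> W}"
   using openin_continuous_map_preimage[OF cont, of W] by simp
  \<comment> \<open>Relative openness is enough: \<open>T\<close> maps into \<open>D\<close>, so the
    preimage of \<open>D Int Op\<close> is that of the open set \<open>Op\<close>, whether or not
    \<open>D\<close> is Borel.\<close>
  then obtain Op where Op: "open Op" "{d \<in> D. V d \<in> W} = D Int Op" by (auto simp: openin_open)
  have "(%om. dirac_sum S (I om) (%i. p i om)) -` W Int space M = T -` Op Int space M"
  proof (intro set_eqI)
   fix om
   have "V (T om) \<in> W \<longleftrightarrow> T om \<in> Op" if "om \<in> space M"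
    using TD[OF that] Op(2) by blast
   then show "om \<in> (%om. dirac_sum S (I om) (%i. p i om)) -` W Int space M \<longleftrightarrow> om \<in> T -` Op Int space M"
    using VT by auto
  qed
  also have "... \<in> sets M" by (rule measurable_sets[OF T]) (use Op(1) in simp)
  finally show "(%om. dirac_sum S (I om) (%i. p i om)) -` W Int space M \<in> sets M" .
 qed (rule sets_measure_of, auto dest: openin_subset)
qed

end

lemma borel_measurable_random_element:
 assumes "random_element X M \<xi>" and h: "continuous_map X euclideanreal h"
 shows "(%om. h (\<xi> om)) \<in> borel_measurable M"
proof -
 let ?X = "sigma (topspace X) {U. openin X U}"
 have sub: "{U. openin X U} <= Pow (topspace X)" by (auto dest: openin_subset)
 have "h \<in> borel_measurable ?X"
 proof (rule borel_measurableI)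
  fix U :: "real set" assume "open U"
  then have "openin X {x \<in> topspace X. h x \<in> U}" using openin_continuous_map_preimage[OF h, of U] by simp
  moreover have "h -` U Int space ?X = {x \<in> topspace X. h x \<in> U}"
   using sub by (auto simp: space_measure_of_conv)
  ultimately show "h -` U Int space ?X \<in> sets ?X" using sub by (auto simp: sets_measure_of)
 qed
 with assms(1) show ?thesis unfolding random_element_def by (rule measurable_compose)
qed

text \<open>A multiset has no index set of its own; the pairs \<open>(x, i)\<close> label the copies
  of each point.\<close>

definition mset_point_measure :: "'a::topological_space set => 'a multiset => 'a measure" where
 "mset_point_measure S X = dirac_sum S {(x, i). i < count X x} fst"

lemma card_count_points:
 "finite {xi \<in> {(x, i). i < count X x}. fst xi \<in> B} \<and>
  card {xi \<in> {(x, i). i < count X x}. fst xi \<in> B} = size (filter_mset (%x. x \<in> B) X)"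
proof -
 have eq: "{xi \<in> {(x, i). i < count X x}. fst xi \<in> B} = (SIGMA x:set_mset (filter_mset (%x. x \<in> B) X). {..<count X x})"
  by (auto simp: count_greater_zero_iff[symmetric] simp del: count_greater_zero_iff)
 have "card {xi \<in> {(x, i). i < count X x}. fst xi \<in> B} = (\<Sum>x\<in>set_mset (filter_mset (%x. x \<in> B) X). count X x)"
  unfolding eq by (subst card_SigmaI) auto
 also have "... = size (filter_mset (%x. x \<in> B) X)"
  unfolding size_multiset_overloaded_eq by (intro sum.cong) auto
 finally show ?thesis unfolding eq by (intro conjI finite_SigmaI) auto
qed

text \<open>Emeasures of a finite Dirac sum count points with multiplicity, so only the multiset
  matters. This links random point measures with the functionals of
  \<open>poisson_mean\<close>.\<close>

lemma dirac_sum_finite: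
 assumes "finite I"
 shows "dirac_sum S I p = mset_point_measure S (image_mset p (mset_set I))"
proof (rule measure_eqI)
 show "sets (dirac_sum S I p) = sets (mset_point_measure S (image_mset p (mset_set I)))" by (simp add: mset_point_measure_def)
 fix B assume "B \<in> sets (dirac_sum S I p)"
 then have B: "B \<in> sets (restrict_space borel S)" by simp
 let ?X = "image_mset p (mset_set I)"
 have "size (filter_mset (%x. x \<in> B) ?X) = card {i \<in> I. p i \<in> B}"
  using assms by (simp add: filter_mset_image_mset filter_mset_mset_set)
 then show "emeasure (dirac_sum S I p) B = emeasure (mset_point_measure S ?X) B"
  using assms card_count_points[of ?X B] unfolding mset_point_measure_def by (simp add: emeasure_dirac_sum[OF B] emeasure_count_space_finite)
qed

section \<open>Scaling limits of the weights\<close>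

text \<open>The generalised inverse of the tail: a uniform \<open>p\<close> turns into a variable
  with law \<mu>. The value 0 outside the open unit interval is an arbitrary default.\<close>

definition upper_quantile :: "real measure => real => real" where
 "upper_quantile \<mu> p = (if 0 < p & p < 1 then Inf {x. measure \<mu> {x<..} <= p} else 0)"

definition ev_inv :: "ev_class => real => real" where
 "ev_inv c r = (case c of Weibull \<alpha> => - (r powr (1 / \<alpha>)) | Gumbel => - ln r | Frechet \<alpha> => r powr (- 1 / \<alpha>))"

locale ev_setting =
 fixes c :: ev_class and \<mu> :: "real measure" and A B :: "real => real"
 assumes ev: "ev_assumption c \<mu> A B"
begin

lemma prob_space_\<mu>: "prob_space \<mu>" and sets_\<mu>[simp, measurable_cong]: "sets \<mu> = sets borel"
 and AE_pos: "AE x in \<mu>. 0 < x" and abs_cont: "absolutely_continuous lborel \<mu>"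
 using ev by (auto simp: ev_assumption_def)

sublocale M: real_distribution \<mu>
 using prob_space_\<mu> sets_\<mu> sets_eq_imp_space_eq[OF sets_\<mu>] by (auto simp: real_distribution_def real_distribution_axioms_def)

lemma null_singleton: "emeasure \<mu> {x} = 0"
 using abs_cont by (auto simp: absolutely_continuous_def null_sets_def subset_eq)

text \<open>The only mass that the restriction to points below \<open>ess_end\<close> could lose
  sits at the right end point, which is null by absolute continuity.\<close>

lemma tail_mass_eq: "tail_mass \<mu> a = emeasure \<mu> {a<..}"
proof -
 have "ess_end \<mu> = 1 \<or> ess_end \<mu> = \<infinity>"
  using ev by (auto simp: ev_assumption_def split: ev_class.splits)
 then have "AE x in \<mu>. ereal x < ess_end \<mu>"
 proof
  assume e: "ess_end \<mu> = 1"
  have "AE x in \<mu>. ereal x <= 1" using esssup_AE[of ereal \<mu>] e by (simp add: ess_end_def)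
  moreover have "AE x in \<mu>. x ~= 1"
   using null_singleton[of 1] by (intro AE_I[of _ _ "{1}"]) auto
  ultimately show ?thesis by eventually_elim (auto simp: e less_le one_ereal_def)
 qed simp
 moreover have [measurable]: "{x. a < x & ereal x < ess_end \<mu>} \<in> sets \<mu>" by simp
 ultimately show ?thesis
  unfolding tail_mass_def by (intro emeasure_eq_AE) (auto elim: eventually_mono)
qed

abbreviation "G x \<equiv> measure \<mu> {x<..}"
abbreviation "quant \<equiv> upper_quantile \<mu>"

lemma G_eq: "G x = 1 - cdf \<mu> x"
proof -
 have "UNIV - {..x} = {x<..}" by auto
 then show ?thesis using M.prob_compl[of "{..x}"] by (simp add: cdf_def)
qed

lemma G_antimono: "x <= y ==> G y <= G x" by (intro M.finite_measure_mono) auto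

lemma G_0: "x <= 0 ==> G x = 1"
 using AE_pos by (intro M.prob_eq_1[THEN iffD2]) (auto elim: eventually_mono)

text \<open>This is the Galois relation between tail and quantile; right continuity of the tail puts
  \<open>quant p\<close> itself into the set whose infimum it is.\<close>

lemma quant_gt_iff:
 assumes p: "0 < p" "p < 1"
 shows "x < quant p \<longleftrightarrow> p < G x"
proof -
 let ?X = "{x. G x <= p}"
 have q: "quant p = Inf ?X" using p by (simp add: upper_quantile_def)
 have "((%x. G x) \<longlongrightarrow> 1 - 1) at_top"
  unfolding G_eq using M.cdf_lim_at_top_prob by (intro tendsto_diff tendsto_const)
 then have "\<forall>\<^sub>F x in at_top. G x < p" using p by (intro order_tendstoD(2)[where y=0]) auto
 then obtain b where "G b < p" by (auto simp: eventually_at_top_linorder)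
 then have ne: "?X ~= {}" by (auto intro: less_imp_le)
 have bdd: "bdd_below ?X"
 proof (rule bdd_belowI[of _ 0])
  fix x assume "x \<in> ?X"
  then show "0 <= x" using G_0[of x] p by (cases "x <= 0") auto
 qed
 have "G (quant p) <= p"
 proof (rule tendsto_upperbound)
  have "(cdf \<mu> \<longlongrightarrow> cdf \<mu> (quant p)) (at_right (quant p))"
   using M.cdf_is_right_cont[of "quant p"] by (simp add: continuous_within)
  then show "(G \<longlongrightarrow> G (quant p)) (at_right (quant p))"
   unfolding G_eq by (intro tendsto_diff tendsto_const)
  have "G x <= p" if qx: "quant p < x" for x
  proof -
   obtain y where "y \<in> ?X" "y < x"
    using cInf_lessD[OF ne qx[unfolded q]] by blast
   then show ?thesis using G_antimono[of y x] by simp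
  qed
  then show "\<forall>\<^sub>F x in at_right (quant p). G x <= p" by (auto simp: eventually_at_filter)
 qed simp
 then have "G x <= p" if "quant p <= x" using G_antimono[OF that] by simp
 moreover have "quant p <= x" if "G x <= p"
  unfolding q using that bdd by (intro cInf_lower) auto
 ultimately show ?thesis by (meson not_le)
qed

lemma quant_antimono: "0 < p ==> p <= q ==> q < 1 ==> quant q <= quant p"
 by (metis (mono_tags, opaque_lifting) quant_gt_iff le_less_trans less_le_trans less_irrefl not_le)

lemma quant_pos: "0 < p ==> p < 1 ==> 0 < quant p"
 using quant_gt_iff[of p 0] G_0[of 0] by simp

lemma measurable_quant[measurable]: "quant \<in> borel_measurable borel"
proof (rule borel_measurableI_greater)
 fix a :: real
 have "a < quant x \<longleftrightarrow> x \<in> (if a < 0 then - {0<..<1} else {}) Un ({0<..<1} Int {..<G a})" for x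
 proof (cases "0 < x & x < 1")
  case True
  then show ?thesis using quant_gt_iff[of x a] by auto
 next
  case False
  then have "quant x = 0" by (simp only: upper_quantile_def if_False)
  then show ?thesis using False by auto
 qed
 then have "{x \<in> space borel. a < quant x} =
   (if a < 0 then - {0<..<1} else {}) Un ({0<..<1} Int {..<G a})" by (intro set_eqI) (simp only: mem_Collect_eq space_borel UNIV_I simp_thms)
 then show "{x \<in> space borel. a < quant x} \<in> sets borel" by simp
qed

text \<open>By the quantile relation, weights above \<open>a\<close> correspond to an interval of
  \<open>r\<close> of length \<open>u * G a\<close>. This is what allows a weight to be replaced by
  a second spatial coordinate.\<close>

lemma distr_quant:
 assumes u: "0 < u"
 shows "distr (density lborel (indicator {0<..<u})) borel (%r. quant (r / u))
    = scale_measure (ennreal u) \<mu>" (is "distr ?D borel ?f = _")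
proof (rule measure_eqI_lessThan)
 have f[measurable]: "?f \<in> borel_measurable borel" by (rule measurable_compose[OF _ measurable_quant]) simp
 show "sets (distr ?D borel ?f) = sets borel" "sets (scale_measure (ennreal u) \<mu>) = sets borel" by auto
 fix a :: real
 have G1: "G a <= 1" by simp
 have "emeasure (distr ?D borel ?f) {a<..} = emeasure ?D (?f -` {a<..})" by (subst emeasure_distr) (auto simp: measurable_def[symmetric])
 also have "... = (\<integral>\<^sup>+r. indicator {0<..<u} r * indicator (?f -` {a<..}) r \<partial>lborel)"
  by (rule emeasure_density) (auto intro: measurable_sets_borel[OF f])
 also have "... = (\<integral>\<^sup>+r. indicator {0<..<u * G a} r \<partial>lborel)"
 proof (intro nn_integral_cong)
  fix r :: real
  have "u * G a <= u" using G1 u by (simp add: mult_left_le)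
  then have "r < u" if "r < u * G a" using that by linarith
  then show "indicator {0<..<u} r * indicator (?f -` {a<..}) r = (indicator {0<..<u * G a} r :: ennreal)"
   using u quant_gt_iff[of "r / u" a] by (auto simp: indicator_def divide_less_eq mult.commute)
 qed
 also have "... = ennreal (u * G a)" using u by simp
 also have "... = emeasure (scale_measure (ennreal u) \<mu>) {a<..}"
  using u by (simp add: M.emeasure_eq_measure ennreal_mult)
 finally show "emeasure (distr ?D borel ?f) {a<..} = emeasure (scale_measure (ennreal u) \<mu>) {a<..}" .
 then show "emeasure (distr ?D borel ?f) {a<..} < \<infinity>"
  using u by (simp add: M.emeasure_eq_measure ennreal_mult_less_top)
qed

section \<open>The scaling functions\<close>

abbreviation "u \<equiv> scale_u c A B"
abbreviation "v \<equiv> scale_v c A B"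
abbreviation "w \<equiv> scale_w c A B"
abbreviation "is_frechet \<equiv> (case c of Frechet _ => True | _ => False)"

lemma tail_limit: "((%t. ennreal t * emeasure \<mu> {A t + x * B t<..}) \<longlongrightarrow> ev_limit c x) at_top"
 using ev unfolding ev_assumption_def tail_mass_eq by blast

lemma not_frechetD:
 assumes "\<not> is_frechet"
 shows "continuous_on {0..} A" "continuous_on {0..} B" "!!t. 0 <= t ==> 0 < B t"
  "mono_on {0..} (%t. A t / B t)" "filterlim (%t. A t / B t) at_top at_top"
  "\<exists>a>0. \<forall>t\<ge>0. a <= A t"
  "0 < x ==> ((%t. \<integral>\<^sup>+u\<in>{x..}. ennreal t * emeasure \<mu> {A t + u * B t<..} \<partial>lborel)
        \<longlongrightarrow> (\<integral>\<^sup>+u\<in>{x..}. ev_limit c u \<partial>lborel)) at_top"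
proof -
 have r: "ratio_and_tail_condition c \<mu> A B" and B0: "\<forall>t\<ge>0. 0 <= B t"
  using ev assms unfolding ev_assumption_def by (cases c; simp)+
 show "continuous_on {0..} A" "continuous_on {0..} B" using ev by (auto simp: ev_assumption_def)
 show "0 < B t" if "0 <= t" for t using r B0 that unfolding ratio_and_tail_condition_def by (simp add: less_le)
 show "mono_on {0..} (%t. A t / B t)" "filterlim (%t. A t / B t) at_top at_top"
  using r by (auto simp: ratio_and_tail_condition_def)
 show "\<exists>a>0. \<forall>t\<ge>0. a <= A t"
  using ev assms unfolding ev_assumption_def by (cases c) (auto intro: exI[of _ 1])
 show "((%t. \<integral>\<^sup>+u\<in>{x..}. ennreal t * emeasure \<mu> {A t + u * B t<..} \<partial>lborel)
        \<longlongrightarrow> (\<integral>\<^sup>+u\<in>{x..}. ev_limit c u \<partial>lborel)) at_top" if "0 < x"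
  using r that unfolding ratio_and_tail_condition_def tail_mass_eq by blast
qed

text \<open>\<open>x * A x / B x\<close> is continuous, and it is strictly increasing since
  \<open>A / B\<close> is positive and non-decreasing; so it takes the value \<open>t\<close>
  exactly once. The last statement is the form of this monotonicity that yields the growth of
  \<open>u\<close>.\<close>

lemma scale_u_solves:
 assumes nf: "\<not> is_frechet" and t: "0 < t"
 shows "0 < u t" "t * B (u t) = u t * A (u t)" "!!x. 0 <= x ==> x * A x / B x < t ==> x < u t"
proof -
 note [simp] = not_frechetD(3)[OF nf]
 obtain a where a: "0 < a" "!!t. 0 <= t ==> a <= A t" using not_frechetD(6)[OF nf] by blast
 define g where "g x = x * (A x / B x)" for x
 have AB: "0 < A x / B x" if "0 <= x" for x using a(1) a(2)[OF that] that by (intro divide_pos_pos) auto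
 have smono: "g x < g y" if "0 <= x" "x < y" for x y
 proof -
  have "A x / B x <= A y / B y" using mono_onD[OF not_frechetD(4)[OF nf], of x y] that by auto
  then have "g x <= x * (A y / B y)" unfolding g_def using that by (intro mult_left_mono) auto
  also have "... < g y" unfolding g_def using that AB[of y] by (intro mult_strict_right_mono) auto
  finally show ?thesis .
 qed
 have sol: "t * B x = x * A x \<longleftrightarrow> g x = t" if "0 <= x" for x
  using not_frechetD(3)[OF nf that] by (auto simp: g_def field_simps)
 have "\<forall>\<^sub>F x in at_top. 1 <= A x / B x" using not_frechetD(5)[OF nf] by (simp add: filterlim_at_top)
 then obtain b where b: "!!x. b <= x ==> 1 <= A x / B x" by (auto simp: eventually_at_top_linorder)
 \<comment> \<open>Beyond \<open>b\<close> the ratio \<open>A / B\<close> is at least 1, so the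
   function has reached \<open>t\<close> at this point.\<close>
 define m where "m = max t (max b 0)"
 have "t <= g m"
 proof -
  have "t <= m * 1" by (simp add: m_def)
  also have "... <= g m" unfolding g_def by (intro mult_left_mono b) (auto simp: m_def)
  finally show ?thesis .
 qed
 moreover have "continuous_on {0..m} g"
  unfolding g_def using not_frechetD(3)[OF nf]
  by (intro continuous_intros continuous_on_subset[OF not_frechetD(1)[OF nf]] continuous_on_subset[OF not_frechetD(2)[OF nf]]) (auto simp: less_imp_neq[symmetric] dest: less_imp_neq)
 moreover have "g 0 <= t" "0 <= m" using t by (simp_all add: g_def m_def)
 ultimately obtain x where x: "0 <= x" "g x = t"
  using IVT'[of g 0 t m] by blast
 have uniq: "y = x" if "0 <= y" "g y = t" for y
  using smono[of x y] smono[of y x] x that by (cases x y rule: linorder_cases) auto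
 have "u t = (THE x. 0 <= x & t * B x = x * A x)" using nf by (simp add: scale_u_def split: ev_class.splits)
 also have "... = x"
 proof (rule the_equality)
  show "0 <= x & t * B x = x * A x" using x sol[OF x(1)] by blast
  show "y = x" if "0 <= y & t * B y = y * A y" for y using uniq[of y] sol[of y] that by blast
 qed
 finally have ut: "u t = x" .
 have "x ~= 0" using x t by (auto simp: g_def)
 then show "0 < u t" using ut x by simp
 show "t * B (u t) = u t * A (u t)" using ut x sol[OF x(1)] by metis
 show "y < u t" if y: "0 <= y" "y * A y / B y < t" for y
 proof (rule ccontr)
  assume "\<not> y < u t"
  then have "g x <= g y" using smono[of x y] x ut by (cases "x = y") auto
  then show False using y x by (simp add: g_def)
 qed
qed

lemma scale_u_at_top: "filterlim u at_top at_top"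
proof (cases "is_frechet")
 case True
 then have "u = (%t. t)" by (auto simp: scale_u_def fun_eq_iff split: ev_class.splits)
 then show ?thesis by (simp add: filterlim_ident)
next
 case nf: False
 show ?thesis
  unfolding filterlim_at_top
 proof
  fix Z :: real
  let ?y = "max Z 0"
  show "\<forall>\<^sub>F t in at_top. Z <= u t"
   using eventually_gt_at_top[of "max 0 (?y * A ?y / B ?y)"]
  proof eventually_elim
   case (elim t)
   then have "?y < u t" by (intro scale_u_solves(3)[OF nf]) auto
   then show ?case by simp
  qed
 qed
qed

text \<open>In the Frechet case the support is unbounded, so every fixed tail \<open>G b\<close> is
  positive; if \<open>B t\<close> stayed below \<open>b\<close>, then \<open>t * G (B t)\<close>
  would outgrow its limit 1.\<close>

lemma frechetD:
 assumes "is_frechet"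
 shows "u t = t" "v t = 0" "w t = B t" "filterlim B at_top at_top"
proof -
 obtain \<alpha> where c: "c = Frechet \<alpha>" using assms by (cases c) auto
 show "u t = t" "v t = 0" "w t = B t" by (simp_all add: c scale_u_def scale_v_def scale_w_def)
 have A0: "!!t. 0 <= t ==> A t = 0" and B0: "!!t. 0 <= t ==> 0 <= B t" and e: "ess_end \<mu> = \<infinity>"
  using ev by (auto simp: ev_assumption_def c)
 have lim: "((%t. ennreal t * emeasure \<mu> {A t + 1 * B t<..}) \<longlongrightarrow> 1) at_top"
  using tail_limit[of 1] by (simp add: c)
 have ev2: "\<forall>\<^sub>F t in at_top. ennreal t * emeasure \<mu> {A t + 1 * B t<..} < 2" by (rule order_tendstoD(2)[OF lim]) simp
 show "filterlim B at_top at_top"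
  unfolding filterlim_at_top
 proof
  fix b :: real
  have Gb: "0 < G b"
  proof (rule ccontr)
   assume "\<not> 0 < G b"
   then have "emeasure \<mu> {b<..} = 0" by (simp add: M.emeasure_eq_measure zero_less_measure_iff)
   then have "AE x in \<mu>. ereal x <= ereal b" by (intro AE_I[of _ _ "{b<..}"]) auto
   then have "esssup \<mu> ereal <= ereal b" by (intro esssup_I) auto
   then show False using e by (simp add: ess_end_def)
  qed
  show "\<forall>\<^sub>F t in at_top. b <= B t"
   using ev2 eventually_ge_at_top[of "max 0 (2 / G b)"]
  proof eventually_elim
   case (elim t)
   show ?case
   proof (rule ccontr)
    assume "\<not> b <= B t"
    then have "G b <= G (B t)" by (intro G_antimono) simp
    have t0: "0 <= t" "2 / G b <= t" using order_trans[OF max.cobounded1 elim(2)] order_trans[OF max.cobounded2 elim(2)] by blast+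
    have "2 = 2 / G b * G b" using Gb by simp
    also have "... <= t * G b" using t0 Gb by (intro mult_right_mono) auto
    also have "... <= t * G (B t)" using t0 \<open>G b <= G (B t)\<close> by (intro mult_left_mono) auto
    finally have "ennreal 2 <= ennreal (t * G (B t))" by (rule ennreal_leI)
    also have "... = ennreal t * emeasure \<mu> {A t + 1 * B t<..}"
     using t0 by (simp add: A0 M.emeasure_eq_measure ennreal_mult)
    finally show False using elim(1) by (metis ennreal_numeral leD)
   qed
  qed
 qed
qed

lemma scale_v_w:
 assumes nf: "\<not> is_frechet"
 shows "v t = A (u t)" "w t = B (u t)"
 using nf by (simp_all add: scale_v_def scale_w_def split: ev_class.splits)

lemma eventually_scales_pos: "\<forall>\<^sub>F t in at_top. 0 < t & 0 < u t & 0 < w t"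
proof (cases "is_frechet")
 case True
 have "\<forall>\<^sub>F t in at_top. 0 < B t" using frechetD(4)[OF True] by (simp add: filterlim_at_top_dense)
 then show ?thesis using eventually_gt_at_top[of 0] by eventually_elim (simp add: frechetD[OF True])
next
 case False
 show ?thesis using eventually_gt_at_top[of 0]
  by eventually_elim (use scale_u_solves[OF False] not_frechetD(3)[OF False] scale_v_w[OF False] in \<open>auto simp: less_imp_le\<close>)
qed

lemma scaled_tail_limit:
 "((%t. ennreal (u t) * emeasure \<mu> {v t + x * w t<..}) \<longlongrightarrow> ev_limit c x) at_top"
proof (cases "is_frechet")
 case True
 then have A0: "!!t. 0 <= t ==> A t = 0" using ev by (auto simp: ev_assumption_def split: ev_class.splits)
 have "\<forall>\<^sub>F t in at_top. ennreal t * emeasure \<mu> {A t + x * B t<..} = ennreal (u t) * emeasure \<mu> {v t + x * w t<..}"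
  using eventually_ge_at_top[of 0] by eventually_elim (simp add: frechetD[OF True] A0)
 with tail_limit[of x] show ?thesis by (rule Lim_transform_eventually)
next
 case False
 show ?thesis
  using filterlim_compose[OF tail_limit[of x] scale_u_at_top] by (simp add: scale_v_w[OF False])
qed

lemma ev_limit_gt:
 assumes "0 < r" "x < ev_inv c r"
 shows "ennreal r < ev_limit c x"
proof (cases c)
 case (Weibull \<alpha>)
 then have \<alpha>: "0 < \<alpha>" using ev by (simp add: ev_assumption_def)
 have "r powr (1 / \<alpha>) < - x" using assms by (simp add: ev_inv_def Weibull)
 then have "(r powr (1 / \<alpha>)) powr \<alpha> < (- x) powr \<alpha>" using \<alpha> by (intro powr_less_mono2) auto
 moreover have "x < 0" using \<open>r powr (1 / \<alpha>) < - x\<close> powr_ge_zero[of r "1 / \<alpha>"] by linarith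
 ultimately show ?thesis using assms \<alpha> by (simp add: Weibull powr_powr ennreal_lessI)
next
 case Gumbel
 then have "ln r < - x" using assms by (simp add: ev_inv_def)
 then have "r < exp (- x)" using assms by (metis exp_less_mono exp_ln)
 then show ?thesis by (simp add: Gumbel ennreal_lessI)
next
 case (Frechet \<alpha>)
 then have \<alpha>: "0 < \<alpha>" using ev by (simp add: ev_assumption_def)
 show ?thesis
 proof (cases "x <= 0")
  case False
  have "x < r powr (- 1 / \<alpha>)" using assms by (simp add: ev_inv_def Frechet)
  then have "(r powr (- 1 / \<alpha>)) powr (- \<alpha>) < x powr (- \<alpha>)"
   using False \<alpha> by (intro powr_less_mono2_neg) auto
  then show ?thesis using assms False \<alpha> by (simp add: Frechet powr_powr ennreal_lessI)
 qed (simp add: Frechet)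
qed

lemma ev_limit_less:
 assumes "0 < r" "ev_inv c r < x"
 shows "ev_limit c x < ennreal r"
proof (cases c)
 case (Weibull \<alpha>)
 then have \<alpha>: "0 < \<alpha>" using ev by (simp add: ev_assumption_def)
 show ?thesis
 proof (cases "x < 0")
  case True
  have "- x < r powr (1 / \<alpha>)" using assms by (simp add: ev_inv_def Weibull)
  then have "(- x) powr \<alpha> < (r powr (1 / \<alpha>)) powr \<alpha>" using \<alpha> True by (intro powr_less_mono2) auto
  then show ?thesis using assms \<alpha> True by (simp add: Weibull powr_powr ennreal_lessI)
 qed (use assms in \<open>simp add: Weibull\<close>)
next
 case Gumbel
 then have "- x < ln r" using assms by (simp add: ev_inv_def)
 then have "exp (- x) < r" using assms by (metis exp_less_mono exp_ln)
 then show ?thesis using assms by (simp add: Gumbel ennreal_lessI)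
next
 case (Frechet \<alpha>)
 then have \<alpha>: "0 < \<alpha>" using ev by (simp add: ev_assumption_def)
 have x: "r powr (- 1 / \<alpha>) < x" using assms by (simp add: ev_inv_def Frechet)
 then have "0 < x" using powr_gt_zero[of r "- 1 / \<alpha>"] assms by linarith
 have "x powr (- \<alpha>) < (r powr (- 1 / \<alpha>)) powr (- \<alpha>)"
  using x assms \<alpha> by (intro powr_less_mono2_neg) auto
 then show ?thesis using assms \<open>0 < x\<close> \<alpha> by (simp add: Frechet powr_powr ennreal_lessI)
qed

definition mark where "mark t r = (quant (r / u t) - v t) / w t"

text \<open>By the quantile relation, \<open>mark t r\<close> exceeds \<open>x\<close> exactly when
  \<open>r\<close> is below the scaled tail at \<open>x\<close>; convergence of the tails thus
  becomes convergence of their inverse functions.\<close>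

lemma mark_limit:
 assumes r: "0 < r"
 shows "((%t. mark t r) \<longlongrightarrow> ev_inv c r) at_top"
proof (rule order_tendstoI)
 have evr: "\<forall>\<^sub>F t in at_top. r < u t" using scale_u_at_top by (simp add: filterlim_at_top_dense)
 have iff: "x < mark t r \<longleftrightarrow> ennreal r < ennreal (u t) * emeasure \<mu> {v t + x * w t<..}"
  if "0 < u t" "0 < w t" "r < u t" for t x
 proof -
  have "x < mark t r \<longleftrightarrow> v t + x * w t < quant (r / u t)"
   using that by (simp add: mark_def field_simps)
  also have "... \<longleftrightarrow> r / u t < G (v t + x * w t)" using that r by (intro quant_gt_iff) auto
  also have "... \<longleftrightarrow> r < u t * G (v t + x * w t)" using that by (simp add: field_simps)
  also have "... \<longleftrightarrow> ennreal r < ennreal (u t * G (v t + x * w t))"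
   using r by (simp add: ennreal_less_iff)
  finally show ?thesis using that by (simp add: M.emeasure_eq_measure ennreal_mult)
 qed
 show "\<forall>\<^sub>F t in at_top. x < mark t r" if "x < ev_inv c r" for x
  using order_tendstoD(1)[OF scaled_tail_limit ev_limit_gt[OF r that]] evr eventually_scales_pos by eventually_elim (simp add: iff)
 show "\<forall>\<^sub>F t in at_top. mark t r < x" if lt: "ev_inv c r < x" for x
 proof -
  \<comment> \<open>An intermediate \<open>x'\<close> turns the non-strict conclusion of the
    relation into a strict one.\<close>
  obtain x' where x': "ev_inv c r < x'" "x' < x" using dense[OF lt] by blast
  from order_tendstoD(2)[OF scaled_tail_limit ev_limit_less[OF r x'(1)]] evr eventually_scales_pos
  show ?thesis
  proof eventually_elim
   case (elim t)
   then have "\<not> x' < mark t r" by (simp add: iff)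
   then show ?case using x' by simp
  qed
 qed
qed

end

section \<open>Rescaled heights at a fixed point of the quadrant\<close>

context ev_setting
begin

text \<open>The image of arrival times in \<open>[0, t]\<close> and quantile levels in
  \<open>(0, 1)\<close>: times are divided and levels multiplied by \<open>u t\<close>, so that area
  is preserved.\<close>

definition window :: "real => (real \<times> real) set" where
 "window t = {(s, r). 0 <= s & s <= t / u t & 0 < r & r < u t}"

definition height :: "real => real => real => (rat => nat) => real" where
 "height t s r p = (ln (real (path_eval (quant (r / u t) * (t - s * u t)) p)) - t * v t) / (t * w t)"

text \<open>The height with the logarithm of the Yule population replaced by the age at which it is
  evaluated.\<close>

definition drift :: "real => real => real => real" where
 "drift t s r = (quant (r / u t) * (t - s * u t) - t * v t) / (t * w t)"

definition height_lim :: "real => real => real" where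
 "height_lim s r = limit_height c s (ev_inv c r)"

lemma scales_at_top: "filterlim (%t. t * w t) at_top at_top"
proof (cases "is_frechet")
 case True
 show ?thesis unfolding frechetD[OF True] by (rule filterlim_at_top_mult_at_top[OF filterlim_ident frechetD(4)[OF True]])
next
 case nf: False
 obtain a where a: "0 < a" "!!t. 0 <= t ==> a <= A t" using not_frechetD(6)[OF nf] by blast
 have "filterlim (%t. u t * a) at_top at_top"
  using a(1) by (intro filterlim_at_top_mult_tendsto_pos[OF tendsto_const _ scale_u_at_top])
 then show ?thesis
 proof (rule filterlim_at_top_mono)
  show "\<forall>\<^sub>F t in at_top. u t * a <= t * w t"
   using eventually_gt_at_top[of 0]
  proof eventually_elim
   case (elim t)
   then show ?case
    using scale_u_solves(2)[OF nf elim] a(2)[OF less_imp_le[OF scale_u_solves(1)[OF nf elim]]]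
     scale_u_solves(1)[OF nf elim] by (simp add: scale_v_w[OF nf])
  qed
 qed
qed

text \<open>The equation that defines \<open>u t\<close> reads \<open>t * w t = u t * v t\<close>:
  to leading order, one unit of rescaled delay costs one unit of height.\<close>

lemma ratio_limit:
 assumes nf: "\<not> is_frechet"
 shows "((%t. w t / v t) \<longlongrightarrow> 0) at_top" "filterlim (%t. t / u t) at_top at_top"
  "!!t. 0 < t ==> t * w t = u t * v t"
  "\<exists>a>0. \<forall>t>0. a <= v t"
proof -
 have l: "filterlim (%t. v t / w t) at_top at_top"
  using filterlim_compose[OF not_frechetD(5)[OF nf] scale_u_at_top] by (simp add: scale_v_w[OF nf])
 have "((%t. inverse (v t / w t)) \<longlongrightarrow> 0) at_top" by (rule tendsto_inverse_0_at_top[OF l])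
 then show "((%t. w t / v t) \<longlongrightarrow> 0) at_top" by (simp add: inverse_eq_divide)
 show tw: "t * w t = u t * v t" if "0 < t" for t
  using scale_u_solves(2)[OF nf that] by (simp add: scale_v_w[OF nf])
 show "filterlim (%t. t / u t) at_top at_top"
  using l
 proof (rule filterlim_mono_eventually[OF _ order_refl order_refl])
  show "\<forall>\<^sub>F t in at_top. v t / w t = t / u t"
   using eventually_scales_pos
  proof eventually_elim
   case (elim t)
   then show ?case using tw[of t] by (simp add: field_simps)
  qed
 qed
 obtain a where a: "0 < a" "!!t. 0 <= t ==> a <= A t" using not_frechetD(6)[OF nf] by blast
 have "a <= v t" if "0 < t" for t
  using a(2)[OF less_imp_le[OF scale_u_solves(1)[OF nf that]]] by (simp add: scale_v_w[OF nf])
 with a(1) show "\<exists>a>0. \<forall>t>0. a <= v t" by blast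
qed

lemma weight_eq: "0 < w t ==> quant (r / u t) = v t + mark t r * w t" by (simp add: mark_def)

text \<open>Outside the Frechet case a delay \<open>s\<close> costs
  \<open>s * (1 + mark t r * (w t / v t))\<close>, and \<open>w t / v t\<close> tends to 0; in the
  Frechet case the delay enters only as the factor \<open>1 - s\<close>.\<close>

lemma drift_limit:
 assumes r: "0 < r" and s: "s \<in> time_domain c"
 shows "((%t. drift t s r) \<longlongrightarrow> height_lim s r) at_top"
proof (cases "is_frechet")
 case True
 have "\<forall>\<^sub>F t in at_top. mark t r * (1 - s) = drift t s r"
  using eventually_scales_pos
 proof eventually_elim
  case (elim t)
  then have "quant (r / t) = mark t r * B t" using weight_eq[of t r] by (simp add: frechetD[OF True])
  then have "drift t s r = (mark t r * B t * (t * (1 - s))) / (t * B t)" by (simp add: drift_def frechetD[OF True] algebra_simps)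
  then show ?case using elim by (simp add: frechetD[OF True])
 qed
 moreover have "((%t. mark t r * (1 - s)) \<longlongrightarrow> height_lim s r) at_top"
 proof -
  have "height_lim s r = ev_inv c r * (1 - s)"
   using True by (simp add: height_lim_def limit_height_def split: ev_class.splits)
  then show ?thesis using tendsto_mult[OF mark_limit[OF r] tendsto_const] by metis
 qed
 ultimately show ?thesis by (rule Lim_transform_eventually[rotated])
next
 case nf: False
 have "\<forall>\<^sub>F t in at_top. mark t r - s * (1 + mark t r * (w t / v t)) = drift t s r"
  using eventually_scales_pos
 proof eventually_elim
  case (elim t)
  then have t: "0 < t" "0 < u t" "0 < w t" by auto
  have v: "0 < v t" using ratio_limit(4)[OF nf] t(1) by (meson less_le_trans)
  have tw: "t * w t = u t * v t" by (rule ratio_limit(3)[OF nf t(1)])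
  have "drift t s r = (t * w t * mark t r - s * u t * (v t + mark t r * w t)) / (t * w t)"
   using t by (simp add: drift_def weight_eq algebra_simps)
  also have "... = mark t r - s * u t * (v t + mark t r * w t) / (t * w t)"
   using t by (simp add: diff_divide_distrib)
  also have "s * u t * (v t + mark t r * w t) / (t * w t) = s * (1 + mark t r * (w t / v t))"
   unfolding tw using t v by (simp add: field_simps)
  finally show ?case ..
 qed
 moreover have "((%t. mark t r - s * (1 + mark t r * (w t / v t))) \<longlongrightarrow> ev_inv c r - s * (1 + ev_inv c r * 0)) at_top"
  by (intro tendsto_intros mark_limit[OF r] ratio_limit(1)[OF nf])
 ultimately have "((%t. drift t s r) \<longlongrightarrow> ev_inv c r - s * (1 + ev_inv c r * 0)) at_top" by (rule Lim_transform_eventually[rotated])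
 then show ?thesis using nf by (simp add: height_lim_def limit_height_def split: ev_class.splits)
qed

lemma eventually_window:
 assumes r: "0 < r" and s: "s \<in> time_domain c"
 shows "\<forall>\<^sub>F t in at_top. (s, r) \<in> window t"
proof -
 have ru: "\<forall>\<^sub>F t in at_top. r < u t" using scale_u_at_top by (simp add: filterlim_at_top_dense)
 have s0: "0 <= s" using s by (auto simp: time_domain_def split: ev_class.splits)
 have "\<forall>\<^sub>F t in at_top. s <= t / u t"
 proof (cases "is_frechet")
  case True
  then have s1: "s <= 1" using s by (auto simp: time_domain_def split: ev_class.splits)
  show ?thesis using eventually_gt_at_top[of 0] by eventually_elim (simp add: frechetD[OF True] s1)
 next
  case False
  then show ?thesis using ratio_limit(2)[OF False] by (simp add: filterlim_at_top)
 qed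
 with ru show ?thesis by eventually_elim (use r s0 in \<open>auto simp: window_def\<close>)
qed

lemma window_nonneg:
 assumes "0 < u t" "(s, r) \<in> window t"
 shows "0 <= quant (r / u t) * (t - s * u t)" "0 < quant (r / u t)"
proof -
 show "0 < quant (r / u t)" using assms by (intro quant_pos) (auto simp: window_def)
 moreover have "0 <= t - s * u t" using assms by (auto simp: window_def field_simps)
 ultimately show "0 <= quant (r / u t) * (t - s * u t)" by simp
qed

lemma measurable_path_eval': "(%p. path_eval \<sigma> p) \<in> measurable path_space (count_space UNIV)" by (rule measurable_path_eval) auto

text \<open>By the two geometric tail bounds, the logarithm of a Yule population misses its age by
  \<open>X\<close> with probability at most \<open>exp (- X)\<close> on each side; here
  \<open>X = d * (t * w t)\<close>.\<close>

lemma height_deviation: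
 assumes pos: "0 < t" "0 < u t" "0 < w t" and win: "(s, r) \<in> window t" and d: "0 < d"
 shows "emeasure ylaw {p \<in> space ylaw. d < \<bar>height t s r p - drift t s r\<bar>} <= ennreal (2 * exp (- (d * (t * w t))))"
proof -
 interpret Y: prob_space ylaw by (rule prob_space_ylaw)
 let ?\<sigma> = "quant (r / u t) * (t - s * u t)" and ?X = "d * (t * w t)"
 have \<sigma>: "0 <= ?\<sigma>" by (rule window_nonneg[OF pos(2) win])
 \<comment> \<open>Rounding down loses nothing, as the population is an integer.\<close>
 let ?k = "nat \<lfloor>exp (?\<sigma> - ?X)\<rfloor>"
 let ?L = "{p \<in> space ylaw. path_eval ?\<sigma> p <= ?k}" and ?U = "{p \<in> space ylaw. exp (?\<sigma> + ?X) <= real (path_eval ?\<sigma> p)}"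
 note [measurable] = measurable_path_eval'
 have LU: "?L \<in> sets ylaw" "?U \<in> sets ylaw" by measurable
 have "{p \<in> space ylaw. d < \<bar>height t s r p - drift t s r\<bar>} <= ?L Un ?U"
 proof
  fix p assume "p \<in> {p \<in> space ylaw. d < \<bar>height t s r p - drift t s r\<bar>}"
  then have p: "p \<in> space ylaw" "d < \<bar>height t s r p - drift t s r\<bar>" by auto
  let ?Z = "path_eval ?\<sigma> p"
  have "height t s r p - drift t s r = (ln (real ?Z) - ?\<sigma>) / (t * w t)" by (simp add: height_def drift_def diff_divide_distrib)
  then have "d < \<bar>ln (real ?Z) - ?\<sigma>\<bar> / (t * w t)" using p(2) pos by (simp add: abs_mult)
  then have X: "?X < \<bar>ln (real ?Z) - ?\<sigma>\<bar>" using pos by (simp add: pos_less_divide_eq)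
  show "p \<in> ?L Un ?U"
  \<comment> \<open>\<open>ln 0 = 0\<close> is a default value that says nothing about the
    population; a path with value 0 is counted with the lower event.\<close>
  proof (cases "?Z = 0")
   case False
   then have Z: "0 < real ?Z" by simp
   from X consider "ln (real ?Z) < ?\<sigma> - ?X" | "?\<sigma> + ?X < ln (real ?Z)" by linarith
   then show ?thesis
   proof cases
    case 1
    then have "real ?Z < exp (?\<sigma> - ?X)" using Z by (metis exp_less_mono exp_ln)
    then have "?Z <= ?k" by (simp add: le_nat_iff le_floor_iff)
    then show ?thesis using p by simp
   next
    case 2
    then have "exp (?\<sigma> + ?X) < real ?Z" using Z by (metis exp_less_mono exp_ln)
    then show ?thesis using p by simp
   qed
  qed (use p in simp)
 qed
 then have "emeasure ylaw {p \<in> space ylaw. d < \<bar>height t s r p - drift t s r\<bar>} <= emeasure ylaw (?L Un ?U)"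
  by (rule emeasure_mono) (rule sets.Un[OF LU])
 also have "... <= emeasure ylaw ?L + emeasure ylaw ?U" by (rule emeasure_subadditive[OF LU])
 also have "... <= ennreal (real ?k * exp (- ?\<sigma>)) + ennreal (exp ?\<sigma> / exp (?\<sigma> + ?X))"
  by (intro add_mono ylaw_tail[OF \<sigma>]) simp
 also have "... <= ennreal (exp (- ?X)) + ennreal (exp (- ?X))"
 proof (intro add_mono ennreal_leI)
  have "real ?k * exp (- ?\<sigma>) <= exp (?\<sigma> - ?X) * exp (- ?\<sigma>)" by (intro mult_right_mono) (auto simp: of_nat_floor)
  also have "... = exp (- ?X)" by (simp add: exp_add[symmetric])
  finally show "real ?k * exp (- ?\<sigma>) <= exp (- ?X)" .
  have "exp ?\<sigma> / exp (?\<sigma> + ?X) = exp (?\<sigma> - (?\<sigma> + ?X))" by (rule exp_diff[symmetric])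
  then show "exp ?\<sigma> / exp (?\<sigma> + ?X) <= exp (- ?X)" by simp
 qed
 also have "... = ennreal (2 * exp (- ?X))" by (simp add: ennreal_plus[symmetric] del: ennreal_plus)
 finally show ?thesis .
qed

text \<open>The drift converges, and the deviation bound vanishes because \<open>t * w t\<close>
  tends to infinity.\<close>

lemma height_limit:
 assumes r: "0 < r" and s: "s \<in> time_domain c" and d: "0 < d"
 shows "((%t. emeasure ylaw {p \<in> space ylaw. d < \<bar>height t s r p - height_lim s r\<bar>}) \<longlongrightarrow> 0) at_top"
proof (rule tendsto_sandwich[OF _ _ tendsto_const])
 have "((%t. exp (- (d / 2 * (t * w t)))) \<longlongrightarrow> 0) at_top"
  using d by (intro filterlim_compose[OF exp_at_bot] filterlim_uminus_at_bot_at_top[THEN filterlim_compose]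
    filterlim_tendsto_pos_mult_at_top[OF tendsto_const _ scales_at_top]) simp
 then have "((%t. ennreal (2 * exp (- (d / 2 * (t * w t))))) \<longlongrightarrow> ennreal (2 * 0)) at_top"
  by (intro tendsto_ennrealI tendsto_mult_left)
 then show "((%t. ennreal (2 * exp (- (d / 2 * (t * w t))))) \<longlongrightarrow> 0) at_top" by simp
 have "\<forall>\<^sub>F t in at_top. dist (drift t s r) (height_lim s r) < d / 2" by (rule tendstoD[OF drift_limit[OF r s]]) (use d in simp)
 with eventually_scales_pos eventually_window[OF r s]
 show "\<forall>\<^sub>F t in at_top. emeasure ylaw {p \<in> space ylaw. d < \<bar>height t s r p - height_lim s r\<bar>}
   <= ennreal (2 * exp (- (d / 2 * (t * w t))))"
 proof eventually_elim
  case (elim t)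
  note [measurable] = measurable_path_eval'
  have m: "{p \<in> space ylaw. d / 2 < \<bar>height t s r p - drift t s r\<bar>} \<in> sets ylaw"
   unfolding height_def by measurable
  have "d / 2 < \<bar>height t s r p - drift t s r\<bar>" if "d < \<bar>height t s r p - height_lim s r\<bar>" for p
   using that elim(3) unfolding dist_real_def by linarith
  then have "emeasure ylaw {p \<in> space ylaw. d < \<bar>height t s r p - height_lim s r\<bar>}
    <= emeasure ylaw {p \<in> space ylaw. d / 2 < \<bar>height t s r p - drift t s r\<bar>}" by (intro emeasure_mono m) auto
  also have "... <= ennreal (2 * exp (- (d / 2 * (t * w t))))"
   using elim d by (intro height_deviation) auto
  finally show ?case .
 qed
qed simp

end

lemma nn_integral_exp_decay:
 fixes a :: real
 assumes a: "0 < a"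
 shows "(\<integral>\<^sup>+s. indicator {0..} s * ennreal (exp (- (a * s))) \<partial>lborel) = ennreal (1 / a)"
proof -
 have "(\<integral>\<^sup>+s. indicator {0..} s * ennreal (exp (- (a * s))) \<partial>lborel) = (\<integral>\<^sup>+s. ennreal (1 / a) * ennreal (exponential_density a s) \<partial>lborel)"
  using a by (intro nn_integral_cong) (auto simp: exponential_density_def ennreal_mult[symmetric] indicator_def mult.commute)
 also have "... = ennreal (1 / a) * (\<integral>\<^sup>+s. ennreal (exponential_density a s) \<partial>lborel)" by (rule nn_integral_cmult) simp
 also have "(\<integral>\<^sup>+s. ennreal (exponential_density a s) \<partial>lborel) = 1"
  using prob_space.emeasure_space_1[OF prob_space_exponential_density[OF a]] by (simp add: emeasure_density)
 finally show ?thesis by simp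
qed

lemma le_sum4:
 fixes x :: ennreal
 assumes "x <= a \<or> x <= b \<or> x <= c \<or> x <= d"
 shows "x <= a + b + (c + d)"
proof -
 have "a <= a + b + (c + d)" "b <= a + b + (c + d)" "c <= a + b + (c + d)" "d <= a + b + (c + d)" by (metis add.assoc add.commute le_iff_add)+
 with assms show ?thesis using order_trans by blast
qed

lemma nn_integral_pair_add:
 fixes f g :: "real => real => ennreal"
 assumes f: "(%(s, r). f s r) \<in> borel_measurable borel2" and g: "(%(s, r). g s r) \<in> borel_measurable borel2"
 shows "(\<integral>\<^sup>+s. \<integral>\<^sup>+r. f s r + g s r \<partial>lborel \<partial>lborel) = (\<integral>\<^sup>+s. \<integral>\<^sup>+r. f s r \<partial>lborel \<partial>lborel) + (\<integral>\<^sup>+s. \<integral>\<^sup>+r. g s r \<partial>lborel \<partial>lborel)"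
proof -
 have f': "(%(s, r). f s r) \<in> borel_measurable (borel \<Otimes>\<^sub>M lborel)"
  and g': "(%(s, r). g s r) \<in> borel_measurable (borel \<Otimes>\<^sub>M lborel)"
  using f g by (simp_all cong: measurable_cong_sets sets_pair_measure_cong)
 have "(\<integral>\<^sup>+s. \<integral>\<^sup>+r. f s r + g s r \<partial>lborel \<partial>lborel) = (\<integral>\<^sup>+s. (\<integral>\<^sup>+r. f s r \<partial>lborel) + (\<integral>\<^sup>+r. g s r \<partial>lborel) \<partial>lborel)"
 proof (intro nn_integral_cong nn_integral_add)
  fix s :: real
  show "f s \<in> borel_measurable lborel" using measurable_compose[OF measurable_Pair1'[of s borel borel] f] by simp
  show "g s \<in> borel_measurable lborel" using measurable_compose[OF measurable_Pair1'[of s borel borel] g] by simp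
 qed
 also have "... = (\<integral>\<^sup>+s. \<integral>\<^sup>+r. f s r \<partial>lborel \<partial>lborel) + (\<integral>\<^sup>+s. \<integral>\<^sup>+r. g s r \<partial>lborel \<partial>lborel)"
  using lborel.borel_measurable_nn_integral[OF f'] lborel.borel_measurable_nn_integral[OF g'] by (intro nn_integral_add) simp_all
 finally show ?thesis .
qed

lemma nn_integral_pair_add4:
 fixes f1 f2 f3 f4 :: "real => real => ennreal"
 assumes f1: "(%(s, r). f1 s r) \<in> borel_measurable borel2" and f2: "(%(s, r). f2 s r) \<in> borel_measurable borel2"
  and f3: "(%(s, r). f3 s r) \<in> borel_measurable borel2" and f4: "(%(s, r). f4 s r) \<in> borel_measurable borel2"
 defines "J f \<equiv> \<integral>\<^sup>+s. \<integral>\<^sup>+r. f s r \<partial>lborel \<partial>lborel"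
 shows "J (%s r. (f1 s r + f2 s r) + (f3 s r + f4 s r)) = (J f1 + J f2) + (J f3 + J f4)"
proof -
 have "(%(s, r). f1 s r + f2 s r) \<in> borel_measurable borel2" "(%(s, r). f3 s r + f4 s r) \<in> borel_measurable borel2"
  using f1 f2 f3 f4 by (simp_all add: split_beta')
 from nn_integral_pair_add[OF this] nn_integral_pair_add[OF f1 f2] nn_integral_pair_add[OF f3 f4]
 show ?thesis unfolding J_def by (simp only:)
qed

section \<open>Tightness above a fixed level\<close>

context ev_setting
begin

text \<open>Compact subsets of the state space keep the height away from its excluded lower end,
  which is 0 in the Frechet case and minus infinity otherwise; these levels decrease to that
  end.\<close>

definition level :: "nat => real" where
 "level k = (if is_frechet then 1 / (real k + 1) else - real k)"

definition exceed_prob :: "nat => real => real => real => ennreal" where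
 "exceed_prob k t s r = emeasure ylaw {p \<in> space ylaw. level k <= height t s r p}"

lemma exceed_prob_le_1: "exceed_prob k t s r <= 1"
proof -
 interpret Y: prob_space ylaw by (rule prob_space_ylaw)
 show ?thesis unfolding exceed_prob_def by (rule Y.emeasure_le_1)
qed

lemma exceed_prob_le:
 assumes pos: "0 < t" "0 < u t" "0 < w t" and win: "(s, r) \<in> window t"
 shows "exceed_prob k t s r <= ennreal (exp (quant (r / u t) * (t - s * u t) - t * v t - level k * (t * w t)))"
proof -
 let ?\<sigma> = "quant (r / u t) * (t - s * u t)" and ?b = "t * v t + level k * (t * w t)"
 have \<sigma>: "0 <= ?\<sigma>" by (rule window_nonneg[OF pos(2) win])
 note [measurable] = measurable_path_eval'
 \<comment> \<open>\<open>?L\<close> collects the paths with value 0, for which the default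
   \<open>ln 0 = 0\<close> gives no information; its probability is bounded by 0.\<close>
 let ?L = "{p \<in> space ylaw. path_eval ?\<sigma> p <= 0}" and ?U = "{p \<in> space ylaw. exp ?b <= real (path_eval ?\<sigma> p)}"
 have LU: "?L \<in> sets ylaw" "?U \<in> sets ylaw" by measurable
 have "{p \<in> space ylaw. level k <= height t s r p} <= ?L Un ?U"
 proof
  fix p assume "p \<in> {p \<in> space ylaw. level k <= height t s r p}"
  then have p: "p \<in> space ylaw" "level k <= height t s r p" by auto
  then have "?b <= ln (real (path_eval ?\<sigma> p))" using pos by (simp add: height_def field_simps)
  then have "exp ?b <= real (path_eval ?\<sigma> p)" if "0 < path_eval ?\<sigma> p"
   using that by (metis exp_le_cancel_iff exp_ln of_nat_0_less_iff)
  then show "p \<in> ?L Un ?U" using p(1) by blast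
 qed
 then have "exceed_prob k t s r <= emeasure ylaw (?L Un ?U)"
  unfolding exceed_prob_def by (rule emeasure_mono) (rule sets.Un[OF LU])
 also have "... <= emeasure ylaw ?L + emeasure ylaw ?U" by (rule emeasure_subadditive[OF LU])
 also have "... <= ennreal (real 0 * exp (- ?\<sigma>)) + ennreal (exp ?\<sigma> / exp ?b)" by (intro add_mono ylaw_tail[OF \<sigma>]) simp
 also have "... = ennreal (exp (?\<sigma> - ?b))" by (simp add: exp_diff)
 finally show ?thesis by (simp add: algebra_simps)
qed

lemma mark_antimono: "0 < u t ==> 0 < w t ==> 0 < r ==> r <= r' ==> r' < u t ==> mark t r' <= mark t r"
 unfolding mark_def by (intro divide_right_mono diff_right_mono quant_antimono) (auto simp: divide_right_mono)

text \<open>The set of \<open>r\<close> with a high mark is an interval starting at 0 whose length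
  is the scaled tail; this is how the integrated tail condition enters.\<close>

lemma emeasure_mark_gt:
 assumes "0 < u t" "0 < w t"
 shows "(\<integral>\<^sup>+r. indicator {0<..<u t} r * indicator {x<..} (mark t r) \<partial>lborel) = ennreal (u t) * emeasure \<mu> {v t + x * w t<..}"
proof -
 let ?g = "G (v t + x * w t)"
 have iff: "x < mark t r \<longleftrightarrow> r < u t * ?g" if "0 < r" "r < u t" for r
 proof -
  have "x < mark t r \<longleftrightarrow> v t + x * w t < quant (r / u t)"
   using assms by (simp add: mark_def field_simps)
  also have "... \<longleftrightarrow> r / u t < ?g" using that by (intro quant_gt_iff) auto
  also have "... \<longleftrightarrow> r < u t * ?g" using assms by (simp add: field_simps)
  finally show ?thesis .
 qed
 have "u t * ?g <= u t" using assms by (simp add: mult_left_le)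
 then have lt: "r < u t" if "r < u t * ?g" for r using that by linarith
 have "(\<integral>\<^sup>+r. indicator {0<..<u t} r * indicator {x<..} (mark t r) \<partial>lborel) = (\<integral>\<^sup>+r. indicator {0<..<u t * ?g} r \<partial>lborel)"
  using iff lt by (intro nn_integral_cong) (auto simp: indicator_def simp del: nn_integral_indicator)
 also have "... = ennreal (u t * ?g)" using assms by simp
 finally show ?thesis using assms by (simp add: M.emeasure_eq_measure ennreal_mult)
qed

lemma ev_limit_tail_small:
 assumes nf: "\<not> is_frechet" and e: "0 < \<epsilon>"
 shows "\<exists>X>0. (\<integral>\<^sup>+x\<in>{X..}. ev_limit c x \<partial>lborel) < ennreal \<epsilon>"
proof (cases c)
 case (Weibull \<alpha>)
 have "(\<integral>\<^sup>+x\<in>{1..}. ev_limit c x \<partial>lborel) = (\<integral>\<^sup>+x. 0 \<partial>(lborel :: real measure))"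
  by (intro nn_integral_cong) (auto simp: Weibull indicator_def)
 then show ?thesis using e by (intro exI[of _ 1]) simp
next
 case Gumbel
 define X where "X = \<bar>ln \<epsilon>\<bar> + 1"
 have "(\<integral>\<^sup>+x\<in>{X..}. ev_limit c x \<partial>lborel) = (\<integral>\<^sup>+x. ennreal (exp (- x)) * indicator {X..} x \<partial>lborel)"
  by (simp add: Gumbel)
 also have "... = ennreal (0 - (- exp (- X)))"
 proof (rule nn_integral_FTC_atLeast)
  show "((%x::real. - exp (- x)) \<longlongrightarrow> 0) at_top" by real_asymp
 qed (auto intro!: derivative_eq_intros)
 also have "... < ennreal \<epsilon>"
 proof (rule ennreal_lessI[OF e])
  have "- X < ln \<epsilon>" unfolding X_def by linarith
  then have "exp (- X) < \<epsilon>" using e by (metis exp_less_mono exp_ln)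
  then show "0 - - exp (- X) < \<epsilon>" by simp
 qed
 finally show ?thesis by (intro exI[of _ X]) (simp add: X_def)
qed (use nf in simp)

text \<open>With \<open>m = t * w t = u t * v t\<close> and \<open>y = mark t r\<close>, the
  exponent is \<open>E = m * (y + k) - s * u t * (v t + y * w t)\<close>. For \<open>R < r\<close>
  the mark is at most \<open>- k - 1\<close>: either the weight is at least \<open>v t / 2\<close>
  and \<open>E\<close> is at most \<open>- m - m / 2 * s\<close>, or \<open>y * w t\<close> is below
  \<open>- v t / 2\<close> and \<open>E\<close> is at most \<open>- (t * a / 4)\<close>. For
  \<open>r <= R\<close> the time is late: marks above \<open>s / 2 - k\<close> get the trivial bound
  1 and are left to the integrated tail, and smaller ones give \<open>E <= - (m / 4 * s)\<close>.
  The four terms are these four cases.\<close>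

lemma exceed_prob_bound:
 assumes nf: "\<not> is_frechet" and pos: "0 < t" "0 < u t" "0 < w t" and a: "0 < a" "a <= v t"
  and R: "0 < R" "R < u t" "mark t R <= - real k - 1" and C: "- C <= mark t R" "C * w t <= v t / 2"
  and k: "real k * w t <= v t / 4" and win: "(s, r) \<in> window t" and out: "R < r \<or> S0 <= s" and S0: "4 * real k <= S0"
 shows "exceed_prob k t s r <= ennreal (exp (- (u t * v t)) * exp (- (u t * v t / 2 * s))) + ennreal (exp (- (t * a / 4)))
   + (indicator {s / 2 - k<..} (mark t r) * indicator {S0..} s + indicator {0<..R} r * ennreal (exp (- (u t * v t / 4 * s))))"
proof -
 have tw: "t * w t = u t * v t" by (rule ratio_limit(3)[OF nf pos(1)])
 define y where "y = mark t r"
 define m where "m = u t * v t"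
 have v: "0 < v t" using a by linarith
 have m: "0 < m" using v pos by (simp add: m_def)
 have W: "quant (r / u t) = v t + y * w t" using weight_eq[OF pos(3)] by (simp add: y_def)
 have Wpos: "0 < v t + y * w t" using window_nonneg(2)[OF pos(2) win] by (simp add: W)
 have s: "0 <= s" "0 < r" "r < u t" using win by (auto simp: window_def)
 have lev: "level k = - real k" using nf by (simp add: level_def)
 define E where "E = m * (y + k) - s * u t * (v t + y * w t)"
 have "exceed_prob k t s r <= ennreal (exp E)"
 proof -
  have "quant (r / u t) * (t - s * u t) - t * v t - level k * (t * w t) = (t * w t) * (y + k) - s * u t * (v t + y * w t)"
   by (simp add: W lev algebra_simps)
  then show ?thesis using exceed_prob_le[OF pos win, of k] by (simp add: E_def m_def tw)
 qed
 note E_le = order_trans[OF this ennreal_leI[OF exp_le_cancel_iff[THEN iffD2]]]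
 let ?T1 = "ennreal (exp (- m) * exp (- (m / 2 * s)))" and ?T2 = "ennreal (exp (- (t * a / 4)))"
  and ?T3 = "indicator {s / 2 - k<..} (mark t r) * indicator {S0..} s :: ennreal"
  and ?T4 = "indicator {0<..R} r * ennreal (exp (- (m / 4 * s)))"
 have "exceed_prob k t s r <= ?T1 \<or> exceed_prob k t s r <= ?T2 \<or> exceed_prob k t s r <= ?T3 \<or> exceed_prob k t s r <= ?T4"
 proof (cases "R < r")
  case True
  have y1: "y <= - k - 1" using mark_antimono[of t R r] R pos s True by (simp add: y_def)
  show ?thesis
  proof (cases "v t / 2 <= v t + y * w t")
   case True
   have "m * (y + k) <= m * (- 1)" using y1 m by (intro mult_left_mono) auto
   moreover have "s * u t * (v t / 2) <= s * u t * (v t + y * w t)" using True s pos by (intro mult_left_mono) auto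
   moreover have "s * u t * (v t / 2) = m / 2 * s" by (simp add: m_def)
   ultimately have "E <= - m - m / 2 * s" unfolding E_def by linarith
   moreover have "exp (- m - m / 2 * s) = exp (- m) * exp (- (m / 2 * s))" by (simp add: exp_add[symmetric])
   ultimately show ?thesis using E_le[of "- m - m / 2 * s"] by metis
  next
   case False
   have "E <= m * (y + k)" unfolding E_def using s pos Wpos by simp
   also have "... = t * (w t * y + k * w t)" by (simp add: m_def tw[symmetric] algebra_simps)
   also have "... <= t * (- (v t / 2) + v t / 4)"
    using False k pos by (intro mult_left_mono add_mono) (auto simp: mult.commute)
   also have "... <= - (t * a / 4)" using a pos by (simp add: field_simps)
   finally show ?thesis using E_le by blast
  qed
 next
  case False
  with out S0 have sS: "S0 <= s" and s4: "4 * real k <= s" by simp_all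
  show ?thesis
  proof (cases "s / 2 - k < y")
   case True
   then show ?thesis using sS exceed_prob_le_1[of k t s r] by (simp add: y_def)
  next
   case sy: False
   have yC: "- C <= y" using C(1) mark_antimono[of t r R] R pos s False by (simp add: y_def)
   have "E <= - (m / 4 * s)"
   proof (cases "0 <= y")
    case True
    have "s * u t * v t <= s * u t * (v t + y * w t)" using True s pos by (intro mult_left_mono) auto
    then have "E <= m * (y + k) - m * s" by (simp add: E_def m_def algebra_simps)
    also have "... <= m * (s / 2) - m * s" using sy m by (intro diff_right_mono mult_left_mono) auto
    also have "... = - (m * s / 2)" by simp
    also have "... <= - (m / 4 * s)" using m s by simp
    finally show ?thesis .
   next
    \<comment> \<open>As \<open>r <= R\<close>, antitonicity bounds the mark below by
      \<open>- C\<close>, so a negative mark still leaves a weight of at least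
      \<open>v t / 2\<close>.\<close>
    case False
    have "- (C * w t) <= y * w t" using yC pos by (metis mult_minus_left mult_right_mono less_imp_le)
    then have "v t / 2 <= v t + y * w t" using C(2) by linarith
    then have "s * u t * (v t / 2) <= s * u t * (v t + y * w t)" using s pos by (intro mult_left_mono) auto
    then have "E <= m * (y + k) - m * s / 2" by (simp add: E_def m_def algebra_simps)
    also have "... <= m * (s / 4) - m * s / 2" using False s4 m by (intro diff_right_mono mult_left_mono) auto
    finally show ?thesis by (simp add: algebra_simps)
   qed
   moreover have "r \<in> {0<..R}" using s False by simp
   ultimately show ?thesis using E_le[of "- (m / 4 * s)"] by simp
  qed
 qed
 then show ?thesis unfolding m_def[symmetric] by (rule le_sum4)
qed

lemma measurable_mark: "mark t \<in> borel_measurable borel"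
 unfolding mark_def[abs_def] by measurable

text \<open>Each term of the pointwise bound integrates to at most \<open>\<epsilon> / 4\<close>:
  the first and the last decay exponentially in \<open>s\<close> over a width of \<open>u t\<close>
  or \<open>R\<close> in \<open>r\<close>, the second is constant on the window of area
  \<open>t\<close>, and the third is an integrated tail.\<close>

lemma tightness_not_frechet:
 assumes nf: "\<not> is_frechet" and e: "0 < \<epsilon>"
 shows "\<exists>n::nat. \<forall>\<^sub>F t in at_top.
  (\<integral>\<^sup>+s. \<integral>\<^sup>+r. indicator (window t - {0..real n} \<times> {0..real n}) (s, r) * exceed_prob k t s r \<partial>lborel \<partial>lborel) <= ennreal \<epsilon>"
proof -
 note [measurable] = measurable_mark
 \<comment> \<open>The limit mark is placed below \<open>- k - 2\<close>, so that
   \<open>mark t R\<close> is below \<open>- k - 1\<close> for all large \<open>t\<close>.\<close>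
 obtain R where R: "0 < R" "ev_inv c R < - real k - 2"
 proof (cases c)
  case (Weibull \<alpha>)
  then have "0 < \<alpha>" using ev by (simp add: ev_assumption_def)
  then show ?thesis by (intro that[of "(real k + 3) powr \<alpha>"]) (auto simp: Weibull ev_inv_def powr_powr)
 next
  case Gumbel
  then show ?thesis by (intro that[of "exp (real k + 3)"]) (auto simp: ev_inv_def)
 qed (use nf in simp)
 \<comment> \<open>The fraction 1/8 makes up for the factor 2 from the substitution
   \<open>x = s / 2 - k\<close>.\<close>
 obtain X where X: "0 < X" "(\<integral>\<^sup>+x\<in>{X..}. ev_limit c x \<partial>lborel) < ennreal (\<epsilon> / 8)"
  using ev_limit_tail_small[OF nf, of "\<epsilon> / 8"] e by auto
 obtain a where a: "0 < a" "!!t. 0 < t ==> a <= v t" using ratio_limit(4)[OF nf] by blast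
 \<comment> \<open>\<open>- C\<close> lies one below the limit of \<open>mark t R\<close>, hence
   bounds it from below for large \<open>t\<close>.\<close>
 define C where "C = 1 - ev_inv c R"
 \<comment> \<open>This makes \<open>s / 2 - k\<close> at least \<open>X\<close> for
   \<open>s >= S0\<close>, and \<open>S0\<close> at least \<open>4 * k\<close> as the pointwise
   bound demands.\<close>
 define S0 where "S0 = 2 * (X + 2 * real k)"
 obtain n :: nat where n: "max R S0 <= real n" using real_arch_simple by blast
 let ?m = "%t. u t * v t"
 have m_top: "filterlim ?m at_top at_top"
  using scales_at_top by (rule filterlim_mono_eventually[OF _ order_refl order_refl])
    (rule eventually_mono[OF eventually_gt_at_top[of 0] ratio_limit(3)[OF nf]])
 have e1: "\<forall>\<^sub>F t in at_top. 2 / a * exp (- ?m t) < \<epsilon> / 4"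
 proof (rule order_tendstoD(2))
  have "((%x::real. 2 / a * exp (- x)) \<longlongrightarrow> 0) at_top" by real_asymp
  from filterlim_compose[OF this m_top] show "((%t. 2 / a * exp (- ?m t)) \<longlongrightarrow> 0) at_top" .
 qed (use e in simp)
 have e2: "\<forall>\<^sub>F t in at_top. t * exp (- (t * a / 4)) < \<epsilon> / 4"
 proof (rule order_tendstoD(2))
  show "((%t. t * exp (- (t * a / 4))) \<longlongrightarrow> 0) at_top" using a(1) by real_asymp
 qed (use e in simp)
 have e3: "\<forall>\<^sub>F t in at_top. (\<integral>\<^sup>+x\<in>{X..}. ennreal (u t) * emeasure \<mu> {v t + x * w t<..} \<partial>lborel) < ennreal (\<epsilon> / 8)"
  using order_tendstoD(2)[OF filterlim_compose[OF not_frechetD(7)[OF nf X(1)] scale_u_at_top] X(2)] by (simp add: scale_v_w[OF nf])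
 have e4: "\<forall>\<^sub>F t in at_top. R * (4 / ?m t) < \<epsilon> / 4"
 proof (rule order_tendstoD(2))
  have "((%x::real. R * (4 / x)) \<longlongrightarrow> 0) at_top" by real_asymp
  from filterlim_compose[OF this m_top] show "((%t. R * (4 / ?m t)) \<longlongrightarrow> 0) at_top" .
 qed (use e in simp)
 have e5: "\<forall>\<^sub>F t in at_top. mark t R < - real k - 1"
  using order_tendstoD(2)[OF mark_limit[OF R(1)], of "- real k - 1"] R(2) by simp
 have e6: "\<forall>\<^sub>F t in at_top. - C < mark t R"
  using order_tendstoD(1)[OF mark_limit[OF R(1)], of "- C"] by (simp add: C_def)
 have small: "\<forall>\<^sub>F t in at_top. b * w t <= v t / d" if "0 < d" "0 <= b" for b d
 proof -
  have "((%t. b * (w t / v t)) \<longlongrightarrow> b * 0) at_top" by (intro tendsto_intros ratio_limit(1)[OF nf])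
  then have "\<forall>\<^sub>F t in at_top. b * (w t / v t) < 1 / d" by (rule order_tendstoD(2)) (use that in simp)
  then show ?thesis using eventually_gt_at_top[of 0]
  proof eventually_elim
   case (elim t)
   have "0 < v t" using a(1) a(2)[OF elim(2)] by linarith
   then show ?case using elim(1) that by (simp add: field_simps)
  qed
 qed
 have C0: "0 <= C" using R(2) by (simp add: C_def)
 have e7: "\<forall>\<^sub>F t in at_top. C * w t <= v t / 2" by (rule small) (use C0 in auto)
 have e8: "\<forall>\<^sub>F t in at_top. real k * w t <= v t / 4" by (rule small) auto
 have e9: "\<forall>\<^sub>F t in at_top. R < u t" using scale_u_at_top by (simp add: filterlim_at_top_dense)
 have "\<forall>\<^sub>F t in at_top.
  (\<integral>\<^sup>+s. \<integral>\<^sup>+r. indicator (window t - {0..real n} \<times> {0..real n}) (s, r) * exceed_prob k t s r \<partial>lborel \<partial>lborel) <= ennreal \<epsilon>"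
  using e1 e2 e3 e4 e5 e6 e7 e8 e9 eventually_scales_pos
 proof eventually_elim
  case (elim t)
  then have pos: "0 < t" "0 < u t" "0 < w t" by auto
  note av = a(2)[OF pos(1)]
  have v: "0 < v t" using a(1) av by linarith
  have m: "0 < ?m t" using pos v by simp
  let ?I = "indicator {0<..<u t} :: real => ennreal"
  let ?f1 = "%s r. ?I r * (ennreal (exp (- ?m t)) * (indicator {0..} s * ennreal (exp (- (?m t / 2 * s)))))"
  let ?f2 = "%s r. ?I r * (indicator {0..t / u t} s * ennreal (exp (- (t * a / 4))))"
  let ?f3 = "%s r. indicator {S0..} s * (?I r * indicator {s / 2 - k<..} (mark t r))"
  let ?f4 = "%s r. indicator {0<..R} r * (indicator {0..} s * ennreal (exp (- (?m t / 4 * s))))"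
  have bound: "indicator (window t - {0..real n} \<times> {0..real n}) (s, r) * exceed_prob k t s r
    <= (?f1 s r + ?f2 s r) + (?f3 s r + ?f4 s r)" for s r
  proof (cases "(s, r) \<in> window t - {0..real n} \<times> {0..real n}")
   case True
   then have win: "(s, r) \<in> window t" by simp
   have out: "R < r \<or> S0 <= s" using True n by (auto simp: window_def)
   have "exceed_prob k t s r <= ennreal (exp (- (u t * v t)) * exp (- (u t * v t / 2 * s))) + ennreal (exp (- (t * a / 4)))
    + (indicator {s / 2 - k<..} (mark t r) * indicator {S0..} s + indicator {0<..R} r * ennreal (exp (- (u t * v t / 4 * s))))"
    by (rule exceed_prob_bound[OF nf pos a(1) av R(1) _ _ _ _ _ win out]) (use elim X in \<open>auto simp: S0_def\<close>)
   also have "... = (?f1 s r + ?f2 s r) + (?f3 s r + ?f4 s r)"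
    using win by (simp add: window_def ennreal_mult[symmetric] mult.commute)
   finally show ?thesis using True by simp
  qed simp
  have "(\<integral>\<^sup>+s. \<integral>\<^sup>+r. indicator (window t - {0..real n} \<times> {0..real n}) (s, r) * exceed_prob k t s r \<partial>lborel \<partial>lborel)
    <= (\<integral>\<^sup>+s. \<integral>\<^sup>+r. (?f1 s r + ?f2 s r) + (?f3 s r + ?f4 s r) \<partial>lborel \<partial>lborel)"
   by (intro nn_integral_mono bound)
  also have "... = ((\<integral>\<^sup>+s. \<integral>\<^sup>+r. ?f1 s r \<partial>lborel \<partial>lborel) + (\<integral>\<^sup>+s. \<integral>\<^sup>+r. ?f2 s r \<partial>lborel \<partial>lborel))
    + ((\<integral>\<^sup>+s. \<integral>\<^sup>+r. ?f3 s r \<partial>lborel \<partial>lborel) + (\<integral>\<^sup>+s. \<integral>\<^sup>+r. ?f4 s r \<partial>lborel \<partial>lborel))"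
  proof (rule nn_integral_pair_add4)
   have [measurable]: "(%z. mark t (snd z)) \<in> borel_measurable borel2" by (rule measurable_compose[OF measurable_snd measurable_mark])
   show "(%(s, r). ?f1 s r) \<in> borel_measurable borel2" by measurable
   show "(%(s, r). ?f2 s r) \<in> borel_measurable borel2" by measurable
   show "(%(s, r). ?f4 s r) \<in> borel_measurable borel2" by measurable
   have "(%(s, r). ?f3 s r) = (%z. indicator {S0..} (fst z) * (?I (snd z) * indicator {z. fst z / 2 - k < mark t (snd z)} z))"
    by (auto simp: indicator_def fun_eq_iff)
   also have "... \<in> borel_measurable borel2" by measurable
   finally show "(%(s, r). ?f3 s r) \<in> borel_measurable borel2" .
  qed
  also have "(\<integral>\<^sup>+s. \<integral>\<^sup>+r. ?f1 s r \<partial>lborel \<partial>lborel) <= ennreal (\<epsilon> / 4)"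
  proof -
   have "(\<integral>\<^sup>+s. \<integral>\<^sup>+r. ?f1 s r \<partial>lborel \<partial>lborel)
     = (\<integral>\<^sup>+s. ennreal (u t) * ennreal (exp (- ?m t)) * (indicator {0..} s * ennreal (exp (- (?m t / 2 * s)))) \<partial>lborel)"
    using pos by (intro nn_integral_cong) (simp add: nn_integral_multc mult.assoc)
   also have "... = ennreal (u t) * ennreal (exp (- ?m t)) * ennreal (1 / (?m t / 2))"
   proof (subst nn_integral_cmult)
    show "(%s. indicator {0..} s * ennreal (exp (- (?m t / 2 * s)))) \<in> borel_measurable lborel" by measurable
   qed (use m in \<open>simp only: nn_integral_exp_decay half_gt_zero_iff\<close>)
   also have "... = ennreal (2 / v t * exp (- ?m t))"
    using pos v by (simp add: ennreal_mult[symmetric] field_simps)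
   also have "... <= ennreal (2 / a * exp (- ?m t))"
    using a(1) av v by (intro ennreal_leI mult_right_mono divide_left_mono) auto
   also have "... <= ennreal (\<epsilon> / 4)" using elim(1) by (intro ennreal_leI) simp
   finally show ?thesis .
  qed
  also have "(\<integral>\<^sup>+s. \<integral>\<^sup>+r. ?f2 s r \<partial>lborel \<partial>lborel) <= ennreal (\<epsilon> / 4)"
  proof -
   have "(\<integral>\<^sup>+s. \<integral>\<^sup>+r. ?f2 s r \<partial>lborel \<partial>lborel)
     = (\<integral>\<^sup>+s. ennreal (u t) * ennreal (exp (- (t * a / 4))) * indicator {0..t / u t} s \<partial>lborel)"
    using pos by (intro nn_integral_cong) (subst nn_integral_multc, simp, simp add: mult_ac)
   also have "... = ennreal (u t) * ennreal (exp (- (t * a / 4))) * ennreal (t / u t)"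
    using pos by (subst nn_integral_cmult) auto
   also have "... = ennreal (t * exp (- (t * a / 4)))"
    using pos by (simp add: ennreal_mult[symmetric] field_simps)
   also have "... <= ennreal (\<epsilon> / 4)" using elim(2) by (intro ennreal_leI) simp
   finally show ?thesis .
  qed
  also have "(\<integral>\<^sup>+s. \<integral>\<^sup>+r. ?f3 s r \<partial>lborel \<partial>lborel) <= ennreal (\<epsilon> / 4)"
  proof -
   let ?g = "%x. ennreal (u t) * emeasure \<mu> {v t + x * w t<..}"
   have gm: "?g \<in> borel_measurable borel"
   proof -
    have [measurable]: "(%z. mark t (snd z)) \<in> borel_measurable (borel \<Otimes>\<^sub>M lborel)"
     by (rule measurable_compose[OF measurable_snd]) (simp add: measurable_mark)
    have "(%(x, r). ?I r * indicator {x<..} (mark t r)) = (%z. ?I (snd z) * indicator {z. fst z < mark t (snd z)} z)"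
     by (auto simp: indicator_def fun_eq_iff)
    also have "... \<in> borel_measurable (borel \<Otimes>\<^sub>M lborel)" by measurable
    finally have "(%x. \<integral>\<^sup>+r. ?I r * indicator {x<..} (mark t r) \<partial>lborel) \<in> borel_measurable borel"
     by (rule lborel.borel_measurable_nn_integral)
    then show ?thesis by (simp only: emeasure_mark_gt[OF pos(2,3)])
   qed
   have "(\<integral>\<^sup>+s. \<integral>\<^sup>+r. ?f3 s r \<partial>lborel \<partial>lborel) = (\<integral>\<^sup>+s. indicator {S0..} s * ?g (s / 2 - k) \<partial>lborel)"
    by (intro nn_integral_cong) (subst nn_integral_cmult, measurable, simp only: emeasure_mark_gt[OF pos(2,3)])
   \<comment> \<open>After \<open>s = 2 * k + 2 * x\<close> the condition \<open>S0 <= s\<close>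
     becomes a lower bound on \<open>x\<close> that implies \<open>X <= x\<close>.\<close>
   also have "... = 2 * (\<integral>\<^sup>+x. indicator {S0..} (2 * real k + 2 * x) * ?g ((2 * real k + 2 * x) / 2 - k) \<partial>lborel)"
    using gm by (subst nn_integral_real_affine[of _ 2 "2 * real k"]) auto
   also have "... <= 2 * (\<integral>\<^sup>+x\<in>{X..}. ?g x \<partial>lborel)"
    by (intro mult_left_mono nn_integral_mono) (auto simp: indicator_def S0_def add_divide_distrib)
   also have "... <= 2 * ennreal (\<epsilon> / 8)" using elim(3) by (intro mult_left_mono) auto
   also have "... = ennreal (\<epsilon> / 4)" using e by (simp add: ennreal_mult'[symmetric] flip: ennreal_numeral)
   finally show ?thesis .
  qed
  also have "(\<integral>\<^sup>+s. \<integral>\<^sup>+r. ?f4 s r \<partial>lborel \<partial>lborel) <= ennreal (\<epsilon> / 4)"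
  proof -
   have "(\<integral>\<^sup>+s. \<integral>\<^sup>+r. ?f4 s r \<partial>lborel \<partial>lborel)
     = (\<integral>\<^sup>+s. ennreal R * (indicator {0..} s * ennreal (exp (- (?m t / 4 * s)))) \<partial>lborel)"
    using R by (intro nn_integral_cong) (simp add: nn_integral_multc)
   also have "... = ennreal R * ennreal (1 / (?m t / 4))"
   proof (subst nn_integral_cmult)
    show "(%s. indicator {0..} s * ennreal (exp (- (?m t / 4 * s)))) \<in> borel_measurable lborel" by measurable
    have "0 < ?m t / 4" using m by simp
    then show "ennreal R * (\<integral>\<^sup>+s. indicator {0..} s * ennreal (exp (- (?m t / 4 * s))) \<partial>lborel) = ennreal R * ennreal (1 / (?m t / 4))"
     by (simp only: nn_integral_exp_decay)
   qed
   also have "... = ennreal (R * (4 / ?m t))"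
    using R m by (simp add: ennreal_mult[symmetric])
   also have "... <= ennreal (\<epsilon> / 4)" using elim(4) by (intro ennreal_leI) simp
   finally show ?thesis .
  qed
  finally show ?case using e by (simp add: ennreal_plus[symmetric] add_mono del: ennreal_plus)
 qed
 then show ?thesis by blast
qed

text \<open>Time is confined to \<open>[0, 1]\<close>, so only large \<open>r\<close> can leave the
  box. Such marks lie below half the level, and the missing half costs a factor
  \<open>exp (- t)\<close> once \<open>B t >= 2 / ka\<close>, against a window of area
  \<open>t\<close>.\<close>

lemma tightness_frechet:
 assumes f: "is_frechet" and e: "0 < \<epsilon>"
 shows "\<exists>n::nat. \<forall>\<^sub>F t in at_top.
  (\<integral>\<^sup>+s. \<integral>\<^sup>+r. indicator (window t - {0..real n} \<times> {0..real n}) (s, r) * exceed_prob k t s r \<partial>lborel \<partial>lborel) <= ennreal \<epsilon>"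
proof -
 note F = frechetD[OF f]
 define ka where "ka = 1 / (real k + 1)"
 have ka: "0 < ka" by (simp add: ka_def)
 have lev: "level k = ka" using f by (simp add: level_def ka_def)
 obtain \<alpha> where c: "c = Frechet \<alpha>" using f by (cases c) auto
 have \<alpha>: "0 < \<alpha>" using ev by (simp add: ev_assumption_def c)
 obtain R where R: "0 < R" "ev_inv c R < ka / 2"
 \<comment> \<open>At this \<open>R\<close> the limit mark is a quarter of the level, safely below
   one half.\<close>
 proof (rule that[of "(ka / 4) powr (- \<alpha>)"])
  show "0 < (ka / 4) powr (- \<alpha>)" using ka by simp
  show "ev_inv c ((ka / 4) powr (- \<alpha>)) < ka / 2" using ka \<alpha> by (simp add: c ev_inv_def powr_powr)
 qed
 obtain n :: nat where n: "max R 1 <= real n" using real_arch_simple by blast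
 have e1: "\<forall>\<^sub>F t in at_top. t * exp (- t) < \<epsilon>"
 proof (rule order_tendstoD(2))
  show "((%t::real. t * exp (- t)) \<longlongrightarrow> 0) at_top" by real_asymp
 qed (use e in simp)
 have e2: "\<forall>\<^sub>F t in at_top. mark t R < ka / 2" by (rule order_tendstoD(2)[OF mark_limit[OF R(1)] R(2)])
 have e3: "\<forall>\<^sub>F t in at_top. 2 / ka <= B t" using F(4) by (simp add: filterlim_at_top)
 have "\<forall>\<^sub>F t in at_top.
  (\<integral>\<^sup>+s. \<integral>\<^sup>+r. indicator (window t - {0..real n} \<times> {0..real n}) (s, r) * exceed_prob k t s r \<partial>lborel \<partial>lborel) <= ennreal \<epsilon>"
  using e1 e2 e3 eventually_scales_pos
 proof eventually_elim
  case (elim t)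
  then have pos: "0 < t" "0 < u t" "0 < w t" by auto
  have bound: "indicator (window t - {0..real n} \<times> {0..real n}) (s, r) * exceed_prob k t s r
    <= indicator {0<..<t} r * (indicator {0..1} (s::real) * ennreal (exp (- t)))" for s r
  proof (cases "(s, r) \<in> window t - {0..real n} \<times> {0..real n}")
   case True
   then have win: "(s, r) \<in> window t" by simp
   then have s: "0 <= s" "s <= 1" "0 < r" "r < t" using pos by (auto simp: window_def F)
   have "R < r" using True n s by auto
   have W: "quant (r / u t) = mark t r * w t" using weight_eq[OF pos(3)] by (simp add: F)
   have Wpos: "0 < mark t r * w t" using window_nonneg(2)[OF pos(2) win] by (simp add: W)
   have y: "mark t r <= ka / 2"
    using mark_antimono[of t R r] R pos s \<open>R < r\<close> elim(2) by (simp add: F)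
   have "mark t r * w t * (t - s * t) <= mark t r * w t * t"
    using s pos Wpos by (intro mult_left_mono) auto
   also have "... <= ka / 2 * w t * t" using y pos by (intro mult_right_mono) auto
   finally have "mark t r * w t * (t - s * t) - ka * (t * w t) <= - (ka / 2 * w t * t)" by (simp add: algebra_simps)
   also have "... <= - t"
   proof -
    have "1 <= ka / 2 * w t" using elim(3) ka by (simp add: F field_simps)
    then have "1 * t <= ka / 2 * w t * t" using pos by (intro mult_right_mono) auto
    then show ?thesis by simp
   qed
   finally have E: "mark t r * w t * (t - s * t) - ka * (t * w t) <= - t" .
   have "exceed_prob k t s r <= ennreal (exp (quant (r / u t) * (t - s * u t) - t * v t - level k * (t * w t)))" by (rule exceed_prob_le[OF pos win])
   also have "... <= ennreal (exp (- t))"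
    unfolding W lev using E by (intro ennreal_leI) (simp add: F)
   finally show ?thesis using True s by simp
  qed simp
  have "(\<integral>\<^sup>+s. \<integral>\<^sup>+r. indicator (window t - {0..real n} \<times> {0..real n}) (s, r) * exceed_prob k t s r \<partial>lborel \<partial>lborel)
    <= (\<integral>\<^sup>+s. \<integral>\<^sup>+r. indicator {0<..<t} r * (indicator {0..1} (s::real) * ennreal (exp (- t))) \<partial>lborel \<partial>lborel)"
   by (intro nn_integral_mono bound)
  also have "... = (\<integral>\<^sup>+s. ennreal t * ennreal (exp (- t)) * indicator {0..1} (s::real) \<partial>lborel)"
   using pos by (intro nn_integral_cong) (subst nn_integral_multc, simp, simp add: mult_ac)
  also have "... = ennreal (t * exp (- t))"
   using pos by (subst nn_integral_cmult) (auto simp: ennreal_mult)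
  also have "... <= ennreal \<epsilon>" using elim(1) by (intro ennreal_leI) simp
  finally show ?case .
 qed
 then show ?thesis by blast
qed

lemmas tightness = tightness_frechet tightness_not_frechet

end

section \<open>A marked Poisson process in the quadrant\<close>

type_synonym mark_point = "real \<times> real \<times> (rat => nat)"

definition plane_space :: "mark_point measure" where
 "plane_space = borel \<Otimes>\<^sub>M borel \<Otimes>\<^sub>M path_space"

definition plane_int :: "real => (real \<times> real) set => mark_point measure" where
 "plane_int th D = density (lborel \<Otimes>\<^sub>M lborel \<Otimes>\<^sub>M ylaw) (%z. ennreal th * indicator D (fst z, fst (snd z)))"

definition unit_marks :: "(real \<times> (rat => nat)) measure" where
 "unit_marks = density lborel (indicator {0..<1}) \<Otimes>\<^sub>M ylaw"

text \<open>The half-strip \<open>[0, \<infinity>) \<times> [0, 1)\<close> is cut into unit squares, which are rearranged into a quadrant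
  along the enumeration \<open>prod_decode\<close>; the first \<open>n\<close> of them form \<open>squares n\<close>.\<close>

definition rearrange :: "real \<times> real \<times> (rat => nat) => mark_point" where
 "rearrange = (%(a, U, p). (real (fst (prod_decode (nat \<lfloor>a\<rfloor>))) + frac a, real (snd (prod_decode (nat \<lfloor>a\<rfloor>))) + U, p))"

definition squares :: "nat => (real \<times> real) set" where
 "squares n = {(s, r). 0 <= s & 0 <= r & prod_encode (nat \<lfloor>s\<rfloor>, nat \<lfloor>r\<rfloor>) < n}"

lemma sets_plane_int[simp, measurable_cong]: "sets (plane_int th D) = sets plane_space"
 unfolding plane_int_def plane_space_def sets_density by (intro sets_pair_measure_cong) simp_all

lemma space_plane_space: "space plane_space = UNIV" by (simp add: plane_space_def space_pair_measure space_path_space)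

lemma space_plane_int[simp]: "space (plane_int th D) = UNIV"
 using sets_eq_imp_space_eq[OF sets_plane_int] space_plane_space by simp

lemma prob_space_unit_uniform: "prob_space (density lborel (indicator {0..<1::real}))" by (rule prob_spaceI) (simp add: emeasure_density)

lemma prob_space_unit_marks: "prob_space unit_marks"
 unfolding unit_marks_def by (intro prob_space_pair prob_space_unit_uniform prob_space_ylaw)

lemma sets_unit_marks[simp, measurable_cong]: "sets unit_marks = sets (borel \<Otimes>\<^sub>M path_space)"
 unfolding unit_marks_def by (intro sets_pair_measure_cong) simp_all

lemma measurable_squares[measurable]: "squares n \<in> sets borel2"
proof -
 have "(%z. prod_encode (nat \<lfloor>fst z :: real\<rfloor>, nat \<lfloor>snd z :: real\<rfloor>)) \<in> measurable borel2 (count_space UNIV)"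
  by measurable
 then have "{z \<in> space borel2. 0 <= fst z & 0 <= snd z & prod_encode (nat \<lfloor>fst z :: real\<rfloor>, nat \<lfloor>snd z :: real\<rfloor>) < n} \<in> sets borel2"
  by measurable
 also have "{z \<in> space borel2. 0 <= fst z & 0 <= snd z & prod_encode (nat \<lfloor>fst z :: real\<rfloor>, nat \<lfloor>snd z :: real\<rfloor>) < n} = squares n"
  by (auto simp: squares_def space_pair_measure)
 finally show ?thesis .
qed

lemma measurable_rearrange: "rearrange \<in> measurable (borel \<Otimes>\<^sub>M unit_marks) plane_space"
proof -
 have "(%z. (real (fst (prod_decode (nat \<lfloor>fst z\<rfloor>))) + frac (fst z), real (snd (prod_decode (nat \<lfloor>fst z\<rfloor>))) + fst (snd z), snd (snd z)))
  \<in> measurable (borel \<Otimes>\<^sub>M borel \<Otimes>\<^sub>M path_space) (borel \<Otimes>\<^sub>M borel \<Otimes>\<^sub>M path_space)"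
  unfolding frac_def by measurable
 then show ?thesis
  unfolding rearrange_def plane_space_def split_beta' by (subst measurable_cong_sets[OF sets_pair_measure_cong[OF refl sets_unit_marks] refl]) simp
qed

lemma nn_integral_plane:
 assumes D[measurable]: "D \<in> sets borel2" and f: "f \<in> borel_measurable plane_space"
 shows "(\<integral>\<^sup>+z. f z \<partial>plane_int th D)
    = (\<integral>\<^sup>+s. \<integral>\<^sup>+r. ennreal th * indicator D (s, r) * (\<integral>\<^sup>+p. f (s, r, p) \<partial>ylaw) \<partial>lborel \<partial>lborel)"
proof -
 interpret Y: prob_space ylaw by (rule prob_space_ylaw)
 interpret LY: pair_sigma_finite lborel ylaw ..
 have f'[measurable]: "f \<in> borel_measurable (lborel \<Otimes>\<^sub>M lborel \<Otimes>\<^sub>M ylaw)"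
  using f by (subst measurable_cong_sets[OF sets_pair_measure_cong[OF _ sets_pair_measure_cong[OF _ sets_ylaw]] refl, of _ borel _ borel])
    (simp_all add: plane_space_def)
 have [measurable]: "(%z. (fst z, fst (snd z))) \<in> measurable (lborel \<Otimes>\<^sub>M lborel \<Otimes>\<^sub>M ylaw) borel2" by measurable
 let ?g = "%z. ennreal th * indicator D (fst z, fst (snd z)) * f z"
 have g: "?g \<in> borel_measurable (lborel \<Otimes>\<^sub>M lborel \<Otimes>\<^sub>M ylaw)" by measurable
 have gs: "(%z. ?g (s, z)) \<in> borel_measurable (lborel \<Otimes>\<^sub>M ylaw)" for s by (rule measurable_compose[OF measurable_Pair1' g]) simp
 have gsr: "(%p. f (s, r, p)) \<in> borel_measurable ylaw" for s r
  by (rule measurable_compose[OF measurable_Pair1' measurable_compose[OF measurable_Pair1' f']]) simp_all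
 have "(\<integral>\<^sup>+z. f z \<partial>plane_int th D) = (\<integral>\<^sup>+z. ?g z \<partial>(lborel \<Otimes>\<^sub>M lborel \<Otimes>\<^sub>M ylaw))"
  unfolding plane_int_def by (rule nn_integral_density) measurable
 also have "... = (\<integral>\<^sup>+s. \<integral>\<^sup>+z. ?g (s, z) \<partial>(lborel \<Otimes>\<^sub>M ylaw) \<partial>lborel)"
  by (rule LY.P.nn_integral_fst[OF g, symmetric])
 also have "... = (\<integral>\<^sup>+s. \<integral>\<^sup>+r. \<integral>\<^sup>+p. ?g (s, r, p) \<partial>ylaw \<partial>lborel \<partial>lborel)"
  by (intro nn_integral_cong Y.nn_integral_fst[OF gs, symmetric])
 also have "... = (\<integral>\<^sup>+s. \<integral>\<^sup>+r. ennreal th * indicator D (s, r) * (\<integral>\<^sup>+p. f (s, r, p) \<partial>ylaw) \<partial>lborel \<partial>lborel)"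
  using gsr by (intro nn_integral_cong) (simp add: nn_integral_cmult)
 finally show ?thesis .
qed

lemma nn_integral_plane_section:
 assumes X: "X \<in> sets plane_space"
 shows "(\<integral>\<^sup>+p. indicator X (s, r, p) \<partial>ylaw) = emeasure ylaw {p. (s, r, p) \<in> X}"
proof -
 have "(%p. (s, r, p)) \<in> measurable ylaw plane_space" unfolding plane_space_def by measurable
 from measurable_sets[OF this X] have "{p. (s, r, p) \<in> X} \<in> sets ylaw" by (simp add: space_ylaw vimage_def)
 then have "(\<integral>\<^sup>+p. indicator {p. (s, r, p) \<in> X} p \<partial>ylaw) = emeasure ylaw {p. (s, r, p) \<in> X}"
  by (rule nn_integral_indicator)
 also have "(%p. indicator {p. (s, r, p) \<in> X} p) = (%p. indicator X (s, r, p) :: ennreal)" by (simp add: indicator_def fun_eq_iff)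
 finally show ?thesis .
qed

lemma measurable_plane_section:
 assumes X: "X \<in> sets plane_space"
 shows "(%(s, r). emeasure ylaw {p. (s, r, p) \<in> X}) \<in> borel_measurable borel2"
proof -
 interpret Y: prob_space ylaw by (rule prob_space_ylaw)
 have [measurable]: "(%z. (fst (fst z), snd (fst z), snd z)) \<in> measurable (borel2 \<Otimes>\<^sub>M ylaw) plane_space"
  unfolding plane_space_def by measurable
 have "(%x. emeasure ylaw (Pair x -` ((%z. (fst (fst z), snd (fst z), snd z)) -` X Int space (borel2 \<Otimes>\<^sub>M ylaw)))) \<in> borel_measurable borel2"
  by (rule Y.measurable_emeasure_Pair) (use X in measurable)
 also have "(%x. emeasure ylaw (Pair x -` ((%z. (fst (fst z), snd (fst z), snd z)) -` X Int space (borel2 \<Otimes>\<^sub>M ylaw))))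
  = (%(s, r). emeasure ylaw {p. (s, r, p) \<in> X})" by (auto simp: space_pair_measure space_ylaw fun_eq_iff intro!: arg_cong[of _ _ "emeasure ylaw"])
 finally show ?thesis .
qed

lemma emeasure_plane_space:
 assumes "D \<in> sets borel2" and X: "X \<in> sets plane_space"
 shows "emeasure (plane_int th D) X
    = (\<integral>\<^sup>+s. \<integral>\<^sup>+r. ennreal th * indicator D (s, r) * emeasure ylaw {p. (s, r, p) \<in> X} \<partial>lborel \<partial>lborel)"
proof -
 have m: "indicator X \<in> borel_measurable plane_space" using X by simp
 have "emeasure (plane_int th D) X = (\<integral>\<^sup>+z. indicator X z \<partial>plane_int th D)" using X by simp
 also have "... = (\<integral>\<^sup>+s. \<integral>\<^sup>+r. ennreal th * indicator D (s, r) * (\<integral>\<^sup>+p. indicator X (s, r, p) \<partial>ylaw) \<partial>lborel \<partial>lborel)"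
  by (rule nn_integral_plane[OF assms(1) m])
 also have "... = (\<integral>\<^sup>+s. \<integral>\<^sup>+r. ennreal th * indicator D (s, r) * emeasure ylaw {p. (s, r, p) \<in> X} \<partial>lborel \<partial>lborel)"
  by (simp only: nn_integral_plane_section[OF X])
 finally show ?thesis .
qed

lemma density_plane_int:
 assumes [measurable]: "D \<in> sets borel2" "D' \<in> sets borel2"
 shows "density (plane_int th D) (indicator {z. (fst z, fst (snd z)) \<in> D'}) = plane_int th (D Int D')"
proof -
 have [measurable]: "(%z. (fst z, fst (snd z))) \<in> measurable (lborel \<Otimes>\<^sub>M lborel \<Otimes>\<^sub>M ylaw) borel2" by measurable
 have "(%z. indicator {z. (fst z, fst (snd z)) \<in> D'} z :: ennreal) = (%z. indicator D' (fst z, fst (snd z)))" by (auto simp: indicator_def)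
 then have "density (plane_int th D) (indicator {z. (fst z, fst (snd z)) \<in> D'})
   = density (plane_int th D) (%z. indicator D' (fst z, fst (snd z)))" by (rule arg_cong)
 also have "... = density (lborel \<Otimes>\<^sub>M lborel \<Otimes>\<^sub>M ylaw) (%z. ennreal th * indicator D (fst z, fst (snd z)) * indicator D' (fst z, fst (snd z)))"
  unfolding plane_int_def by (rule density_density_eq) measurable
 also have "... = plane_int th (D Int D')"
  unfolding plane_int_def by (rule density_cong) (auto simp: indicator_def)
 finally show ?thesis .
qed

lemma indicator_squares:
 "(\<Sum>l<n. indicator {real (fst (prod_decode l))..<real (fst (prod_decode l)) + 1} s * indicator {real (snd (prod_decode l))..<real (snd (prod_decode l)) + 1} r)
  = (indicator (squares n) (s, r) :: ennreal)"
proof -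
 let ?m = "prod_encode (nat \<lfloor>s\<rfloor>, nat \<lfloor>r\<rfloor>)"
 have in_iff: "x \<in> {real i..<real i + 1} \<longleftrightarrow> 0 <= x & i = nat \<lfloor>x\<rfloor>" for x :: real and i :: nat
 proof
  assume "x \<in> {real i..<real i + 1}"
  then have "\<lfloor>x\<rfloor> = int i" "0 <= x" by (auto simp: floor_eq_iff)
  then show "0 <= x & i = nat \<lfloor>x\<rfloor>" by simp
 next
  assume "0 <= x & i = nat \<lfloor>x\<rfloor>"
  then have "int i = \<lfloor>x\<rfloor>" by simp
  then have "real i = real_of_int \<lfloor>x\<rfloor>" by (metis of_int_of_nat_eq)
  then have "real i <= x" "x < real i + 1" by linarith+
  then show "x \<in> {real i..<real i + 1}" by simp
 qed
 have "(\<Sum>l<n. indicator {real (fst (prod_decode l))..<real (fst (prod_decode l)) + 1} s * indicator {real (snd (prod_decode l))..<real (snd (prod_decode l)) + 1} r)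
   = (\<Sum>l<n. if l = ?m then (if 0 <= s & 0 <= r then 1 else 0) else (0::ennreal))"
 proof (rule sum.cong)
  fix l
  have "l = ?m \<longleftrightarrow> fst (prod_decode l) = nat \<lfloor>s\<rfloor> & snd (prod_decode l) = nat \<lfloor>r\<rfloor>"
   by (metis prod.collapse prod_decode_inverse prod_encode_inverse prod.inject)
  then show "indicator {real (fst (prod_decode l))..<real (fst (prod_decode l)) + 1} s * indicator {real (snd (prod_decode l))..<real (snd (prod_decode l)) + 1} r
   = (if l = ?m then (if 0 <= s & 0 <= r then 1 else 0) else (0::ennreal))"
   unfolding indicator_def in_iff by auto
 qed simp
 also have "... = indicator (squares n) (s, r)" by (subst sum.delta) (auto simp: squares_def)
 finally show ?thesis .
qed

text \<open>Each unit square of the half-strip is moved by a translation, which keeps Lebesgue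
  measure; the first \<open>n\<close> unit intervals of time fill \<open>squares n\<close>.\<close>

lemma distr_rearrange:
 "distr (arr_intensity th unit_marks {0..real n}) plane_space rearrange = plane_int th (squares n)" (is "?L = ?R")
proof (rule measure_eqI)
 interpret Y: prob_space ylaw by (rule prob_space_ylaw)
 fix X assume "X \<in> sets ?L"
 then have X: "X \<in> sets plane_space" by simp
 define k where "k s r = emeasure ylaw {p. (s, r, p) \<in> X}" for s r
 have k[measurable]: "(%(s, r). k s r) \<in> borel_measurable borel2"
  unfolding k_def by (rule measurable_plane_section[OF X])
 have k1[measurable]: "(%r. k s r) \<in> borel_measurable borel" for s
  using measurable_compose[OF measurable_Pair1' k, of s] by simp
 let ?i = "%l. real (fst (prod_decode l))" and ?j = "%l. real (snd (prod_decode l))"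
 let ?I = "%l s. \<integral>\<^sup>+U. indicator {0..<1} U * k s (?j l + U) \<partial>lborel"
 have re: "rearrange \<in> measurable (arr_intensity th unit_marks {0..real n}) plane_space"
  using measurable_rearrange by (simp add: measurable_cong_sets[OF sets_arr_intensity refl])
 have mX: "(%z. indicator X (rearrange z) :: ennreal) \<in> borel_measurable (borel \<Otimes>\<^sub>M unit_marks)"
  by (rule measurable_compose[OF measurable_rearrange]) (use X in simp)
 have inner: "(\<integral>\<^sup>+m. indicator X (rearrange (v, m)) \<partial>unit_marks) = ?I l (?i l + v - real l)"
  if v: "v \<in> {real l..<real l + 1}" for v l
 proof -
  have fl: "nat \<lfloor>v\<rfloor> = l" using v by (auto simp: nat_eq_iff floor_eq_iff)
  have fr: "frac v = v - real l" using v by (auto simp: frac_def floor_eq_iff) (metis fl floor_of_int of_int_of_nat_eq floor_unique)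
  have mv: "(%m. indicator X (rearrange (v, m)) :: ennreal) \<in> borel_measurable (density lborel (indicator {0..<1}) \<Otimes>\<^sub>M ylaw)"
   using measurable_compose[OF measurable_Pair1' mX, of v] by (simp add: unit_marks_def)
  have ind: "(\<integral>\<^sup>+p. indicator X (s, r, p) \<partial>ylaw) = k s r" for s r
   unfolding k_def by (rule nn_integral_plane_section[OF X])
  have "(\<integral>\<^sup>+m. indicator X (rearrange (v, m)) \<partial>unit_marks)
    = (\<integral>\<^sup>+U. \<integral>\<^sup>+p. indicator X (rearrange (v, U, p)) \<partial>ylaw \<partial>density lborel (indicator {0..<1}))"
   unfolding unit_marks_def by (rule Y.nn_integral_fst[OF mv, symmetric])
  also have "... = (\<integral>\<^sup>+U. k (?i l + v - real l) (?j l + U) \<partial>density lborel (indicator {0..<1}))"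
   by (intro nn_integral_cong) (simp add: rearrange_def fl fr ind add_diff_eq)
  also have "... = ?I l (?i l + v - real l)" by (rule nn_integral_density) measurable
  finally show ?thesis .
 qed
 have "emeasure ?L X = (\<integral>\<^sup>+z. indicator X z \<partial>?L)" using X by simp
 also have "... = (\<integral>\<^sup>+z. indicator X (rearrange z) \<partial>arr_intensity th unit_marks {0..real n})"
  by (rule nn_integral_distr[OF re]) (use X in simp)
 also have "... = (\<integral>\<^sup>+v. ennreal th * indicator {0..real n} v * (\<integral>\<^sup>+m. indicator X (rearrange (v, m)) \<partial>unit_marks) \<partial>lborel)"
  by (rule nn_integral_arr_intensity[OF prob_space_unit_marks _ mX]) simp
 also have "... = (\<integral>\<^sup>+v. (\<Sum>l<n. ennreal th * (indicator {real l..<real l + 1} v * ?I l (?i l + v - real l))) \<partial>lborel)"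
 \<comment> \<open>The closed time interval contains the end point \<open>real n\<close>, which
   belongs to the next square and is null.\<close>
 proof (rule nn_integral_cong_AE, use AE_lborel_singleton[of "real n"] in eventually_elim)
  fix v :: real assume "v ~= real n"
  show "ennreal th * indicator {0..real n} v * (\<integral>\<^sup>+m. indicator X (rearrange (v, m)) \<partial>unit_marks)
    = (\<Sum>l<n. ennreal th * (indicator {real l..<real l + 1} v * ?I l (?i l + v - real l)))"
  proof (cases "0 <= v & v < real n")
   case True
   define m where "m = nat \<lfloor>v\<rfloor>"
   have m: "v \<in> {real m..<real m + 1}" using True by (auto simp: m_def of_nat_floor)
   then have mn: "m < n" using True by auto
   have "(\<Sum>l<n. ennreal th * (indicator {real l..<real l + 1} v * ?I l (?i l + v - real l)))
     = (\<Sum>l<n. if l = m then ennreal th * ?I m (?i m + v - real m) else 0)"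
   proof (rule sum.cong)
    fix l
    have "v \<in> {real l..<real l + 1} \<longleftrightarrow> l = m"
    proof
     assume "v \<in> {real l..<real l + 1}"
     then have "real l < real (m + 1)" "real m < real (l + 1)" using m by auto
     then show "l = m" unfolding of_nat_less_iff by linarith
    qed (use m in simp)
    then show "ennreal th * (indicator {real l..<real l + 1} v * ?I l (?i l + v - real l)) = (if l = m then ennreal th * ?I m (?i m + v - real m) else 0)"
     by (simp add: indicator_def)
   qed simp
   also have "... = ennreal th * ?I m (?i m + v - real m)" using mn by (subst sum.delta) auto
   finally show ?thesis using True inner[OF m] by simp
  next
   case False
   have "indicator {real l..<real l + 1} v = (0::ennreal)" if "l < n" for l
    using False that by (auto simp: indicator_def)
   then have "(\<Sum>l<n. ennreal th * (indicator {real l..<real l + 1} v * ?I l (?i l + v - real l))) = 0" by (intro sum.neutral) simp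
   moreover have "v \<notin> {0..real n}" using False \<open>v ~= real n\<close> by auto
   then have "indicator {0..real n} v = (0::ennreal)" by (rule indicator_simps(2))
   ultimately show ?thesis by (simp only: mult_zero_left mult_zero_right)
  qed
 qed
 also have "... = (\<Sum>l<n. \<integral>\<^sup>+v. ennreal th * (indicator {real l..<real l + 1} v * ?I l (?i l + v - real l)) \<partial>lborel)"
 proof (rule nn_integral_sum)
  fix l
  have [measurable]: "(%s. ?I l s) \<in> borel_measurable borel"
  proof (rule lborel.borel_measurable_nn_integral)
   have "(%z. (fst z, ?j l + snd z)) \<in> measurable (borel \<Otimes>\<^sub>M lborel) borel2" by measurable
   from measurable_compose[OF this k]
   show "(%(s, U). indicator {0..<1} U * k s (?j l + U)) \<in> borel_measurable (borel \<Otimes>\<^sub>M lborel)" by (simp add: split_beta')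
  qed
  show "(%v. ennreal th * (indicator {real l..<real l + 1} v * ?I l (?i l + v - real l))) \<in> borel_measurable lborel" by measurable
 qed
 also have "... = (\<Sum>l<n. \<integral>\<^sup>+s. \<integral>\<^sup>+r. ennreal th * (indicator {?i l..<?i l + 1} s * indicator {?j l..<?j l + 1} r) * k s r \<partial>lborel \<partial>lborel)"
 proof (rule sum.cong)
  fix l
  have [measurable]: "(%s. ?I l s) \<in> borel_measurable borel"
  proof (rule lborel.borel_measurable_nn_integral)
   have "(%z. (fst z, ?j l + snd z)) \<in> measurable (borel \<Otimes>\<^sub>M lborel) borel2" by measurable
   from measurable_compose[OF this k]
   show "(%(s, U). indicator {0..<1} U * k s (?j l + U)) \<in> borel_measurable (borel \<Otimes>\<^sub>M lborel)" by (simp add: split_beta')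
  qed
  have "(\<integral>\<^sup>+s. \<integral>\<^sup>+r. ennreal th * (indicator {?i l..<?i l + 1} s * indicator {?j l..<?j l + 1} r) * k s r \<partial>lborel \<partial>lborel)
    = (\<integral>\<^sup>+s. ennreal th * (indicator {?i l..<?i l + 1} s * ?I l s) \<partial>lborel)"
  proof (intro nn_integral_cong)
   fix s
   have "(\<integral>\<^sup>+r. ennreal th * (indicator {?i l..<?i l + 1} s * indicator {?j l..<?j l + 1} r) * k s r \<partial>lborel)
     = (\<integral>\<^sup>+r. ennreal th * indicator {?i l..<?i l + 1} s * (indicator {?j l..<?j l + 1} r * k s r) \<partial>lborel)"
    by (simp add: mult_ac)
   also have "... = ennreal th * indicator {?i l..<?i l + 1} s * (\<integral>\<^sup>+r. indicator {?j l..<?j l + 1} r * k s r \<partial>lborel)"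
    by (rule nn_integral_cmult) measurable
   also have "(\<integral>\<^sup>+r. indicator {?j l..<?j l + 1} r * k s r \<partial>lborel) = (\<integral>\<^sup>+U. indicator {?j l..<?j l + 1} (?j l + 1 * U) * k s (?j l + 1 * U) \<partial>lborel)"
    by (subst nn_integral_real_affine[of _ 1 "?j l"]) auto
   also have "... = ?I l s" by (intro nn_integral_cong) (auto simp: indicator_def)
   finally show "(\<integral>\<^sup>+r. ennreal th * (indicator {?i l..<?i l + 1} s * indicator {?j l..<?j l + 1} r) * k s r \<partial>lborel)
    = ennreal th * (indicator {?i l..<?i l + 1} s * ?I l s)" by (simp add: mult.assoc)
  qed
  also have "... = (\<integral>\<^sup>+v. ennreal th * (indicator {?i l..<?i l + 1} (?i l - real l + 1 * v) * ?I l (?i l - real l + 1 * v)) \<partial>lborel)"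
   by (subst nn_integral_real_affine[of _ 1 "?i l - real l"]) auto
  also have "... = (\<integral>\<^sup>+v. ennreal th * (indicator {real l..<real l + 1} v * ?I l (?i l + v - real l)) \<partial>lborel)"
   by (intro nn_integral_cong) (auto simp: indicator_def algebra_simps)
  finally show "(\<integral>\<^sup>+v. ennreal th * (indicator {real l..<real l + 1} v * ?I l (?i l + v - real l)) \<partial>lborel)
   = (\<integral>\<^sup>+s. \<integral>\<^sup>+r. ennreal th * (indicator {?i l..<?i l + 1} s * indicator {?j l..<?j l + 1} r) * k s r \<partial>lborel \<partial>lborel)" ..
 qed simp
 also have "... = (\<integral>\<^sup>+s. \<integral>\<^sup>+r. ennreal th * indicator (squares n) (s, r) * k s r \<partial>lborel \<partial>lborel)"
 proof -
  let ?h = "%l s r. ennreal th * (indicator {?i l..<?i l + 1} s * indicator {?j l..<?j l + 1} r) * k s r"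
  have hm: "(%(s, r). ?h l s r) \<in> borel_measurable (borel \<Otimes>\<^sub>M lborel)" for l
   using k by (simp add: split_beta')
  have hr: "?h l s \<in> borel_measurable lborel" for l s by measurable
  have "(\<Sum>l<n. \<integral>\<^sup>+s. \<integral>\<^sup>+r. ?h l s r \<partial>lborel \<partial>lborel) = (\<integral>\<^sup>+s. (\<Sum>l<n. \<integral>\<^sup>+r. ?h l s r \<partial>lborel) \<partial>lborel)"
   by (rule nn_integral_sum[symmetric]) (use lborel.borel_measurable_nn_integral[OF hm] in simp)
  also have "... = (\<integral>\<^sup>+s. \<integral>\<^sup>+r. (\<Sum>l<n. ?h l s r) \<partial>lborel \<partial>lborel)"
   by (intro nn_integral_cong nn_integral_sum[symmetric] hr)
  also have "... = (\<integral>\<^sup>+s. \<integral>\<^sup>+r. ennreal th * indicator (squares n) (s, r) * k s r \<partial>lborel \<partial>lborel)"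
   by (simp only: sum_distrib_left[symmetric] sum_distrib_right[symmetric] indicator_squares)
  finally show ?thesis .
 qed
 also have "... = emeasure ?R X" unfolding k_def by (rule emeasure_plane_space[OF measurable_squares X, symmetric])
 finally show "emeasure ?L X = emeasure ?R X" .
qed simp

section \<open>Poisson point processes from count probabilities\<close>

text \<open>With infinite mean every finite count has probability 0.\<close>

definition poisson_mass :: "ennreal => nat => real" where
 "poisson_mass m k = (if m = \<infinity> then 0 else enn2real m ^ k / fact k * exp (- enn2real m))"

lemma poisson_mass_sums: "m ~= \<infinity> ==> poisson_mass m sums 1"
proof -
 assume m: "m ~= \<infinity>"
 have "(%k. enn2real m ^ k /\<^sub>R fact k) sums exp (enn2real m)" by (rule exp_converges)
 from sums_mult2[OF this, of "exp (- enn2real m)"]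
 have "(%k. enn2real m ^ k / fact k * exp (- enn2real m)) sums 1" by (simp add: exp_minus_inverse divide_inverse mult_ac)
 then show ?thesis using m by (simp add: poisson_mass_def[abs_def])
qed

text \<open>Means that grow to infinity are included, because \<open>x ^ k * exp (- x)\<close>
  vanishes at infinity.\<close>

lemma tendsto_poisson_mass:
 assumes f: "f \<longlonglongrightarrow> m" and fin: "!!n. f n ~= (\<infinity>::ennreal)"
 shows "(%n. poisson_mass (f n) k) \<longlonglongrightarrow> poisson_mass m k"
proof (cases "m = \<infinity>")
 case False
 then have "f \<longlonglongrightarrow> ennreal (enn2real m)" using f by (simp add: less_top)
 then have "(%n. enn2real (f n)) \<longlonglongrightarrow> enn2real m" by (rule tendsto_enn2real) simp
 then have "(%n. enn2real (f n) ^ k / fact k * exp (- enn2real (f n))) \<longlonglongrightarrow> enn2real m ^ k / fact k * exp (- enn2real m)"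
  by (intro tendsto_mult tendsto_divide tendsto_power tendsto_exp tendsto_minus tendsto_const) simp_all
 then show ?thesis using False fin by (simp add: poisson_mass_def)
next
 case True
 have "filterlim (%n. enn2real (f n)) at_top sequentially"
  unfolding filterlim_at_top_gt[where c=0]
 proof (intro allI impI)
  fix b :: real assume b: "0 < b"
  have "\<forall>\<^sub>F n in sequentially. ennreal b < f n" by (rule order_tendstoD(1)[OF f]) (simp add: True)
  then show "\<forall>\<^sub>F n in sequentially. b <= enn2real (f n)"
  proof eventually_elim
   case (elim n)
   have "ennreal (enn2real (f n)) = f n" using fin[of n] by (simp add: less_top)
   then show ?case using elim b by (metis ennreal_less_iff less_imp_le)
  qed
 qed
 from filterlim_compose[OF tendsto_power_div_exp_0 this]
 have "(%n. enn2real (f n) ^ k / exp (enn2real (f n))) \<longlonglongrightarrow> 0" .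
 from tendsto_divide[OF this tendsto_const, of "fact k"]
 have "(%n. enn2real (f n) ^ k / fact k * exp (- enn2real (f n))) \<longlonglongrightarrow> 0" by (simp add: exp_minus divide_inverse mult_ac)
 then show ?thesis using True fin by (simp add: poisson_mass_def)
qed

lemma vimage_countable_values:
 assumes X: "!!om. om \<in> \<Omega> ==> X om \<in> insert \<infinity> (range of_nat)"
 shows "X -` A Int \<Omega> = (\<Union>k\<in>{k. of_nat k \<in> A}. {om \<in> \<Omega>. X om = (of_nat k :: ennreal)})
   Un (if \<infinity> \<in> A then \<Omega> - (\<Union>k. {om \<in> \<Omega>. X om = of_nat k}) else {})"
 using X by (auto split: if_splits) (metis insert_iff rangeE)+

text \<open>Joint probabilities of finite counts on disjoint sets suffice: the events of a fixed
  finite count generate the sigma-algebra of a count, the infinite value being the complement of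
  countably many of them.\<close>

lemma poisson_point_processI:
 assumes "prob_space M" and radon: "!!om. om \<in> space M ==> N om \<in> radon_measures S"
  and vals: "!!om B. om \<in> space M ==> B \<in> sets (restrict_space borel S) ==> emeasure (N om) B \<in> insert \<infinity> (range of_nat)"
  and meas: "!!B k. B \<in> sets (restrict_space borel S) ==> {om \<in> space M. emeasure (N om) B = of_nat k} \<in> sets M"
  and law: "!!(I::nat set) B k. finite I ==> (!!i. i \<in> I ==> B i \<in> sets (restrict_space borel S)) ==> disjoint_family_on B I ==>
    measure M {om \<in> space M. \<forall>i\<in>I. emeasure (N om) (B i) = of_nat (k i)} = (\<Prod>i\<in>I. poisson_mass (emeasure \<zeta> (B i)) (k i))"
 shows "poisson_point_process M S \<zeta> N"
proof -
 interpret prob_space M by fact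
 have law1: "measure M {om \<in> space M. emeasure (N om) B = of_nat k} = poisson_mass (emeasure \<zeta> B) k"
  if "B \<in> sets (restrict_space borel S)" for B k
  using law[of "{0}" "%_. B" "%_. k"] that by (simp add: disjoint_family_on_def)
 have borel: "(%om. emeasure (N om) B) \<in> borel_measurable M" if B: "B \<in> sets (restrict_space borel S)" for B
 proof (rule measurableI)
  fix A :: "ennreal set"
  show "(%om. emeasure (N om) B) -` A Int space M \<in> sets M" by (subst vimage_countable_values) (use vals B meas[OF B] in auto)
 qed simp
 \<comment> \<open>Every finite count has probability 0, so only the infinite value remains.\<close>
 have inf: "AE om in M. emeasure (N om) B = \<infinity>" if B: "B \<in> sets (restrict_space borel S)" and i: "emeasure \<zeta> B = \<infinity>" for B
 proof -
  have "AE om in M. emeasure (N om) B ~= of_nat k" for k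
  proof -
   have "{om \<in> space M. emeasure (N om) B = of_nat k} \<in> null_sets M"
    using law1[OF B, of k] meas[OF B] i by (auto simp: null_sets_def emeasure_eq_measure poisson_mass_def)
   then have "AE om in M. om \<notin> {om \<in> space M. emeasure (N om) B = of_nat k}" by (rule AE_not_in)
   with AE_space show ?thesis by eventually_elim simp
  qed
  then have "AE om in M. ALL k. emeasure (N om) B ~= of_nat k" by (simp add: AE_all_countable)
  with AE_space show ?thesis
  proof eventually_elim
   case (elim om)
   then show ?case using vals[OF elim(1) B] by auto
  qed
 qed
 have indep: "indep_vars (%_. borel) (%i om. emeasure (N om) (B i)) {..<n}"
  if B: "!!i. i < n ==> B i \<in> sets (restrict_space borel S)" and d: "disjoint_family_on B {..<n}" for n :: nat and B
 proof -
  \<comment> \<open>Two different counts exclude each other, so adding the empty set makes the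
    generator stable under intersections.\<close>
  define F where "F i = insert {} (range (%k. {om \<in> space M. emeasure (N om) (B i) = of_nat k}))" for i
  have "indep_sets F {..<n}"
   unfolding indep_sets_def
  proof (intro conjI ballI allI impI)
   show "F i <= events" if "i \<in> {..<n}" for i using meas[OF B] that by (auto simp: F_def)
   fix J A assume J: "J <= {..<n}" "J ~= {}" "finite J" and A: "A \<in> Pi J F"
   show "prob (\<Inter>j\<in>J. A j) = (\<Prod>j\<in>J. prob (A j))"
   proof (cases "\<exists>j\<in>J. A j = {}")
    case True
    then have "(\<Inter>j\<in>J. A j) = {}" by auto
    moreover have "(\<Prod>j\<in>J. prob (A j)) = 0" using True by (intro prod_zero[OF J(3)]) (metis measure_empty)
    ultimately show ?thesis by simp
   next
    case False
    have "\<forall>j\<in>J. EX k. A j = {om \<in> space M. emeasure (N om) (B j) = of_nat k}"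
     using A False unfolding F_def Pi_def by blast
    then obtain k where k: "!!j. j \<in> J ==> A j = {om \<in> space M. emeasure (N om) (B j) = of_nat (k j)}" by metis
    have "(\<Inter>j\<in>J. A j) = {om \<in> space M. \<forall>j\<in>J. emeasure (N om) (B j) = of_nat (k j)}"
     using k J(2) by auto
    moreover have "prob {om \<in> space M. \<forall>j\<in>J. emeasure (N om) (B j) = of_nat (k j)} = (\<Prod>j\<in>J. poisson_mass (emeasure \<zeta> (B j)) (k j))"
     by (rule law[OF J(3)]) (use J(1) B d in \<open>auto intro: disjoint_family_on_mono\<close>)
    moreover have "(\<Prod>j\<in>J. prob (A j)) = (\<Prod>j\<in>J. poisson_mass (emeasure \<zeta> (B j)) (k j))"
     by (rule prod.cong) (use k J(1) B in \<open>auto simp: law1\<close>)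
    ultimately show ?thesis by simp
   qed
  qed
  moreover have "Int_stable (F i)" if "i \<in> {..<n}" for i
  proof (rule Int_stableI)
   fix a b assume "a \<in> F i" "b \<in> F i"
   then consider "a = {} \<or> b = {}" | k l where "a = {om \<in> space M. emeasure (N om) (B i) = of_nat k}" "b = {om \<in> space M. emeasure (N om) (B i) = of_nat l}"
    unfolding F_def by blast
   then show "a Int b \<in> F i"
   proof cases
    case 1
    then show ?thesis unfolding F_def by auto
   next
    case (2 k l)
    then have "a Int b = (if k = l then a else {})" by auto
    then show ?thesis using \<open>a \<in> F i\<close> unfolding F_def by auto
   qed
  qed
  ultimately have ind: "indep_sets (%i. sigma_sets (space M) (F i)) {..<n}" by (rule indep_sets_sigma)
  show ?thesis
   unfolding indep_vars_def2
  proof (intro conjI ballI)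
   show "random_variable borel (%om. emeasure (N om) (B i))" if "i \<in> {..<n}" for i
    using borel B that by simp
   show "indep_sets (%i. {(%om. emeasure (N om) (B i)) -` A Int space M |A. A \<in> sets borel}) {..<n}"
   proof (rule indep_sets_mono_sets[OF ind], safe)
    fix i and A :: "ennreal set" assume i: "i < n"
    interpret s: sigma_algebra "space M" "sigma_sets (space M) (F i)" by (rule sigma_algebra_sigma_sets) (auto simp: F_def)
    have k: "{om \<in> space M. emeasure (N om) (B i) = of_nat k} \<in> sigma_sets (space M) (F i)" for k by (rule sigma_sets.Basic) (simp add: F_def)
    show "(%om. emeasure (N om) (B i)) -` A Int space M \<in> sigma_sets (space M) (F i)"
    proof (subst vimage_countable_values)
     show "emeasure (N om) (B i) \<in> insert \<infinity> (range of_nat)" if "om \<in> space M" for om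
      using that B[OF i] by (rule vals)
     have all: "(\<Union>k. {om \<in> space M. emeasure (N om) (B i) = of_nat k}) \<in> sigma_sets (space M) (F i)"
      using k by (intro s.countable_UN) auto
     have "(\<Union>k\<in>{k. of_nat k \<in> A}. {om \<in> space M. emeasure (N om) (B i) = of_nat k}) \<in> sigma_sets (space M) (F i)"
      using k by (intro s.countable_UN'') auto
     then show "(\<Union>k\<in>{k. of_nat k \<in> A}. {om \<in> space M. emeasure (N om) (B i) = of_nat k}) \<union>
      (if \<infinity> \<in> A then space M - (\<Union>k. {om \<in> space M. emeasure (N om) (B i) = of_nat k}) else {}) \<in> sigma_sets (space M) (F i)"
      using all by (intro s.Un) auto
    qed
   qed
  qed
 qed
 show ?thesis
  unfolding poisson_point_process_def
 proof (intro conjI ballI allI impI)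
  show "prob_space M" by fact
  show "N om \<in> radon_measures S" if "om \<in> space M" for om using radon that .
  show "(%om. emeasure (N om) B) \<in> borel_measurable M" if "B \<in> sets (restrict_space borel S)" for B using borel that .
  show "if emeasure \<zeta> B = \<infinity> then AE om in M. emeasure (N om) B = \<infinity>
    else \<forall>k::nat. measure M {om \<in> space M. emeasure (N om) B = of_nat k} = measure \<zeta> B ^ k / fact k * exp (- measure \<zeta> B)"
   if B: "B \<in> sets (restrict_space borel S)" for B
   using inf[OF B] law1[OF B] by (auto simp: poisson_mass_def measure_def)
  show "prob_space.indep_vars M (%_. borel) (%i om. emeasure (N om) (B i)) {..<n}"
   if "(\<forall>i<n. B i \<in> sets (restrict_space borel S)) & disjoint_family_on B {..<n}" for n :: nat and B by (rule indep) (use that in auto)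
 qed
qed

section \<open>Counting the points of the quadrant process\<close>

definition arrival_time :: "(nat => real \<times> 'm) => nat => real" where
 "arrival_time om i = (\<Sum>j\<le>i. fst (om j))"

definition ppt :: "(nat => real \<times> real \<times> (rat => nat)) => nat => mark_point" where
 "ppt om i = rearrange (arrival_time om i, snd (om i))"

definition plane_prob :: "real => (nat => real \<times> real \<times> (rat => nat)) measure" where
 "plane_prob th = (\<Pi>\<^sub>M i\<in>UNIV. exp_marked th unit_marks)"

definition cyl :: "(real \<times> real) set => mark_point set" where
 "cyl D = {z. (fst z, fst (snd z)) \<in> D}"

text \<open>A series of indicators, so that measurability in \<open>om\<close> is immediate.\<close>

definition point_count :: "(nat => real \<times> real \<times> (rat => nat)) => mark_point set => ennreal" where
 "point_count om B = (\<Sum>i. indicator B (ppt om i))"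

lemma point_count_eq: "point_count om B = emeasure (count_space UNIV) {i. ppt om i \<in> B}"
proof -
 have "point_count om B = (\<integral>\<^sup>+i. indicator {i. ppt om i \<in> B} i \<partial>count_space UNIV)"
  unfolding point_count_def nn_integral_count_space_nat by (rule suminf_cong) (simp add: indicator_def)
 then show ?thesis by simp
qed

lemma point_count_values: "point_count om B \<in> insert \<infinity> (range of_nat)"
 unfolding point_count_eq by (cases "finite {i. ppt om i \<in> B}") (auto simp: emeasure_count_space_finite)

lemma finite_points: "point_count om B = of_nat k ==> finite {i. ppt om i \<in> B}"
 unfolding point_count_eq by (rule ccontr) simp

lemma measurable_cyl[measurable]: "D \<in> sets borel2 ==> cyl D \<in> sets plane_space"
proof -
 assume D: "D \<in> sets borel2"
 have "(%z. (fst z, fst (snd z))) \<in> measurable plane_space borel2" unfolding plane_space_def by measurable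
 from measurable_sets[OF this D] show ?thesis by (simp add: cyl_def vimage_def space_plane_space)
qed

lemma UN_squares: "(\<Union>n. squares n) = {0..} \<times> {0..}"
proof (intro set_eqI iffI)
 fix z assume "z \<in> ({0..} \<times> {0..} :: (real \<times> real) set)"
 then show "z \<in> (\<Union>n. squares n)"
  by (cases z) (auto simp: squares_def intro!: exI[of _ "Suc (prod_encode (nat \<lfloor>fst z\<rfloor>, nat \<lfloor>snd z\<rfloor>))"])
qed (auto simp: squares_def)

lemma squares_mono: "m <= n ==> squares m <= squares n" by (auto simp: squares_def)

lemma emeasure_plane_int_restrict:
 assumes "D \<in> sets borel2" "D' \<in> sets borel2" "B \<in> sets plane_space"
 shows "emeasure (plane_int th D) (B Int cyl D') = emeasure (plane_int th (D Int D')) B"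
 unfolding density_plane_int[OF assms(1,2), symmetric] cyl_def[symmetric]
 by (subst emeasure_restricted) (use assms(2,3) in \<open>auto simp: Int_commute\<close>)

lemma finite_plane_int: "finite_measure (plane_int th (squares n))"
proof (rule finite_measureI)
 have re: "rearrange \<in> measurable (arr_intensity th unit_marks {0..real n}) plane_space"
  using measurable_rearrange by (simp add: measurable_cong_sets[OF sets_arr_intensity refl])
 have "emeasure (plane_int th (squares n)) (space (plane_int th (squares n)))
   = emeasure (arr_intensity th unit_marks {0..real n}) (space (arr_intensity th unit_marks {0..real n}))"
  unfolding distr_rearrange[symmetric] by (subst emeasure_distr[OF re]) (use sets.top[of plane_space] in \<open>auto simp: space_plane_space\<close>)
 also have "... < \<infinity>" by (subst emeasure_arr_intensity_space[OF prob_space_unit_marks]) (auto simp: ennreal_mult_less_top)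
 finally show "emeasure (plane_int th (squares n)) (space (plane_int th (squares n))) ~= \<infinity>" by simp
qed

abbreviation "qplane \<equiv> ({0..} \<times> {0..} :: (real \<times> real) set)"

lemma measurable_qplane[measurable]: "qplane \<in> sets borel2"
 unfolding UN_squares[symmetric] by (intro sets.countable_UN) auto

lemma tendsto_plane_int:
 assumes B: "B \<in> sets plane_space"
 shows "(%n. emeasure (plane_int th (squares n)) B) \<longlonglongrightarrow> emeasure (plane_int th qplane) B"
proof -
 let ?q = "plane_int th qplane"
 have eq: "emeasure ?q (B Int cyl (squares n)) = emeasure (plane_int th (squares n)) B" for n
 proof -
  have "qplane Int squares n = squares n" by (auto simp: squares_def)
  then show ?thesis using emeasure_plane_int_restrict[OF measurable_qplane measurable_squares B] by simp
 qed
 have "(%n. emeasure ?q (B Int cyl (squares n))) \<longlonglongrightarrow> emeasure ?q (\<Union>n. B Int cyl (squares n))"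
 proof (rule Lim_emeasure_incseq)
  show "range (%n. B Int cyl (squares n)) <= sets ?q" using B measurable_cyl[OF measurable_squares] by auto
  show "incseq (%n. B Int cyl (squares n))" using squares_mono by (fastforce simp: incseq_def cyl_def)
 qed
 also have "(\<Union>n. B Int cyl (squares n)) = B Int cyl qplane"
  unfolding UN_squares[symmetric] by (auto simp: cyl_def)
 also have "emeasure ?q (B Int cyl qplane) = emeasure ?q B"
  using B by (subst emeasure_plane_int_restrict) auto
 finally show ?thesis unfolding eq .
qed

section \<open>Counts of the quadrant process\<close>

context
 fixes th :: real assumes th: "0 < th"
begin

lemma prob_space_plane: "prob_space (plane_prob th)"
 unfolding plane_prob_def by (intro prob_space_PiM prob_space_exp_marked[OF th] prob_space_unit_marks)

lemma space_plane_prob: "space (plane_prob th) = UNIV"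
proof -
 have "space (exp_marked th unit_marks) = UNIV"
  using sets_eq_imp_space_eq[OF sets_unit_marks] by (simp add: exp_marked_def space_pair_measure space_path_space)
 then show ?thesis by (simp add: plane_prob_def space_PiM)
qed

lemma measurable_arrival_time[measurable]: "(%om. arrival_time om i) \<in> borel_measurable (plane_prob th)"
 unfolding plane_prob_def arrival_time_def by (rule borel_measurable_time_sum)

lemma measurable_ppt[measurable]: "(%om. ppt om i) \<in> measurable (plane_prob th) plane_space"
 unfolding ppt_def
proof (rule measurable_compose[OF _ measurable_rearrange], rule measurable_Pair)
 have "(%om. om i) \<in> measurable (plane_prob th) (exp_marked th unit_marks)"
  unfolding plane_prob_def by (rule measurable_component_singleton) simp
 then show "(%om. snd (om i)) \<in> measurable (plane_prob th) unit_marks" by (rule measurable_compose) (simp add: exp_marked_def)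
qed measurable

lemma measurable_point_count[measurable]:
 assumes [measurable]: "B \<in> sets plane_space" shows "(%om. point_count om B) \<in> borel_measurable (plane_prob th)"
 unfolding point_count_def by measurable

text \<open>Rearranging points commutes with taking the multiset of a sample, so the Poisson law of
  the marked arrivals up to time \<open>n\<close> carries over to the first \<open>n\<close>
  squares.\<close>

lemma nn_integral_ppts:
 assumes F: "mset_meas plane_space F"
 shows "(\<integral>\<^sup>+om. F (pts (ppt om) {i. arrival_time om i <= real n}) \<partial>plane_prob th)
  = poisson_mean (plane_int th (squares n)) F"
proof -
 let ?a = "arr_intensity th unit_marks {0..real n}"
 have re: "rearrange \<in> measurable ?a plane_space"
  using measurable_rearrange by (simp add: measurable_cong_sets[OF sets_arr_intensity refl])
 have fin: "finite_measure ?a"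
  by (rule finite_measureI) (subst emeasure_arr_intensity_space[OF prob_space_unit_marks], auto simp: ennreal_mult_eq_top_iff)
 have "poisson_mean (plane_int th (squares n)) F = poisson_mean ?a (%X. F (image_mset rearrange X))"
  unfolding distr_rearrange[symmetric] by (rule poisson_mean_distr[OF fin re F])
 also have "... = (\<integral>\<^sup>+om. F (image_mset rearrange (pts (%i. (\<Sum>j\<le>i. fst (om j), snd (om i))) {i. (\<Sum>j\<le>i. fst (om j)) <= real n})) \<partial>plane_prob th)"
  unfolding plane_prob_def
  by (rule nn_integral_arrivals(1)[OF th prob_space_unit_marks, symmetric]) (auto intro: mset_meas_image[OF F measurable_rearrange])
 also have "... = (\<integral>\<^sup>+om. F (pts (ppt om) {i. arrival_time om i <= real n}) \<partial>plane_prob th)"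
  by (simp add: multiset.map_comp comp_def ppt_def[abs_def] arrival_time_def[abs_def])
 finally show ?thesis ..
qed

text \<open>The uniform coordinate lies in \<open>[0, 1)\<close>, so the integer parts of a
  rearranged point recover its square and thereby the integer part of its arrival time.\<close>

lemma AE_ppts:
 "AE om in plane_prob th. (ALL n. finite {i. arrival_time om i <= real n}) \<and>
   (ALL n i. ppt om i \<in> cyl (squares n) \<longleftrightarrow> arrival_time om i < real n)"
proof -
 interpret Y: prob_space ylaw by (rule prob_space_ylaw)
 interpret u: prob_space "density lborel (indicator {0..<1::real})" by (rule prob_space_unit_uniform)
 interpret um: prob_space unit_marks by (rule prob_space_unit_marks)
 interpret e: prob_space "density lborel (exponential_density th)" by (rule prob_space_exponential_density[OF th])
 interpret uY: pair_sigma_finite "density lborel (indicator {0..<1::real})" ylaw ..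
 interpret eu: pair_sigma_finite "density lborel (exponential_density th)" unit_marks ..
 have "AE U in density lborel (indicator {0..<1}). U \<in> {0..<1::real}" by (subst AE_density) (auto simp: indicator_def)
 then have um: "AE m in unit_marks. fst m \<in> {0..<1}"
  unfolding unit_marks_def by (intro uY.AE_pair_measure) ((measurable)[1], auto elim: eventually_mono)
 have "AE z in exp_marked th unit_marks. fst (snd z) \<in> {0..<1}"
  unfolding exp_marked_def by (intro eu.AE_pair_measure) ((measurable)[1], use um in auto)
 then have "AE om in plane_prob th. fst (snd (om i)) \<in> {0..<1}" for i
  unfolding plane_prob_def by (intro AE_PiM_component prob_space_exp_marked[OF th prob_space_unit_marks]) auto
 then have U: "AE om in plane_prob th. ALL i. fst (snd (om i)) \<in> {0..<1}" by (simp add: AE_all_countable)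
 have "AE om in plane_prob th. finite {i. arrival_time om i <= real n}" for n
  unfolding plane_prob_def arrival_time_def by (rule nn_integral_arrivals(2)[OF th prob_space_unit_marks _ mset_meas_size[of _ "%_. 0"]]) simp
 then have fin: "AE om in plane_prob th. ALL n. finite {i. arrival_time om i <= real n}" by (simp add: AE_all_countable)
 have "AE om in plane_prob th. ALL i. 0 <= fst (om i)"
  unfolding plane_prob_def using AE_gaps_nonneg[OF th prob_space_unit_marks, of UNIV] by simp
 with U fin show ?thesis
 proof eventually_elim
  case (elim om)
  have "ppt om i \<in> cyl (squares n) \<longleftrightarrow> arrival_time om i < real n" for n i
  proof -
   let ?a = "arrival_time om i" and ?U = "fst (snd (om i))"
   have a: "0 <= ?a" using elim(3) by (auto simp: arrival_time_def intro!: sum_nonneg)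
   have U: "0 <= ?U" "?U < 1" using elim(1) by auto
   have fl: "\<lfloor>real l + x\<rfloor> = int l" if "0 <= x" "x < 1" for l x using that by (simp add: floor_eq_iff)
   have "ppt om i \<in> cyl (squares n) \<longleftrightarrow> nat \<lfloor>?a\<rfloor> < n"
    using U fl[OF frac_ge_0 frac_lt_1] fl[OF U] by (auto simp: ppt_def rearrange_def cyl_def squares_def split_beta' add_nonneg_nonneg frac_ge_0)
   also have "... \<longleftrightarrow> ?a < real n"
    using a by (simp add: nat_less_iff floor_less_iff)
   finally show ?thesis .
  qed
  then show ?case using elim(2) by blast
 qed
qed

lemma AE_in_qplane: "AE om in plane_prob th. ALL i. ppt om i \<in> cyl qplane"
 using AE_ppts
proof eventually_elim
 case (elim om)
 show ?case
 proof
  fix i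
  obtain n :: nat where "arrival_time om i < real n" using reals_Archimedean2 by blast
  then have "ppt om i \<in> cyl (squares n)" using elim by blast
  then show "ppt om i \<in> cyl qplane" by (auto simp: cyl_def squares_def)
 qed
qed

lemma prob_point_counts_squares:
 assumes I: "finite I" and B: "!!i. i \<in> I ==> B i \<in> sets plane_space" and d: "disjoint_family_on B I"
 shows "measure (plane_prob th) {om. \<forall>i\<in>I. point_count om (B i Int cyl (squares n)) = of_nat (k i)}
  = (\<Prod>i\<in>I. poisson_mass (emeasure (plane_int th (squares n)) (B i)) (k i))"
proof -
 interpret prob_space "plane_prob th" by (rule prob_space_plane)
 interpret nv: finite_measure "plane_int th (squares n)" by (rule finite_plane_int)
 let ?B = "%i. B i Int cyl (squares n)"
 let ?F = "%X. \<Prod>i\<in>I. indicator {k i} (size (filter_mset (%x. x \<in> ?B i) X)) :: ennreal"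
 let ?E = "{om. \<forall>i\<in>I. point_count om (?B i) = of_nat (k i)}"
 have E: "?E \<in> events"
 proof -
  have "{om \<in> space (plane_prob th). \<forall>i\<in>I. point_count om (?B i) = of_nat (k i)} \<in> events"
   using I B by (intro sets.sets_Collect_finite_All) (auto intro!: borel_measurable_eq)
  then show ?thesis by (simp add: space_plane_prob)
 qed
 have F: "mset_meas plane_space ?F" by (intro mset_meas_prod mset_meas_count[where g="indicator {k i}" for i]) (use B in auto)
 have "emeasure (plane_prob th) ?E = (\<integral>\<^sup>+om. indicator ?E om \<partial>plane_prob th)" using E by simp
 also have "... = (\<integral>\<^sup>+om. ?F (pts (ppt om) {i. arrival_time om i <= real n}) \<partial>plane_prob th)"
 proof (rule nn_integral_cong_AE, use AE_ppts in eventually_elim)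
  fix om assume *: "(ALL n. finite {i. arrival_time om i <= real n}) \<and>
   (ALL n i. ppt om i \<in> cyl (squares n) \<longleftrightarrow> arrival_time om i < real n)"
  have cnt: "size (filter_mset (%x. x \<in> ?B i) (pts (ppt om) {i. arrival_time om i <= real n})) = card {j. ppt om j \<in> ?B i}"
   and fin: "finite {j. ppt om j \<in> ?B i}" for i
  proof -
   \<comment> \<open>Points in \<open>squares n\<close> arrive strictly before \<open>n\<close>, so
     the bound on the arrival time is implied.\<close>
   have eq: "{j \<in> {i. arrival_time om i <= real n}. ppt om j \<in> ?B i} = {j. ppt om j \<in> ?B i}" using * by auto
   show "size (filter_mset (%x. x \<in> ?B i) (pts (ppt om) {i. arrival_time om i <= real n})) = card {j. ppt om j \<in> ?B i}"
    using * unfolding eq[symmetric] by (simp add: filter_mset_image_mset filter_mset_mset_set)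
   show "finite {j. ppt om j \<in> ?B i}" unfolding eq[symmetric] using * by simp
  qed
  have "point_count om (?B i) = of_nat (card {j. ppt om j \<in> ?B i})" for i
   using fin by (simp add: point_count_eq emeasure_count_space_finite)
  then show "indicator ?E om = ?F (pts (ppt om) {i. arrival_time om i <= real n})"
   unfolding cnt using I by (auto simp: indicator_def intro!: prod_zero[symmetric])
 qed
 also have "... = poisson_mean (plane_int th (squares n)) ?F" by (rule nn_integral_ppts[OF F])
 also have "... = (\<Prod>i\<in>I. ennreal (measure (plane_int th (squares n)) (?B i) ^ k i / fact (k i) * exp (- measure (plane_int th (squares n)) (?B i))))"
  by (rule poisson_mean_counts[OF I finite_plane_int]) (use B d in \<open>auto simp: disjoint_family_on_def\<close>)
 also have "... = (\<Prod>i\<in>I. ennreal (poisson_mass (emeasure (plane_int th (squares n)) (B i)) (k i)))"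
 proof (rule prod.cong)
  fix i assume i: "i \<in> I"
  have "emeasure (plane_int th (squares n)) (?B i) = emeasure (plane_int th (squares n)) (B i)"
   using B[OF i] by (subst emeasure_plane_int_restrict) auto
  then show "ennreal (measure (plane_int th (squares n)) (?B i) ^ k i / fact (k i) * exp (- measure (plane_int th (squares n)) (?B i)))
   = ennreal (poisson_mass (emeasure (plane_int th (squares n)) (B i)) (k i))" by (simp add: poisson_mass_def measure_def)
 qed simp
 also have "... = ennreal (\<Prod>i\<in>I. poisson_mass (emeasure (plane_int th (squares n)) (B i)) (k i))"
  by (rule prod_ennreal) (auto simp: poisson_mass_def)
 finally show ?thesis by (simp add: emeasure_eq_measure prod_nonneg poisson_mass_def)
qed

text \<open>Exhaustion by \<open>squares n\<close>: counts and intensities increase to those of the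
  quadrant, and the indicators of the count events converge almost surely.\<close>

lemma prob_point_counts:
 assumes I: "finite I" and B: "!!i. i \<in> I ==> B i \<in> sets plane_space" and d: "disjoint_family_on B I"
 shows "measure (plane_prob th) {om. \<forall>i\<in>I. point_count om (B i) = of_nat (k i)}
  = (\<Prod>i\<in>I. poisson_mass (emeasure (plane_int th qplane) (B i)) (k i))"
proof -
 interpret prob_space "plane_prob th" by (rule prob_space_plane)
 let ?E = "%C. {om. \<forall>i\<in>I. point_count om (B i Int C) = of_nat (k i)}"
 have E: "?E C \<in> events" if "C \<in> sets plane_space" for C
 proof -
  have "{om \<in> space (plane_prob th). \<forall>i\<in>I. point_count om (B i Int C) = of_nat (k i)} \<in> events"
   using I B that by (intro sets.sets_Collect_finite_All) (auto intro!: borel_measurable_eq)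
  then show ?thesis by (simp add: space_plane_prob)
 qed
 have "(%n. prob (?E (cyl (squares n)))) \<longlonglongrightarrow> (\<Prod>i\<in>I. poisson_mass (emeasure (plane_int th qplane) (B i)) (k i))"
 proof -
  have eq: "prob (?E (cyl (squares n))) = (\<Prod>i\<in>I. poisson_mass (emeasure (plane_int th (squares n)) (B i)) (k i))" for n
   using I B d by (rule prob_point_counts_squares)
  show ?thesis
   unfolding eq by (intro tendsto_prod tendsto_poisson_mass tendsto_plane_int B)
     (simp_all add: finite_measure.emeasure_finite[OF finite_plane_int])
 qed
 moreover have "(%n. prob (?E (cyl (squares n)))) \<longlonglongrightarrow> prob (?E UNIV)"
 proof -
  have UNIV: "UNIV \<in> sets plane_space" using sets.top[of plane_space] by (simp add: space_plane_space)
  have "(%n. \<integral>om. indicator (?E (cyl (squares n))) om \<partial>plane_prob th) \<longlonglongrightarrow> (\<integral>om. indicator (?E UNIV) om \<partial>plane_prob th :: real)"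
  proof (rule integral_dominated_convergence[where w="%_. 1"])
   show "(%om. indicator (?E UNIV) om :: real) \<in> borel_measurable (plane_prob th)" using E[OF UNIV] by simp
   show "(%om. indicator (?E (cyl (squares n))) om :: real) \<in> borel_measurable (plane_prob th)" for n
    using E[OF measurable_cyl[OF measurable_squares]] by simp
   show "AE om in plane_prob th. (%n. indicator (?E (cyl (squares n))) om :: real) \<longlonglongrightarrow> indicator (?E UNIV) om"
    using AE_in_qplane
   proof eventually_elim
    case (elim om)
    \<comment> \<open>A finite count is eventually constant; an infinite one eventually exceeds
      \<open>k i\<close>, so that both sides become false.\<close>
    have ev: "\<forall>\<^sub>F n in sequentially. (point_count om (B i Int cyl (squares n)) = of_nat (k i)) = (point_count om (B i) = of_nat (k i))" for i
    proof -
     let ?A = "%n. {j. ppt om j \<in> B i Int cyl (squares n)}"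
     have mono: "?A m <= ?A n" if "m <= n" for m n using squares_mono[OF that] by (auto simp: cyl_def)
     have Un: "(\<Union>n. ?A n) = {j. ppt om j \<in> B i}"
      using elim unfolding UN_squares[symmetric] by (auto simp: cyl_def)
     have lim: "(%n. point_count om (B i Int cyl (squares n))) \<longlonglongrightarrow> point_count om (B i)"
      unfolding point_count_eq Un[symmetric] by (rule Lim_emeasure_incseq) (use mono in \<open>auto simp: incseq_def\<close>)
     show ?thesis
     proof (cases "finite {j. ppt om j \<in> B i}")
      case True
      have "ALL j. EX n. ppt om j \<in> B i --> j \<in> ?A n" using Un by blast
      then obtain f where f: "!!j. ppt om j \<in> B i ==> j \<in> ?A (f j)" by metis
      let ?N = "Max (f ` {j. ppt om j \<in> B i})"
      have "?A n = {j. ppt om j \<in> B i}" if n: "?N <= n" for n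
      proof
       show "{j. ppt om j \<in> B i} <= ?A n"
       proof
        fix j assume j: "j \<in> {j. ppt om j \<in> B i}"
        then have "f j <= ?N" using True by (intro Max_ge) auto
        then have "?A (f j) <= ?A n" using n by (intro mono) linarith
        moreover have "j \<in> ?A (f j)" using j by (intro f) simp
        ultimately show "j \<in> ?A n" by (rule subsetD)
       qed
      qed auto
      then show ?thesis unfolding point_count_eq eventually_sequentially by (intro exI[of _ ?N]) simp
     next
      case False
      then have i: "point_count om (B i) = \<infinity>" by (simp add: point_count_eq)
      have "\<forall>\<^sub>F n in sequentially. of_nat (k i) < point_count om (B i Int cyl (squares n))"
       by (rule order_tendstoD(1)[OF lim]) (simp add: i of_nat_less_top)
      then show ?thesis by eventually_elim (use i in auto)
     qed
    qed
    have "\<forall>\<^sub>F n in sequentially. \<forall>i\<in>I. (point_count om (B i Int cyl (squares n)) = of_nat (k i)) = (point_count om (B i) = of_nat (k i))"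
     using I ev by (simp add: eventually_ball_finite)
    then have "\<forall>\<^sub>F n in sequentially. (indicator (?E (cyl (squares n))) om :: real) = indicator (?E UNIV) om"
     by eventually_elim (simp add: indicator_def)
    then show ?case by (rule tendsto_eventually)
   qed
  qed auto
  then show ?thesis by (simp add: space_plane_prob)
 qed
 ultimately have "prob (?E UNIV) = (\<Prod>i\<in>I. poisson_mass (emeasure (plane_int th qplane) (B i)) (k i))"
  using LIMSEQ_unique by blast
 then show ?thesis by simp
qed

lemma prob_point_count:
 assumes "B \<in> sets plane_space"
 shows "measure (plane_prob th) {om. point_count om B = of_nat k} = poisson_mass (emeasure (plane_int th qplane) B) k"
 using prob_point_counts[of "{0::nat}" "%_. B" "%_. k"] assms by (simp add: disjoint_family_on_def)

text \<open>With a finite mean the Poisson weights sum to one, which leaves no mass for an infinite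
  count.\<close>

lemma AE_finite_points:
 assumes B: "B \<in> sets plane_space" and fin: "emeasure (plane_int th qplane) B < \<infinity>"
 shows "AE om in plane_prob th. finite {i. ppt om i \<in> B}"
proof -
 interpret prob_space "plane_prob th" by (rule prob_space_plane)
 have ev: "{om. point_count om B = of_nat k} \<in> events" for k
 proof -
  have "{om \<in> space (plane_prob th). point_count om B = of_nat k} \<in> events" using B by measurable
  then show ?thesis by (simp add: space_plane_prob)
 qed
 have "(%k. prob {om. point_count om B = of_nat k}) sums prob (\<Union>k. {om. point_count om B = of_nat k})"
  by (rule finite_measure_UNION) (use ev in \<open>auto simp: disjoint_family_on_def\<close>)
 moreover have "(%k. prob {om. point_count om B = of_nat k}) sums 1"
  unfolding prob_point_count[OF B] using fin by (intro poisson_mass_sums) simp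
 ultimately have "prob (\<Union>k. {om. point_count om B = of_nat k}) = 1" by (rule sums_unique2)
 then have "AE om in plane_prob th. om \<in> (\<Union>k. {om. point_count om B = of_nat k})"
  using ev by (intro AE_prob_1) simp
 then show ?thesis by eventually_elim (auto dest: finite_points)
qed

text \<open>A void set has probability \<open>exp (- m)\<close>, and
  \<open>1 - exp (- m) <= m\<close>.\<close>

lemma prob_some_point_le:
 assumes B: "B \<in> sets plane_space"
 shows "emeasure (plane_prob th) {om. EX i. ppt om i \<in> B} <= emeasure (plane_int th qplane) B"
proof (cases "emeasure (plane_int th qplane) B = \<infinity>")
 case False
 interpret prob_space "plane_prob th" by (rule prob_space_plane)
 let ?m = "enn2real (emeasure (plane_int th qplane) B)"
 have ev: "{om. point_count om B = 0} \<in> events"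
 proof -
  have "{om \<in> space (plane_prob th). point_count om B = 0} \<in> events" using B by measurable
  then show ?thesis by (simp add: space_plane_prob)
 qed
 have "{om. EX i. ppt om i \<in> B} = space (plane_prob th) - {om. point_count om B = 0}"
  by (auto simp: space_plane_prob point_count_eq emeasure_count_space_eq_0)
 then have "prob {om. EX i. ppt om i \<in> B} = 1 - exp (- ?m)"
  using prob_compl[OF ev] prob_point_count[OF B, of 0] False by (simp add: poisson_mass_def)
 also have "... <= ?m" using exp_ge_add_one_self[of "- ?m"] by simp
 finally have "ennreal (prob {om. EX i. ppt om i \<in> B}) <= ennreal ?m" by (rule ennreal_leI)
 moreover have "ennreal ?m = emeasure (plane_int th qplane) B" using False by (simp add: less_top)
 ultimately show ?thesis by (simp only: emeasure_eq_measure)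
qed simp

end

section \<open>State space and limiting intensity\<close>

context ev_setting
begin

abbreviation "S \<equiv> state_space c"

definition level_set :: "nat => point set" where
 "level_set k = {z \<in> S. ereal (level k) <= snd (snd z)}"

lemma S_closed_form:
 "S = (if is_frechet then {0..1} \<times> {0..\<infinity>} \<times> {0<..\<infinity>} else {0..\<infinity>} \<times> {-\<infinity>..\<infinity>} \<times> {-\<infinity><..\<infinity>})"
 by (simp add: state_space_def split: ev_class.splits)

lemma borel_S: "S \<in> sets borel"
 unfolding S_closed_form by (auto intro!: borel_Times)

lemma level_antimono: "k <= l ==> level l <= level k" by (simp add: level_def frac_le)

text \<open>Only the lower end of the height is missing from the state space, and the height attains
  its infimum on a compact set; some level lies below that infimum.\<close>

sublocale K: compact_exhaustion S level_set
proof
 show "level_set k <= S" for k by (auto simp: level_set_def)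
 show "level_set k \<in> sets borel" for k
 proof -
  have "level_set k = S Int (UNIV \<times> UNIV \<times> {ereal (level k)..})" by (auto simp: level_set_def)
  then show ?thesis using borel_S by (auto intro!: borel_Times)
 qed
 fix C :: "point set" assume C: "compact C" "C <= S"
 show "EX k. C <= level_set k"
 proof (cases "C = {}")
  case False
  have "compact ((%z. snd (snd z)) ` C)" by (intro compact_continuous_image C continuous_intros)
  then obtain z where z: "z \<in> C" "!!z'. z' \<in> C ==> snd (snd z) <= snd (snd z')"
   using compact_attains_inf[of "(%z. snd (snd z)) ` C"] False by auto
  have "EX k. ereal (level k) <= snd (snd z)"
  proof (cases "is_frechet")
   case True
   then have "0 < snd (snd z)" using z(1) C(2) by (auto simp: S_closed_form)
   then obtain e where e: "0 < e" "ereal e <= snd (snd z)" by (cases "snd (snd z)") (auto intro: that[of 1])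
   obtain k where "1 / e < real k" using reals_Archimedean2 by blast
   then have "1 / (real k + 1) <= e" using e(1) by (simp add: field_simps)
   then show ?thesis using True e(2) by (intro exI[of _ k]) (auto simp: level_def intro: order_trans[rotated])
  next
   case nf: False
   have "-\<infinity> < snd (snd z)" using z(1) C(2) nf by (auto simp: S_closed_form)
   then obtain b where b: "ereal b <= snd (snd z)" by (cases "snd (snd z)") auto
   obtain k where "- b < real k" using reals_Archimedean2 by blast
   then show ?thesis using nf b by (intro exI[of _ k]) (auto simp: level_def intro: order_trans[rotated])
  qed
  then obtain k where "ereal (level k) <= snd (snd z)" by blast
  then have "C <= level_set k" using z(2) C(2) by (auto simp: level_set_def intro: order_trans)
  then show ?thesis by blast
 qed simp
qed

lemma level_set_mono:
 assumes "k <= l" shows "level_set k <= level_set l"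
proof
 fix z assume "z \<in> level_set k"
 then show "z \<in> level_set l"
  using order_trans[of "ereal (level l)" "ereal (level k)" "snd (snd z)"] level_antimono[OF assms] by (simp add: level_set_def)
qed

definition limit_point :: "real \<times> real \<times> (rat => nat) => point" where
 "limit_point = (%(s, r, p). (ereal s, ereal (ev_inv c r), ereal (height_lim s r)))"

definition quadrant :: "(real \<times> real) set" where
 "quadrant = {(s, r). s \<in> time_domain c & 0 < r}"

section \<open>The mark intensity as an image of Lebesgue measure\<close>

lemma measurable_ev_inv[measurable]: "ev_inv c \<in> borel_measurable borel"
 unfolding ev_inv_def[abs_def] by (cases c) simp_all

text \<open>Half-open intervals increase to the domain while their closures stay inside, so that
  \<Phi> is differentiable on each closed interval.\<close>

lemma mark_domain_cases:
 obtains a b where "!!n::nat. a n < (b n :: real)" "!!n. {a n..b n} <= mark_domain c"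
  "incseq (%n. {a n<..b n})" "(\<Union>n. {a n<..b n}) = mark_domain c"
proof (cases c)
 case (Weibull \<alpha>)
 have "(\<Union>n::nat. {- real n - 2<..- 1 / (real n + 1)}) = {..<0}"
 proof
  show "{..<0} <= (\<Union>n::nat. {- real n - 2<..- 1 / (real n + 1)})"
  proof
   fix x :: real assume "x \<in> {..<0}"
   then have x: "x < 0" by simp
   obtain n :: nat where n: "max (- x) (1 / (- x)) < real n" using reals_Archimedean2 by blast
   then have "1 / (- x) < real n + 1" by simp
   then have "x <= - 1 / (real n + 1)" using x by (simp add: field_simps)
   then show "x \<in> (\<Union>n::nat. {- real n - 2<..- 1 / (real n + 1)})" using n by (intro UN_I[of n]) auto
  qed
  show "(\<Union>n::nat. {- real n - 2<..- 1 / (real n + 1)}) <= {..<0}"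
  proof
   fix x assume "x \<in> (\<Union>n::nat. {- real n - 2<..- 1 / (real n + 1)})"
   then obtain n :: nat where "x \<in> {- real n - 2<..- 1 / (real n + 1)}" by (rule UN_E)
   then have "x <= - 1 / (real n + 1)" by (simp only: greaterThanAtMost_iff)
   also have "... < 0" by simp
   finally show "x \<in> {..<0}" by simp
  qed
 qed
 moreover have "incseq (%n::nat. {- real n - 2<..- 1 / (real n + 1)})"
 proof (rule incseq_SucI)
  fix n
  have le: "- 1 / (real n + 1) <= - 1 / (real (Suc n) + 1)" by (simp add: field_simps)
  show "{- real n - 2<..- 1 / (real n + 1)} <= {- real (Suc n) - 2<..- 1 / (real (Suc n) + 1)}"
  proof
   fix x assume x: "x \<in> {- real n - 2<..- 1 / (real n + 1)}"
   then have "- real (Suc n) - 2 < x" by simp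
   moreover have "x <= - 1 / (real (Suc n) + 1)"
    using x le order_trans unfolding greaterThanAtMost_iff by blast
   ultimately show "x \<in> {- real (Suc n) - 2<..- 1 / (real (Suc n) + 1)}" unfolding greaterThanAtMost_iff by blast
  qed
 qed
 moreover have "- real n - 2 < - 1 / (real n + 1)" for n
 proof -
  have "1 / (real n + 1) <= 1" by simp
  then show ?thesis by linarith
 qed
 moreover have "{- real n - 2..- 1 / (real n + 1)} <= {..<0}" for n
 proof
  fix x assume "x \<in> {- real n - 2..- 1 / (real n + 1)}"
  then have "x <= - 1 / (real n + 1)" unfolding atLeastAtMost_iff by blast
  also have "... < 0" by simp
  finally show "x \<in> {..<0}" by simp
 qed
 moreover have "mark_domain c = {..<0}" by (simp add: Weibull mark_domain_def)
 ultimately show ?thesis by (intro that[of "%n. - real n - 2" "%n. - 1 / (real n + 1)"]) (simp_all only:)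
next
 case Gumbel
 have "(\<Union>n::nat. {- real n - 1<..real n}) = UNIV"
 proof (intro set_eqI iffI UNIV_I)
  fix x :: real
  obtain n :: nat where "\<bar>x\<bar> < real n" using reals_Archimedean2 by blast
  then show "x \<in> (\<Union>n::nat. {- real n - 1<..real n})" by (intro UN_I[of n]) auto
 qed
 then show ?thesis by (intro that[of "%n. - real n - 1" "%n. real n"]) (auto simp: Gumbel mark_domain_def incseq_def)
next
 case (Frechet \<alpha>)
 have "(\<Union>n::nat. {1 / (real n + 1)<..real n + 2}) = {0<..}"
 proof
  show "{0<..} <= (\<Union>n::nat. {1 / (real n + 1)<..real n + 2})"
  proof
   fix x :: real assume "x \<in> {0<..}"
   then have x: "0 < x" by simp
   obtain n :: nat where n: "max x (1 / x) < real n" using reals_Archimedean2 by blast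
   then have "1 / x < real n + 1" by simp
   then have "1 / (real n + 1) < x" using x by (simp add: field_simps)
   then show "x \<in> (\<Union>n::nat. {1 / (real n + 1)<..real n + 2})" using n by (intro UN_I[of n]) auto
  qed
  show "(\<Union>n::nat. {1 / (real n + 1)<..real n + 2}) <= {0<..}"
  proof
   fix x assume "x \<in> (\<Union>n::nat. {1 / (real n + 1)<..real n + 2})"
   then obtain n :: nat where "x \<in> {1 / (real n + 1)<..real n + 2}" by (rule UN_E)
   then have "1 / (real n + 1) < x" by (simp only: greaterThanAtMost_iff)
   moreover have "0 < 1 / (real n + 1)" by simp
   ultimately show "x \<in> {0<..}" unfolding greaterThan_iff by (rule less_trans[rotated])
  qed
 qed
 moreover have "incseq (%n::nat. {1 / (real n + 1)<..real n + 2})"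
 proof (rule incseq_SucI)
  have "1 / (real (Suc n) + 1) <= 1 / (real n + 1)" for n by (simp add: field_simps)
  then show "{1 / (real n + 1)<..real n + 2} <= {1 / (real (Suc n) + 1)<..real (Suc n) + 2}" for n
   using le_less_trans by fastforce
 qed
 moreover have "1 / (real n + 1) < real n + 2" for n
 proof -
  have "1 / (real n + 1) <= 1" by simp
  then show ?thesis by linarith
 qed
 moreover have "{1 / (real n + 1)..real n + 2} <= {0<..}" for n
 proof
  fix x assume "x \<in> {1 / (real n + 1)..real n + 2}"
  then have "1 / (real n + 1) <= x" unfolding atLeastAtMost_iff by blast
  moreover have "0 < 1 / (real n + 1)" by simp
  ultimately show "x \<in> {0<..}" unfolding greaterThan_iff by (rule less_le_trans[rotated])
 qed
 moreover have "mark_domain c = {0<..}" by (simp add: Frechet mark_domain_def)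
 ultimately show ?thesis by (intro that[of "%n. 1 / (real n + 1)" "%n. real n + 2"]) (simp_all only:)
qed

lemma \<alpha>_pos: "c = Weibull \<alpha> \<or> c = Frechet \<alpha> ==> 0 < \<alpha>"
 using ev by (auto simp: ev_assumption_def)

lemma ev_limit_deriv:
 assumes x: "x \<in> mark_domain c"
 shows "((%x. enn2real (ev_limit c x)) has_real_derivative deriv (%x. enn2real (ev_limit c x)) x) (at x)"
  "deriv (%x. enn2real (ev_limit c x)) x <= 0"
proof -
 let ?f = "%x. enn2real (ev_limit c x)"
 have "\<exists>D\<le>0. (?f has_real_derivative D) (at x)"
 proof (cases c)
  case (Weibull \<alpha>)
  then have x0: "x < 0" using x by (simp add: mark_domain_def)
  have "((%x. (- x) powr \<alpha>) has_real_derivative - (\<alpha> * (- x) powr (\<alpha> - 1))) (at x)"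
   using x0 by (auto intro!: derivative_eq_intros simp: powr_diff field_simps)
  then have "(?f has_real_derivative - (\<alpha> * (- x) powr (\<alpha> - 1))) (at x)" by (rule DERIV_cong_ev[OF refl _ refl, THEN iffD2, rotated])
     (use x0 in \<open>auto simp: Weibull eventually_nhds intro!: exI[of _ "{..<0}"]\<close>)
  then show ?thesis using \<alpha>_pos[of \<alpha>] Weibull by (intro exI[of _ "- (\<alpha> * (- x) powr (\<alpha> - 1))"]) auto
 next
  case Gumbel
  have "(?f has_real_derivative - exp (- x)) (at x)" by (auto simp: Gumbel intro!: derivative_eq_intros)
  then show ?thesis by (intro exI[of _ "- exp (- x)"]) auto
 next
  case (Frechet \<alpha>)
  then have x0: "0 < x" using x by (simp add: mark_domain_def)
  have "((%x. x powr (- \<alpha>)) has_real_derivative - \<alpha> * x powr (- \<alpha> - 1)) (at x)"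
   using x0 by (auto intro!: derivative_eq_intros simp: powr_diff field_simps)
  then have "(?f has_real_derivative - \<alpha> * x powr (- \<alpha> - 1)) (at x)" by (rule DERIV_cong_ev[OF refl _ refl, THEN iffD2, rotated])
     (use x0 in \<open>auto simp: Frechet eventually_nhds intro!: exI[of _ "{0<..}"]\<close>)
  then show ?thesis using \<alpha>_pos[of \<alpha>] Frechet by (intro exI[of _ "- \<alpha> * x powr (- \<alpha> - 1)"]) auto
 qed
 then obtain D where "D <= 0" "(?f has_real_derivative D) (at x)" by blast
 then show "(?f has_real_derivative deriv ?f x) (at x)" "deriv ?f x <= 0" by (auto dest: DERIV_imp_deriv)
qed

text \<open>\<open>ev_inv\<close> inverts a decreasing function and so reverses the inequality;
  \<Phi> is finite on the domain, which makes \<open>enn2real\<close> harmless.\<close>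

lemma ev_inv_gt_iff:
 assumes x: "x \<in> mark_domain c" and r: "0 < r"
 shows "x < ev_inv c r \<longleftrightarrow> r < enn2real (ev_limit c x)"
proof -
 have fin: "ev_limit c x = ennreal (enn2real (ev_limit c x))"
  using x by (cases c) (auto simp: mark_domain_def)
 have inv: "ev_inv c (enn2real (ev_limit c x)) = x" and pos: "0 < enn2real (ev_limit c x)"
  using x \<alpha>_pos by (cases c; auto simp: mark_domain_def ev_inv_def powr_powr)+
 show ?thesis
 proof
  assume "x < ev_inv c r"
  from ev_limit_gt[OF r this] show "r < enn2real (ev_limit c x)"
   using r fin by (metis ennreal_less_iff less_imp_le)
 next
  assume lt: "r < enn2real (ev_limit c x)"
  show "x < ev_inv c r"
  proof (rule ccontr)
   assume "\<not> x < ev_inv c r"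
   then consider "ev_inv c r < x" | "ev_inv c r = x" by linarith
   then show False
   proof cases
    case 1
    from ev_limit_less[OF r this] show False using lt r fin by (metis ennreal_less_iff enn2real_nonneg order_less_asym)
   next
    case 2
    then have "ev_inv c r = ev_inv c (enn2real (ev_limit c x))" using inv by simp
    moreover have "inj_on (ev_inv c) {0<..}"
     using \<alpha>_pos by (intro inj_on_inverseI[where g="%x. enn2real (ev_limit c x)"], cases c) (auto simp: ev_inv_def powr_powr)
    ultimately show False using lt r pos by (auto dest!: inj_onD)
   qed
  qed
 qed
qed

lemma ev_inv_in_domain: "0 < r ==> ev_inv c r \<in> mark_domain c" by (cases c) (auto simp: ev_inv_def mark_domain_def)

text \<open>Both measures give a half-open interval from \<open>x\<close> to \<open>y\<close> the
  mass \<Phi>(x) - \<Phi>(y): one by the fundamental theorem of calculus, the other because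
  \<open>ev_inv\<close> inverts \<Phi>. Their total masses are not finite, so they are compared on
  the exhausting intervals.\<close>

lemma mark_measure_eq: "mark_measure c = distr (density lborel (indicator {0<..})) borel (ev_inv c)"
proof -
 let ?f = "%x. enn2real (ev_limit c x)"
 let ?M = "mark_measure c" and ?N = "distr (density lborel (indicator {0<..})) borel (ev_inv c)"
 have dm[measurable]: "mark_domain c \<in> sets borel" by (cases c) (auto simp: mark_domain_def)
 \<comment> \<open>The derivative is a pointwise limit of difference quotients on the domain, hence
   measurable there.\<close>
 have dens[measurable]: "(%y. ennreal (- deriv ?f y) * indicator (mark_domain c) y) \<in> borel_measurable borel"
 proof -
  have "(%y. indicator (mark_domain c) y * deriv ?f y) \<in> borel_measurable borel"
  proof (rule borel_measurable_LIMSEQ_real)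
   have fm[measurable]: "?f \<in> borel_measurable borel" by (cases c) (simp_all add: if_distrib)
   show "(%y. indicator (mark_domain c) y * ((?f (y + 1 / (real n + 1)) - ?f y) / (1 / (real n + 1)))) \<in> borel_measurable borel" for n :: nat
    by measurable
   fix y :: real
   show "(%n::nat. indicator (mark_domain c) y * ((?f (y + 1 / (real n + 1)) - ?f y) / (1 / (real n + 1)))) \<longlonglongrightarrow> indicator (mark_domain c) y * deriv ?f y"
   proof (cases "y \<in> mark_domain c")
    case True
    have "filterlim (%n::nat. 1 / (real n + 1)) (at 0) sequentially"
     unfolding filterlim_at by (auto intro!: eventuallyI) real_asymp
    from filterlim_compose[OF ev_limit_deriv(1)[OF True, unfolded DERIV_def] this] show ?thesis using True by simp
   qed simp
  qed
  then have "(%y. ennreal (- (indicator (mark_domain c) y * deriv ?f y))) \<in> borel_measurable borel" by measurable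
  also have "(%y. ennreal (- (indicator (mark_domain c) y * deriv ?f y))) = (%y. ennreal (- deriv ?f y) * indicator (mark_domain c) y)"
   by (auto simp: indicator_def)
  finally show ?thesis .
 qed
 obtain a b where ab: "!!n::nat. a n < (b n :: real)" "!!n. {a n..b n} <= mark_domain c"
  "incseq (%n. {a n<..b n})" "(\<Union>n. {a n<..b n}) = mark_domain c" by (rule mark_domain_cases) (rule that)
 have M: "emeasure ?M {x<..y} = ennreal (?f x - ?f y)" if xy: "x <= y" "{x..y} <= mark_domain c" for x y
 proof -
  have "emeasure ?M {x<..y} = (\<integral>\<^sup>+z. ennreal (- deriv ?f z) * indicator (mark_domain c) z * indicator {x<..y} z \<partial>lborel)"
   unfolding mark_measure_def by (rule emeasure_density) auto
  \<comment> \<open>Closing the interval at \<open>x\<close> changes a null set and gives the shape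
    needed for the fundamental theorem.\<close>
  also have "... = (\<integral>\<^sup>+z. ennreal (indicator (mark_domain c) z * - deriv ?f z) * indicator {x..y} z \<partial>lborel)"
   by (intro nn_integral_cong_AE) (use AE_lborel_singleton[of x] xy in \<open>auto simp: indicator_def elim!: eventually_mono\<close>)
  also have "... = ennreal (- ?f y - - ?f x)"
  proof (rule nn_integral_FTC_Icc)
   have "(%z. enn2real (ennreal (- deriv ?f z) * indicator (mark_domain c) z)) \<in> borel_measurable borel" by measurable
   also have "(%z. enn2real (ennreal (- deriv ?f z) * indicator (mark_domain c) z)) = (%z. indicator (mark_domain c) z * - deriv ?f z)"
    using ev_limit_deriv(2) by (auto simp: indicator_def fun_eq_iff)
   finally show "(%z. indicator (mark_domain c) z * - deriv ?f z) \<in> borel_measurable borel" .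
   fix z assume "z \<in> {x..y}"
   then have z: "z \<in> mark_domain c" using xy by auto
   then show "((%x. - ?f x) has_real_derivative indicator (mark_domain c) z * - deriv ?f z) (at z)"
    using DERIV_minus[OF ev_limit_deriv(1)[OF z]] by simp
   show "0 <= indicator (mark_domain c) z * - deriv ?f z" using ev_limit_deriv(2)[OF z] z by simp
  qed (rule xy)
  finally show ?thesis by simp
 qed
 have N: "emeasure ?N {x<..y} = ennreal (?f x - ?f y)" if xy: "x <= y" "{x..y} <= mark_domain c" for x y
 proof -
  have x: "x \<in> mark_domain c" and y: "y \<in> mark_domain c" using xy by auto
  have "emeasure ?N {x<..y} = emeasure (density lborel (indicator {0<..})) (ev_inv c -` {x<..y})"
   by (subst emeasure_distr) (simp_all add: measurable_def[symmetric])
  also have "... = (\<integral>\<^sup>+r. indicator {0<..} r * indicator (ev_inv c -` {x<..y}) r \<partial>lborel)"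
   by (rule emeasure_density) (auto intro: measurable_sets_borel[OF measurable_ev_inv])
  also have "... = (\<integral>\<^sup>+r. indicator {?f y..<?f x} r \<partial>lborel)"
  proof (intro nn_integral_cong_AE, use AE_lborel_singleton[of 0] in eventually_elim)
   fix r :: real assume "r ~= 0"
   show "indicator {0<..} r * indicator (ev_inv c -` {x<..y}) r = (indicator {?f y..<?f x} r :: ennreal)"
   proof (cases "0 < r")
    case True
    then show ?thesis using ev_inv_gt_iff[OF x True] ev_inv_gt_iff[OF y True] by (auto simp: indicator_def not_less[symmetric])
   next
    case False
    with \<open>r ~= 0\<close> have "r < 0" by simp
    then have "\<not> ?f y <= r" using enn2real_nonneg[of "ev_limit c y"] by linarith
    then show ?thesis using False by simp
   qed
  qed
  also have "... = ennreal (?f x - ?f y)"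
  proof (cases "?f y <= ?f x")
   case True
   then show ?thesis by simp
  next
   case False
   then show ?thesis by (simp add: ennreal_neg)
  qed
  finally show ?thesis .
 qed
 have outside: "emeasure ?M (- mark_domain c) = 0" "emeasure ?N (- mark_domain c) = 0"
 proof -
  have "emeasure ?M (- mark_domain c) = (\<integral>\<^sup>+z. ennreal (- deriv ?f z) * indicator (mark_domain c) z * indicator (- mark_domain c) z \<partial>lborel)"
   unfolding mark_measure_def by (rule emeasure_density) auto
  also have "... = (\<integral>\<^sup>+z. 0 \<partial>(lborel :: real measure))" by (intro nn_integral_cong) (auto simp: indicator_def)
  finally show "emeasure ?M (- mark_domain c) = 0" by simp
  have "emeasure ?N (- mark_domain c) = emeasure (density lborel (indicator {0<..})) (ev_inv c -` (- mark_domain c))"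
   by (subst emeasure_distr) (simp_all add: measurable_def[symmetric])
  also have "... = (\<integral>\<^sup>+r. indicator {0<..} r * indicator (ev_inv c -` (- mark_domain c)) r \<partial>lborel)"
   by (rule emeasure_density) (auto intro: measurable_sets_borel[OF measurable_ev_inv])
  also have "... = (\<integral>\<^sup>+z. 0 \<partial>(lborel :: real measure))"
   using ev_inv_in_domain by (intro nn_integral_cong) (auto simp: indicator_def)
  finally show "emeasure ?N (- mark_domain c) = 0" by simp
 qed
 have piece: "density ?M (indicator {a n<..b n}) = density ?N (indicator {a n<..b n})" for n
 proof (rule measure_eqI_lessThan)
  show "sets (density ?M (indicator {a n<..b n})) = sets borel" "sets (density ?N (indicator {a n<..b n})) = sets borel"
   by (simp_all add: mark_measure_def)
  fix x :: real
  have sets: "sets ?M = sets borel" by (simp add: mark_measure_def)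
  have 1: "emeasure (density ?M (indicator {a n<..b n})) {x<..} = emeasure ?M {max x (a n)<..b n}"
   using sets by (subst emeasure_restricted) (auto simp: greaterThanAtMost_def Int_assoc intro!: arg_cong[of _ _ "emeasure ?M"])
  have 2: "emeasure (density ?N (indicator {a n<..b n})) {x<..} = emeasure ?N {max x (a n)<..b n}"
   by (subst emeasure_restricted) (auto simp: greaterThanAtMost_def Int_assoc intro!: arg_cong[of _ _ "emeasure ?N"])
  have eq: "emeasure ?M {max x (a n)<..b n} = emeasure ?N {max x (a n)<..b n} & emeasure ?M {max x (a n)<..b n} < \<infinity>"
  proof (cases "max x (a n) <= b n")
   case True
   have "{max x (a n)..b n} <= mark_domain c" using ab(2)[of n] by auto
   then show ?thesis by (simp only: M[OF True] N[OF True]) simp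
  next
   case False
   then have "{max x (a n)<..b n} = {}" by auto
   then show ?thesis by (simp only: emeasure_empty) simp
  qed
  show "emeasure (density ?M (indicator {a n<..b n})) {x<..} < \<infinity>" unfolding 1 by (rule eq[THEN conjunct2])
  show "emeasure (density ?M (indicator {a n<..b n})) {x<..} = emeasure (density ?N (indicator {a n<..b n})) {x<..}"
   unfolding 1 2 by (rule eq[THEN conjunct1])
 qed
 show ?thesis
 proof (rule measure_eqI)
  show "sets ?M = sets ?N" by (simp add: mark_measure_def)
  fix X assume "X \<in> sets ?M"
  then have X: "X \<in> sets borel" by (simp add: mark_measure_def)
  \<comment> \<open>A measure that does not charge the complement of the domain is the supremum of
    its restrictions to the increasing intervals.\<close>
  have sup: "emeasure L X = (SUP n. emeasure (density L (indicator {a n<..b n})) X)"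
   if L: "sets L = sets borel" "emeasure L (- mark_domain c) = 0" for L
  proof -
   have "(SUP n. emeasure (density L (indicator {a n<..b n})) X) = (SUP n. emeasure L ({a n<..b n} Int X))"
    using L X by (intro SUP_cong refl emeasure_restricted) auto
   also have "... = emeasure L (\<Union>n. {a n<..b n} Int X)"
    using L X ab(3) by (intro SUP_emeasure_incseq) (auto simp: incseq_def)
   also have "(\<Union>n. {a n<..b n} Int X) = mark_domain c Int X" using ab(4) by auto
   also have "emeasure L (mark_domain c Int X) = emeasure L X"
   proof (rule emeasure_eq_AE)
    have "AE x in L. x \<notin> - mark_domain c" using L dm by (intro AE_not_in) (auto simp: null_sets_def)
    then show "AE x in L. x \<in> mark_domain c Int X \<longleftrightarrow> x \<in> X" by (auto elim: eventually_mono)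
   qed (use L X dm in auto)
   finally show ?thesis ..
  qed
  have "sets ?M = sets borel" by (simp add: mark_measure_def)
  from sup[OF this outside(1)] sup[OF _ outside(2)] show "emeasure ?M X = emeasure ?N X" by (simp add: piece)
 qed
qed

end

section \<open>The limiting point process\<close>

lemma emeasure_cyl:
 assumes "D \<in> sets borel2" "E \<in> sets borel2"
 shows "emeasure (plane_int th D) (cyl E) = (\<integral>\<^sup>+s. \<integral>\<^sup>+r. ennreal th * indicator (D Int E) (s, r) \<partial>lborel \<partial>lborel)"
proof -
 interpret Y: prob_space ylaw by (rule prob_space_ylaw)
 have "emeasure ylaw {p. (s, r, p) \<in> cyl E} = indicator E (s, r)" for s r
  using Y.emeasure_space_1 by (simp add: cyl_def space_ylaw indicator_def)
 then show ?thesis by (simp only: emeasure_plane_space[OF assms(1) measurable_cyl[OF assms(2)]] indicator_inter_arith mult.assoc)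
qed

context ev_setting
begin

definition limit_pair :: "real \<times> real => point" where
 "limit_pair = (%(s, r). (ereal s, ereal (ev_inv c r), ereal (height_lim s r)))"

lemma limit_point_pair: "limit_point z = limit_pair (fst z, fst (snd z))" by (simp add: limit_point_def limit_pair_def split_beta')

lemma limit_height_eq: "limit_height c s y = (if is_frechet then y * (1 - s) else y - s)" by (simp add: limit_height_def split: ev_class.splits)

lemma measurable_height_lim[measurable]: "(%(s, r). height_lim s r) \<in> borel_measurable borel2"
 unfolding height_lim_def limit_height_eq by measurable

lemma measurable_limit_pair[measurable]: "limit_pair \<in> borel_measurable borel2"
 unfolding limit_pair_def split_beta'
 using measurable_height_lim[unfolded split_beta'] by (intro borel_measurable_Pair) measurable

lemma measurable_quadrant[measurable]: "quadrant \<in> sets borel2"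
proof -
 have "time_domain c \<in> sets borel" by (cases c) (auto simp: time_domain_def)
 moreover have "quadrant = time_domain c \<times> {0<..}" by (auto simp: quadrant_def)
 ultimately show ?thesis by simp
qed

lemma quadrant_subset: "quadrant <= qplane" by (auto simp: quadrant_def time_domain_def split: ev_class.splits)

lemma limit_region: "cyl quadrant Int limit_point -` C = cyl (quadrant Int limit_pair -` C)" by (auto simp: cyl_def limit_point_pair)

lemma measurable_limit_region:
 assumes "C \<in> sets borel" shows "quadrant Int limit_pair -` C \<in> sets borel2"
 using measurable_sets[OF measurable_limit_pair assms] by (intro sets.Int measurable_quadrant) (simp add: space_pair_measure)

lemma ev_limit_inv: "0 < r ==> enn2real (ev_limit c (ev_inv c r)) = r"
 using \<alpha>_pos by (cases c) (auto simp: ev_inv_def powr_powr)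

text \<open>The set where \<Phi> is at most \<open>n\<close> has mass at most \<open>n\<close>;
  Fubini for the limiting intensity rests on this.\<close>

lemma sigma_finite_mark_measure: "sigma_finite_measure (mark_measure c)"
proof
 have [measurable]: "(%x. enn2real (ev_limit c x)) \<in> borel_measurable borel" by (cases c) (simp_all add: if_distrib)
 define T where "T n = {x. enn2real (ev_limit c x) <= real n}" for n :: nat
 have T: "T n \<in> sets borel" for n unfolding T_def by measurable
 have fin: "emeasure (mark_measure c) (T n) ~= \<infinity>" for n
 proof -
  have "emeasure (mark_measure c) (T n) = emeasure (density lborel (indicator {0<..})) (ev_inv c -` T n)"
   unfolding mark_measure_eq using T by (subst emeasure_distr) (simp_all add: measurable_def[symmetric])
  also have "... = (\<integral>\<^sup>+r. indicator {0<..} r * indicator (ev_inv c -` T n) r \<partial>lborel)"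
   by (rule emeasure_density) (auto intro: measurable_sets_borel[OF measurable_ev_inv T])
  also have "... <= (\<integral>\<^sup>+r. indicator {0..real n} r \<partial>lborel)"
   by (intro nn_integral_mono) (auto simp: T_def ev_limit_inv split: split_indicator)
  also have "... < \<infinity>" by simp
  finally show ?thesis by simp
 qed
 show "EX T. countable T & T <= sets (mark_measure c) & \<Union>T = space (mark_measure c) & (\<forall>a\<in>T. emeasure (mark_measure c) a ~= \<infinity>)"
 proof (intro exI[of _ "range T"] conjI ballI)
  show "range T <= sets (mark_measure c)" using T by (auto simp: mark_measure_eq)
  have "x \<in> (\<Union>n. T n)" for x using real_arch_simple[of "enn2real (ev_limit c x)"] by (auto simp: T_def)
  then show "\<Union>(range T) = space (mark_measure c)" by (auto simp: mark_measure_eq)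
  show "emeasure (mark_measure c) a ~= \<infinity>" if "a \<in> range T" for a using that fin by auto
 qed simp
qed

lemma borel_of_restrict: "C \<in> sets (restrict_space borel S) ==> C \<in> sets borel"
 using borel_S by (auto simp: sets_restrict_space)

text \<open>Substituting \<open>y = ev_inv c r\<close> turns the mark measure into Lebesgue measure
  in \<open>r\<close>, so the limiting intensity is the image of the planar one under
  \<open>limit_point\<close>; the Yule path integrates out.\<close>

lemma emeasure_limit_intensity:
 assumes C: "C \<in> sets (restrict_space borel S)"
 shows "emeasure (limit_intensity c th) C = emeasure (plane_int th qplane) (cyl quadrant Int limit_point -` C)"
proof -
 interpret m: sigma_finite_measure "mark_measure c" by (rule sigma_finite_mark_measure)
 have Bb[measurable]: "C \<in> sets borel" by (rule borel_of_restrict[OF C])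
 have BS: "C <= S" using sets.sets_into_space[OF C] by (simp add: space_restrict_space)
 have [measurable]: "time_domain c \<in> sets borel" by (cases c) (auto simp: time_domain_def)
 have sm[measurable_cong]: "sets (mark_measure c) = sets borel" by (simp add: mark_measure_eq)
 let ?L = "density lborel (%s. ennreal th * indicator (time_domain c) s)"
 let ?f = "%(s, y). (ereal s, ereal y, ereal (limit_height c s y))"
 have f[measurable]: "?f \<in> borel_measurable borel2"
  unfolding split_beta' limit_height_eq by (intro borel_measurable_Pair) measurable
 have f': "?f \<in> borel_measurable (?L \<Otimes>\<^sub>M mark_measure c)"
  using f by (simp add: measurable_cong_sets[OF sets_pair_measure_cong[OF _ sm] refl, of ?L borel])
 have fB: "?f -` C \<in> sets borel2"
  using measurable_sets[OF f Bb] by (simp add: space_pair_measure)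
 have fB': "?f -` C \<in> sets (?L \<Otimes>\<^sub>M mark_measure c)"
  using fB by (simp add: sets_pair_measure_cong[OF _ sm, of ?L borel])
 have k: "(%s. emeasure (mark_measure c) (Pair s -` (?f -` C))) \<in> borel_measurable borel"
  using m.measurable_emeasure_Pair[OF fB'] by simp
 have "emeasure (limit_intensity c th) C = emeasure (distr (?L \<Otimes>\<^sub>M mark_measure c) borel ?f) C"
  unfolding limit_intensity_def using borel_S BS by (intro emeasure_restrict_space) auto
 also have "... = emeasure (?L \<Otimes>\<^sub>M mark_measure c) (?f -` C)"
  by (subst emeasure_distr[OF f' Bb]) (auto simp: space_pair_measure mark_measure_eq intro!: arg_cong2[where f=emeasure])
 also have "... = (\<integral>\<^sup>+s. emeasure (mark_measure c) (Pair s -` (?f -` C)) \<partial>?L)" by (rule m.emeasure_pair_measure_alt[OF fB'])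
 also have "... = (\<integral>\<^sup>+s. ennreal th * indicator (time_domain c) s * emeasure (mark_measure c) (Pair s -` (?f -` C)) \<partial>lborel)"
  by (rule nn_integral_density) (use k in measurable)
 also have "... = (\<integral>\<^sup>+s. \<integral>\<^sup>+r. ennreal th * indicator (qplane Int (quadrant Int limit_pair -` C)) (s, r) \<partial>lborel \<partial>lborel)"
 proof (rule nn_integral_cong)
  fix s :: real
  have sec: "Pair s -` (?f -` C) \<in> sets borel" using sets_Pair1[OF fB, of s] .
  let ?E = "ev_inv c -` (Pair s -` (?f -` C))"
  have E: "?E \<in> sets borel" using measurable_sets_borel[OF measurable_ev_inv sec] .
  have "emeasure (mark_measure c) (Pair s -` (?f -` C)) = emeasure (density lborel (indicator {0<..})) ?E"
   unfolding mark_measure_eq using sec by (subst emeasure_distr) (simp_all add: measurable_def[symmetric])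
  also have "... = (\<integral>\<^sup>+r. indicator {0<..} r * indicator ?E r \<partial>lborel)" by (rule emeasure_density) (use E in auto)
  finally have "ennreal th * indicator (time_domain c) s * emeasure (mark_measure c) (Pair s -` (?f -` C))
   = (\<integral>\<^sup>+r. ennreal th * indicator (time_domain c) s * (indicator {0<..} r * indicator ?E r) \<partial>lborel)"
   using E by (simp add: nn_integral_cmult)
  also have "... = (\<integral>\<^sup>+r. ennreal th * indicator (qplane Int (quadrant Int limit_pair -` C)) (s, r) \<partial>lborel)"
  proof (rule nn_integral_cong)
   fix r :: real
   have "(s, r) \<in> qplane Int (quadrant Int limit_pair -` C) \<longleftrightarrow> s \<in> time_domain c & r \<in> {0<..} & r \<in> ?E"
    using quadrant_subset by (auto simp: quadrant_def limit_pair_def height_lim_def)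
   then show "ennreal th * indicator (time_domain c) s * (indicator {0<..} r * indicator ?E r)
     = ennreal th * indicator (qplane Int (quadrant Int limit_pair -` C)) (s, r)"
    unfolding indicator_def by simp
  qed
  finally show "ennreal th * indicator (time_domain c) s * emeasure (mark_measure c) (Pair s -` (?f -` C))
   = (\<integral>\<^sup>+r. ennreal th * indicator (qplane Int (quadrant Int limit_pair -` C)) (s, r) \<partial>lborel)" .
 qed
 also have "... = emeasure (plane_int th qplane) (cyl (quadrant Int limit_pair -` C))"
  by (rule emeasure_cyl[symmetric]) (auto intro: measurable_limit_region[OF Bb])
 finally show ?thesis unfolding limit_region .
qed

text \<open>The region above a level lies under an integrable curve: time is bounded in the Frechet
  case, negative marks force \<open>s <= k\<close> in the Weibull case, and the Gumbel case means
  \<open>ln r <= k - s\<close>.\<close>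

lemma level_region_bound:
 obtains g :: "real => real" where "g \<in> borel_measurable borel" "(\<integral>\<^sup>+s. ennreal (g s) * indicator {0..} s \<partial>lborel) < \<infinity>"
  "!!s r. (s, r) \<in> quadrant ==> level k <= height_lim s r ==> r <= g s"
proof (cases c)
 case (Frechet \<alpha>)
 \<comment> \<open>Half of the level: the relation between \<open>ev_inv\<close> and \<Phi> is
   strict, so some room below the level is needed.\<close>
 define x where "x = 1 / (2 * (real k + 1))"
 define \<rho> where "\<rho> = enn2real (ev_limit c x)"
 have x: "x \<in> mark_domain c" "0 < x" "x < 1 / (real k + 1)" by (auto simp: x_def Frechet mark_domain_def field_simps)
 show thesis
 proof (rule that[of "%s. \<rho> * indicator {0..1} s"])
  have "(\<integral>\<^sup>+s. ennreal (\<rho> * indicator {0..1} s) * indicator {0..} (s::real) \<partial>lborel) <= (\<integral>\<^sup>+s. ennreal \<rho> * indicator {0..1::real} s \<partial>lborel)"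
   by (intro nn_integral_mono) (auto split: split_indicator)
  also have "... < \<infinity>" by (simp add: nn_integral_cmult ennreal_mult_less_top)
  finally show "(\<integral>\<^sup>+s. ennreal (\<rho> * indicator {0..1} s) * indicator {0..} (s::real) \<partial>lborel) < \<infinity>" .
  fix s r assume sr: "(s, r) \<in> quadrant" "level k <= height_lim s r"
  then have s: "0 <= s" "s <= 1" and r: "0 < r" unfolding quadrant_def by (auto simp: Frechet time_domain_def)
  have "0 < ev_inv c r" using ev_inv_in_domain[OF r] by (simp add: Frechet mark_domain_def)
  then have "ev_inv c r * (1 - s) <= ev_inv c r * 1" using s by (intro mult_left_mono) auto
  moreover have "1 / (real k + 1) <= ev_inv c r * (1 - s)"
   using sr(2) unfolding level_def height_lim_def limit_height_eq by (simp add: Frechet)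
  ultimately have "x < ev_inv c r" using x(3) by linarith
  then show "r <= \<rho> * indicator {0..1} s" using ev_inv_gt_iff[OF x(1) r] s by (simp add: \<rho>_def)
 qed simp
next
 case (Weibull \<alpha>)
 \<comment> \<open>The argument is one below the level, again to obtain a strict inequality.\<close>
 define \<rho> where "\<rho> = enn2real (ev_limit c (- real k - 1))"
 have x: "- real k - 1 \<in> mark_domain c" by (simp add: Weibull mark_domain_def)
 show thesis
 proof (rule that[of "%s. \<rho> * indicator {0..real k} s"])
  have "(\<integral>\<^sup>+s. ennreal (\<rho> * indicator {0..real k} s) * indicator {0..} s \<partial>lborel) <= (\<integral>\<^sup>+s. ennreal \<rho> * indicator {0..real k} s \<partial>lborel)"
   by (intro nn_integral_mono) (auto split: split_indicator)
  also have "... < \<infinity>" by (simp add: nn_integral_cmult ennreal_mult_less_top)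
  finally show "(\<integral>\<^sup>+s. ennreal (\<rho> * indicator {0..real k} s) * indicator {0..} s \<partial>lborel) < \<infinity>" .
  fix s r assume sr: "(s, r) \<in> quadrant" "level k <= height_lim s r"
  then have s: "0 <= s" and r: "0 < r" unfolding quadrant_def by (auto simp: Weibull time_domain_def)
  have "ev_inv c r < 0" using ev_inv_in_domain[OF r] by (simp add: Weibull mark_domain_def)
  moreover have "- real k <= ev_inv c r - s"
   using sr(2) unfolding level_def height_lim_def limit_height_eq by (simp add: Weibull)
  ultimately have "- real k - 1 < ev_inv c r" "s <= real k" using s by linarith+
  then show "r <= \<rho> * indicator {0..real k} s" using ev_inv_gt_iff[OF x r] s by (simp add: \<rho>_def)
 qed simp
next
 case Gumbel
 show thesis
 proof (rule that[of "%s. exp (real k - s)"])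
  have "(\<integral>\<^sup>+s. ennreal (exp (real k - s)) * indicator {0..} s \<partial>lborel) = ennreal (0 - (- exp (real k - 0)))"
  proof (rule nn_integral_FTC_atLeast)
   show "((%s. - exp (real k - s)) \<longlongrightarrow> 0) at_top" by real_asymp
   show "((%s. - exp (real k - s)) has_real_derivative exp (real k - s)) (at s)" for s by (auto intro!: derivative_eq_intros)
  qed auto
  then show "(\<integral>\<^sup>+s. ennreal (exp (real k - s)) * indicator {0..} s \<partial>lborel) < \<infinity>" by simp
  fix s r assume sr: "(s, r) \<in> quadrant" "level k <= height_lim s r"
  then have r: "0 < r" by (auto simp: quadrant_def)
  have "ln r <= real k - s" using sr(2) unfolding level_def height_lim_def limit_height_eq by (simp add: Gumbel ev_inv_def)
  then show "r <= exp (real k - s)" using r by (metis exp_ln exp_le_cancel_iff)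
 qed measurable
qed

lemma limit_pair_level: "z \<in> quadrant ==> limit_pair z \<in> level_set k \<longleftrightarrow> level k <= height_lim (fst z) (snd z)"
proof -
 assume z: "z \<in> quadrant"
 obtain s r where sr: "z = (s, r)" by (cases z)
 have r: "0 < r" using z sr by (simp add: quadrant_def)
 have lev: "0 < level k" if "is_frechet" using that by (simp add: level_def)
 have "limit_pair z \<in> S" if h: "level k <= height_lim s r"
 proof (cases is_frechet)
  case True
  then have "0 < height_lim s r" using h lev by linarith
  moreover have "0 < ev_inv c r" "0 <= s" "s <= 1"
   using True ev_inv_in_domain[OF r] z by (auto simp: sr quadrant_def mark_domain_def time_domain_def split: ev_class.splits)
  ultimately show ?thesis using True by (auto simp: S_closed_form limit_pair_def sr)
 next
  case False
  then show ?thesis using z quadrant_subset by (auto simp: S_closed_form limit_pair_def sr)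
 qed
 then show ?thesis by (auto simp: level_set_def limit_pair_def sr)
qed

lemma finite_level_region: "emeasure (plane_int th qplane) (cyl quadrant Int limit_point -` level_set k) < \<infinity>"
proof -
 obtain g where g: "g \<in> borel_measurable borel" "(\<integral>\<^sup>+s. ennreal (g s) * indicator {0..} s \<partial>lborel) < \<infinity>"
  "!!s r. (s, r) \<in> quadrant ==> level k <= height_lim s r ==> r <= g s" using level_region_bound[of k] by blast
 have "emeasure (plane_int th qplane) (cyl quadrant Int limit_point -` level_set k)
   = (\<integral>\<^sup>+s. \<integral>\<^sup>+r. ennreal th * indicator (qplane Int (quadrant Int limit_pair -` level_set k)) (s, r) \<partial>lborel \<partial>lborel)"
  unfolding limit_region by (rule emeasure_cyl) (auto intro: measurable_limit_region K.K_borel)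
 also have "... <= (\<integral>\<^sup>+s. ennreal th * (ennreal (g s) * indicator {0..} s) \<partial>lborel)"
 proof (rule nn_integral_mono)
  fix s :: real
  have "(\<integral>\<^sup>+r. ennreal th * indicator (qplane Int (quadrant Int limit_pair -` level_set k)) (s, r) \<partial>lborel)
    <= (\<integral>\<^sup>+r. ennreal th * (indicator {0..} s * indicator {0..g s} r) \<partial>lborel)"
  proof (intro nn_integral_mono mult_left_mono)
   fix r
   show "indicator (qplane Int (quadrant Int limit_pair -` level_set k)) (s, r) <= (indicator {0..} s * indicator {0..g s} r :: ennreal)"
    using g(3)[of s r] limit_pair_level[of "(s, r)" k] by (auto split: split_indicator)
  qed simp
  also have "... = ennreal th * (indicator {0..} s * emeasure lborel {0..g s})" by (simp add: nn_integral_cmult)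
  also have "... <= ennreal th * (ennreal (g s) * indicator {0..} s)" by (cases "0 <= g s") (auto simp: mult.commute)
  finally show "(\<integral>\<^sup>+r. ennreal th * indicator (qplane Int (quadrant Int limit_pair -` level_set k)) (s, r) \<partial>lborel)
    <= ennreal th * (ennreal (g s) * indicator {0..} s)" .
 qed
 also have "... = ennreal th * (\<integral>\<^sup>+s. ennreal (g s) * indicator {0..} s \<partial>lborel)"
  by (rule nn_integral_cmult) (use g(1) in measurable)
 also have "... < \<infinity>" using g(2) by (simp add: ennreal_mult_less_top)
 finally show ?thesis .
qed

definition locally_finite :: "(nat => real \<times> real \<times> (rat => nat)) => bool" where
 "locally_finite om \<longleftrightarrow> (ALL k. finite {i. ppt om i \<in> cyl quadrant Int limit_point -` level_set k})"

text \<open>The guard empties the index set on the exceptional null set, so the limit is a Radon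
  measure for every \<open>om\<close>, as \<open>poisson_point_process\<close> demands.\<close>

definition limit_index :: "(nat => real \<times> real \<times> (rat => nat)) => nat set" where
 "limit_index om = {i. locally_finite om & ppt om i \<in> cyl quadrant}"

definition limit_measure :: "(nat => real \<times> real \<times> (rat => nat)) => point measure" where
 "limit_measure om = dirac_sum S (limit_index om) (%i. limit_point (ppt om i))"

lemma finite_limit_index: "finite {i \<in> limit_index om. limit_point (ppt om i) \<in> level_set k}"
proof (cases "locally_finite om")
 case True
 then have "finite {i. ppt om i \<in> cyl quadrant Int limit_point -` level_set k}" by (simp add: locally_finite_def)
 then show ?thesis by (rule rev_finite_subset) (auto simp: limit_index_def)
qed (simp add: limit_index_def)

lemma measurable_limit_point[measurable]: "limit_point \<in> borel_measurable plane_space"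
proof -
 have "(%z. (fst z, fst (snd z))) \<in> measurable plane_space borel2" unfolding plane_space_def by measurable
 from measurable_compose[OF this measurable_limit_pair] show ?thesis by (simp add: limit_point_pair[abs_def])
qed

lemma sets_limit_region: "C \<in> sets borel ==> cyl quadrant Int limit_point -` C \<in> sets plane_space"
 unfolding limit_region by (intro measurable_cyl measurable_limit_region)

section \<open>The limit and its law\<close>

context
 fixes th :: real assumes th: "0 < th"
begin

lemma locally_finite: "AE om in plane_prob th. locally_finite om"
 unfolding locally_finite_def AE_all_countable
 using AE_finite_points[OF th sets_limit_region[OF K.K_borel] finite_level_region] by blast

lemma measurable_locally_finite[measurable]: "Measurable.pred (plane_prob th) locally_finite"
proof -
 note measurable_ppt[OF th, measurable] sets_limit_region[OF K.K_borel, measurable]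
 \<comment> \<open>Finiteness of a set of indices is boundedness, a countable combination of
   measurable events.\<close>
 have eq: "locally_finite = (%om. ALL k. EX m. ALL i. ppt om i \<in> cyl quadrant Int limit_point -` level_set k --> i < m)"
  by (rule ext) (unfold locally_finite_def finite_nat_set_iff_bounded, simp)
 show ?thesis unfolding eq by measurable
qed

lemma random_element_limit: "random_element (vague_topology S) (plane_prob th) limit_measure"
 unfolding limit_measure_def[abs_def]
proof (rule K.random_element_dirac_sum)
 note measurable_ppt[OF th, measurable]
 show "(%om. limit_point (ppt om i)) \<in> borel_measurable (plane_prob th)" for i by measurable
 show "{om \<in> space (plane_prob th). i \<in> limit_index om} \<in> sets (plane_prob th)" for i
  unfolding limit_index_def mem_Collect_eq using measurable_cyl[OF measurable_quadrant, measurable] by measurable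
qed (rule finite_limit_index)

lemma limit_measure_radon: "limit_measure om \<in> radon_measures S"
 unfolding limit_measure_def by (rule K.dirac_sum_radon) (rule finite_limit_index)

lemma emeasure_limit_measure:
 assumes "C \<in> sets (restrict_space borel S)"
 shows "emeasure (limit_measure om) C = (if locally_finite om then point_count om (cyl quadrant Int limit_point -` C) else 0)"
 unfolding limit_measure_def point_count_eq emeasure_dirac_sum[OF assms] by (auto simp: limit_index_def intro!: arg_cong2[where f=emeasure])

text \<open>Counts of the limit are counts of the planar process in preimages, up to the null set
  where local finiteness fails.\<close>

lemma limit_measure_counts:
 assumes I: "finite (I::nat set)" and C: "!!i. i \<in> I ==> C i \<in> sets (restrict_space borel S)" and d: "disjoint_family_on C I"
 shows "{om. \<forall>i\<in>I. emeasure (limit_measure om) (C i) = of_nat (k i)} \<in> sets (plane_prob th)"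
  and "measure (plane_prob th) {om. \<forall>i\<in>I. emeasure (limit_measure om) (C i) = of_nat (k i)}
    = (\<Prod>i\<in>I. poisson_mass (emeasure (limit_intensity c th) (C i)) (k i))"
proof -
 interpret prob_space "plane_prob th" by (rule prob_space_plane[OF th])
 let ?R = "%i. cyl quadrant Int limit_point -` C i"
 have R[measurable]: "i \<in> I ==> ?R i \<in> sets plane_space" for i by (intro sets_limit_region borel_of_restrict C)
 have m[measurable]: "i \<in> I ==> (%om. point_count om (?R i)) \<in> borel_measurable (plane_prob th)" for i
  by (intro measurable_point_count[OF th] R)
 have m': "i \<in> I ==> (%om. emeasure (limit_measure om) (C i)) \<in> borel_measurable (plane_prob th)" for i
  using m[of i] C by (subst measurable_cong[OF emeasure_limit_measure]) auto
 have "{om \<in> space (plane_prob th). \<forall>i\<in>I. emeasure (limit_measure om) (C i) = of_nat (k i)} \<in> events"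
  using I m' by (intro sets.sets_Collect_finite_All) (auto intro!: borel_measurable_eq)
 then show E: "{om. \<forall>i\<in>I. emeasure (limit_measure om) (C i) = of_nat (k i)} \<in> events" by (simp add: space_plane_prob[OF th])
 have "{om \<in> space (plane_prob th). \<forall>i\<in>I. point_count om (?R i) = of_nat (k i)} \<in> events"
  using I m by (intro sets.sets_Collect_finite_All) (auto intro!: borel_measurable_eq)
 then have E': "{om. \<forall>i\<in>I. point_count om (?R i) = of_nat (k i)} \<in> events" by (simp add: space_plane_prob[OF th])
 have "prob {om. \<forall>i\<in>I. emeasure (limit_measure om) (C i) = of_nat (k i)} = prob {om. \<forall>i\<in>I. point_count om (?R i) = of_nat (k i)}"
  by (rule finite_measure_eq_AE[OF _ E E'], use locally_finite in eventually_elim) (simp add: emeasure_limit_measure C)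
 also have "... = (\<Prod>i\<in>I. poisson_mass (emeasure (plane_int th qplane) (?R i)) (k i))"
 proof (rule prob_point_counts[OF th I R])
  show "disjoint_family_on ?R I"
  proof (rule disjoint_family_on_bisimulation[OF d])
   fix n m assume "C n Int C m = {}"
   then have "limit_point -` (C n Int C m) = {}" by simp
   then show "?R n Int ?R m = {}" unfolding vimage_Int by blast
  qed
 qed
 also have "... = (\<Prod>i\<in>I. poisson_mass (emeasure (limit_intensity c th) (C i)) (k i))"
  by (intro prod.cong) (simp_all add: emeasure_limit_intensity C)
 finally show "prob {om. \<forall>i\<in>I. emeasure (limit_measure om) (C i) = of_nat (k i)} = (\<Prod>i\<in>I. poisson_mass (emeasure (limit_intensity c th) (C i)) (k i))" .
qed

text \<open>The limit is realised as the identity map on the range of \<open>limit_measure\<close>, with the law of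
  \<open>limit_measure\<close> on the largest sigma-algebra that makes \<open>limit_measure\<close> measurable.\<close>

definition limit_law :: "point measure measure" where
 "limit_law = distr (plane_prob th)
   (sigma (range limit_measure) {X. X <= range limit_measure & limit_measure -` X \<in> sets (plane_prob th)}) limit_measure"

lemma limit_law:
 shows "space limit_law = range limit_measure"
  and "!!X. X <= range limit_measure ==> limit_measure -` X \<in> sets (plane_prob th) ==> X \<in> sets limit_law"
  and "limit_measure \<in> measurable (plane_prob th) limit_law"
  and "limit_law = distr (plane_prob th) limit_law limit_measure"
proof -
 let ?\<A> = "{X. X <= range limit_measure & limit_measure -` X \<in> sets (plane_prob th)}"
 let ?N = "sigma (range limit_measure) ?\<A>"
 have pow: "?\<A> <= Pow (range limit_measure)" by auto
 show "space limit_law = range limit_measure" using pow by (simp add: limit_law_def space_measure_of_conv)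
 show "X \<in> sets limit_law" if "X <= range limit_measure" "limit_measure -` X \<in> sets (plane_prob th)" for X
  using that pow by (simp add: limit_law_def sets_measure_of)
 have "limit_measure \<in> measurable (plane_prob th) ?N" by (rule measurable_measure_of[OF pow]) (auto simp: space_plane_prob[OF th])
 then show m: "limit_measure \<in> measurable (plane_prob th) limit_law" by (simp add: limit_law_def measurable_cong_sets[OF refl sets_distr])
 show "limit_law = distr (plane_prob th) limit_law limit_measure"
  unfolding limit_law_def by (rule distr_cong) simp_all
qed

text \<open>Every event about the identity map pulls back along \<open>limit_measure\<close> to an
  event of the planar process, which is all that the sigma-algebra of \<open>limit_law\<close> asks
  for.\<close>

lemma poisson_limit_law: "poisson_point_process limit_law S (limit_intensity c th) (%m. m)"
proof (rule poisson_point_processI)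
 interpret prob_space "plane_prob th" by (rule prob_space_plane[OF th])
 show "prob_space limit_law" by (subst limit_law(4)) (rule prob_space_distr[OF limit_law(3)])
 show "m \<in> radon_measures S" if "m \<in> space limit_law" for m using that by (auto simp: limit_law(1) limit_measure_radon)
 show "emeasure m C \<in> insert \<infinity> (range of_nat)" if m: "m \<in> space limit_law" and C: "C \<in> sets (restrict_space borel S)" for m C
 proof -
  obtain om where m': "m = limit_measure om" using m by (auto simp: limit_law(1))
  show ?thesis
  proof (cases "locally_finite om")
   case True
   then show ?thesis unfolding m' emeasure_limit_measure[OF C] using point_count_values by simp
  next
   case False
   then have "emeasure m C = of_nat 0" unfolding m' emeasure_limit_measure[OF C] by simp
   then show ?thesis by blast
  qed
 qed
 have sets: "{m \<in> space limit_law. \<forall>i\<in>I. emeasure m (C i) = of_nat (k i)} \<in> sets limit_law"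
  if I: "finite I" and C: "!!i. i \<in> I ==> C i \<in> sets (restrict_space borel S)" and d: "disjoint_family_on C I"
  for I :: "nat set" and C k
 proof (rule limit_law(2))
  have "limit_measure -` {m \<in> space limit_law. \<forall>i\<in>I. emeasure m (C i) = of_nat (k i)}
    = {om. \<forall>i\<in>I. emeasure (limit_measure om) (C i) = of_nat (k i)}" by (auto simp: limit_law(1))
  then show "limit_measure -` {m \<in> space limit_law. \<forall>i\<in>I. emeasure m (C i) = of_nat (k i)} \<in> events"
   using limit_measure_counts(1)[OF I C d] by simp
 qed (auto simp: limit_law(1))
 show "{m \<in> space limit_law. emeasure m C = of_nat k} \<in> sets limit_law"
  if "C \<in> sets (restrict_space borel S)" for C k
  using sets[of "{0}" "%_. C" "%_. k"] that by (simp add: disjoint_family_on_def)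
 show "measure limit_law {m \<in> space limit_law. \<forall>i\<in>I. emeasure m (C i) = of_nat (k i)}
   = (\<Prod>i\<in>I. poisson_mass (emeasure (limit_intensity c th) (C i)) (k i))"
  if I: "finite I" and C: "!!i. i \<in> I ==> C i \<in> sets (restrict_space borel S)" and d: "disjoint_family_on C I"
  for I :: "nat set" and C k
 proof -
  let ?X = "{m \<in> space limit_law. \<forall>i\<in>I. emeasure m (C i) = of_nat (k i)}"
  have X: "?X \<in> sets limit_law" by (rule sets[OF I C d])
  have "measure limit_law ?X = measure (distr (plane_prob th) limit_law limit_measure) ?X" by (simp only: limit_law(4)[symmetric])
  also have "... = prob (limit_measure -` ?X Int space (plane_prob th))" by (rule measure_distr[OF limit_law(3) X])
  also have "limit_measure -` ?X Int space (plane_prob th) = {om. \<forall>i\<in>I. emeasure (limit_measure om) (C i) = of_nat (k i)}"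
   by (auto simp: limit_law(1) space_plane_prob[OF th])
  finally show ?thesis by (simp only: limit_measure_counts(2)[OF I C d])
 qed
qed

lemma random_element_limit_law: "random_element (vague_topology S) limit_law (%m. m)"
 unfolding random_element_def
proof (rule measurable_sigma_sets[where \<Omega>="topspace (vague_topology S)" and A="{U. openin (vague_topology S) U}"])
 show "{U. openin (vague_topology S) U} <= Pow (topspace (vague_topology S))" by (auto dest: openin_subset)
 show "(%m. m) \<in> space limit_law \<rightarrow> topspace (vague_topology S)"
  by (auto simp: limit_law(1) topspace_vague_topology limit_measure_radon)
 fix U assume U: "U \<in> {U. openin (vague_topology S) U}"
 have "(%m. m) -` U Int space limit_law = U Int range limit_measure" by (auto simp: limit_law(1))
 also have "... \<in> sets limit_law"
 proof (rule limit_law(2))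
  have "U \<in> sets (sigma (topspace (vague_topology S)) {U. openin (vague_topology S) U})"
   using U by (subst sets_measure_of) (auto dest: openin_subset)
  from measurable_sets[OF random_element_limit[unfolded random_element_def] this]
  show "limit_measure -` (U Int range limit_measure) \<in> sets (plane_prob th)" by (simp add: space_plane_prob[OF th] vimage_def)
 qed simp
 finally show "(%m. m) -` U Int space limit_law \<in> sets limit_law" .
qed (rule sets_measure_of, auto dest: openin_subset)

lemma integral_limit_law:
 assumes "continuous_map (vague_topology S) euclideanreal h"
 shows "(\<integral>m. h m \<partial>limit_law) = (\<integral>om. h (limit_measure om) \<partial>plane_prob th)" by (subst limit_law(4))
   (rule integral_distr[OF limit_law(3) borel_measurable_random_element[OF random_element_limit_law assms]])

end

end

section \<open>The prelimit in quantile coordinates\<close>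

context ev_setting
begin

abbreviation "table_marks \<equiv> \<mu> \<Otimes>\<^sub>M ylaw"

definition table_point :: "real => real \<times> real \<times> (rat => nat) => point" where
 "table_point t = (%(a, x, p). (ereal (a / u t), ereal ((x - v t) / w t),
   ereal ((ln (real (path_eval (x * (t - a)) p)) - t * v t) / (t * w t))))"

definition quantile_coords :: "real => mark_point => real \<times> real \<times> (rat => nat)" where
 "quantile_coords t = (%(s, r, p). (s * u t, quant (r / u t), p))"

definition pre_point :: "real => mark_point => point" where
 "pre_point t = (%(s, r, p). (ereal s, ereal (mark t r), ereal (height t s r p)))"

text \<open>The finiteness guard is a default for a null set; it keeps \<open>pre_measure\<close> a
  Radon measure for every \<open>om\<close>.\<close>

definition pre_index :: "real => (nat => real \<times> real \<times> (rat => nat)) => nat set" where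
 "pre_index t om = {i. finite {i. ppt om i \<in> cyl (window t)} & ppt om i \<in> cyl (window t)}"

definition pre_measure :: "real => (nat => real \<times> real \<times> (rat => nat)) => point measure" where
 "pre_measure t om = dirac_sum S (pre_index t om) (%i. pre_point t (ppt om i))"

lemma table_point_coords: "u t ~= 0 ==> table_point t (quantile_coords t z) = pre_point t z"
 by (simp add: table_point_def quantile_coords_def pre_point_def mark_def height_def split_beta')

lemma prob_space_table_marks: "prob_space table_marks" by (intro prob_space_pair prob_space_\<mu> prob_space_ylaw)

lemma sets_table_space: "sets (borel \<Otimes>\<^sub>M table_marks) = sets plane_space"
 unfolding plane_space_def by (intro sets_pair_measure_cong) simp_all

lemma measurable_table_point[measurable]: "table_point t \<in> borel_measurable plane_space"
proof -
 have "(%z. path_eval (fst (snd z) * (t - fst z)) (snd (snd z))) \<in> measurable plane_space (count_space UNIV)"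
  by (rule measurable_path_eval) (simp_all add: plane_space_def)
 then have [measurable]: "(%z. real (path_eval (fst (snd z) * (t - fst z)) (snd (snd z)))) \<in> borel_measurable plane_space" by simp
 have [measurable]: "(%z. fst z) \<in> borel_measurable plane_space" "(%z. fst (snd z)) \<in> borel_measurable plane_space"
  by (simp_all add: plane_space_def)
 show ?thesis unfolding table_point_def split_beta' by (intro borel_measurable_Pair) measurable
qed

lemma measurable_quantile_coords[measurable]: "quantile_coords t \<in> measurable plane_space plane_space"
 unfolding quantile_coords_def split_beta' plane_space_def using measurable_quant by measurable

text \<open>The shift by \<open>b\<close> anticipates a bounded \<open>h\<close>: when
  \<open>b\<close> is its bound, the truncation in \<open>ennreal\<close> loses nothing.\<close>

lemma mset_meas_vague:
 assumes g[measurable]: "g \<in> borel_measurable N" and h: "continuous_map (vague_topology S) euclideanreal h"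
 shows "mset_meas N (%X. ennreal (h (mset_point_measure S (image_mset g X)) + b))"
 unfolding mset_meas_def
proof
 fix m :: nat
 \<comment> \<open>A constant point fills the places outside the sample, since a measurable point is
   wanted for every index.\<close>
 have re: "random_element (vague_topology S) (\<Pi>\<^sub>M i\<in>{..<m}. N) (%x. dirac_sum S {..<m} (%i. if i < m then g (x i) else undefined))"
 proof (rule K.random_element_dirac_sum[where p="%i x. if i < m then g (x i) else undefined" and I="%_. {..<m}"])
  show "(%x. if i < m then g (x i) else undefined) \<in> borel_measurable (\<Pi>\<^sub>M i\<in>{..<m}. N)" for i
   by (cases "i < m") (simp_all add: measurable_compose[OF _ g] measurable_component_singleton)
 qed auto
 have eq: "dirac_sum S {..<m} (%i. if i < m then g (x i) else undefined) = mset_point_measure S (image_mset g (pts x {..<m}))" for x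
  by (subst dirac_sum_finite) (auto simp: multiset.map_comp intro!: arg_cong[where f="mset_point_measure S"] image_mset_cong)
 from borel_measurable_random_element[OF re h, unfolded eq]
 show "(%x. ennreal (h (mset_point_measure S (image_mset g (pts x {..<m}))) + b)) \<in> borel_measurable (\<Pi>\<^sub>M i\<in>{..<m}. N)"
  by measurable
qed

lemma measurable_window[measurable]: "window t \<in> sets borel2"
proof -
 have "window t = {0..t / u t} \<times> {0<..<u t}" by (auto simp: window_def)
 then show ?thesis by simp
qed

text \<open>A bounded box meets finitely many unit squares, and the enumeration has passed all of
  them after finitely many steps.\<close>

lemma bounded_in_squares: "EX n. \<forall>m\<ge>n. {0..a} \<times> {0..b} <= squares m"
proof -
 define Z where "Z = (%(i, j). prod_encode (i, j)) ` ({..nat \<lfloor>a\<rfloor>} \<times> {..nat \<lfloor>b\<rfloor>})"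
 have fin: "finite Z" by (simp add: Z_def)
 have "{0..a} \<times> {0..b} <= squares m" if m: "Suc (Max Z) <= m" for m
 proof
  fix z assume "z \<in> {0..a} \<times> {0..b}"
  then obtain s r where z: "z = (s, r)" "0 <= s" "s <= a" "0 <= r" "r <= b" by auto
  have "prod_encode (nat \<lfloor>s\<rfloor>, nat \<lfloor>r\<rfloor>) \<in> Z"
   unfolding Z_def by (rule image_eqI[of _ _ "(nat \<lfloor>s\<rfloor>, nat \<lfloor>r\<rfloor>)"]) (use z in \<open>auto intro!: nat_mono floor_mono\<close>)
  then have "prod_encode (nat \<lfloor>s\<rfloor>, nat \<lfloor>r\<rfloor>) <= Max Z" using fin by simp
  then show "z \<in> squares m" using z m by (simp add: squares_def)
 qed
 then show ?thesis by blast
qed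

text \<open>The quantile coordinate contributes \<open>u t\<close> copies of \<mu> and the
  substitution \<open>a = s * u t\<close> in time the factor \<open>1 / u t\<close>, so the window
  carries exactly the intensity of the tables up to time \<open>t\<close>.\<close>

lemma distr_window:
 assumes u0: "0 < u t"
 shows "distr (plane_int th (window t)) plane_space (quantile_coords t) = arr_intensity th table_marks {0..t}" (is "?L = ?R")
proof (rule measure_eqI)
 interpret Y: prob_space ylaw by (rule prob_space_ylaw)
 show "sets ?L = sets ?R" by (simp only: sets_distr sets_arr_intensity sets_table_space)
 fix X assume "X \<in> sets ?L"
 then have X: "X \<in> sets plane_space" by simp
 define k where "k s r = emeasure ylaw {p. (s, r, p) \<in> X}" for s r
 have k[measurable]: "(%(s, r). k s r) \<in> borel_measurable borel2"
  unfolding k_def by (rule measurable_plane_section[OF X])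
 have k1[measurable]: "(%r. k s r) \<in> borel_measurable borel" for s
  using measurable_compose[OF measurable_Pair1' k, of s] by simp
 have kint[measurable]: "(%a. \<integral>\<^sup>+x. k a x \<partial>\<mu>) \<in> borel_measurable borel"
 proof -
  have "(%(s, r). k s r) \<in> borel_measurable (borel \<Otimes>\<^sub>M \<mu>)"
   using k by (simp add: measurable_cong_sets[OF sets_pair_measure_cong[OF refl sets_\<mu>] refl])
  then show ?thesis by (rule M.borel_measurable_nn_integral)
 qed
 have X': "(%z. indicator X z :: ennreal) \<in> borel_measurable (borel \<Otimes>\<^sub>M table_marks)"
  using X by (simp add: measurable_cong_sets[OF sets_table_space refl])
 have q: "quantile_coords t \<in> measurable (plane_int th (window t)) plane_space" by (simp add: measurable_cong_sets[OF sets_plane_int refl])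
 have "emeasure ?L X = (\<integral>\<^sup>+z. indicator X z \<partial>?L)" using X by simp
 also have "... = (\<integral>\<^sup>+z. indicator X (quantile_coords t z) \<partial>plane_int th (window t))"
  by (rule nn_integral_distr[OF q]) (use X in simp)
 also have "... = (\<integral>\<^sup>+s. \<integral>\<^sup>+r. ennreal th * indicator (window t) (s, r) * (\<integral>\<^sup>+p. indicator X (quantile_coords t (s, r, p)) \<partial>ylaw) \<partial>lborel \<partial>lborel)"
  by (rule nn_integral_plane) (use X in measurable)
 also have "... = (\<integral>\<^sup>+s. \<integral>\<^sup>+r. ennreal th * indicator {0..t / u t} s * (indicator {0<..<u t} r * k (s * u t) (quant (r / u t))) \<partial>lborel \<partial>lborel)"
 proof (intro nn_integral_cong)
  fix s r :: real
  have "indicator (window t) (s, r) = (indicator {0..t / u t} s * indicator {0<..<u t} r :: ennreal)"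
   by (auto simp: window_def split: split_indicator)
  then show "ennreal th * indicator (window t) (s, r) * (\<integral>\<^sup>+p. indicator X (quantile_coords t (s, r, p)) \<partial>ylaw)
   = ennreal th * indicator {0..t / u t} s * (indicator {0<..<u t} r * k (s * u t) (quant (r / u t)))"
   unfolding quantile_coords_def prod.case nn_integral_plane_section[OF X] k_def by (simp add: mult.assoc)
 qed
 also have "... = (\<integral>\<^sup>+s. ennreal th * indicator {0..t / u t} s * (ennreal (u t) * (\<integral>\<^sup>+x. k (s * u t) x \<partial>\<mu>)) \<partial>lborel)"
 proof (rule nn_integral_cong)
  fix s :: real
  have [measurable]: "(%r. quant (r / u t)) \<in> borel_measurable borel" using measurable_quant by measurable
  have "(\<integral>\<^sup>+r. indicator {0<..<u t} r * k (s * u t) (quant (r / u t)) \<partial>lborel)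
    = (\<integral>\<^sup>+r. k (s * u t) (quant (r / u t)) \<partial>density lborel (indicator {0<..<u t}))"
   by (rule nn_integral_density[symmetric]) measurable
  also have "... = (\<integral>\<^sup>+x. k (s * u t) x \<partial>distr (density lborel (indicator {0<..<u t})) borel (%r. quant (r / u t)))"
   by (rule nn_integral_distr[symmetric]) measurable
  also have "... = ennreal (u t) * (\<integral>\<^sup>+x. k (s * u t) x \<partial>\<mu>)"
   unfolding distr_quant[OF u0] by (rule nn_integral_scale_measure) measurable
  finally show "(\<integral>\<^sup>+r. ennreal th * indicator {0..t / u t} s * (indicator {0<..<u t} r * k (s * u t) (quant (r / u t))) \<partial>lborel)
    = ennreal th * indicator {0..t / u t} s * (ennreal (u t) * (\<integral>\<^sup>+x. k (s * u t) x \<partial>\<mu>))"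
   by (simp add: nn_integral_cmult)
 qed
 also have "... = (\<integral>\<^sup>+s. ennreal (u t) * (ennreal th * indicator {0..t} (0 + u t * s) * (\<integral>\<^sup>+x. k (0 + u t * s) x \<partial>\<mu>)) \<partial>lborel)"
 proof (rule nn_integral_cong)
  fix s :: real
  have "indicator {0..t / u t} s = (indicator {0..t} (0 + u t * s) :: ennreal)"
   using u0 by (auto simp: field_simps zero_le_mult_iff split: split_indicator)
  then show "ennreal th * indicator {0..t / u t} s * (ennreal (u t) * (\<integral>\<^sup>+x. k (s * u t) x \<partial>\<mu>))
   = ennreal (u t) * (ennreal th * indicator {0..t} (0 + u t * s) * (\<integral>\<^sup>+x. k (0 + u t * s) x \<partial>\<mu>))"
   by (simp only: add_0_left mult_ac)
 qed
 also have "... = ennreal (u t) * (\<integral>\<^sup>+s. ennreal th * indicator {0..t} (0 + u t * s) * (\<integral>\<^sup>+x. k (0 + u t * s) x \<partial>\<mu>) \<partial>lborel)"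
  by (rule nn_integral_cmult) measurable
 also have "... = (\<integral>\<^sup>+a. ennreal th * indicator {0..t} a * (\<integral>\<^sup>+x. k a x \<partial>\<mu>) \<partial>lborel)"
 proof -
  have m: "(%a. ennreal th * indicator {0..t} a * (\<integral>\<^sup>+x. k a x \<partial>\<mu>)) \<in> borel_measurable borel" by measurable
  show ?thesis using u0 by (subst nn_integral_real_affine[OF m, of "u t" 0]) auto
 qed
 also have "... = (\<integral>\<^sup>+a. ennreal th * indicator {0..t} a * (\<integral>\<^sup>+m. indicator X (a, m) \<partial>table_marks) \<partial>lborel)"
 proof (rule nn_integral_cong)
  fix a :: real
  have "(%m. indicator X (a, m) :: ennreal) \<in> borel_measurable table_marks"
   using measurable_compose[OF measurable_Pair1' X', of a] by simp
  from Y.nn_integral_fst[OF this]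
  have "(\<integral>\<^sup>+m. indicator X (a, m) \<partial>table_marks) = (\<integral>\<^sup>+x. k a x \<partial>\<mu>)"
   unfolding nn_integral_plane_section[OF X] k_def by simp
  then show "ennreal th * indicator {0..t} a * (\<integral>\<^sup>+x. k a x \<partial>\<mu>) = ennreal th * indicator {0..t} a * (\<integral>\<^sup>+m. indicator X (a, m) \<partial>table_marks)"
   by simp
 qed
 also have "... = (\<integral>\<^sup>+z. indicator X z \<partial>?R)"
  by (rule nn_integral_arr_intensity[OF prob_space_table_marks _ X', symmetric]) simp
 also have "... = emeasure ?R X"
 proof (rule nn_integral_indicator)
  show "X \<in> sets ?R" using X by (simp only: sets_arr_intensity sets_table_space)
 qed
 finally show "emeasure ?L X = emeasure ?R X" .
qed

text \<open>The planar prelimit is the quadrant process restricted to the window; restriction and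
  image of Poisson samples identify its law with that of the tables.\<close>

lemma nn_integral_prelimit:
 assumes th: "0 < th" and u0: "0 < u t" and h: "continuous_map (vague_topology S) euclideanreal h"
 shows "(\<integral>\<^sup>+om. ennreal (h (pre_measure t om) + b) \<partial>plane_prob th)
  = poisson_mean (arr_intensity th table_marks {0..t}) (%X. ennreal (h (mset_point_measure S (image_mset (table_point t) X)) + b))"
proof -
 let ?H = "%g X. ennreal (h (mset_point_measure S (image_mset g X)) + b)"
 have pp: "pre_point t = (%z. table_point t (quantile_coords t z))" using table_point_coords u0 by auto
 have pm[measurable]: "pre_point t \<in> borel_measurable plane_space" unfolding pp by measurable
 have H: "mset_meas plane_space (?H (pre_point t))" by (rule mset_meas_vague[OF pm h])
 \<comment> \<open>The window is bounded, so the arrivals up to some integer time contain all its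
   points.\<close>
 obtain n where n: "{0..t / u t} \<times> {0..u t} <= squares n" using bounded_in_squares by blast
 have win: "window t <= squares n" using n by (auto simp: window_def)
 let ?nv = "plane_int th (squares n)"
 have "(\<integral>\<^sup>+om. ennreal (h (pre_measure t om) + b) \<partial>plane_prob th)
  = (\<integral>\<^sup>+om. ?H (pre_point t) (filter_mset (%z. z \<notin> - cyl (window t)) (pts (ppt om) {i. arrival_time om i <= real n})) \<partial>plane_prob th)"
 proof (rule nn_integral_cong_AE, use AE_ppts[OF th] in eventually_elim)
  fix om assume *: "(ALL n. finite {i. arrival_time om i <= real n}) \<and>
   (ALL n i. ppt om i \<in> cyl (squares n) \<longleftrightarrow> arrival_time om i < real n)"
  have fin: "finite {i. arrival_time om i <= real n}" using * by blast
  have eq: "{i. ppt om i \<in> cyl (window t)} = {i \<in> {i. arrival_time om i <= real n}. ppt om i \<notin> - cyl (window t)}"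
  proof -
   have "arrival_time om i <= real n" if "ppt om i \<in> cyl (window t)" for i
   proof -
    have "ppt om i \<in> cyl (squares n)" using that win by (auto simp: cyl_def)
    then show ?thesis using * by (auto intro: less_imp_le)
   qed
   then show ?thesis by auto
  qed
  have "finite {i. ppt om i \<in> cyl (window t)}" unfolding eq using fin by simp
  then have ix: "pre_index t om = {i. ppt om i \<in> cyl (window t)}" by (simp add: pre_index_def)
  have "pre_measure t om = mset_point_measure S (image_mset (%i. pre_point t (ppt om i)) (mset_set {i \<in> {i. arrival_time om i <= real n}. ppt om i \<notin> - cyl (window t)}))"
   unfolding pre_measure_def ix eq by (rule dirac_sum_finite) (use fin in simp)
  also have "... = mset_point_measure S (image_mset (pre_point t) (filter_mset (%z. z \<notin> - cyl (window t)) (pts (ppt om) {i. arrival_time om i <= real n})))"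
   using fin by (simp only: filter_mset_image_mset filter_mset_mset_set multiset.map_comp comp_def)
  finally show "ennreal (h (pre_measure t om) + b) = ?H (pre_point t) (filter_mset (%z. z \<notin> - cyl (window t)) (pts (ppt om) {i. arrival_time om i <= real n}))"
   by (simp only:)
 qed
 also have "... = poisson_mean ?nv (%X. ?H (pre_point t) (filter_mset (%z. z \<notin> - cyl (window t)) X))"
 proof (rule nn_integral_ppts[OF th])
  have "- cyl (window t) \<in> sets plane_space"
   using sets.compl_sets[OF measurable_cyl[OF measurable_window]] by (simp add: space_plane_space Compl_eq_Diff_UNIV)
  from mset_meas_filter[OF H this]
  show "mset_meas plane_space (%X. ?H (pre_point t) (filter_mset (%z. z \<notin> - cyl (window t)) X))" .
 qed
 also have "... = poisson_mean (density ?nv (indicator (space ?nv - - cyl (window t)))) (?H (pre_point t))"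
 proof (rule poisson_mean_restrict[OF finite_plane_int])
  show "- cyl (window t) \<in> sets ?nv"
   using sets.compl_sets[OF measurable_cyl[OF measurable_window]] by (simp add: space_plane_space Compl_eq_Diff_UNIV)
  show "mset_meas ?nv (?H (pre_point t))" using H by (simp add: mset_meas_cong_sets[OF sets_plane_int])
 qed
 also have "density ?nv (indicator (space ?nv - - cyl (window t))) = plane_int th (window t)"
 proof -
  have "squares n Int window t = window t" using win by auto
  then show ?thesis using density_plane_int[OF measurable_squares measurable_window, of th n t] by (simp add: cyl_def)
 qed
 also have "poisson_mean (plane_int th (window t)) (?H (pre_point t))
   = poisson_mean (plane_int th (window t)) (%X. ?H (table_point t) (image_mset (quantile_coords t) X))"
  unfolding pp by (simp add: multiset.map_comp comp_def)
 also have "... = poisson_mean (distr (plane_int th (window t)) plane_space (quantile_coords t)) (?H (table_point t))"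
 proof (rule poisson_mean_distr[symmetric])
  have "plane_int th (window t) = density ?nv (indicator (cyl (window t)))"
   using density_plane_int[OF measurable_squares measurable_window, of th n t] win by (simp add: cyl_def Int_absorb1)
  then show "finite_measure (plane_int th (window t))"
   using finite_measure_density_indicator[OF finite_plane_int[of th n], of "cyl (window t)"] by simp
  show "quantile_coords t \<in> measurable (plane_int th (window t)) plane_space" by (simp add: measurable_cong_sets[OF sets_plane_int refl])
  show "mset_meas plane_space (?H (table_point t))" by (rule mset_meas_vague[OF measurable_table_point h])
 qed
 finally show ?thesis unfolding distr_window[OF u0] .
qed

end

section \<open>Convergence of the prelimit\<close>

text \<open>Dominated convergence on the bounded region \<open>squares m\<close>, carried out first
  in \<open>r\<close> and then in \<open>s\<close>.\<close>

lemma plane_int_tendsto_0: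
 assumes X: "!!j::nat. X j \<in> sets plane_space" and sub: "!!j. X j <= cyl (squares m)"
  and lim: "!!s r. (s, r) \<in> squares m ==> (%j. emeasure ylaw {p. (s, r, p) \<in> X j}) \<longlonglongrightarrow> 0"
 shows "(%j. emeasure (plane_int th qplane) (X j)) \<longlonglongrightarrow> 0"
proof -
 interpret Y: prob_space ylaw by (rule prob_space_ylaw)
 define e where "e j s r = ennreal th * indicator qplane (s, r) * emeasure ylaw {p. (s, r, p) \<in> X j}" for j s r
 define D where "D s r = ennreal th * indicator (squares m) (s, r)" for s r :: real
 have e2[measurable]: "(%(s, r). e j s r) \<in> borel_measurable borel2" for j
  unfolding e_def using measurable_plane_section[OF X[of j]] by (simp add: split_beta')
 have D2[measurable]: "(%(s, r). D s r) \<in> borel_measurable borel2"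
  unfolding D_def by (simp add: split_beta')
 have e1[measurable]: "e j s \<in> borel_measurable borel" for j s
  using measurable_compose[OF measurable_Pair1' e2, of s] by simp
 have D1[measurable]: "D s \<in> borel_measurable borel" for s
  using measurable_compose[OF measurable_Pair1' D2, of s] by simp
 have ei[measurable]: "(%s. \<integral>\<^sup>+r. e j s r \<partial>lborel) \<in> borel_measurable borel" for j
  by (rule lborel.borel_measurable_nn_integral) (use e2 in \<open>simp add: split_beta'\<close>)
 have Di[measurable]: "(%s. \<integral>\<^sup>+r. D s r \<partial>lborel) \<in> borel_measurable borel"
  by (rule lborel.borel_measurable_nn_integral) (use D2 in \<open>simp add: split_beta'\<close>)
 have e_le: "e j s r <= D s r" for j s r
 proof (cases "(s, r) \<in> squares m")
  case True
  then show ?thesis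
   using Y.emeasure_le_1[of "{p. (s, r, p) \<in> X j}"] mult_left_mono[of "emeasure ylaw {p. (s, r, p) \<in> X j}" 1 "ennreal th"]
   by (auto simp: e_def D_def split: split_indicator)
 next
  case False
  then have "{p. (s, r, p) \<in> X j} = {}" using sub[of j] by (auto simp: cyl_def)
  then show ?thesis by (simp add: e_def)
 qed
 have e_lim: "(%j. e j s r) \<longlonglongrightarrow> 0" for s r
 proof (cases "(s, r) \<in> squares m")
  case True
  have "(%j. ennreal th * indicator qplane (s, r) * emeasure ylaw {p. (s, r, p) \<in> X j}) \<longlonglongrightarrow> ennreal th * indicator qplane (s, r) * 0"
   by (rule ennreal_tendsto_cmult[OF _ lim[OF True]]) (simp split: split_indicator)
  then show ?thesis by (simp add: e_def)
 next
  case False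
  then have "e j s r = 0" for j using e_le[of j s r] by (simp add: D_def)
  then show ?thesis by simp
 qed
 have Dfin: "(\<integral>\<^sup>+s. \<integral>\<^sup>+r. D s r \<partial>lborel \<partial>lborel) < \<infinity>"
 proof -
  have "(\<integral>\<^sup>+s. \<integral>\<^sup>+r. D s r \<partial>lborel \<partial>lborel) = emeasure (plane_int th (squares m)) (cyl (squares m))"
   unfolding D_def by (subst emeasure_cyl) auto
  also have "... < \<infinity>" using finite_measure.emeasure_finite[OF finite_plane_int] by (simp add: less_top)
  finally show ?thesis .
 qed
 have Drow: "(\<integral>\<^sup>+r. D s r \<partial>lborel) < \<infinity>" for s
 proof -
  \<comment> \<open>The pairing function dominates its second argument, which bounds the sections of
    \<open>squares m\<close>.\<close>
  have "EX R. ALL r. (s, r) \<in> squares m --> 0 <= r & r <= R"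
  proof -
   have "r <= real m + 1" if "(s, r) \<in> squares m" for r
   proof -
    have "nat \<lfloor>r\<rfloor> <= prod_encode (nat \<lfloor>s\<rfloor>, nat \<lfloor>r\<rfloor>)" by (rule le_prod_encode_2)
    then have "nat \<lfloor>r\<rfloor> < m" using that by (simp add: squares_def)
    then show ?thesis using that by (simp add: squares_def nat_less_iff) linarith
   qed
   then show ?thesis by (auto simp: squares_def)
  qed
  then obtain R where R: "!!r. (s, r) \<in> squares m ==> 0 <= r & r <= R" by blast
  have "(\<integral>\<^sup>+r. D s r \<partial>lborel) <= (\<integral>\<^sup>+r. ennreal th * indicator {0..R} r \<partial>lborel)"
   unfolding D_def using R by (intro nn_integral_mono mult_left_mono) (auto split: split_indicator)
  also have "... = ennreal th * emeasure lborel {0..R}" by (simp add: nn_integral_cmult)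
  also have "... < \<infinity>" by (cases "0 <= R") (auto simp: ennreal_mult_less_top)
  finally show ?thesis .
 qed
 have row: "(%j. \<integral>\<^sup>+r. e j s r \<partial>lborel) \<longlonglongrightarrow> (\<integral>\<^sup>+r. 0 \<partial>(lborel :: real measure))" for s
  by (rule nn_integral_dominated_convergence[where w="D s"]) (use e_le e_lim Drow in auto)
 have "(%j. \<integral>\<^sup>+s. \<integral>\<^sup>+r. e j s r \<partial>lborel \<partial>lborel) \<longlonglongrightarrow> (\<integral>\<^sup>+s. 0 \<partial>(lborel :: real measure))"
  by (rule nn_integral_dominated_convergence[where w="%s. \<integral>\<^sup>+r. D s r \<partial>lborel"])
    (use e_le row Dfin in \<open>auto intro!: nn_integral_mono\<close>)
 then show ?thesis unfolding e_def emeasure_plane_space[OF measurable_qplane X] by simp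
qed

section \<open>Exceptional regions of the plane\<close>

context ev_setting
begin

lemma measurable_height[measurable]: "(%z. height t (fst z) (fst (snd z)) (snd (snd z))) \<in> borel_measurable plane_space"
proof -
 have [measurable]: "(%r. quant (r / u t)) \<in> borel_measurable borel" using measurable_quant by measurable
 have [measurable]: "(%z. fst z) \<in> borel_measurable plane_space" "(%z. fst (snd z)) \<in> borel_measurable plane_space"
  by (simp_all add: plane_space_def)
 have [measurable]: "(%z. snd (snd z)) \<in> measurable plane_space path_space" by (simp add: plane_space_def)
 have "(%z. path_eval (quant (fst (snd z) / u t) * (t - fst z * u t)) (snd (snd z))) \<in> measurable plane_space (count_space UNIV)"
  by (rule measurable_path_eval) measurable
 then show ?thesis unfolding height_def by measurable
qed

text \<open>The points that tightness makes rare: they leave a bounded box and still reach level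
  \<open>k\<close>.\<close>

definition far_region :: "nat => nat => real => mark_point set" where
 "far_region k n t = cyl (window t - {0..real n} \<times> {0..real n}) Int {z. level k <= height t (fst z) (fst (snd z)) (snd (snd z))}"

text \<open>The points of a bounded part of the quadrant that have not entered the window or are not
  yet within \<open>(1/2) ^ k\<close> of their limit.\<close>

definition deviant_region :: "nat => nat => real => mark_point set" where
 "deviant_region k m t = cyl (squares m Int quadrant) \<inter>
   {z. \<not> ((fst z, fst (snd z)) \<in> window t & \<bar>mark t (fst (snd z)) - ev_inv c (fst (snd z))\<bar> <= (1/2) ^ k \<and>
    \<bar>height t (fst z) (fst (snd z)) (snd (snd z)) - height_lim (fst z) (fst (snd z))\<bar> <= (1/2) ^ k)}"

lemma sets_far_region: "far_region k n t \<in> sets plane_space"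
proof -
 have "{z \<in> space plane_space. level k <= height t (fst z) (fst (snd z)) (snd (snd z))} \<in> sets plane_space" by measurable
 moreover have "window t - {0..real n} \<times> {0..real n} \<in> sets borel2" by (intro sets.Diff measurable_window) simp
 ultimately show ?thesis unfolding far_region_def by (auto simp: space_plane_space)
qed

lemma sets_deviant_region: "deviant_region k m t \<in> sets plane_space"
proof -
 note measurable_mark[measurable]
 have [measurable]: "(%z. fst z) \<in> borel_measurable plane_space" "(%z. fst (snd z)) \<in> borel_measurable plane_space"
  by (simp_all add: plane_space_def)
 have [measurable]: "(%z. (fst z, fst (snd z))) \<in> measurable plane_space borel2" by measurable
 have [measurable]: "(%z. height_lim (fst z) (fst (snd z))) \<in> borel_measurable plane_space"
  using measurable_compose[OF _ measurable_height_lim, of "%z. (fst z, fst (snd z))" plane_space] by simp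
 have "{z \<in> space plane_space. \<not> ((fst z, fst (snd z)) \<in> window t & \<bar>mark t (fst (snd z)) - ev_inv c (fst (snd z))\<bar> <= (1/2) ^ k \<and>
    \<bar>height t (fst z) (fst (snd z)) (snd (snd z)) - height_lim (fst z) (fst (snd z))\<bar> <= (1/2) ^ k)} \<in> sets plane_space" by measurable
 then show ?thesis unfolding deviant_region_def by (auto simp: space_plane_space)
qed

text \<open>Fubini expresses the intensity as \<open>th\<close> times the integral in the tightness
  statement.\<close>

lemma far_region_small:
 assumes "0 < th" "0 < \<epsilon>"
 shows "EX n. \<forall>\<^sub>F t in at_top. emeasure (plane_int th qplane) (far_region k n t) <= ennreal \<epsilon>"
proof -
 have "0 < \<epsilon> / th" using assms by simp
 then obtain n where n: "\<forall>\<^sub>F t in at_top. (\<integral>\<^sup>+s. \<integral>\<^sup>+r. indicator (window t - {0..real n} \<times> {0..real n}) (s, r) * exceed_prob k t s r \<partial>lborel \<partial>lborel) <= ennreal (\<epsilon> / th)"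
  using tightness[of "\<epsilon> / th" k] by (cases is_frechet) blast+
 have "\<forall>\<^sub>F t in at_top. emeasure (plane_int th qplane) (far_region k n t) <= ennreal \<epsilon>"
  using n
 proof eventually_elim
  case (elim t)
  let ?W = "window t - {0..real n} \<times> {0..real n}"
  have W: "?W \<in> sets borel2" by (intro sets.Diff measurable_window) simp
  have sec: "ennreal th * indicator qplane (s, r) * emeasure ylaw {p. (s, r, p) \<in> far_region k n t}
   = ennreal th * (indicator ?W (s, r) * exceed_prob k t s r)" for s r
  proof (cases "(s, r) \<in> ?W")
   case True
   then have "{p. (s, r, p) \<in> far_region k n t} = {p \<in> space ylaw. level k <= height t s r p}"
    by (auto simp: far_region_def cyl_def space_ylaw)
   moreover have "(s, r) \<in> qplane" using True by (auto simp: window_def)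
   ultimately show ?thesis using True by (simp add: exceed_prob_def)
  next
   case False
   then have "{p. (s, r, p) \<in> far_region k n t} = {}" by (auto simp: far_region_def cyl_def)
   then show ?thesis using False by simp
  qed
  have mP: "(%(s, r). indicator ?W (s, r) * exceed_prob k t s r) \<in> borel_measurable borel2"
  proof -
   have "{z \<in> space plane_space. level k <= height t (fst z) (fst (snd z)) (snd (snd z))} \<in> sets plane_space" by measurable
   from measurable_plane_section[OF this]
   have "(%(s, r). exceed_prob k t s r) \<in> borel_measurable borel2" by (simp add: exceed_prob_def space_plane_space space_ylaw)
   then show ?thesis using W by (simp add: split_beta')
  qed
  have m1: "(%r. indicator ?W (s, r) * exceed_prob k t s r) \<in> borel_measurable borel" for s
   using measurable_compose[OF measurable_Pair1' mP, of s] by simp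
  have m2: "(%s. \<integral>\<^sup>+r. indicator ?W (s, r) * exceed_prob k t s r \<partial>lborel) \<in> borel_measurable borel"
   by (rule lborel.borel_measurable_nn_integral) (use mP in \<open>simp add: split_beta'\<close>)
  have "emeasure (plane_int th qplane) (far_region k n t)
    = (\<integral>\<^sup>+s. \<integral>\<^sup>+r. ennreal th * (indicator ?W (s, r) * exceed_prob k t s r) \<partial>lborel \<partial>lborel)"
   by (simp only: emeasure_plane_space[OF measurable_qplane sets_far_region] sec)
  also have "... = ennreal th * (\<integral>\<^sup>+s. \<integral>\<^sup>+r. indicator ?W (s, r) * exceed_prob k t s r \<partial>lborel \<partial>lborel)"
   using m1 m2 by (simp add: nn_integral_cmult)
  also have "... <= ennreal th * ennreal (\<epsilon> / th)" by (rule mult_left_mono[OF elim]) simp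
  also have "... = ennreal \<epsilon>" using assms by (simp add: ennreal_mult[symmetric])
  finally show ?case .
 qed
 then show ?thesis by blast
qed

text \<open>For fixed \<open>(s, r)\<close> the window and the mark are eventually fine for every
  path, so only the deviation of the height contributes, and it tends to 0 in probability.\<close>

lemma deviant_region_small:
 assumes "0 < \<epsilon>"
 shows "\<forall>\<^sub>F t in at_top. emeasure (plane_int th qplane) (deviant_region k m t) <= ennreal \<epsilon>"
proof -
 have "((%t. emeasure (plane_int th qplane) (deviant_region k m t)) \<longlongrightarrow> 0) at_top"
 proof (rule tendsto_at_topI_sequentially)
  fix T :: "nat => real" assume T: "filterlim T at_top sequentially"
  show "(%j. emeasure (plane_int th qplane) (deviant_region k m (T j))) \<longlonglongrightarrow> 0"
  proof (rule plane_int_tendsto_0[OF sets_deviant_region])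
   show "deviant_region k m (T j) <= cyl (squares m)" for j by (auto simp: deviant_region_def cyl_def)
   fix s r
   let ?d = "(1/2) ^ k :: real"
   show "(%j. emeasure ylaw {p. (s, r, p) \<in> deviant_region k m (T j)}) \<longlonglongrightarrow> 0"
   proof (cases "(s, r) \<in> squares m Int quadrant")
    case True
    then have sr: "0 < r" "s \<in> time_domain c" by (auto simp: quadrant_def)
    have "\<forall>\<^sub>F t in at_top. \<bar>mark t r - ev_inv c r\<bar> < ?d"
     using tendstoD[OF mark_limit[OF sr(1)], of ?d] by (simp add: dist_real_def)
    with eventually_window[OF sr]
    have "\<forall>\<^sub>F t in at_top. (s, r) \<in> window t & \<bar>mark t r - ev_inv c r\<bar> < ?d" by (rule eventually_conj)
    then have "\<forall>\<^sub>F j in sequentially. (s, r) \<in> window (T j) & \<bar>mark (T j) r - ev_inv c r\<bar> < ?d"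
     by (rule eventually_compose_filterlim[OF _ T])
    then have eq: "\<forall>\<^sub>F j in sequentially. emeasure ylaw {p \<in> space ylaw. ?d < \<bar>height (T j) s r p - height_lim s r\<bar>}
     = emeasure ylaw {p. (s, r, p) \<in> deviant_region k m (T j)}"
    proof eventually_elim
     case (elim j)
     have "{p \<in> space ylaw. ?d < \<bar>height (T j) s r p - height_lim s r\<bar>} = {p. (s, r, p) \<in> deviant_region k m (T j)}"
      using True elim unfolding deviant_region_def cyl_def space_ylaw by (auto simp: not_le)
     then show ?case by simp
    qed
    have "(%j. emeasure ylaw {p \<in> space ylaw. ?d < \<bar>height (T j) s r p - height_lim s r\<bar>}) \<longlonglongrightarrow> 0"
     by (rule filterlim_compose[OF height_limit[OF sr] T]) simp
    then show ?thesis using eq by (rule Lim_transform_eventually)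
   next
    case False
    then have "{p. (s, r, p) \<in> deviant_region k m (T j)} = {}" for j by (auto simp: deviant_region_def cyl_def)
    then show ?thesis by simp
   qed
  qed
 qed
 then have "\<forall>\<^sub>F t in at_top. emeasure (plane_int th qplane) (deviant_region k m t) < ennreal \<epsilon>"
  by (rule order_tendstoD(2)) (use assms in simp)
 then show ?thesis by (rule eventually_mono) simp
qed

lemma window_subset_quadrant: "0 < t ==> window t <= quadrant"
 using frechetD(1) by (auto simp: window_def quadrant_def time_domain_def split: ev_class.splits)

text \<open>A deterministic statement. Outside the exceptional regions, a point above level
  \<open>d\<close> at stage \<open>k >= d\<close> lies in the box, hence in
  \<open>squares (m k)\<close>, hence within \<open>(1/2) ^ k\<close> of its limit, and so belongs
  to a fixed finite set. Conversely \<open>k <= m k\<close> puts every fixed point into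
  \<open>squares (m k)\<close> eventually.\<close>

lemma limitin_prelimit:
 fixes T :: "nat => real" and n m :: "nat => nat"
 assumes lf: "locally_finite om" and fin: "!!n. finite {i. arrival_time om i <= real n}"
  and sq: "!!n i. ppt om i \<in> cyl (squares n) \<longleftrightarrow> arrival_time om i < real n"
  and T: "!!k. 0 < T k" and m: "!!k. k <= m k" "!!k. {0..real (n k)} \<times> {0..real (n k)} <= squares (m k)"
  and good: "\<forall>\<^sub>F k in sequentially. ALL i. ppt om i \<notin> far_region k (n k) (T k) & ppt om i \<notin> deviant_region k (m k) (T k)"
 shows "limitin (vague_topology S) (%k. pre_measure (T k) om) (limit_measure om) sequentially"
 unfolding pre_measure_def limit_measure_def
proof (rule K.limitin_vague_dirac_sum)
 let ?pt = "ppt om"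
 have finw: "finite {i. ?pt i \<in> cyl (window t)}" for t
 proof -
  obtain N where N: "{0..t / u t} \<times> {0..u t} <= squares N" using bounded_in_squares by blast
  then have "window t <= squares N" by (auto simp: window_def)
  then have "{i. ?pt i \<in> cyl (window t)} <= {i. arrival_time om i <= real N}"
   using sq[of _ N] by (auto simp: cyl_def intro: less_imp_le)
  then show ?thesis using fin finite_subset by blast
 qed
 then have pre: "pre_index t om = {i. ?pt i \<in> cyl (window t)}" for t by (simp add: pre_index_def)
 show "dirac_sum S (pre_index (T k) om) (%i. pre_point (T k) (?pt i)) \<in> radon_measures S" for k
  by (rule K.dirac_sum_radon) (use finw in \<open>simp add: pre\<close>)
 show "dirac_sum S (limit_index om) (%i. limit_point (?pt i)) \<in> radon_measures S" by (rule K.dirac_sum_radon) (rule finite_limit_index)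
 fix d
 \<comment> \<open>One level of slack absorbs the error \<open>(1/2) ^ k\<close> in the
   height.\<close>
 define F where "F = {i \<in> limit_index om. limit_point (?pt i) \<in> level_set (d + 1)}"
 have small: "(%k. (1/2) ^ k :: real) \<longlonglongrightarrow> 0" by (rule LIMSEQ_power_zero) simp
 show "EX F. finite F & F <= {i \<in> limit_index om. limit_point (?pt i) \<in> S} & {i \<in> limit_index om. limit_point (?pt i) \<in> level_set d} <= F \<and>
   (\<forall>\<^sub>F k in sequentially. {i \<in> pre_index (T k) om. pre_point (T k) (?pt i) \<in> level_set d} <= F) \<and>
   (\<forall>i\<in>F. (\<forall>\<^sub>F k in sequentially. i \<in> pre_index (T k) om & pre_point (T k) (?pt i) \<in> S) \<and>
    (%k. pre_point (T k) (?pt i)) \<longlonglongrightarrow> limit_point (?pt i))"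
 proof (intro exI[of _ F] conjI ballI)
  show "finite F" unfolding F_def by (rule finite_limit_index)
  show "F <= {i \<in> limit_index om. limit_point (?pt i) \<in> S}" using K.K_subset by (auto simp: F_def)
  show "{i \<in> limit_index om. limit_point (?pt i) \<in> level_set d} <= F"
   using level_set_mono[of d "d + 1"] by (auto simp: F_def)
  have "level (d + 1) < level d" by (simp add: level_def frac_less2)
  then have "\<forall>\<^sub>F k in sequentially. (1/2) ^ k < level d - level (d + 1)" by (intro order_tendstoD(2)[OF small]) simp
  with good eventually_ge_at_top[of d]
  show "\<forall>\<^sub>F k in sequentially. {i \<in> pre_index (T k) om. pre_point (T k) (?pt i) \<in> level_set d} <= F"
  proof eventually_elim
   case (elim k)
   show ?case
   proof
    fix i assume i: "i \<in> {i \<in> pre_index (T k) om. pre_point (T k) (?pt i) \<in> level_set d}"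
    obtain s r p where z: "?pt i = (s, r, p)" by (metis prod.collapse)
    have w: "(s, r) \<in> window (T k)" using i by (simp add: pre cyl_def z)
    then have q: "(s, r) \<in> quadrant" using window_subset_quadrant[OF T[of k]] by blast
    have lev: "level d <= height (T k) s r p" using i by (simp add: level_set_def pre_point_def z)
    then have "level k <= height (T k) s r p" using level_antimono[OF elim(2)] by linarith
    then have "(s, r) \<in> {0..real (n k)} \<times> {0..real (n k)}"
     using elim(1)[rule_format, of i] w unfolding far_region_def cyl_def z by simp
    then have "(s, r) \<in> squares (m k)" using m(2)[of k] by blast
    then have "\<bar>height (T k) s r p - height_lim s r\<bar> <= (1/2) ^ k"
     using elim(1)[rule_format, of i] w q unfolding deviant_region_def cyl_def z by simp
    then have "level (d + 1) <= height_lim s r" using lev elim(3) by linarith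
    then have "limit_pair (s, r) \<in> level_set (d + 1)" using limit_pair_level[OF q] by simp
    then show "i \<in> F" using lf q by (simp add: F_def limit_index_def cyl_def limit_point_pair z)
   qed
  qed
  fix i assume i: "i \<in> F"
  obtain s r p where z: "?pt i = (s, r, p)" by (metis prod.collapse)
  have q: "(s, r) \<in> quadrant" using i by (simp add: F_def limit_index_def cyl_def z)
  have lev: "level (d + 1) <= height_lim s r"
   using i limit_pair_level[OF q] by (simp add: F_def limit_point_pair z)
  obtain N :: nat where N: "arrival_time om i < real N" using reals_Archimedean2 by blast
  have close: "\<forall>\<^sub>F k in sequentially. (s, r) \<in> window (T k) & \<bar>mark (T k) r - ev_inv c r\<bar> <= (1/2) ^ k & \<bar>height (T k) s r p - height_lim s r\<bar> <= (1/2) ^ k"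
   using good eventually_ge_at_top[of N]
  proof eventually_elim
   case (elim k)
   have "arrival_time om i < real (m k)" using N elim(2) m(1)[of k] by linarith
   then have "(s, r) \<in> squares (m k)" using sq[of i "m k"] by (simp add: cyl_def z)
   then show ?case using elim(1)[rule_format, of i] q unfolding deviant_region_def cyl_def z by auto
  qed
  have m_lim: "(%k. mark (T k) r) \<longlonglongrightarrow> ev_inv c r"
   by (rule Lim_transform2[OF tendsto_const], rule Lim_null_comparison[OF _ small])
     (use close in \<open>auto elim!: eventually_mono simp: abs_minus_commute\<close>)
  have h_lim: "(%k. height (T k) s r p) \<longlonglongrightarrow> height_lim s r"
   by (rule Lim_transform2[OF tendsto_const], rule Lim_null_comparison[OF _ small])
     (use close in \<open>auto elim!: eventually_mono simp: abs_minus_commute\<close>)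
  show "(%k. pre_point (T k) (?pt i)) \<longlonglongrightarrow> limit_point (?pt i)"
   unfolding z pre_point_def limit_point_def prod.case by (intro tendsto_Pair tendsto_const) (use m_lim h_lim in simp_all)
  show "\<forall>\<^sub>F k in sequentially. i \<in> pre_index (T k) om & pre_point (T k) (?pt i) \<in> S"
  proof (cases is_frechet)
   case True
   have "0 < ev_inv c r" using ev_inv_in_domain[of r] q True by (auto simp: quadrant_def mark_domain_def split: ev_class.splits)
   then have e1: "\<forall>\<^sub>F k in sequentially. 0 < mark (T k) r" by (rule order_tendstoD(1)[OF m_lim])
   have "0 < height_lim s r" using lev True by (auto simp: level_def intro: less_le_trans[rotated])
   then have e2: "\<forall>\<^sub>F k in sequentially. 0 < height (T k) s r p" by (rule order_tendstoD(1)[OF h_lim])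
   have "0 <= s & s <= 1" using q True by (auto simp: quadrant_def time_domain_def split: ev_class.splits)
   with True have sb: "is_frechet" "0 <= s & s <= 1" by blast+
   from e1 e2 close show ?thesis by eventually_elim (use sb in \<open>auto simp: pre cyl_def z pre_point_def S_closed_form\<close>)
  next
   case False
   have "0 <= s" using q quadrant_subset by auto
   then show ?thesis using close by (auto elim!: eventually_mono simp: False pre cyl_def z pre_point_def S_closed_form)
  qed
 qed
qed

lemma pre_radon: "pre_measure t om \<in> radon_measures S"
proof -
 have "finite (pre_index t om)" by (cases "finite {i. ppt om i \<in> cyl (window t)}") (simp_all add: pre_index_def)
 then show ?thesis unfolding pre_measure_def by (intro K.dirac_sum_radon) simp
qed

lemma random_element_prelimit:
 assumes "0 < th" "u t ~= 0"
 shows "random_element (vague_topology S) (plane_prob th) (pre_measure t)"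
 unfolding pre_measure_def[abs_def]
proof (rule K.random_element_dirac_sum)
 note measurable_ppt[OF assms(1), measurable] measurable_cyl[OF measurable_window, measurable]
 have pp: "pre_point t = (%z. table_point t (quantile_coords t z))" using table_point_coords assms(2) by auto
 have [measurable]: "pre_point t \<in> borel_measurable plane_space" unfolding pp by measurable
 show "(%om. pre_point t (ppt om i)) \<in> borel_measurable (plane_prob th)" for i by measurable
 show "{om \<in> space (plane_prob th). i \<in> pre_index t om} \<in> sets (plane_prob th)" for i
  unfolding pre_index_def finite_nat_set_iff_bounded mem_Collect_eq Ball_def by measurable
 show "finite {i \<in> pre_index t om. pre_point t (ppt om i) \<in> level_set k}" for om k
  by (cases "finite {i. ppt om i \<in> cyl (window t)}") (simp_all add: pre_index_def)
qed

text \<open>If convergence failed, times \<open>T k\<close> with a fixed discrepancy could be chosen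
  after the box \<open>n k\<close> and the squares \<open>m k\<close>, with both exceptional regions
  of intensity at most \<open>(1/2) ^ k\<close>. Borel-Cantelli and dominated convergence then
  contradict the discrepancy.\<close>

lemma tendsto_prelimit:
 assumes th: "0 < th" and h: "continuous_map (vague_topology S) euclideanreal h" and b: "!!m. m \<in> radon_measures S ==> \<bar>h m\<bar> <= b"
 shows "((%t. \<integral>om. h (pre_measure t om) \<partial>plane_prob th) \<longlongrightarrow> (\<integral>om. h (limit_measure om) \<partial>plane_prob th)) at_top"
proof (rule ccontr)
 interpret prob_space "plane_prob th" by (rule prob_space_plane[OF th])
 let ?E = "%t. \<integral>om. h (pre_measure t om) \<partial>plane_prob th" and ?L = "\<integral>om. h (limit_measure om) \<partial>plane_prob th"
 let ?nv = "plane_int th qplane"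
 assume "\<not> (?E \<longlongrightarrow> ?L) at_top"
 then obtain e where e: "0 < e" "\<not> (\<forall>\<^sub>F t in at_top. dist (?E t) ?L < e)" unfolding tendsto_iff by blast
 \<comment> \<open>Closeness to the limit is recorded in the sizes of the two regions rather than in
   the growth of the times.\<close>
 define ok where "ok k n m t \<longleftrightarrow> 0 < t & 0 < u t & e <= dist (?E t) ?L & k <= m & {0..real n} \<times> {0..real n} <= squares m \<and>
   emeasure ?nv (far_region k n t) <= ennreal ((1/2) ^ k) & emeasure ?nv (deviant_region k m t) <= ennreal ((1/2) ^ k)" for k n m t
 have "ALL k. EX n m t. ok k n m t"
 proof
  fix k
  have pos: "0 < (1/2 :: real) ^ k" by simp
  obtain n where n: "\<forall>\<^sub>F t in at_top. emeasure ?nv (far_region k n t) <= ennreal ((1/2) ^ k)"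
   using far_region_small[OF th pos] by blast
  obtain m0 where m0: "!!m. m0 <= m ==> {0..real n} \<times> {0..real n} <= squares m"
   using bounded_in_squares[of "real n" "real n"] by blast
  let ?m = "max m0 k"
  define Q where "Q t \<longleftrightarrow> (0 < t & 0 < u t & 0 < w t) & emeasure ?nv (far_region k n t) <= ennreal ((1/2) ^ k) \<and>
   emeasure ?nv (deviant_region k ?m t) <= ennreal ((1/2) ^ k)" for t
  have ev: "\<forall>\<^sub>F t in at_top. Q t" unfolding Q_def
   by (rule eventually_conj[OF eventually_scales_pos eventually_conj[OF n deviant_region_small[OF pos]]])
  \<comment> \<open>The good times contain all large ones, while discrepancies occur at arbitrarily
    large times; so some time is both.\<close>
  have "EX t. Q t & \<not> dist (?E t) ?L < e"
  proof (rule ccontr)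
   assume "\<nexists>t. Q t & \<not> dist (?E t) ?L < e"
   then have *: "!!t. Q t ==> dist (?E t) ?L < e" by blast
   have "\<forall>\<^sub>F t in at_top. dist (?E t) ?L < e" by (rule eventually_mono[OF ev *])
   with e(2) show False by (rule notE)
  qed
  then obtain t where t: "Q t" "e <= dist (?E t) ?L" by (auto simp: not_less)
  have m: "k <= ?m" "{0..real n} \<times> {0..real n} <= squares ?m" using m0[of ?m] by simp_all
  have "ok k n ?m t" unfolding ok_def using t(1)[unfolded Q_def] t(2) m by (intro conjI) simp_all
  then show "EX n m t. ok k n m t" by blast
 qed
 then obtain n m T where "!!k. ok k (n k) (m k) (T k)" by metis
 then have T: "!!k. 0 < T k" "!!k. 0 < u (T k)" "!!k. e <= dist (?E (T k)) ?L" "!!k. k <= m k"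
   "!!k. {0..real (n k)} \<times> {0..real (n k)} <= squares (m k)"
   "!!k. emeasure ?nv (far_region k (n k) (T k)) <= ennreal ((1/2) ^ k)" "!!k. emeasure ?nv (deviant_region k (m k) (T k)) <= ennreal ((1/2) ^ k)"
  unfolding ok_def by blast+
 \<comment> \<open>The chance of a point in \<open>R k\<close> is at most the intensity of
   \<open>R k\<close>, which is summable.\<close>
 have bc: "AE om in plane_prob th. \<forall>\<^sub>F k in sequentially. om \<in> space (plane_prob th) - {om. EX i. ppt om i \<in> R k}"
  if R: "!!k. R k \<in> sets plane_space" "!!k. emeasure ?nv (R k) <= ennreal ((1/2) ^ k)" for R
 proof (rule borel_cantelli_AE1)
  note measurable_ppt[OF th, measurable] R(1)[measurable]
  fix k
  have "{om \<in> space (plane_prob th). EX i. ppt om i \<in> R k} \<in> events" by measurable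
  then show "{om. EX i. ppt om i \<in> R k} \<in> events" by (simp add: space_plane_prob[OF th])
  show "emeasure (plane_prob th) {om. EX i. ppt om i \<in> R k} < \<infinity>" by (simp add: less_top[symmetric])
 next
  show "summable (%k. prob {om. EX i. ppt om i \<in> R k})"
  proof (rule summable_comparison_test[OF _ summable_geometric[of "1/2 :: real"]])
   have "prob {om. EX i. ppt om i \<in> R k} <= (1/2) ^ k" for k
   proof -
    have "ennreal (prob {om. EX i. ppt om i \<in> R k}) <= ennreal ((1/2) ^ k)"
     using order_trans[OF prob_some_point_le[OF th R(1)] R(2)] by (simp only: emeasure_eq_measure)
    then show ?thesis by (simp add: ennreal_le_iff)
   qed
   then show "EX N. \<forall>k\<ge>N. norm (prob {om. EX i. ppt om i \<in> R k}) <= (1/2) ^ k" by simp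
  qed simp
 qed
 have lim: "AE om in plane_prob th. (%k. h (pre_measure (T k) om)) \<longlonglongrightarrow> h (limit_measure om)"
  using bc[OF sets_far_region T(6)] bc[OF sets_deviant_region T(7)] AE_ppts[OF th] locally_finite[OF th]
 proof eventually_elim
  case (elim om)
  have good: "\<forall>\<^sub>F k in sequentially. ALL i. ppt om i \<notin> far_region k (n k) (T k) & ppt om i \<notin> deviant_region k (m k) (T k)"
   using elim(1,2) by eventually_elim auto
  have "limitin (vague_topology S) (%k. pre_measure (T k) om) (limit_measure om) sequentially"
   using elim(3) by (intro limitin_prelimit[OF elim(4) _ _ T(1) T(4) T(5) good]) auto
  from continuous_map_limit[OF h this] show ?case by (simp add: comp_def)
 qed
 have "(%k. ?E (T k)) \<longlonglongrightarrow> ?L"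
 proof (rule integral_dominated_convergence[where w="%_. b"])
  show "(%om. h (limit_measure om)) \<in> borel_measurable (plane_prob th)"
   by (rule borel_measurable_random_element[OF random_element_limit[OF th] h])
  show "(%om. h (pre_measure (T k) om)) \<in> borel_measurable (plane_prob th)" for k
   by (rule borel_measurable_random_element[OF random_element_prelimit[OF th] h]) (use T(2)[of k] in simp)
  show "AE om in plane_prob th. norm (h (pre_measure (T k) om)) <= b" for k
   using b[OF pre_radon] by simp
 qed (use lim in simp_all)
 then have "\<forall>\<^sub>F k in sequentially. dist (?E (T k)) ?L < e" using e(1) by (rule tendstoD)
 then obtain k where "dist (?E (T k)) ?L < e" by (auto simp: eventually_sequentially)
 then show False using T(3)[of k] by linarith
qed

end

section \<open>The marked arrivals of the tables\<close>

lemma (in prob_space) distr_pair_indep: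
 assumes X[measurable]: "X \<in> measurable M S" and Y[measurable]: "Y \<in> measurable M T"
  and ind: "!!a b. a \<in> sets S ==> b \<in> sets T ==>
   prob ((X -` a Int space M) Int (Y -` b Int space M)) = prob (X -` a Int space M) * prob (Y -` b Int space M)"
 shows "distr M (S \<Otimes>\<^sub>M T) (%om. (X om, Y om)) = distr M S X \<Otimes>\<^sub>M distr M T Y"
proof -
 interpret X: prob_space "distr M S X" by (rule prob_space_distr) measurable
 interpret Y: prob_space "distr M T Y" by (rule prob_space_distr) measurable
 have "distr M S X \<Otimes>\<^sub>M distr M T Y = distr M (S \<Otimes>\<^sub>M T) (%om. (X om, Y om))"
 proof (rule pair_measure_eqI)
  show "sigma_finite_measure (distr M S X)" "sigma_finite_measure (distr M T Y)" by unfold_locales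
  show "sets (distr M S X \<Otimes>\<^sub>M distr M T Y) = sets (distr M (S \<Otimes>\<^sub>M T) (%om. (X om, Y om)))"
   unfolding sets_distr by (rule sets_pair_measure_cong) simp_all
  fix a b assume "a \<in> sets (distr M S X)" "b \<in> sets (distr M T Y)"
  then have a: "a \<in> sets S" and b: "b \<in> sets T" by simp_all
  have "emeasure (distr M (S \<Otimes>\<^sub>M T) (%om. (X om, Y om))) (a \<times> b) = emeasure M ((%om. (X om, Y om)) -` (a \<times> b) Int space M)"
   using a b by (intro emeasure_distr) auto
  also have "(%om. (X om, Y om)) -` (a \<times> b) Int space M = (X -` a Int space M) Int (Y -` b Int space M)" by auto
  also have "emeasure M ... = emeasure M (X -` a Int space M) * emeasure M (Y -` b Int space M)"
   by (simp add: emeasure_eq_measure ind[OF a b] ennreal_mult)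
  finally show "emeasure (distr M S X) a * emeasure (distr M T Y) b = emeasure (distr M (S \<Otimes>\<^sub>M T) (%om. (X om, Y om))) (a \<times> b)"
   using a b by (simp add: emeasure_distr[OF X] emeasure_distr[OF Y])
 qed
 then show ?thesis ..
qed

lemma dirac_sum_cong:
 assumes "!!i. i \<in> I ==> p i = q i" shows "dirac_sum S I p = dirac_sum S I q"
proof -
 have "{i \<in> I. p i \<in> S} = {i \<in> I. q i \<in> S}" using assms by auto
 then show ?thesis unfolding dirac_sum_def using assms by (intro distr_cong) auto
qed

lemma lessThan_card_downward_closed:
 fixes D :: "nat set"
 assumes "finite D" and down: "!!i j. j \<in> D ==> i <= j ==> i \<in> D"
 shows "{..<card D} = D"
proof (cases "D = {}")
 case False
 have eq: "D = {..Max D}"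
 proof (intro set_eqI iffI)
  show "x \<in> {..Max D}" if "x \<in> D" for x using Max_ge[OF assms(1) that] by simp
  show "x \<in> D" if "x \<in> {..Max D}" for x using that by (intro down[OF Max_in[OF assms(1) False]]) simp
 qed
 have "card D = card {..Max D}" by (rule arg_cong[OF eq])
 also have "... = Suc (Max D)" by (rule card_atMost)
 finally have "{..<card D} = {..Max D}" by (simp only: lessThan_Suc_atMost)
 then show ?thesis using eq[symmetric] by (rule trans)
qed simp

lemma Int_stable_vimage: "Int_stable {f -` a Int \<Omega> |a. a \<in> sets N}"
proof (rule Int_stableI)
 fix x y assume "x \<in> {f -` a Int \<Omega> |a. a \<in> sets N}" "y \<in> {f -` a Int \<Omega> |a. a \<in> sets N}"
 then obtain a b where "x = f -` a Int \<Omega>" "y = f -` b Int \<Omega>" "a \<in> sets N" "b \<in> sets N" by blast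
 then show "x Int y \<in> {f -` a Int \<Omega> |a. a \<in> sets N}" by (intro CollectI exI[of _ "a Int b"]) auto
qed

text \<open>The Bochner integral of a bounded functional is recovered from the non-negative integral
  of its shift by \<open>b\<close>, the form in which the Poisson computations are done.\<close>

lemma integral_random_element:
 assumes M: "prob_space M" and \<xi>: "random_element (vague_topology S) M \<xi>"
  and h: "continuous_map (vague_topology S) euclideanreal h" and b: "!!m. m \<in> radon_measures S ==> \<bar>h m\<bar> <= b"
 shows "(\<integral>om. h (\<xi> om) \<partial>M) = enn2real (\<integral>\<^sup>+om. ennreal (h (\<xi> om) + b) \<partial>M) - b"
proof -
 interpret M: prob_space M by fact
 have m: "(%om. h (\<xi> om)) \<in> borel_measurable M" by (rule borel_measurable_random_element[OF \<xi> h])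
 have bd: "\<bar>h (\<xi> om)\<bar> <= b" if "om \<in> space M" for om
  using b measurable_space[OF \<xi>[unfolded random_element_def] that] by (simp add: topspace_vague_topology space_measure_of_conv)
 then have int: "integrable M (%om. h (\<xi> om))" by (intro M.integrable_const_bound[where B=b] m) simp
 have "(\<integral>om. h (\<xi> om) + b \<partial>M) = enn2real (\<integral>\<^sup>+om. ennreal (h (\<xi> om) + b) \<partial>M)"
 proof (rule integral_eq_nn_integral)
  show "(%om. h (\<xi> om) + b) \<in> borel_measurable M" using m by measurable
  have "0 <= h (\<xi> om) + b" if "om \<in> space M" for om using bd[OF that] by linarith
  then show "AE om in M. 0 <= h (\<xi> om) + b" by (rule AE_I2)
 qed
 then show ?thesis using int by (simp add: M.prob_space)
qed

locale table_process = ev_setting c \<mu> A B + P: prob_space P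
 for c :: ev_class and \<mu> :: "real measure" and A B :: "real => real" and P :: "'a measure" +
 fixes th :: real and W \<tau> :: "nat => 'a => real" and Y :: "nat => real => 'a => nat"
 assumes th: "0 < th" and W[measurable]: "!!i. W i \<in> borel_measurable P" and distr_W: "!!i. distr P borel (W i) = \<mu>"
  and jumps: "poisson_jump_times P th \<tau>" and yule: "!!i. yule_process P (Y i)" and sources: "independent_sources P W \<tau> Y"
begin

section \<open>Independence of gaps, weights and paths\<close>

definition gap :: "nat => 'a => real" where
 "gap i om = \<tau> i om - (if i = 0 then 0 else \<tau> (i - 1) om)"

definition path :: "nat => 'a => rat => nat" where
 "path i om = (%q. Y i (of_rat q) om)"

text \<open>Intersection-stable generators, with the tags 0, 1 and 2 for the gap, the weight and the
  path of table \<open>i\<close>.\<close>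

definition feature :: "nat \<times> nat => 'a set set" where
 "feature = (%(i, m). if m = 0 then {gap i -` a Int space P |a. a \<in> sets borel}
   else if m = 1 then {W i -` a Int space P |a. a \<in> sets borel} else {path i -` a Int space P |a. a \<in> sets path_space})"

lemma sum_gap: "(\<Sum>j\<le>i. gap j om) = \<tau> i om" by (induction i) (simp_all add: gap_def)

lemma gap_indep: "P.indep_vars (%_. borel) gap UNIV" and gap_distributed: "distributed P lborel (gap i) (exponential_density th)"
 using jumps by (simp_all add: poisson_jump_times_def Let_def gap_def[abs_def])

lemma measurable_gap[measurable]: "gap i \<in> borel_measurable P"
 using gap_distributed[of i] by (simp add: distributed_def)

lemma measurable_jump[measurable]: "\<tau> i \<in> borel_measurable P"
proof -
 have "(%om. \<Sum>j\<le>i. gap j om) \<in> borel_measurable P" by measurable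
 then show ?thesis by (simp add: sum_gap)
qed

lemma measurable_path[measurable]: "path i \<in> measurable P path_space"
 unfolding path_def[abs_def] by (rule yule_processD(4)[OF P.prob_space_axioms yule])

lemma feature_simps:
 "feature (i, 0) = {gap i -` a Int space P |a. a \<in> sets borel}"
 "feature (i, Suc 0) = {W i -` a Int space P |a. a \<in> sets borel}"
 "feature (i, 2) = {path i -` a Int space P |a. a \<in> sets path_space}" by (simp_all add: feature_def)

lemma feature_events: "feature k <= P.events"
 unfolding feature_def by (auto split: prod.splits if_splits)

lemma Int_stable_feature: "Int_stable (feature k)"
 unfolding feature_def by (cases k) (simp add: Int_stable_vimage)

text \<open>Two layers of independence are merged: the arrivals as a whole are one source, and the
  gaps are independent within it. A finite family of events is grouped by source, the gap events
  being intersected into one arrival event.\<close>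

lemma indep_features: "P.indep_sets feature (UNIV \<times> {0, Suc 0, 2})"
 unfolding P.indep_sets_def
proof (intro conjI ballI allI impI)
 show "feature k <= P.events" for k by (rule feature_events)
 fix J a assume J: "J <= UNIV \<times> {0, Suc 0, 2}" "J ~= {}" "finite J" and a: "a \<in> Pi J feature"
 define J' where "J' m = {i. (i, m) \<in> J}" for m
 have fin: "finite (J' m)" for m by (rule finite_subset[of _ "fst ` J"]) (use J(3) in \<open>force simp: J'_def\<close>)+
 have aJ: "a (i, m) \<in> feature (i, m)" if "i \<in> J' m" for i m using a that by (auto simp: J'_def)
 \<comment> \<open>The sigma-algebra of the whole sequence of jump times, in which the gaps are
   measurable.\<close>
 define V where "V = vimage_algebra (space P) (%om n. \<tau> n om) (\<Pi>\<^sub>M n\<in>(UNIV::nat set). borel :: real measure)"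
 define b where "b s = (case s of Arrivals => {om \<in> space P. \<forall>i\<in>J' 0. om \<in> a (i, 0)} | Weight i => a (i, Suc 0) | Growth i => a (i, 2))" for s
 \<comment> \<open>\<open>Arrivals\<close> is always included; without gap events its event is the
   whole space.\<close>
 define K where "K = insert Arrivals (Weight ` J' (Suc 0) Un Growth ` J' 2)"
 have spV: "space V = space P" by (simp add: V_def)
 have gV: "gap i \<in> borel_measurable V" for i
 proof -
  have tV: "(%om n. \<tau> n om) \<in> measurable V (\<Pi>\<^sub>M n\<in>(UNIV::nat set). borel)"
   unfolding V_def by (rule measurable_vimage_algebra1) (simp add: space_PiM)
  have [measurable]: "\<tau> n \<in> borel_measurable V" for n
   using measurable_compose[OF tV measurable_component_singleton[of n UNIV]] by simp
  show ?thesis unfolding gap_def[abs_def] by measurable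
 qed
 have arr: "b Arrivals \<in> sets V"
 proof -
  have "{om \<in> space V. \<forall>i\<in>J' 0. om \<in> a (i, 0)} \<in> sets V"
  proof (rule sets.sets_Collect_finite_All[OF _ fin])
   fix i assume "i \<in> J' 0"
   from aJ[OF this] obtain x where x: "a (i, 0) = gap i -` x Int space P" "x \<in> sets borel" unfolding feature_simps by blast
   have aV: "a (i, 0) \<in> sets V" using measurable_sets[OF gV x(2), of i] by (simp only: spV x(1))
   have "{om \<in> space V. om \<in> a (i, 0)} = a (i, 0)" using sets.sets_into_space[OF aV] by (simp add: Collect_conj_eq Int_absorb1)
   then show "{om \<in> space V. om \<in> a (i, 0)} \<in> sets V" using aV by (simp only:)
  qed
  then show ?thesis by (simp add: b_def spV)
 qed
 have "P.prob (\<Inter>s\<in>K. b s) = (\<Prod>s\<in>K. P.prob (b s))"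
 proof (rule P.indep_setsD[OF sources[unfolded independent_sources_def]])
  show "finite K" "K ~= {}" using fin by (auto simp: K_def)
  show "\<forall>s\<in>K. b s \<in> (case s of Weight i => sets (vimage_algebra (space P) (W i) borel)
    | Arrivals => sets (vimage_algebra (space P) (%om n. \<tau> n om) (\<Pi>\<^sub>M n\<in>UNIV. borel))
    | Growth i => sets (vimage_algebra (space P) (%om t. Y i t om) (\<Pi>\<^sub>M t\<in>UNIV. count_space UNIV)))"
  proof
   fix s assume s: "s \<in> K"
   show "b s \<in> (case s of Weight i => sets (vimage_algebra (space P) (W i) borel)
    | Arrivals => sets (vimage_algebra (space P) (%om n. \<tau> n om) (\<Pi>\<^sub>M n\<in>UNIV. borel))
    | Growth i => sets (vimage_algebra (space P) (%om t. Y i t om) (\<Pi>\<^sub>M t\<in>UNIV. count_space UNIV)))"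
   proof (cases s)
    case (Weight i)
    then have "i \<in> J' (Suc 0)" using s by (auto simp: K_def)
    from aJ[OF this] obtain x where "a (i, Suc 0) = W i -` x Int space P" "x \<in> sets borel" unfolding feature_simps by blast
    then show ?thesis using Weight by (auto simp: b_def intro: in_vimage_algebra)
   next
    case Arrivals
    then show ?thesis using arr by (simp add: V_def)
   next
    case (Growth i)
    then have "i \<in> J' 2" using s by (auto simp: K_def)
    from aJ[OF this] obtain x where x: "a (i, 2) = path i -` x Int space P" "x \<in> sets path_space" unfolding feature_simps by blast
    let ?V = "vimage_algebra (space P) (%om t. Y i t om) (\<Pi>\<^sub>M t\<in>(UNIV::real set). count_space (UNIV::nat set))"
    have yV: "(%om t. Y i t om) \<in> measurable ?V (\<Pi>\<^sub>M t\<in>(UNIV::real set). count_space UNIV)"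
     by (rule measurable_vimage_algebra1) (simp add: space_PiM)
    have "path i \<in> measurable ?V path_space"
     unfolding path_def[abs_def] path_space_def
     by (rule measurable_PiM_single') (use measurable_compose[OF yV measurable_component_singleton[OF UNIV_I]] in \<open>simp_all\<close>)
    from measurable_sets[OF this x(2)] show ?thesis using Growth x(1) by (simp add: b_def)
   qed
  qed
 qed simp
 moreover have "(\<Inter>s\<in>K. b s) = (\<Inter>j\<in>J. a j)"
 proof (intro set_eqI)
  fix om
  have "om \<in> (\<Inter>s\<in>K. b s) \<longleftrightarrow> om \<in> space P & (\<forall>i\<in>J' 0. om \<in> a (i, 0)) & (\<forall>i\<in>J' (Suc 0). om \<in> a (i, Suc 0)) & (\<forall>i\<in>J' 2. om \<in> a (i, 2))"
   by (simp add: K_def b_def ball_Un)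
  also have "... \<longleftrightarrow> om \<in> space P & (\<forall>j\<in>J. om \<in> a j)"
   using J(1) by (fastforce simp: J'_def)
  also have "... \<longleftrightarrow> (\<forall>j\<in>J. om \<in> a j)"
  proof -
   obtain j where j: "j \<in> J" using J(2) by blast
   then have "a j \<in> P.events" using a feature_events by blast
   then have "a j <= space P" by (rule sets.sets_into_space)
   then show ?thesis using j by blast
  qed
  finally show "om \<in> (\<Inter>s\<in>K. b s) \<longleftrightarrow> om \<in> (\<Inter>j\<in>J. a j)" by simp
 qed
 moreover have "(\<Prod>s\<in>K. P.prob (b s)) = (\<Prod>j\<in>J. P.prob (a j))"
 proof -
  have 0: "P.prob (b Arrivals) = (\<Prod>i\<in>J' 0. P.prob (a (i, 0)))"
  proof (cases "J' 0 = {}")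
   case True
   then show ?thesis by (simp add: b_def P.prob_space)
  next
   case False
   have sub: "a (i, 0) <= space P" if "i \<in> J' 0" for i
    using aJ[OF that] unfolding feature_simps by blast
   have ind: "P.indep_sets (%i. {gap i -` x Int space P |x. x \<in> sets borel}) UNIV"
    using gap_indep unfolding P.indep_vars_def2 by blast
   have "P.prob (\<Inter>i\<in>J' 0. a (i, 0)) = (\<Prod>i\<in>J' 0. P.prob (a (i, 0)))"
    by (rule P.indep_setsD[OF ind _ False fin]) (use aJ[of _ 0] in \<open>auto simp: feature_simps\<close>)
   moreover have "b Arrivals = (\<Inter>i\<in>J' 0. a (i, 0))" using False sub by (auto simp: b_def)
   ultimately show ?thesis by simp
  qed
  have "(\<Prod>s\<in>K. P.prob (b s)) = P.prob (b Arrivals) * ((\<Prod>s\<in>Weight ` J' (Suc 0). P.prob (b s)) * (\<Prod>s\<in>Growth ` J' 2. P.prob (b s)))"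
   unfolding K_def using fin by (subst prod.insert) (auto intro!: prod.union_disjoint)
  also have "... = (\<Prod>i\<in>J' 0. P.prob (a (i, 0))) * ((\<Prod>i\<in>J' (Suc 0). P.prob (a (i, Suc 0))) * (\<Prod>i\<in>J' 2. P.prob (a (i, 2))))"
   unfolding 0 by (simp add: prod.reindex inj_on_def b_def)
  also have "... = (\<Prod>j\<in>(%i. (i, 0)) ` J' 0. P.prob (a j)) * ((\<Prod>j\<in>(%i. (i, Suc 0)) ` J' (Suc 0). P.prob (a j)) * (\<Prod>j\<in>(%i. (i, 2)) ` J' 2. P.prob (a j)))"
   by (simp add: prod.reindex inj_on_def)
  also have "(\<Prod>j\<in>(%i. (i, Suc 0)) ` J' (Suc 0). P.prob (a j)) * (\<Prod>j\<in>(%i. (i, 2)) ` J' 2. P.prob (a j))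
    = (\<Prod>j\<in>(%i. (i, Suc 0)) ` J' (Suc 0) Un (%i. (i, 2)) ` J' 2. P.prob (a j))" by (rule prod.union_disjoint[symmetric]) (use fin in auto)
  also have "(\<Prod>j\<in>(%i. (i, 0)) ` J' 0. P.prob (a j)) * (\<Prod>j\<in>(%i. (i, Suc 0)) ` J' (Suc 0) Un (%i. (i, 2)) ` J' 2. P.prob (a j))
    = (\<Prod>j\<in>(%i. (i, 0)) ` J' 0 Un ((%i. (i, Suc 0)) ` J' (Suc 0) Un (%i. (i, 2)) ` J' 2). P.prob (a j))"
   by (rule prod.union_disjoint[symmetric]) (use fin in auto)
  also have "(%i. (i, 0)) ` J' 0 Un ((%i. (i, Suc 0)) ` J' (Suc 0) Un (%i. (i, 2)) ` J' 2) = J"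
   using J(1) by (auto simp: J'_def)
  finally show ?thesis .
 qed
 ultimately show "P.prob (\<Inter>j\<in>J. a j) = (\<Prod>j\<in>J. P.prob (a j))" by simp
qed

definition feature_algebra :: "(nat \<times> nat) set => 'a measure" where
 "feature_algebra K = sigma (space P) (\<Union>k\<in>K. feature k)"

lemma feature_Pow: "(\<Union>k\<in>K. feature k) <= Pow (space P)"
 using feature_events sets.sets_into_space by blast

lemma sets_feature_algebra: "sets (feature_algebra K) = sigma_sets (space P) (\<Union>k\<in>K. feature k)"
 and space_feature_algebra: "space (feature_algebra K) = space P"
 unfolding feature_algebra_def using feature_Pow by (simp_all add: sets_measure_of space_measure_of_conv)

lemma measurable_feature_algebra:
 "(i, 0) \<in> K ==> gap i \<in> borel_measurable (feature_algebra K)"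
 "(i, Suc 0) \<in> K ==> W i \<in> borel_measurable (feature_algebra K)"
 "(i, 2) \<in> K ==> path i \<in> measurable (feature_algebra K) path_space"
 by (rule measurableI; force simp: space_feature_algebra sets_feature_algebra feature_simps space_path_space intro!: sigma_sets.Basic)+

lemma indep_feature_algebras:
 assumes "!!j. j \<in> J ==> I j <= UNIV \<times> {0, Suc 0, 2}" and "disjoint_family_on I J"
 shows "P.indep_sets (%j. sets (feature_algebra (I j))) J"
 unfolding sets_feature_algebra
 by (rule P.indep_sets_collect_sigma[OF P.indep_sets_mono_index[OF _ indep_features] Int_stable_feature assms(2)]) (use assms(1) in blast)

lemma prob_feature_algebras:
 assumes K: "K1 <= UNIV \<times> {0, Suc 0, 2}" "K2 <= UNIV \<times> {0, Suc 0, 2}" "K1 Int K2 = {}"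
  and x: "x \<in> sets (feature_algebra K1)" and y: "y \<in> sets (feature_algebra K2)"
 shows "P.prob (x Int y) = P.prob x * P.prob y"
proof -
 have "P.indep_sets (%j. sets (feature_algebra (case_bool K1 K2 j))) UNIV"
  by (rule indep_feature_algebras) (use K in \<open>auto simp: disjoint_family_on_def split: bool.splits\<close>)
 then have "P.prob (\<Inter>j\<in>UNIV. case_bool x y j) = (\<Prod>j\<in>UNIV. P.prob (case_bool x y j))"
  by (rule P.indep_setsD) (use x y in \<open>auto split: bool.splits\<close>)
 then show ?thesis by (simp add: UNIV_bool Int_commute mult.commute)
qed

definition mark_variable :: "nat => 'a => real \<times> real \<times> (rat => nat)" where
 "mark_variable i om = (gap i om, W i om, path i om)"

lemma measurable_mark_variable[measurable]: "mark_variable i \<in> measurable P plane_space"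
 unfolding mark_variable_def[abs_def] plane_space_def by measurable

lemma distr_mark_variable: "distr P plane_space (mark_variable i) = exp_marked th table_marks"
proof -
 have "distr P (borel \<Otimes>\<^sub>M path_space) (%om. (W i om, path i om)) = distr P borel (W i) \<Otimes>\<^sub>M distr P path_space (path i)"
 proof (rule P.distr_pair_indep[OF W measurable_path])
  fix a b assume "a \<in> sets (borel :: real measure)" "b \<in> sets path_space"
  then have "W i -` a Int space P \<in> sets (feature_algebra {(i, Suc 0)})" "path i -` b Int space P \<in> sets (feature_algebra {(i, 2)})"
   using measurable_sets[OF measurable_feature_algebra(2)[of i "{(i, Suc 0)}"]] measurable_sets[OF measurable_feature_algebra(3)[of i "{(i, 2)}"]]
   by (simp_all add: space_feature_algebra)
  then show "P.prob ((W i -` a Int space P) Int (path i -` b Int space P)) = P.prob (W i -` a Int space P) * P.prob (path i -` b Int space P)"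
   by (intro prob_feature_algebras) auto
 qed
 also have "... = table_marks"
  unfolding distr_W path_def[abs_def] yule_processD(1)[OF P.prob_space_axioms yule] ..
 finally have V: "distr P (borel \<Otimes>\<^sub>M path_space) (%om. (W i om, path i om)) = table_marks" .
 have "distr P (borel \<Otimes>\<^sub>M (borel \<Otimes>\<^sub>M path_space)) (%om. (gap i om, (W i om, path i om)))
  = distr P borel (gap i) \<Otimes>\<^sub>M distr P (borel \<Otimes>\<^sub>M path_space) (%om. (W i om, path i om))"
 proof (rule P.distr_pair_indep)
  fix a b assume ab: "a \<in> sets (borel :: real measure)" "b \<in> sets (borel \<Otimes>\<^sub>M path_space :: (real \<times> (rat => nat)) measure)"
  let ?K = "{(i, Suc 0), (i, 2)}"
  have "(%om. (W i om, path i om)) \<in> measurable (feature_algebra ?K) (borel \<Otimes>\<^sub>M path_space)"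
   by (intro measurable_Pair measurable_feature_algebra) auto
  from measurable_sets[OF this ab(2)] measurable_sets[OF measurable_feature_algebra(1)[of i "{(i, 0)}"] ab(1)]
  show "P.prob ((gap i -` a Int space P) Int ((%om. (W i om, path i om)) -` b Int space P))
    = P.prob (gap i -` a Int space P) * P.prob ((%om. (W i om, path i om)) -` b Int space P)"
   by (intro prob_feature_algebras[of "{(i, 0)}" ?K]) (auto simp: space_feature_algebra)
 qed measurable
 also have "distr P borel (gap i) = density lborel (exponential_density th)"
  using distributed_distr_eq_density[OF gap_distributed[of i]] by (simp add: distr_cong[OF refl sets_lborel[symmetric] refl, of P])
 finally show ?thesis unfolding V exp_marked_def plane_space_def mark_variable_def[abs_def] .
qed

text \<open>The triples of gap, weight and path use disjoint groups of features, so they form an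
  independent sequence; this puts the tables into the setting of marked arrivals.\<close>

lemma distr_mark_variables:
 "distr P (\<Pi>\<^sub>M i\<in>UNIV. plane_space) (%om i. mark_variable i om) = (\<Pi>\<^sub>M i\<in>UNIV. exp_marked th table_marks)"
proof -
 have "P.indep_vars (%_. plane_space) mark_variable UNIV"
  unfolding P.indep_vars_def2
 proof (intro conjI ballI)
  have "P.indep_sets (%i. sets (feature_algebra ({i} \<times> {0, Suc 0, 2}))) UNIV"
   by (rule indep_feature_algebras) (auto simp: disjoint_family_on_def)
  then show "P.indep_sets (%i. {mark_variable i -` x Int space P |x. x \<in> sets plane_space}) UNIV"
  proof (rule P.indep_sets_mono_sets, safe)
   fix i and x :: "mark_point set" assume x: "x \<in> sets plane_space"
   have "mark_variable i \<in> measurable (feature_algebra ({i} \<times> {0, Suc 0, 2})) plane_space"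
    unfolding mark_variable_def[abs_def] plane_space_def by (intro measurable_Pair measurable_feature_algebra) auto
   from measurable_sets[OF this x] show "mark_variable i -` x Int space P \<in> sets (feature_algebra ({i} \<times> {0, Suc 0, 2}))"
    by (simp only: space_feature_algebra)
  qed
 qed measurable
 then show ?thesis by (subst (asm) P.indep_vars_iff_distr_eq_PiM) (simp_all add: distr_mark_variable restrict_UNIV)
qed

lemma measurable_mark_variables: "(%om i. mark_variable i om) \<in> measurable P (\<Pi>\<^sub>M i\<in>UNIV. plane_space)"
 by (rule measurable_PiM_single') (auto simp: space_plane_space)

lemma AE_mark_variables:
 assumes "AE x in (\<Pi>\<^sub>M i\<in>UNIV. exp_marked th table_marks). Q x" shows "AE om in P. Q (%i. mark_variable i om)"
 by (rule AE_distrD[OF measurable_mark_variables]) (use assms in \<open>simp only: distr_mark_variables\<close>)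

section \<open>The law of the table measures\<close>

lemma AE_jumps: "AE om in P. finite {i. \<tau> i om <= t}"
proof -
 \<comment> \<open>The arrival computation assumes a non-negative horizon, hence
   \<open>max 0 t\<close>.\<close>
 have "AE x in (\<Pi>\<^sub>M i\<in>(UNIV::nat set). exp_marked th table_marks). finite {i. (\<Sum>j\<le>i. fst (x j)) <= max 0 t}"
  by (rule nn_integral_arrivals(2)[OF th prob_space_table_marks _ mset_meas_size[of _ "%_. 0"]]) simp
 from AE_mark_variables[OF this] show ?thesis
 proof eventually_elim
  case (elim om)
  then have "finite {i. \<tau> i om <= max 0 t}" by (simp add: mark_variable_def sum_gap)
  then show ?case by (rule rev_finite_subset) auto
 qed
qed

text \<open>Non-negative gaps make the jump times non-decreasing, so the tables present at time
  \<open>t\<close> form an initial segment.\<close>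

lemma AE_num_tables: "AE om in P. {..<num_tables \<tau> t om} = {i. \<tau> i om <= t}"
proof -
 have "AE om in P. \<forall>i\<in>UNIV. 0 <= fst (mark_variable i om)" by (rule AE_mark_variables[OF AE_gaps_nonneg[OF th prob_space_table_marks]])
 with AE_jumps[of t] show ?thesis
 proof eventually_elim
  case (elim om)
  have "incseq (%i. \<tau> i om)"
  proof (rule incseq_SucI)
   show "\<tau> i om <= \<tau> (Suc i) om" for i using elim(2)[rule_format, of "Suc i"] by (simp add: mark_variable_def gap_def)
  qed
  then show ?case unfolding num_tables_def by (intro lessThan_card_downward_closed[OF elim(1)]) (auto dest: incseqD intro: order_trans)
 qed
qed

text \<open>The Yule process is evaluated at a random age, weight times remaining time, so its
  agreement with the rational path is needed for all real times at once.\<close>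

lemma table_point_measure_eq:
 "AE om in P. table_point_measure c A B W \<tau> Y t om
   = mset_point_measure S (image_mset (table_point t) (pts (%i. (\<tau> i om, W i om, path i om)) {i. \<tau> i om <= t}))"
proof -
 have "AE om in P. ALL i s. path_eval s (path i om) = Y i s om"
  unfolding AE_all_countable path_def using yule_processD(2)[OF P.prob_space_axioms yule] by blast
 with AE_num_tables[of t] AE_jumps[of t] show ?thesis
 proof eventually_elim
  case (elim om)
  have "table_point_measure c A B W \<tau> Y t om = dirac_sum S {i. \<tau> i om <= t} (%i. table_point t (\<tau> i om, W i om, path i om))"
   unfolding table_point_measure_def Let_def elim(1) by (rule dirac_sum_cong) (simp add: table_point_def table_size_def elim(3))
  also have "... = mset_point_measure S (image_mset (%i. table_point t (\<tau> i om, W i om, path i om)) (mset_set {i. \<tau> i om <= t}))"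
   by (rule dirac_sum_finite[OF elim(2)])
  finally show ?case by (simp add: multiset.map_comp comp_def)
 qed
qed

lemma nn_integral_tables:
 assumes t: "0 <= t" and H: "mset_meas plane_space H"
 shows "(\<integral>\<^sup>+om. H (pts (%i. (\<tau> i om, W i om, path i om)) {i. \<tau> i om <= t}) \<partial>P)
   = poisson_mean (arr_intensity th table_marks {0..t}) H"
proof -
 let ?f = "%x. H (pts (%i. (\<Sum>j\<le>i. fst (x j), snd (x i))) {i. (\<Sum>j\<le>i. fst (x j)) <= t})"
 have H': "mset_meas (borel \<Otimes>\<^sub>M table_marks) H" using H by (simp only: mset_meas_cong_sets[OF sets_table_space])
 have c[measurable]: "(%x. fst (x j)) \<in> borel_measurable (\<Pi>\<^sub>M i\<in>(UNIV::nat set). plane_space)"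
  "(%x. snd (x j)) \<in> measurable (\<Pi>\<^sub>M i\<in>(UNIV::nat set). plane_space) (borel \<Otimes>\<^sub>M path_space)" for j
  by (rule measurable_compose[OF measurable_component_singleton]; simp add: plane_space_def)+
 have f: "?f \<in> borel_measurable (\<Pi>\<^sub>M i\<in>(UNIV::nat set). plane_space)"
  by (rule measurable_pts[OF _ _ H]) (unfold plane_space_def[of], use c in \<open>simp_all add: plane_space_def\<close>)
 have "(\<integral>\<^sup>+om. H (pts (%i. (\<tau> i om, W i om, path i om)) {i. \<tau> i om <= t}) \<partial>P) = (\<integral>\<^sup>+om. ?f (%i. mark_variable i om) \<partial>P)"
  by (simp add: mark_variable_def sum_gap)
 also have "... = (\<integral>\<^sup>+x. ?f x \<partial>distr P (\<Pi>\<^sub>M i\<in>UNIV. plane_space) (%om i. mark_variable i om))"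
  by (rule nn_integral_distr[OF measurable_mark_variables, symmetric]) (use f in simp)
 also have "... = poisson_mean (arr_intensity th table_marks {0..t}) H"
  unfolding distr_mark_variables by (rule nn_integral_arrivals(1)[OF th prob_space_table_marks t H'])
 finally show ?thesis .
qed

lemma random_element_tables: "random_element (vague_topology S) P (table_point_measure c A B W \<tau> Y t)"
 unfolding table_point_measure_def[abs_def] Let_def
proof (rule K.random_element_dirac_sum)
 show "(%om. (ereal (\<tau> i om / u t), ereal ((W i om - v t) / w t), ereal ((ln (real (table_size W \<tau> Y i t om)) - t * v t) / (t * w t)))) \<in> borel_measurable P" for i
 proof -
  have [measurable]: "(%om. Y i (W i om * (t - \<tau> i om)) om) \<in> measurable P (count_space UNIV)"
   by (rule yule_processD(3)[OF P.prob_space_axioms yule]) measurable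
  have "(%om. table_size W \<tau> Y i t om) \<in> measurable P (count_space UNIV)"
   unfolding table_size_def by measurable
  then have [measurable]: "(%om. real (table_size W \<tau> Y i t om)) \<in> borel_measurable P" by simp
  show ?thesis by (intro borel_measurable_Pair) measurable
 qed
 show "{om \<in> space P. i \<in> {..<num_tables \<tau> t om}} \<in> sets P" for i
 proof -
  \<comment> \<open>The \<open>card\<close> of an infinite set is 0, so a positive count provides a
    finite set of indices and with it a code.\<close>
  have "i < num_tables \<tau> t om \<longleftrightarrow> (EX k. i < card (set_decode k) & (ALL j. \<tau> j om <= t \<longleftrightarrow> j \<in> set_decode k))" for om
  proof
   assume i: "i < num_tables \<tau> t om"
   then have "finite {j. \<tau> j om <= t}" unfolding num_tables_def by (metis card.infinite not_less_zero)
   then have d: "set_decode (set_encode {j. \<tau> j om <= t}) = {j. \<tau> j om <= t}" by (rule set_encode_inverse)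
   show "EX k. i < card (set_decode k) & (ALL j. \<tau> j om <= t \<longleftrightarrow> j \<in> set_decode k)"
    by (rule exI[of _ "set_encode {j. \<tau> j om <= t}"]) (use i d in \<open>simp add: num_tables_def\<close>)
  next
   assume "EX k. i < card (set_decode k) & (ALL j. \<tau> j om <= t \<longleftrightarrow> j \<in> set_decode k)"
   then obtain k where k: "i < card (set_decode k)" "!!j. \<tau> j om <= t \<longleftrightarrow> j \<in> set_decode k" by blast
   have "{j. \<tau> j om <= t} = set_decode k" using k(2) by blast
   then show "i < num_tables \<tau> t om" using k(1) by (simp add: num_tables_def)
  qed
  then have "{om \<in> space P. i \<in> {..<num_tables \<tau> t om}} = {om \<in> space P. EX k. i < card (set_decode k) & (ALL j. \<tau> j om <= t \<longleftrightarrow> j \<in> set_decode k)}"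
   by simp
  also have "... \<in> sets P" by measurable
  finally show ?thesis .
 qed
qed simp

text \<open>Both integrals lead to the same \<open>poisson_mean\<close>: the tables through marked
  arrivals, the planar prelimit through the window.\<close>

lemma integral_tables:
 assumes t: "0 <= t" and u0: "0 < u t" and h: "continuous_map (vague_topology S) euclideanreal h"
  and b: "!!m. m \<in> radon_measures S ==> \<bar>h m\<bar> <= b"
 shows "(\<integral>om. h (table_point_measure c A B W \<tau> Y t om) \<partial>P) = (\<integral>om. h (pre_measure t om) \<partial>plane_prob th)"
proof -
 let ?H = "%X. ennreal (h (mset_point_measure S (image_mset (table_point t) X)) + b)"
 have "(\<integral>\<^sup>+om. ennreal (h (table_point_measure c A B W \<tau> Y t om) + b) \<partial>P)
   = (\<integral>\<^sup>+om. ?H (pts (%i. (\<tau> i om, W i om, path i om)) {i. \<tau> i om <= t}) \<partial>P)"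
  by (rule nn_integral_cong_AE, use table_point_measure_eq[of t] in eventually_elim) (simp only:)
 also have "... = (\<integral>\<^sup>+om. ennreal (h (pre_measure t om) + b) \<partial>plane_prob th)"
  unfolding nn_integral_prelimit[OF th u0 h] by (rule nn_integral_tables[OF t mset_meas_vague[OF measurable_table_point h]])
 finally show ?thesis
  using u0 by (simp add: integral_random_element[OF P.prob_space_axioms random_element_tables h b] integral_random_element[OF prob_space_plane[OF th] random_element_prelimit[OF th] h b])
qed

lemma converges_to_limit_law:
 "converges_in_distribution (vague_topology S) P (%t. table_point_measure c A B W \<tau> Y t) at_top (limit_law th) (%m. m)"
 unfolding converges_in_distribution_def
proof (intro conjI allI impI)
 show "\<forall>\<^sub>F t in at_top. random_element (vague_topology S) P (table_point_measure c A B W \<tau> Y t)"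
  by (simp add: random_element_tables)
 show "random_element (vague_topology S) (limit_law th) (%m. m)" by (rule random_element_limit_law[OF th])
 fix h :: "point measure => real"
 assume "continuous_map (vague_topology S) euclideanreal h & bounded (h ` topspace (vague_topology S))"
 then have h: "continuous_map (vague_topology S) euclideanreal h" and "bounded (h ` radon_measures S)" by (simp_all add: topspace_vague_topology)
 then obtain b where b: "!!m. m \<in> radon_measures S ==> \<bar>h m\<bar> <= b" by (auto simp: bounded_iff)
 have "\<forall>\<^sub>F t in at_top. (\<integral>om. h (pre_measure t om) \<partial>plane_prob th) = (\<integral>om. h (table_point_measure c A B W \<tau> Y t om) \<partial>P)"
  using eventually_scales_pos
 proof eventually_elim
  case (elim t)
  then show ?case using integral_tables[OF _ _ h b, of t] by simp
 qed
 from Lim_transform_eventually[OF tendsto_prelimit[OF th h b] this]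
 show "((%t. \<integral>om. h (table_point_measure c A B W \<tau> Y t om) \<partial>P) \<longlongrightarrow> (\<integral>m. h m \<partial>limit_law th)) at_top"
  unfolding integral_limit_law[OF th h] .
qed

end

theorem theorem2p6:
  fixes P :: "'a measure" and \<mu> :: "real measure" and \<theta> :: real and c :: ev_class
    and A B :: "real \<Rightarrow> real" and W \<tau> :: "nat \<Rightarrow> 'a \<Rightarrow> real" and Y :: "nat \<Rightarrow> real \<Rightarrow> 'a \<Rightarrow> nat"
  assumes "0 < \<theta>"
    and "ev_assumption c \<mu> A B"
    and "prob_space P"
    and "\<And>i. W i \<in> borel_measurable P"
    and "\<And>i. distr P borel (W i) = \<mu>"
    and "poisson_jump_times P \<theta> \<tau>"
    and "\<And>i. yule_process P (Y i)"
    and "independent_sources P W \<tau> Y"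
  shows "\<exists>(Q :: point measure measure) (\<Gamma> :: point measure \<Rightarrow> point measure).
           poisson_point_process Q (state_space c) (limit_intensity c \<theta>) \<Gamma> \<and>
           converges_in_distribution (vague_topology (state_space c))
             P (\<lambda>t. table_point_measure c A B W \<tau> Y t) at_top Q \<Gamma>"
proof -
  interpret table_process c \<mu> A B P \<theta> W \<tau> Y
    by (intro table_process.intro table_process_axioms.intro ev_setting.intro assms)
  show ?thesis
    by (intro exI[of _ "limit_law \<theta>"] exI[of _ "\<lambda>m. m"] conjI poisson_limit_law[OF assms(1)] converges_to_limit_law)
qed

end
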